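(* Let $F:\mathcal C\to\mathcal D$ be a tensor functor between tensor categories over a field $\Bbbk$, admitting a right adjoint $R$. Then $A=R(\mathbf 1)$ has a natural structure of commutative central algebra in $\mathcal C$, with half-braiding denoted by $\sigma$. Moreover, if $R$ is faithful exact, then $\mathrm{mod}_{\mathcal C}(A,\sigma)$ is a tensor category and there is a tensor equivalence $K:\mathcal D\to\mathrm{mod}_{\mathcal C}(A,\sigma)$ such that $KF\simeq F_A$ as tensor functors $\mathcal C\to\mathrm{mod}_{\mathcal C}(A,\sigma)$.
   Context: A tensor category over $\Bbbk$ is a $\Bbbk$-linear abelian rigid monoidal category with finite-dimensional Hom spaces, all objects of finite length, monoidal product $\Bbbk$-linear in each variable, and $\operatorname{End}(\mathbf 1)=\Bbbk$. A tensor functor is a $\Bbbk$-linear exact strong monoidal functor between tensor categories. For an algebra $(A,m,u)$ in $\mathcal C$, $\mathrm{mod}_{\mathcal C}A$ is the category of right $A$-modules in $\mathcal C$, and $F_A:\mathcal C\to\mathrm{mod}_{\mathcal C}A$, $X\mapsto(X\otimes A,\mathrm{id}_X\otimes m)$, is the free module functor. A central algebra of $\mathcal C$ is an algebra $A$ in $\mathcal C$ with a half-braiding $\sigma:A\otimes\mathrm{id}_{\mathcal C}\to\mathrm{id}_{\mathcal C}\otimes A$ (natural isomorphisms $\sigma_X:A\otimes X\to X\otimes A$ with $\sigma_{X\otimes Y}=(\mathrm{id}_X\otimes\sigma_Y)(\sigma_X\otimes\mathrm{id}_Y)$) such that $(A,\sigma)$ is an algebra in the categorical center $\mathcal Z(\mathcal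 C)$, i.e. $\sigma_X(m\otimes\mathrm{id}_X)=(\mathrm{id}_X\otimes m)(\sigma_X\otimes\mathrm{id}_A)(\mathrm{id}_A\otimes\sigma_X)$ and $\sigma_X(u\otimes\mathrm{id}_X)=\mathrm{id}_X\otimes u$. It is commutative if $m\sigma_A=m$. If $(A,\sigma)$ is a commutative central algebra, $\mathrm{mod}_{\mathcal C}(A,\sigma)$ denotes $\mathrm{mod}_{\mathcal C}A$ with the monoidal structure where $M\otimes_AN$, for modules $(M,r)$, $(N,s)$, is the coequalizer of $r\otimes\mathrm{id}_N$ and $\mathrm{id}_M\otimes s\sigma_N:M\otimes A\otimes N\rightrightarrows M\otimes N$, with action induced by $\mathrm{id}_M\otimes s$; the unit object is $A$. The functor $F_A$ is naturally strong monoidal from $\mathcal C$ to $\mathrm{mod}_{\mathcal C}(A,\sigma)$. The natural structure on $A=R(\mathbf 1)$: as right adjoint of a strong monoidal functor, $R$ has a canonical monoidal structure $(R_2,R_0)$; $A$ has product $R_2(\mathbf 1,\mathbf 1)$ and unit $R_0$, and, with $\eta:\mathrm{id}_{\mathcal C}\to RF$ the adjunction unit, $\sigma_X$ is the unique morphism $R(\mathbf 1)\otimes X\to X\otimes R(\mathbf 1)$ with $R_2(FX,\mathbf 1)(\eta_X\otimes\mathrm{id})\,\sigma_X=R_2(\mathbf 1,FX)(\mathrm{id}\otimes\eta_X)$ (both composites $R(\mathbf 1)\otimes X\to RF(X)$ and $X\otimes R(\mathbf 1)\to RF(X)$ being isomorphisms). *)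

theory Defs
  imports "HOL-Algebra.Module"
begin

section \<open>Linear and abelian categories\<close>

record ('o, 'm) category =
  Ob :: "'o set"
  Ar :: "'m set"
  src :: "'m \<Rightarrow> 'o"
  tgt :: "'m \<Rightarrow> 'o"
  ide :: "'o \<Rightarrow> 'm"  ("\<iota>\<index>")
  cmp :: "'m \<Rightarrow> 'm \<Rightarrow> 'm"  (infixr "\<cdot>\<index>" 55)

definition Hom where
  "Hom C X Y = {f \<in> Ar C. src C f = X \<and> tgt C f = Y}"

locale category =
  fixes C :: "('o, 'm, 'z) category_scheme" (structure)
  assumes src_tgt_in: "f \<in> Ar C \<Longrightarrow> src C f \<in> Ob C \<and> tgt C f \<in> Ob C"
    and ide_in: "X \<in> Ob C \<Longrightarrow> \<iota> X \<in> Hom C X X"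
    and cmp_in: "\<lbrakk>f \<in> Hom C X Y; g \<in> Hom C Y Z\<rbrakk> \<Longrightarrow> g \<cdot> f \<in> Hom C X Z"
    and cmp_ide: "f \<in> Hom C X Y \<Longrightarrow> f \<cdot> \<iota> X = f"
    and ide_cmp: "f \<in> Hom C X Y \<Longrightarrow> \<iota> Y \<cdot> f = f"
    and cmp_assoc: "\<lbrakk>f \<in> Hom C W X; g \<in> Hom C X Y; h \<in> Hom C Y Z\<rbrakk>
      \<Longrightarrow> (h \<cdot> g) \<cdot> f = h \<cdot> (g \<cdot> f)"

definition inverse_arrows where
  "inverse_arrows C f g \<longleftrightarrow> f \<in> Ar C \<and> g \<in> Hom C (tgt C f) (src C f)
     \<and> g \<cdot> f = \<iota> (src C f) \<and> f \<cdot> g = \<iota> (tgt C f)" for C (structure)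

definition iso_ar where
  "iso_ar C f \<longleftrightarrow> (\<exists>g. inverse_arrows C f g)"

definition inv_ar where
  "inv_ar C f = (THE g. inverse_arrows C f g)"

definition mono_ar where
  "mono_ar C f \<longleftrightarrow> f \<in> Ar C \<and>
     (\<forall>W. \<forall>g \<in> Hom C W (src C f). \<forall>h \<in> Hom C W (src C f). f \<cdot> g = f \<cdot> h \<longrightarrow> g = h)"
  for C (structure)

definition epi_ar where
  "epi_ar C f \<longleftrightarrow> f \<in> Ar C \<and>
     (\<forall>W. \<forall>g \<in> Hom C (tgt C f) W. \<forall>h \<in> Hom C (tgt C f) W. g \<cdot> f = h \<cdot> f \<longrightarrow> g = h)"
  for C (structure)

definition is_coequalizer where
  "is_coequalizer C f g p \<longleftrightarrow> p \<in> Ar C \<and> src C p = tgt C f \<and> p \<cdot> f = p \<cdot> g \<and>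
     (\<forall>W. \<forall>h \<in> Hom C (tgt C f) W. h \<cdot> f = h \<cdot> g \<longrightarrow> (\<exists>!l. l \<in> Hom C (tgt C p) W \<and> l \<cdot> p = h))"
  for C (structure)

text \<open>The linear structure on arrows: addition and scalar multiplication are only meaningful
  on arrows with common source and target.\<close>

record ('o, 'm, 'k) lin_category = "('o, 'm) category" +
  zero_ar :: "'o \<Rightarrow> 'o \<Rightarrow> 'm"
  add_ar :: "'m \<Rightarrow> 'm \<Rightarrow> 'm"
  smul_ar :: "'k \<Rightarrow> 'm \<Rightarrow> 'm"

text \<open>The multiplicative fields of the record \<^typ>\<open>('k, 'm) module\<close> play no role in the locale
  \<^locale>\<open>module\<close>.\<close>

definition Hom_space :: "('o, 'm, 'k, 'z) lin_category_scheme \<Rightarrow> 'o \<Rightarrow> 'o \<Rightarrow> ('k, 'm) module" where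
  "Hom_space C X Y = \<lparr>carrier = Hom C X Y, mult = undefined, one = undefined,
     zero = zero_ar C X Y, add = add_ar C, smult = smul_ar C\<rparr>"

locale linear_category = category C
  for k :: "('k, 'y) ring_scheme" and C :: "('o, 'm, 'k, 'z) lin_category_scheme" (structure) +
  assumes field: "field k"
    and Hom_module: "\<lbrakk>X \<in> Ob C; Y \<in> Ob C\<rbrakk> \<Longrightarrow> module k (Hom_space C X Y)"
    and cmp_add_left: "\<lbrakk>f \<in> Hom C X Y; g \<in> Hom C Y Z; g' \<in> Hom C Y Z\<rbrakk>
      \<Longrightarrow> add_ar C g g' \<cdot> f = add_ar C (g \<cdot> f) (g' \<cdot> f)"
    and cmp_add_right: "\<lbrakk>f \<in> Hom C X Y; f' \<in> Hom C X Y; g \<in> Hom C Y Z\<rbrakk>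
      \<Longrightarrow> g \<cdot> add_ar C f f' = add_ar C (g \<cdot> f) (g \<cdot> f')"
    and cmp_smul_left: "\<lbrakk>c \<in> carrier k; f \<in> Hom C X Y; g \<in> Hom C Y Z\<rbrakk>
      \<Longrightarrow> smul_ar C c g \<cdot> f = smul_ar C c (g \<cdot> f)"
    and cmp_smul_right: "\<lbrakk>c \<in> carrier k; f \<in> Hom C X Y; g \<in> Hom C Y Z\<rbrakk>
      \<Longrightarrow> g \<cdot> smul_ar C c f = smul_ar C c (g \<cdot> f)"

definition zero_ob where
  "zero_ob C Z \<longleftrightarrow> Z \<in> Ob C \<and>
     (\<forall>X \<in> Ob C. (\<exists>!f. f \<in> Hom C X Z) \<and> (\<exists>!f. f \<in> Hom C Z X))"

definition is_biproduct where
  "is_biproduct C X Y P i j p q \<longleftrightarrow>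
     i \<in> Hom C X P \<and> j \<in> Hom C Y P \<and> p \<in> Hom C P X \<and> q \<in> Hom C P Y \<and>
     p \<cdot> i = \<iota> X \<and> q \<cdot> j = \<iota> Y \<and> p \<cdot> j = zero_ar C Y X \<and> q \<cdot> i = zero_ar C X Y \<and>
     add_ar C (i \<cdot> p) (j \<cdot> q) = \<iota> P" for C (structure)

definition is_kernel where
  "is_kernel C f i \<longleftrightarrow> f \<in> Ar C \<and> i \<in> Ar C \<and> tgt C i = src C f \<and>
     f \<cdot> i = zero_ar C (src C i) (tgt C f) \<and>
     (\<forall>W. \<forall>h \<in> Hom C W (src C f). f \<cdot> h = zero_ar C W (tgt C f) \<longrightarrow>
        (\<exists>!l. l \<in> Hom C W (src C i) \<and> i \<cdot> l = h))" for C (structure)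

definition is_cokernel where
  "is_cokernel C f p \<longleftrightarrow> f \<in> Ar C \<and> p \<in> Ar C \<and> src C p = tgt C f \<and>
     p \<cdot> f = zero_ar C (src C f) (tgt C p) \<and>
     (\<forall>W. \<forall>h \<in> Hom C (tgt C f) W. h \<cdot> f = zero_ar C (src C f) W \<longrightarrow>
        (\<exists>!l. l \<in> Hom C (tgt C p) W \<and> l \<cdot> p = h))" for C (structure)

locale abelian_category = linear_category k C
  for k :: "('k, 'y) ring_scheme" and C :: "('o, 'm, 'k, 'z) lin_category_scheme" (structure) +
  assumes zero_ob_ex: "\<exists>Z. zero_ob C Z"
    and biproduct_ex: "\<lbrakk>X \<in> Ob C; Y \<in> Ob C\<rbrakk> \<Longrightarrow> \<exists>P i j p q. is_biproduct C X Y P i j p q"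
    and kernel_ex: "f \<in> Ar C \<Longrightarrow> \<exists>i. is_kernel C f i"
    and cokernel_ex: "f \<in> Ar C \<Longrightarrow> \<exists>p. is_cokernel C f p"
    and mono_normal: "mono_ar C f \<Longrightarrow> \<exists>g. is_kernel C g f"
    and epi_normal: "epi_ar C f \<Longrightarrow> \<exists>g. is_cokernel C g f"

definition short_exact where
  "short_exact C f g \<longleftrightarrow> is_kernel C g f \<and> is_cokernel C f g"

definition simple_ob where
  "simple_ob C S \<longleftrightarrow> S \<in> Ob C \<and> \<not> zero_ob C S \<and>
     (\<forall>f. mono_ar C f \<and> tgt C f = S \<longrightarrow> zero_ob C (src C f) \<or> iso_ar C f)"

inductive finite_length for C where
  finite_length_zero: "zero_ob C X \<Longrightarrow> finite_length C X"
| finite_length_ext: "\<lbrakk>finite_length C X; short_exact C f g; src C f = X; simple_ob C (tgt C g)\<rbrakk>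
    \<Longrightarrow> finite_length C (tgt C f)"

definition finite_dim :: "('k, 'y) ring_scheme \<Rightarrow> ('k, 'v, 'z) module_scheme \<Rightarrow> bool" where
  "finite_dim k V \<longleftrightarrow> (\<exists>B. finite B \<and> B \<subseteq> carrier V \<and>
     (\<forall>v \<in> carrier V. \<exists>c \<in> B \<rightarrow> carrier k. v = (\<Oplus>\<^bsub>V\<^esub>b \<in> B. c b \<odot>\<^bsub>V\<^esub> b)))"


section \<open>Tensor categories\<close>

text \<open>Monoidal categories are not assumed strict: \<open>assoc X Y Z\<close> goes from
  \<open>(X \<otimes> Y) \<otimes> Z\<close> to \<open>X \<otimes> (Y \<otimes> Z)\<close>, \<open>lunit X\<close> from \<open>\<one> \<otimes> X\<close> to \<open>X\<close> and \<open>runit X\<close> from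
  \<open>X \<otimes> \<one>\<close> to \<open>X\<close>.\<close>

record ('o, 'm, 'k) mon_category = "('o, 'm, 'k) lin_category" +
  tens_ob :: "'o \<Rightarrow> 'o \<Rightarrow> 'o"  (infixr "\<otimes>\<^sub>o\<index>" 70)
  tens_ar :: "'m \<Rightarrow> 'm \<Rightarrow> 'm"  (infixr "\<otimes>\<^sub>a\<index>" 70)
  unit_ob :: 'o  ("\<one>\<^sub>o\<index>")
  assoc :: "'o \<Rightarrow> 'o \<Rightarrow> 'o \<Rightarrow> 'm"  ("\<alpha>\<index>")
  lunit :: "'o \<Rightarrow> 'm"  ("\<lambda>\<^sub>l\<index>")
  runit :: "'o \<Rightarrow> 'm"  ("\<rho>\<index>")

locale monoidal_category = category C
  for C :: "('o, 'm, 'k, 'z) mon_category_scheme" (structure) +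
  assumes unit_in: "\<one>\<^sub>o \<in> Ob C"
    and tens_ob_in: "\<lbrakk>X \<in> Ob C; Y \<in> Ob C\<rbrakk> \<Longrightarrow> X \<otimes>\<^sub>o Y \<in> Ob C"
    and tens_ar_in: "\<lbrakk>f \<in> Hom C X X'; g \<in> Hom C Y Y'\<rbrakk>
      \<Longrightarrow> f \<otimes>\<^sub>a g \<in> Hom C (X \<otimes>\<^sub>o Y) (X' \<otimes>\<^sub>o Y')"
    and tens_ide: "\<lbrakk>X \<in> Ob C; Y \<in> Ob C\<rbrakk> \<Longrightarrow> \<iota> X \<otimes>\<^sub>a \<iota> Y = \<iota> (X \<otimes>\<^sub>o Y)"
    and tens_cmp: "\<lbrakk>f \<in> Hom C X X'; f' \<in> Hom C X' X''; g \<in> Hom C Y Y'; g' \<in> Hom C Y' Y''\<rbrakk>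
      \<Longrightarrow> (f' \<cdot> f) \<otimes>\<^sub>a (g' \<cdot> g) = (f' \<otimes>\<^sub>a g') \<cdot> (f \<otimes>\<^sub>a g)"
    and assoc_in: "\<lbrakk>X \<in> Ob C; Y \<in> Ob C; Z \<in> Ob C\<rbrakk>
      \<Longrightarrow> \<alpha> X Y Z \<in> Hom C ((X \<otimes>\<^sub>o Y) \<otimes>\<^sub>o Z) (X \<otimes>\<^sub>o (Y \<otimes>\<^sub>o Z))"
    and assoc_iso: "\<lbrakk>X \<in> Ob C; Y \<in> Ob C; Z \<in> Ob C\<rbrakk> \<Longrightarrow> iso_ar C (\<alpha> X Y Z)"
    and assoc_nat: "\<lbrakk>f \<in> Hom C X X'; g \<in> Hom C Y Y'; h \<in> Hom C Z Z'\<rbrakk>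
      \<Longrightarrow> \<alpha> X' Y' Z' \<cdot> ((f \<otimes>\<^sub>a g) \<otimes>\<^sub>a h) = (f \<otimes>\<^sub>a (g \<otimes>\<^sub>a h)) \<cdot> \<alpha> X Y Z"
    and lunit_in: "X \<in> Ob C \<Longrightarrow> \<lambda>\<^sub>l X \<in> Hom C (\<one>\<^sub>o \<otimes>\<^sub>o X) X"
    and lunit_iso: "X \<in> Ob C \<Longrightarrow> iso_ar C (\<lambda>\<^sub>l X)"
    and lunit_nat: "f \<in> Hom C X Y \<Longrightarrow> \<lambda>\<^sub>l Y \<cdot> (\<iota> \<one>\<^sub>o \<otimes>\<^sub>a f) = f \<cdot> \<lambda>\<^sub>l X"
    and runit_in: "X \<in> Ob C \<Longrightarrow> \<rho> X \<in> Hom C (X \<otimes>\<^sub>o \<one>\<^sub>o) X"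
    and runit_iso: "X \<in> Ob C \<Longrightarrow> iso_ar C (\<rho> X)"
    and runit_nat: "f \<in> Hom C X Y \<Longrightarrow> \<rho> Y \<cdot> (f \<otimes>\<^sub>a \<iota> \<one>\<^sub>o) = f \<cdot> \<rho> X"
    and pentagon: "\<lbrakk>W \<in> Ob C; X \<in> Ob C; Y \<in> Ob C; Z \<in> Ob C\<rbrakk>
      \<Longrightarrow> \<alpha> W X (Y \<otimes>\<^sub>o Z) \<cdot> \<alpha> (W \<otimes>\<^sub>o X) Y Z
        = (\<iota> W \<otimes>\<^sub>a \<alpha> X Y Z) \<cdot> \<alpha> W (X \<otimes>\<^sub>o Y) Z \<cdot> (\<alpha> W X Y \<otimes>\<^sub>a \<iota> Z)"
    and triangle: "\<lbrakk>X \<in> Ob C; Y \<in> Ob C\<rbrakk>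
      \<Longrightarrow> (\<iota> X \<otimes>\<^sub>a \<lambda>\<^sub>l Y) \<cdot> \<alpha> X \<one>\<^sub>o Y = \<rho> X \<otimes>\<^sub>a \<iota> Y"

text \<open>\<open>is_dual C X Y ev coev\<close>: \<open>Y\<close> is a left dual of \<open>X\<close>, equivalently \<open>X\<close> is a right dual
  of \<open>Y\<close>.\<close>

definition is_dual where
  "is_dual C X Y ev coev \<longleftrightarrow> X \<in> Ob C \<and> Y \<in> Ob C \<and>
     ev \<in> Hom C (Y \<otimes>\<^sub>o X) \<one>\<^sub>o \<and> coev \<in> Hom C \<one>\<^sub>o (X \<otimes>\<^sub>o Y) \<and>
     \<rho> X \<cdot> (\<iota> X \<otimes>\<^sub>a ev) \<cdot> \<alpha> X Y X \<cdot> (coev \<otimes>\<^sub>a \<iota> X) = \<lambda>\<^sub>l X \<and>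
     \<lambda>\<^sub>l Y \<cdot> (ev \<otimes>\<^sub>a \<iota> Y) \<cdot> inv_ar C (\<alpha> Y X Y) \<cdot> (\<iota> Y \<otimes>\<^sub>a coev) = \<rho> Y" for C (structure)

definition rigid where
  "rigid C \<longleftrightarrow> (\<forall>X \<in> Ob C.
     (\<exists>Y ev coev. is_dual C X Y ev coev) \<and> (\<exists>Y ev coev. is_dual C Y X ev coev))"

locale tensor_category = abelian_category k C + monoidal_category C
  for k :: "('k, 'y) ring_scheme" and C :: "('o, 'm, 'k, 'z) mon_category_scheme" (structure) +
  assumes rigid: "rigid C"
    and Hom_finite_dim: "\<lbrakk>X \<in> Ob C; Y \<in> Ob C\<rbrakk> \<Longrightarrow> finite_dim k (Hom_space C X Y)"
    and finite_length: "X \<in> Ob C \<Longrightarrow> finite_length C X"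
    and tens_add_left: "\<lbrakk>f \<in> Hom C X X'; f' \<in> Hom C X X'; g \<in> Hom C Y Y'\<rbrakk>
      \<Longrightarrow> add_ar C f f' \<otimes>\<^sub>a g = add_ar C (f \<otimes>\<^sub>a g) (f' \<otimes>\<^sub>a g)"
    and tens_add_right: "\<lbrakk>f \<in> Hom C X X'; g \<in> Hom C Y Y'; g' \<in> Hom C Y Y'\<rbrakk>
      \<Longrightarrow> f \<otimes>\<^sub>a add_ar C g g' = add_ar C (f \<otimes>\<^sub>a g) (f \<otimes>\<^sub>a g')"
    and tens_smul_left: "\<lbrakk>c \<in> carrier k; f \<in> Hom C X X'; g \<in> Hom C Y Y'\<rbrakk>
      \<Longrightarrow> smul_ar C c f \<otimes>\<^sub>a g = smul_ar C c (f \<otimes>\<^sub>a g)"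
    and tens_smul_right: "\<lbrakk>c \<in> carrier k; f \<in> Hom C X X'; g \<in> Hom C Y Y'\<rbrakk>
      \<Longrightarrow> f \<otimes>\<^sub>a smul_ar C c g = smul_ar C c (f \<otimes>\<^sub>a g)"
    and End_unit: "bij_betw (\<lambda>c. smul_ar C c (\<iota> \<one>\<^sub>o)) (carrier k) (Hom C \<one>\<^sub>o \<one>\<^sub>o)"


section \<open>Functors\<close>

record ('o, 'm, 'p, 'n) functor_data =
  fob :: "'o \<Rightarrow> 'p"
  far :: "'m \<Rightarrow> 'n"

locale cat_functor = C: category C + D: category D
  for C :: "('o, 'm, 'y) category_scheme" and D :: "('p, 'n, 'z) category_scheme"
    and F :: "('o, 'm, 'p, 'n, 'w) functor_data_scheme" +
  assumes fob_in: "X \<in> Ob C \<Longrightarrow> fob F X \<in> Ob D"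
    and far_in: "f \<in> Hom C X Y \<Longrightarrow> far F f \<in> Hom D (fob F X) (fob F Y)"
    and far_ide: "X \<in> Ob C \<Longrightarrow> far F (\<iota>\<^bsub>C\<^esub> X) = \<iota>\<^bsub>D\<^esub> (fob F X)"
    and far_cmp: "\<lbrakk>f \<in> Hom C X Y; g \<in> Hom C Y Z\<rbrakk> \<Longrightarrow> far F (g \<cdot>\<^bsub>C\<^esub> f) = far F g \<cdot>\<^bsub>D\<^esub> far F f"

definition faithful where
  "faithful C F \<longleftrightarrow> (\<forall>X \<in> Ob C. \<forall>Y \<in> Ob C. inj_on (far F) (Hom C X Y))"

definition exact where
  "exact C D F \<longleftrightarrow> (\<forall>f g. short_exact C f g \<longrightarrow> short_exact D (far F f) (far F g))"

definition linear where
  "linear k C D F \<longleftrightarrow>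
     (\<forall>X \<in> Ob C. \<forall>Y \<in> Ob C. \<forall>f \<in> Hom C X Y. \<forall>g \<in> Hom C X Y.
        far F (add_ar C f g) = add_ar D (far F f) (far F g)) \<and>
     (\<forall>X \<in> Ob C. \<forall>Y \<in> Ob C. \<forall>f \<in> Hom C X Y. \<forall>c \<in> carrier k.
        far F (smul_ar C c f) = smul_ar D c (far F f))"

definition id_functor :: "('o, 'm, 'o, 'm) functor_data" where
  "id_functor = \<lparr>fob = \<lambda>X. X, far = \<lambda>f. f\<rparr>"

definition comp_functor :: "('p, 'n, 'q, 'l, 'y) functor_data_scheme \<Rightarrow>
    ('o, 'm, 'p, 'n, 'z) functor_data_scheme \<Rightarrow> ('o, 'm, 'q, 'l) functor_data" where
  "comp_functor G F = \<lparr>fob = \<lambda>X. fob G (fob F X), far = \<lambda>f. far G (far F f)\<rparr>"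

definition nat_trans where
  "nat_trans C D F G \<theta> \<longleftrightarrow>
     (\<forall>X \<in> Ob C. \<theta> X \<in> Hom D (fob F X) (fob G X)) \<and>
     (\<forall>X Y. \<forall>f \<in> Hom C X Y. \<theta> Y \<cdot>\<^bsub>D\<^esub> far F f = far G f \<cdot>\<^bsub>D\<^esub> \<theta> X)"

definition nat_iso where
  "nat_iso C D F G \<theta> \<longleftrightarrow> nat_trans C D F G \<theta> \<and> (\<forall>X \<in> Ob C. iso_ar D (\<theta> X))"

definition is_equivalence where
  "is_equivalence C D F \<longleftrightarrow> cat_functor C D F \<and>
     (\<exists>G \<theta> \<theta>'. cat_functor D C (G :: (_, _, _, _) functor_data) \<and>
        nat_iso C C id_functor (comp_functor G F) \<theta> \<and>
        nat_iso D D (comp_functor F G) id_functor \<theta>')"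

text \<open>\<open>adjunction C D F R \<eta> \<epsilon>\<close>: the functor \<open>R\<close> is right adjoint to \<open>F\<close>, with unit \<open>\<eta>\<close> and
  counit \<open>\<epsilon>\<close>.\<close>

locale adjunction = F: cat_functor C D F + R: cat_functor D C R
  for C :: "('o, 'm, 'y) category_scheme" and D :: "('p, 'n, 'z) category_scheme"
    and F :: "('o, 'm, 'p, 'n, 'v) functor_data_scheme"
    and R :: "('p, 'n, 'o, 'm, 'w) functor_data_scheme"
    and \<eta> :: "'o \<Rightarrow> 'm" and \<epsilon> :: "'p \<Rightarrow> 'n" +
  assumes unit_nat: "nat_trans C C id_functor (comp_functor R F) \<eta>"
    and counit_nat: "nat_trans D D (comp_functor F R) id_functor \<epsilon>"
    and triangle_F: "X \<in> Ob C \<Longrightarrow> \<epsilon> (fob F X) \<cdot>\<^bsub>D\<^esub> far F (\<eta> X) = \<iota>\<^bsub>D\<^esub> (fob F X)"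
    and triangle_R: "Y \<in> Ob D \<Longrightarrow> far R (\<epsilon> Y) \<cdot>\<^bsub>C\<^esub> \<eta> (fob R Y) = \<iota>\<^bsub>C\<^esub> (fob R Y)"

text \<open>\<open>fmu F X Y\<close> goes from \<open>FX \<otimes> FY\<close> to \<open>F(X \<otimes> Y)\<close>, and \<open>fmu0 F\<close> from \<open>\<one>\<close> to \<open>F\<one>\<close>.\<close>

record ('o, 'm, 'p, 'n) mon_functor_data = "('o, 'm, 'p, 'n) functor_data" +
  fmu :: "'o \<Rightarrow> 'o \<Rightarrow> 'n"
  fmu0 :: 'n

locale strong_monoidal_functor = C: monoidal_category C + D: monoidal_category D + cat_functor C D F
  for C :: "('o, 'm, 'k, 'y) mon_category_scheme" and D :: "('p, 'n, 'l, 'z) mon_category_scheme"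
    and F :: "('o, 'm, 'p, 'n, 'w) mon_functor_data_scheme" +
  assumes fmu_in: "\<lbrakk>X \<in> Ob C; Y \<in> Ob C\<rbrakk>
      \<Longrightarrow> fmu F X Y \<in> Hom D (fob F X \<otimes>\<^sub>o\<^bsub>D\<^esub> fob F Y) (fob F (X \<otimes>\<^sub>o\<^bsub>C\<^esub> Y))"
    and fmu_iso: "\<lbrakk>X \<in> Ob C; Y \<in> Ob C\<rbrakk> \<Longrightarrow> iso_ar D (fmu F X Y)"
    and fmu_nat: "\<lbrakk>f \<in> Hom C X X'; g \<in> Hom C Y Y'\<rbrakk>
      \<Longrightarrow> fmu F X' Y' \<cdot>\<^bsub>D\<^esub> (far F f \<otimes>\<^sub>a\<^bsub>D\<^esub> far F g) = far F (f \<otimes>\<^sub>a\<^bsub>C\<^esub> g) \<cdot>\<^bsub>D\<^esub> fmu F X Y"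
    and fmu0_in: "fmu0 F \<in> Hom D \<one>\<^sub>o\<^bsub>D\<^esub> (fob F \<one>\<^sub>o\<^bsub>C\<^esub>)"
    and fmu0_iso: "iso_ar D (fmu0 F)"
    and fmu_assoc: "\<lbrakk>X \<in> Ob C; Y \<in> Ob C; Z \<in> Ob C\<rbrakk>
      \<Longrightarrow> far F (\<alpha>\<^bsub>C\<^esub> X Y Z) \<cdot>\<^bsub>D\<^esub> fmu F (X \<otimes>\<^sub>o\<^bsub>C\<^esub> Y) Z \<cdot>\<^bsub>D\<^esub> (fmu F X Y \<otimes>\<^sub>a\<^bsub>D\<^esub> \<iota>\<^bsub>D\<^esub> (fob F Z))
        = fmu F X (Y \<otimes>\<^sub>o\<^bsub>C\<^esub> Z) \<cdot>\<^bsub>D\<^esub> (\<iota>\<^bsub>D\<^esub> (fob F X) \<otimes>\<^sub>a\<^bsub>D\<^esub> fmu F Y Z)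
            \<cdot>\<^bsub>D\<^esub> \<alpha>\<^bsub>D\<^esub> (fob F X) (fob F Y) (fob F Z)"
    and fmu_lunit: "X \<in> Ob C
      \<Longrightarrow> far F (\<lambda>\<^sub>l\<^bsub>C\<^esub> X) \<cdot>\<^bsub>D\<^esub> fmu F \<one>\<^sub>o\<^bsub>C\<^esub> X \<cdot>\<^bsub>D\<^esub> (fmu0 F \<otimes>\<^sub>a\<^bsub>D\<^esub> \<iota>\<^bsub>D\<^esub> (fob F X)) = \<lambda>\<^sub>l\<^bsub>D\<^esub> (fob F X)"
    and fmu_runit: "X \<in> Ob C
      \<Longrightarrow> far F (\<rho>\<^bsub>C\<^esub> X) \<cdot>\<^bsub>D\<^esub> fmu F X \<one>\<^sub>o\<^bsub>C\<^esub> \<cdot>\<^bsub>D\<^esub> (\<iota>\<^bsub>D\<^esub> (fob F X) \<otimes>\<^sub>a\<^bsub>D\<^esub> fmu0 F) = \<rho>\<^bsub>D\<^esub> (fob F X)"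

locale tensor_functor =
  C: tensor_category k C + D: tensor_category k D + strong_monoidal_functor C D F
  for k :: "('k, 'x) ring_scheme"
    and C :: "('o, 'm, 'k, 'y) mon_category_scheme" and D :: "('p, 'n, 'k, 'z) mon_category_scheme"
    and F :: "('o, 'm, 'p, 'n, 'w) mon_functor_data_scheme" +
  assumes F_linear: "linear k C D F"
    and F_exact: "exact C D F"

definition tensor_equivalence where
  "tensor_equivalence k C D F \<longleftrightarrow> tensor_functor k C D F \<and> is_equivalence C D F"

definition comp_mon_functor :: "('q, 'l, 'k, 'x) mon_category_scheme \<Rightarrow>
    ('p, 'n, 'q, 'l, 'y) mon_functor_data_scheme \<Rightarrow> ('o, 'm, 'p, 'n, 'z) mon_functor_data_scheme \<Rightarrow>
    ('o, 'm, 'q, 'l) mon_functor_data" where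
  "comp_mon_functor E G F = \<lparr>fob = \<lambda>X. fob G (fob F X), far = \<lambda>f. far G (far F f),
     fmu = \<lambda>X Y. far G (fmu F X Y) \<cdot>\<^bsub>E\<^esub> fmu G (fob F X) (fob F Y),
     fmu0 = far G (fmu0 F) \<cdot>\<^bsub>E\<^esub> fmu0 G\<rparr>"

definition monoidal_nat_iso where
  "monoidal_nat_iso C D F G \<theta> \<longleftrightarrow> nat_iso C D F G \<theta> \<and>
     (\<forall>X \<in> Ob C. \<forall>Y \<in> Ob C.
        \<theta> (X \<otimes>\<^sub>o\<^bsub>C\<^esub> Y) \<cdot>\<^bsub>D\<^esub> fmu F X Y = fmu G X Y \<cdot>\<^bsub>D\<^esub> (\<theta> X \<otimes>\<^sub>a\<^bsub>D\<^esub> \<theta> Y)) \<and>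
     \<theta> \<one>\<^sub>o\<^bsub>C\<^esub> \<cdot>\<^bsub>D\<^esub> fmu0 F = fmu0 G"

definition isomorphic_tensor_functors where
  "isomorphic_tensor_functors k C D F G \<longleftrightarrow>
     tensor_functor k C D F \<and> tensor_functor k C D G \<and> (\<exists>\<theta>. monoidal_nat_iso C D F G \<theta>)"


section \<open>Central algebras\<close>

record ('o, 'm) alg =
  aob :: 'o
  amul :: 'm
  aone :: 'm

record ('o, 'm) central_alg = "('o, 'm) alg" +
  ahb :: "'o \<Rightarrow> 'm"

locale algebra_object =
  fixes C :: "('o, 'm, 'k, 'y) mon_category_scheme" (structure)
    and A :: "('o, 'm, 'z) alg_scheme"
  assumes aob_in: "aob A \<in> Ob C"
    and amul_in: "amul A \<in> Hom C (aob A \<otimes>\<^sub>o aob A) (aob A)"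
    and aone_in: "aone A \<in> Hom C \<one>\<^sub>o (aob A)"
    and amul_assoc: "amul A \<cdot> (amul A \<otimes>\<^sub>a \<iota> (aob A))
      = amul A \<cdot> (\<iota> (aob A) \<otimes>\<^sub>a amul A) \<cdot> \<alpha> (aob A) (aob A) (aob A)"
    and aone_left: "amul A \<cdot> (aone A \<otimes>\<^sub>a \<iota> (aob A)) = \<lambda>\<^sub>l (aob A)"
    and aone_right: "amul A \<cdot> (\<iota> (aob A) \<otimes>\<^sub>a aone A) = \<rho> (aob A)"

locale half_braiding =
  fixes C :: "('o, 'm, 'k, 'y) mon_category_scheme" (structure)
    and A :: 'o and \<sigma> :: "'o \<Rightarrow> 'm"
  assumes hb_in: "X \<in> Ob C \<Longrightarrow> \<sigma> X \<in> Hom C (A \<otimes>\<^sub>o X) (X \<otimes>\<^sub>o A)"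
    and hb_iso: "X \<in> Ob C \<Longrightarrow> iso_ar C (\<sigma> X)"
    and hb_nat: "f \<in> Hom C X Y \<Longrightarrow> \<sigma> Y \<cdot> (\<iota> A \<otimes>\<^sub>a f) = (f \<otimes>\<^sub>a \<iota> A) \<cdot> \<sigma> X"
    and hb_tens: "\<lbrakk>X \<in> Ob C; Y \<in> Ob C\<rbrakk>
      \<Longrightarrow> \<alpha> X Y A \<cdot> \<sigma> (X \<otimes>\<^sub>o Y) \<cdot> \<alpha> A X Y
        = (\<iota> X \<otimes>\<^sub>a \<sigma> Y) \<cdot> \<alpha> X A Y \<cdot> (\<sigma> X \<otimes>\<^sub>a \<iota> Y)"

locale central_algebra = algebra_object C A + half_braiding C "aob A" "ahb A"
  for C :: "('o, 'm, 'k, 'y) mon_category_scheme" (structure)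
    and A :: "('o, 'm, 'z) central_alg_scheme" +
  assumes hb_mul: "X \<in> Ob C
      \<Longrightarrow> ahb A X \<cdot> (amul A \<otimes>\<^sub>a \<iota> X)
        = (\<iota> X \<otimes>\<^sub>a amul A) \<cdot> \<alpha> X (aob A) (aob A) \<cdot> (ahb A X \<otimes>\<^sub>a \<iota> (aob A))
            \<cdot> inv_ar C (\<alpha> (aob A) X (aob A)) \<cdot> (\<iota> (aob A) \<otimes>\<^sub>a ahb A X) \<cdot> \<alpha> (aob A) (aob A) X"
    and hb_one: "X \<in> Ob C
      \<Longrightarrow> ahb A X \<cdot> (aone A \<otimes>\<^sub>a \<iota> X) = (\<iota> X \<otimes>\<^sub>a aone A) \<cdot> inv_ar C (\<rho> X) \<cdot> \<lambda>\<^sub>l X"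

locale commutative_central_algebra = central_algebra C A
  for C :: "('o, 'm, 'k, 'y) mon_category_scheme" (structure)
    and A :: "('o, 'm, 'z) central_alg_scheme" +
  assumes hb_commutative: "amul A \<cdot> ahb A (aob A) = amul A"


section \<open>Modules over an algebra\<close>

text \<open>A right module is a pair of its underlying object and its action.  An arrow of modules is
  a triple, since the underlying arrow does not determine the actions on its source and target.\<close>

type_synonym ('o, 'm) mod_ob = "'o \<times> 'm"
type_synonym ('o, 'm) mod_ar = "('o, 'm) mod_ob \<times> 'm \<times> ('o, 'm) mod_ob"

definition right_module where
  "right_module C A P \<longleftrightarrow> (case P of (M, r) \<Rightarrow>
     M \<in> Ob C \<and> r \<in> Hom C (M \<otimes>\<^sub>o aob A) M \<and>
     r \<cdot> (r \<otimes>\<^sub>a \<iota> (aob A)) = r \<cdot> (\<iota> M \<otimes>\<^sub>a amul A) \<cdot> \<alpha> M (aob A) (aob A) \<and>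
     r \<cdot> (\<iota> M \<otimes>\<^sub>a aone A) = \<rho> M)" for C (structure)

definition module_hom where
  "module_hom C A P f Q \<longleftrightarrow> (case (P, Q) of ((M, r), (N, s)) \<Rightarrow>
     f \<in> Hom C M N \<and> f \<cdot> r = s \<cdot> (f \<otimes>\<^sub>a \<iota> (aob A)))" for C (structure)

definition mod_cat :: "('o, 'm, 'k, 'y) mon_category_scheme \<Rightarrow> ('o, 'm, 'z) alg_scheme \<Rightarrow>
    (('o, 'm) mod_ob, ('o, 'm) mod_ar, 'k) lin_category" where
  "mod_cat C A = \<lparr>
     Ob = {P. right_module C A P},
     Ar = {(P, f, Q). right_module C A P \<and> right_module C A Q \<and> module_hom C A P f Q},
     src = \<lambda>(P, f, Q). P,
     tgt = \<lambda>(P, f, Q). Q,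
     ide = \<lambda>P. (P, \<iota> (fst P), P),
     cmp = \<lambda>(_, g, Q) (P, f, _). (P, g \<cdot> f, Q),
     zero_ar = \<lambda>P Q. (P, zero_ar C (fst P) (fst Q), Q),
     add_ar = \<lambda>(P, f, Q) (_, g, _). (P, add_ar C f g, Q),
     smul_ar = \<lambda>c (P, f, Q). (P, smul_ar C c f, Q)\<rparr>" for C (structure)

text \<open>The tensor product over \<open>A\<close> uses an arbitrary but fixed choice of coequalizers.\<close>

definition mod_proj :: "('o, 'm, 'k, 'y) mon_category_scheme \<Rightarrow> ('o, 'm, 'z) central_alg_scheme \<Rightarrow>
    ('o, 'm) mod_ob \<Rightarrow> ('o, 'm) mod_ob \<Rightarrow> 'm" where
  "mod_proj C A P Q = (case (P, Q) of ((M, r), (N, s)) \<Rightarrow>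
     SOME p. is_coequalizer C (r \<otimes>\<^sub>a \<iota> N) ((\<iota> M \<otimes>\<^sub>a (s \<cdot> ahb A N)) \<cdot> \<alpha> M (aob A) N) p)"
  for C (structure)

definition mod_tens_ob :: "('o, 'm, 'k, 'y) mon_category_scheme \<Rightarrow>
    ('o, 'm, 'z) central_alg_scheme \<Rightarrow> ('o, 'm) mod_ob \<Rightarrow> ('o, 'm) mod_ob \<Rightarrow> ('o, 'm) mod_ob" where
  "mod_tens_ob C A P Q = (case (P, Q) of ((M, r), (N, s)) \<Rightarrow>
     let p = mod_proj C A P Q; T = tgt C p in
       (T, THE t. t \<in> Hom C (T \<otimes>\<^sub>o aob A) T \<and>
          t \<cdot> (p \<otimes>\<^sub>a \<iota> (aob A)) = p \<cdot> (\<iota> M \<otimes>\<^sub>a s) \<cdot> \<alpha> M N (aob A)))" for C (structure)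

definition mod_tens_ar :: "('o, 'm, 'k, 'y) mon_category_scheme \<Rightarrow>
    ('o, 'm, 'z) central_alg_scheme \<Rightarrow> ('o, 'm) mod_ar \<Rightarrow> ('o, 'm) mod_ar \<Rightarrow> ('o, 'm) mod_ar" where
  "mod_tens_ar C A a b = (case (a, b) of ((P, f, P'), (Q, g, Q')) \<Rightarrow>
     let S = mod_tens_ob C A P Q; T = mod_tens_ob C A P' Q' in
       (S, THE h. h \<in> Hom C (fst S) (fst T) \<and>
          h \<cdot> mod_proj C A P Q = mod_proj C A P' Q' \<cdot> (f \<otimes>\<^sub>a g), T))" for C (structure)

definition mod_assoc :: "('o, 'm, 'k, 'y) mon_category_scheme \<Rightarrow>
    ('o, 'm, 'z) central_alg_scheme \<Rightarrow> ('o, 'm) mod_ob \<Rightarrow> ('o, 'm) mod_ob \<Rightarrow> ('o, 'm) mod_ob \<Rightarrow>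
    ('o, 'm) mod_ar" where
  "mod_assoc C A P Q U =
     (let PQ = mod_tens_ob C A P Q; QU = mod_tens_ob C A Q U;
          S = mod_tens_ob C A PQ U; T = mod_tens_ob C A P QU in
       (S, THE h. h \<in> Hom C (fst S) (fst T) \<and>
          h \<cdot> mod_proj C A PQ U \<cdot> (mod_proj C A P Q \<otimes>\<^sub>a \<iota> (fst U))
            = mod_proj C A P QU \<cdot> (\<iota> (fst P) \<otimes>\<^sub>a mod_proj C A Q U) \<cdot> \<alpha> (fst P) (fst Q) (fst U), T))"
  for C (structure)

definition mod_unit :: "('o, 'm, 'z) alg_scheme \<Rightarrow> ('o, 'm) mod_ob" where
  "mod_unit A = (aob A, amul A)"

definition mod_lunit :: "('o, 'm, 'k, 'y) mon_category_scheme \<Rightarrow>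
    ('o, 'm, 'z) central_alg_scheme \<Rightarrow> ('o, 'm) mod_ob \<Rightarrow> ('o, 'm) mod_ar" where
  "mod_lunit C A P = (case P of (M, r) \<Rightarrow>
     let S = mod_tens_ob C A (mod_unit A) P in
       (S, THE h. h \<in> Hom C (fst S) M \<and> h \<cdot> mod_proj C A (mod_unit A) P = r \<cdot> ahb A M, P))"
  for C (structure)

definition mod_runit :: "('o, 'm, 'k, 'y) mon_category_scheme \<Rightarrow>
    ('o, 'm, 'z) central_alg_scheme \<Rightarrow> ('o, 'm) mod_ob \<Rightarrow> ('o, 'm) mod_ar" where
  "mod_runit C A P = (case P of (M, r) \<Rightarrow>
     let S = mod_tens_ob C A P (mod_unit A) in
       (S, THE h. h \<in> Hom C (fst S) M \<and> h \<cdot> mod_proj C A P (mod_unit A) = r, P))"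
  for C (structure)

definition mod_tensor_cat :: "('o, 'm, 'k, 'y) mon_category_scheme \<Rightarrow>
    ('o, 'm, 'z) central_alg_scheme \<Rightarrow> (('o, 'm) mod_ob, ('o, 'm) mod_ar, 'k) mon_category" where
  "mod_tensor_cat C A = lin_category.extend (mod_cat C A)
     \<lparr>tens_ob = mod_tens_ob C A, tens_ar = mod_tens_ar C A, unit_ob = mod_unit A,
      assoc = mod_assoc C A, lunit = mod_lunit C A, runit = mod_runit C A\<rparr>"

definition free_module :: "('o, 'm, 'k, 'y) mon_category_scheme \<Rightarrow> ('o, 'm, 'z) alg_scheme \<Rightarrow>
    'o \<Rightarrow> ('o, 'm) mod_ob" where
  "free_module C A X = (X \<otimes>\<^sub>o aob A, (\<iota> X \<otimes>\<^sub>a amul A) \<cdot> \<alpha> X (aob A) (aob A))" for C (structure)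

text \<open>The monoidal structure of the free module functor
  is induced by \<open>X \<otimes> A \<otimes> Y \<otimes> A \<rightarrow> X \<otimes> Y \<otimes> A \<otimes> A \<rightarrow> X \<otimes> Y \<otimes> A\<close>, the half-braiding
  of \<open>A\<close> with \<open>Y\<close> followed by the product of \<open>A\<close>.\<close>

definition free_module_functor :: "('o, 'm, 'k, 'y) mon_category_scheme \<Rightarrow>
    ('o, 'm, 'z) central_alg_scheme \<Rightarrow>
    ('o, 'm, ('o, 'm) mod_ob, ('o, 'm) mod_ar) mon_functor_data" where
  "free_module_functor C A = \<lparr>
     fob = free_module C A,
     far = \<lambda>f. (free_module C A (src C f), f \<otimes>\<^sub>a \<iota> (aob A), free_module C A (tgt C f)),
     fmu = \<lambda>X Y.
       let P = free_module C A X; Q = free_module C A Y;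
           S = mod_tens_ob C A P Q; T = free_module C A (X \<otimes>\<^sub>o Y) in
         (S, THE h. h \<in> Hom C (fst S) (fst T) \<and>
            h \<cdot> mod_proj C A P Q
              = inv_ar C (\<alpha> X Y (aob A))
                \<cdot> (\<iota> X \<otimes>\<^sub>a ((\<iota> Y \<otimes>\<^sub>a amul A) \<cdot> \<alpha> Y (aob A) (aob A) \<cdot> (ahb A Y \<otimes>\<^sub>a \<iota> (aob A))
                     \<cdot> inv_ar C (\<alpha> (aob A) Y (aob A))))
                \<cdot> \<alpha> X (aob A) (Y \<otimes>\<^sub>o aob A), T),
     fmu0 = (mod_unit A, inv_ar C (\<lambda>\<^sub>l (aob A)), free_module C A \<one>\<^sub>o)\<rparr>" for C (structure)


section \<open>The central algebra of an adjunction\<close>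

text \<open>The canonical lax monoidal structure on a right adjoint \<open>R\<close> of a strong monoidal functor
  \<open>F\<close>: the adjuncts of
  \<open>F(RX \<otimes> RY) \<rightarrow> FRX \<otimes> FRY \<rightarrow> X \<otimes> Y\<close> and of \<open>F\<one> \<rightarrow> \<one>\<close>.\<close>

definition radj_mu where
  "radj_mu C D F R \<eta> \<epsilon> X Y =
     far R ((\<epsilon> X \<otimes>\<^sub>a\<^bsub>D\<^esub> \<epsilon> Y) \<cdot>\<^bsub>D\<^esub> inv_ar D (fmu F (fob R X) (fob R Y)))
       \<cdot>\<^bsub>C\<^esub> \<eta> (fob R X \<otimes>\<^sub>o\<^bsub>C\<^esub> fob R Y)"

definition radj_mu0 where
  "radj_mu0 C D F R \<eta> = far R (inv_ar D (fmu0 F)) \<cdot>\<^bsub>C\<^esub> \<eta> \<one>\<^sub>o\<^bsub>C\<^esub>"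

definition hb_left where
  "hb_left C D F R \<eta> \<epsilon> X =
     far R (\<lambda>\<^sub>l\<^bsub>D\<^esub> (fob F X)) \<cdot>\<^bsub>C\<^esub> radj_mu C D F R \<eta> \<epsilon> \<one>\<^sub>o\<^bsub>D\<^esub> (fob F X)
       \<cdot>\<^bsub>C\<^esub> (\<iota>\<^bsub>C\<^esub> (fob R \<one>\<^sub>o\<^bsub>D\<^esub>) \<otimes>\<^sub>a\<^bsub>C\<^esub> \<eta> X)"

definition hb_right where
  "hb_right C D F R \<eta> \<epsilon> X =
     far R (\<rho>\<^bsub>D\<^esub> (fob F X)) \<cdot>\<^bsub>C\<^esub> radj_mu C D F R \<eta> \<epsilon> (fob F X) \<one>\<^sub>o\<^bsub>D\<^esub>
       \<cdot>\<^bsub>C\<^esub> (\<eta> X \<otimes>\<^sub>a\<^bsub>C\<^esub> \<iota>\<^bsub>C\<^esub> (fob R \<one>\<^sub>o\<^bsub>D\<^esub>))"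

definition is_adj_braiding where
  "is_adj_braiding C D F R \<eta> \<epsilon> X s \<longleftrightarrow>
     s \<in> Hom C (fob R \<one>\<^sub>o\<^bsub>D\<^esub> \<otimes>\<^sub>o\<^bsub>C\<^esub> X) (X \<otimes>\<^sub>o\<^bsub>C\<^esub> fob R \<one>\<^sub>o\<^bsub>D\<^esub>) \<and>
     hb_right C D F R \<eta> \<epsilon> X \<cdot>\<^bsub>C\<^esub> s = hb_left C D F R \<eta> \<epsilon> X"

definition adj_algebra :: "('o, 'm, 'k, 'x) mon_category_scheme \<Rightarrow>
    ('p, 'n, 'k, 'y) mon_category_scheme \<Rightarrow> ('o, 'm, 'p, 'n, 'z) mon_functor_data_scheme \<Rightarrow>
    ('p, 'n, 'o, 'm, 'w) functor_data_scheme \<Rightarrow> ('o \<Rightarrow> 'm) \<Rightarrow> ('p \<Rightarrow> 'n) \<Rightarrow>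
    ('o, 'm) central_alg" where
  "adj_algebra C D F R \<eta> \<epsilon> = \<lparr>
     aob = fob R \<one>\<^sub>o\<^bsub>D\<^esub>,
     amul = far R (\<lambda>\<^sub>l\<^bsub>D\<^esub> \<one>\<^sub>o\<^bsub>D\<^esub>) \<cdot>\<^bsub>C\<^esub> radj_mu C D F R \<eta> \<epsilon> \<one>\<^sub>o\<^bsub>D\<^esub> \<one>\<^sub>o\<^bsub>D\<^esub>,
     aone = radj_mu0 C D F R \<eta>,
     ahb = \<lambda>X. THE s. is_adj_braiding C D F R \<eta> \<epsilon> X s\<rparr>"

end

theory Submission
  imports Defs
begin

text \<open>
  Why the theorem holds. Write \<open>A = R 1\<close> for the image of the unit object, and let \<open>R2\<close> be the lax
  monoidal structure of \<open>R\<close>, whose coherence follows from that of \<open>F\<close> by transposition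
  (\<open>R2_assoc\<close>, \<open>R2_lunit\<close>). Combining \<open>R2\<close> with the unit of the adjunction gives arrows
  \<open>W \<otimes> R Y \<rightarrow> R(F W \<otimes> Y)\<close>. These are invertible because objects of \<open>C\<close> have duals and \<open>F\<close> preserves
  them (\<open>projection_iso\<close>). For \<open>Y = 1\<close> and for its mirror image this makes the arrows
  \<open>Q : X \<otimes> A \<rightarrow> R F X\<close> and \<open>L : A \<otimes> X \<rightarrow> R F X\<close> invertible, so that the half-braiding exists, is unique,
  and is \<open>Q\<^sup>-\<^sup>1 L\<close>. The axioms of a commutative central algebra then all come from three properties of
  \<open>R2\<close>: it respects the left and the right actions of \<open>A\<close> and is balanced over \<open>A\<close>.

  Let \<open>R\<close> be faithful and exact. By \<open>Q\<close>, modules over \<open>A\<close> are the algebras of the monad \<open>R F\<close>, and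
  Beck's argument shows that \<open>Y \<mapsto> R Y\<close> is an equivalence \<open>K\<close> from \<open>D\<close> to the category of modules
  (\<open>R_full\<close>, \<open>module_from_R\<close>). The crucial point for the monoidal structure is that
  \<open>R2 X Y : R X \<otimes> R Y \<rightarrow> R(X \<otimes> Y)\<close> is the coequalizer that defines the tensor product over \<open>A\<close>
  (\<open>R2_coequalizer\<close>): up to the isomorphism above it is the image of \<open>\<epsilon> \<otimes> Y\<close> under \<open>R\<close>, a cokernel by
  exactness.

  Consequently every module is presented by an object of \<open>D\<close>, the tensor product over \<open>A\<close> of modules
  presented by \<open>X\<close> and \<open>Y\<close> is presented by \<open>X \<otimes> Y\<close> (\<open>tens_pres\<close>), and the arrows that define the
  associator, the unitors and the tensor product of morphisms exist since they can be written down in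
  \<open>D\<close>. They are unique because the projections are epi, which also gives their coherence from that
  of \<open>C\<close>. Abelianness, finite length, finite-dimensional spaces of arrows and duals are transported
  along the equivalence \<open>K\<close>. Finally the isomorphisms \<open>Q\<close> themselves form the monoidal isomorphism
  between \<open>K F\<close> and the free module functor (\<open>free_module_functor_iso\<close>).
\<close>


section \<open>Calculus in a category\<close>

context category
begin

lemma in_Hom: "f \<in> Hom C X Y \<longleftrightarrow> f \<in> Ar C \<and> src C f = X \<and> tgt C f = Y"
  by (auto simp: Hom_def)

lemma src_Ob [simp]: "f \<in> Ar C \<Longrightarrow> src C f \<in> Ob C"
  and tgt_Ob [simp]: "f \<in> Ar C \<Longrightarrow> tgt C f \<in> Ob C"
  using src_tgt_in by auto

lemma ide_Ar [simp]: "X \<in> Ob C \<Longrightarrow> \<iota> X \<in> Ar C"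
  and src_ide [simp]: "X \<in> Ob C \<Longrightarrow> src C (\<iota> X) = X"
  and tgt_ide [simp]: "X \<in> Ob C \<Longrightarrow> tgt C (\<iota> X) = X"
  using ide_in by (auto simp: in_Hom)

lemma cmp_Ar [simp]: "\<lbrakk>src C g = tgt C f; f \<in> Ar C; g \<in> Ar C\<rbrakk> \<Longrightarrow> g \<cdot> f \<in> Ar C"
  and src_cmp [simp]: "\<lbrakk>src C g = tgt C f; f \<in> Ar C; g \<in> Ar C\<rbrakk> \<Longrightarrow> src C (g \<cdot> f) = src C f"
  and tgt_cmp [simp]: "\<lbrakk>src C g = tgt C f; f \<in> Ar C; g \<in> Ar C\<rbrakk> \<Longrightarrow> tgt C (g \<cdot> f) = tgt C g"
  using cmp_in[of f "src C f" "tgt C f" g "tgt C g"] by (auto simp: in_Hom)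

lemma cmp_ide_src [simp]: "\<lbrakk>src C f = X; f \<in> Ar C\<rbrakk> \<Longrightarrow> f \<cdot> \<iota> X = f"
  and ide_tgt_cmp [simp]: "\<lbrakk>tgt C f = X; f \<in> Ar C\<rbrakk> \<Longrightarrow> \<iota> X \<cdot> f = f"
  using cmp_ide ide_cmp by (auto simp: in_Hom)

lemma cmp_assoc_right [simp]:
  "\<lbrakk>src C h = tgt C g; src C g = tgt C f; f \<in> Ar C; g \<in> Ar C; h \<in> Ar C\<rbrakk>
    \<Longrightarrow> (h \<cdot> g) \<cdot> f = h \<cdot> (g \<cdot> f)"
  using cmp_assoc[of f "src C f" "tgt C f" g "tgt C g" h "tgt C h"] by (auto simp: in_Hom)

text \<open>Composites are kept nested to the right; this lemma makes an equation for a composite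
  of two arrows applicable at the front of a longer composite.\<close>

lemma reassoc:
  "\<lbrakk>g \<cdot> f = a; src C g = tgt C f; f \<in> Ar C; g \<in> Ar C; tgt C b = src C f; b \<in> Ar C\<rbrakk>
    \<Longrightarrow> g \<cdot> (f \<cdot> b) = a \<cdot> b"
  using cmp_assoc_right[of g f b] by metis

lemma reassoc3:
  "\<lbrakk>h \<cdot> (g \<cdot> f) = a; src C h = tgt C g; src C g = tgt C f; f \<in> Ar C; g \<in> Ar C; h \<in> Ar C;
    tgt C b = src C f; b \<in> Ar C\<rbrakk>
    \<Longrightarrow> h \<cdot> (g \<cdot> (f \<cdot> b)) = a \<cdot> b"
  using cmp_assoc_right[of g f b] cmp_assoc_right[of h "g \<cdot> f" b] by simp

lemma cmp_assoc_left:
  "\<lbrakk>src C h = tgt C g; src C g = tgt C f; f \<in> Ar C; g \<in> Ar C; h \<in> Ar C\<rbrakk>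
    \<Longrightarrow> h \<cdot> (g \<cdot> f) = (h \<cdot> g) \<cdot> f"
  by simp

lemma inverse_arrows_unique:
  assumes "inverse_arrows C f g" "inverse_arrows C f h" shows "g = h"
proof -
  have "g = g \<cdot> (f \<cdot> h)" using assms by (simp add: inverse_arrows_def in_Hom)
  also have "\<dots> = (g \<cdot> f) \<cdot> h"
    using assms by (intro cmp_assoc_left) (simp_all add: inverse_arrows_def in_Hom)
  also have "\<dots> = h" using assms by (simp add: inverse_arrows_def in_Hom)
  finally show ?thesis .
qed

lemma inv_ar_eq: "inverse_arrows C f g \<Longrightarrow> inv_ar C f = g"
  unfolding inv_ar_def using inverse_arrows_unique by blast

lemma inverse_arrows_inv: "iso_ar C f \<Longrightarrow> inverse_arrows C f (inv_ar C f)"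
  using inv_ar_eq unfolding iso_ar_def by metis

lemma iso_Ar: "iso_ar C f \<Longrightarrow> f \<in> Ar C"
  and inv_Ar [simp]: "iso_ar C f \<Longrightarrow> inv_ar C f \<in> Ar C"
  and src_inv [simp]: "iso_ar C f \<Longrightarrow> src C (inv_ar C f) = tgt C f"
  and tgt_inv [simp]: "iso_ar C f \<Longrightarrow> tgt C (inv_ar C f) = src C f"
  and inv_cmp [simp]: "iso_ar C f \<Longrightarrow> inv_ar C f \<cdot> f = \<iota> (src C f)"
  and cmp_inv [simp]: "iso_ar C f \<Longrightarrow> f \<cdot> inv_ar C f = \<iota> (tgt C f)"
  using inverse_arrows_inv[of f] by (auto simp: inverse_arrows_def in_Hom)

lemma inv_cmp_reassoc [simp]:
    "\<lbrakk>iso_ar C f; tgt C b = src C f; b \<in> Ar C\<rbrakk> \<Longrightarrow> inv_ar C f \<cdot> (f \<cdot> b) = b"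
  and cmp_inv_reassoc [simp]:
    "\<lbrakk>iso_ar C f; tgt C b = tgt C f; b \<in> Ar C\<rbrakk> \<Longrightarrow> f \<cdot> (inv_ar C f \<cdot> b) = b"
  by (simp_all add: inv_cmp[THEN reassoc] cmp_inv[THEN reassoc] iso_Ar)

lemma inverse_arrows_sym: "inverse_arrows C f g \<Longrightarrow> inverse_arrows C g f"
  by (auto simp: inverse_arrows_def in_Hom)

lemma iso_inv [simp]: "iso_ar C f \<Longrightarrow> iso_ar C (inv_ar C f)"
  and inv_inv [simp]: "iso_ar C f \<Longrightarrow> inv_ar C (inv_ar C f) = f"
  using inverse_arrows_inv[THEN inverse_arrows_sym, of f] inv_ar_eq
  by (auto simp: iso_ar_def)

lemma isoI:
  assumes "f \<in> Ar C" "g \<in> Ar C" "src C g = tgt C f" "tgt C g = src C f"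
    "g \<cdot> f = \<iota> (src C f)" "f \<cdot> g = \<iota> (tgt C f)"
  shows "iso_ar C f" and "inv_ar C f = g"
proof -
  have "inverse_arrows C f g" using assms by (auto simp: inverse_arrows_def in_Hom)
  thus "iso_ar C f" "inv_ar C f = g" using inv_ar_eq by (auto simp: iso_ar_def)
qed

lemma iso_ide [simp]: "X \<in> Ob C \<Longrightarrow> iso_ar C (\<iota> X)"
  and inv_ide [simp]: "X \<in> Ob C \<Longrightarrow> inv_ar C (\<iota> X) = \<iota> X"
  using isoI[of "\<iota> X" "\<iota> X"] by auto

lemma iso_cmp [simp]: "\<lbrakk>src C g = tgt C f; iso_ar C f; iso_ar C g\<rbrakk> \<Longrightarrow> iso_ar C (g \<cdot> f)"
  and inv_of_cmp: "\<lbrakk>src C g = tgt C f; iso_ar C f; iso_ar C g\<rbrakk>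
    \<Longrightarrow> inv_ar C (g \<cdot> f) = inv_ar C f \<cdot> inv_ar C g"
  using isoI[of "g \<cdot> f" "inv_ar C f \<cdot> inv_ar C g"] by (auto simp: iso_Ar)

lemma mono_iff: "mono_ar C f \<longleftrightarrow> f \<in> Ar C \<and> (\<forall>g h. g \<in> Ar C \<longrightarrow> h \<in> Ar C \<longrightarrow> tgt C g = src C f
    \<longrightarrow> tgt C h = src C f \<longrightarrow> src C g = src C h \<longrightarrow> f \<cdot> g = f \<cdot> h \<longrightarrow> g = h)"
  unfolding mono_ar_def by (auto simp: in_Hom)

lemma epi_iff: "epi_ar C f \<longleftrightarrow> f \<in> Ar C \<and> (\<forall>g h. g \<in> Ar C \<longrightarrow> h \<in> Ar C \<longrightarrow> src C g = tgt C f
    \<longrightarrow> src C h = tgt C f \<longrightarrow> tgt C g = tgt C h \<longrightarrow> g \<cdot> f = h \<cdot> f \<longrightarrow> g = h)"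
  unfolding epi_ar_def by (auto simp: in_Hom)

lemma monoD: "\<lbrakk>mono_ar C f; f \<cdot> g = f \<cdot> h; g \<in> Ar C; h \<in> Ar C; tgt C g = src C f;
    tgt C h = src C f; src C g = src C h\<rbrakk> \<Longrightarrow> g = h"
  by (auto simp: mono_iff)

lemma epiD: "\<lbrakk>epi_ar C f; g \<cdot> f = h \<cdot> f; g \<in> Ar C; h \<in> Ar C; src C g = tgt C f;
    src C h = tgt C f; tgt C g = tgt C h\<rbrakk> \<Longrightarrow> g = h"
  by (auto simp: epi_iff)

lemma epi_Ar: "epi_ar C f \<Longrightarrow> f \<in> Ar C" and mono_Ar: "mono_ar C f \<Longrightarrow> f \<in> Ar C"
  by (auto simp: epi_ar_def mono_ar_def)

lemma split_mono: "\<lbrakk>f \<in> Ar C; g \<in> Ar C; src C g = tgt C f; g \<cdot> f = \<iota> (src C f)\<rbrakk> \<Longrightarrow> mono_ar C f"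
  unfolding mono_iff using cmp_assoc_right[of g f] by (metis ide_tgt_cmp)

lemma split_epi: "\<lbrakk>f \<in> Ar C; g \<in> Ar C; tgt C g = src C f; f \<cdot> g = \<iota> (tgt C f)\<rbrakk> \<Longrightarrow> epi_ar C f"
  unfolding epi_iff using cmp_assoc_right[of _ f g] by (metis cmp_ide_src)

lemma iso_mono [simp]: "iso_ar C f \<Longrightarrow> mono_ar C f"
  by (rule split_mono[of f "inv_ar C f"]) (simp_all add: iso_Ar)

lemma iso_epi [simp]: "iso_ar C f \<Longrightarrow> epi_ar C f"
  by (rule split_epi[of f "inv_ar C f"]) (simp_all add: iso_Ar)

lemma mono_cmp [simp]:
  assumes "src C g = tgt C f" "mono_ar C f" "mono_ar C g" shows "mono_ar C (g \<cdot> f)"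
  unfolding mono_iff
proof (intro conjI allI impI)
  fix a b assume *: "a \<in> Ar C" "b \<in> Ar C" "tgt C a = src C (g \<cdot> f)" "tgt C b = src C (g \<cdot> f)"
    "src C a = src C b" "(g \<cdot> f) \<cdot> a = (g \<cdot> f) \<cdot> b"
  have "f \<cdot> a = f \<cdot> b" by (rule monoD[OF assms(3)]) (use * assms in \<open>auto simp: mono_Ar\<close>)
  thus "a = b" by (rule monoD[OF assms(2)]) (use * assms in \<open>auto simp: mono_Ar\<close>)
qed (use assms in \<open>auto simp: mono_Ar\<close>)

lemma epi_cmp [simp]:
  assumes "src C g = tgt C f" "epi_ar C f" "epi_ar C g" shows "epi_ar C (g \<cdot> f)"
  unfolding epi_iff
proof (intro conjI allI impI)
  fix a b assume *: "a \<in> Ar C" "b \<in> Ar C" "src C a = tgt C (g \<cdot> f)" "src C b = tgt C (g \<cdot> f)"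
    "tgt C a = tgt C b" "a \<cdot> g \<cdot> f = b \<cdot> g \<cdot> f"
  have "a \<cdot> g = b \<cdot> g" by (rule epiD[OF assms(2)]) (use * assms in \<open>auto simp: epi_Ar\<close>)
  thus "a = b" by (rule epiD[OF assms(3)]) (use * assms in \<open>auto simp: epi_Ar\<close>)
qed (use assms in \<open>auto simp: epi_Ar\<close>)

lemma mono_split_epi_iso:
  assumes "mono_ar C f" "g \<in> Ar C" "tgt C g = src C f" "f \<cdot> g = \<iota> (tgt C f)"
    and "src C g = tgt C f"
  shows "iso_ar C f"
proof -
  have "g \<cdot> f = \<iota> (src C f)"
    by (rule monoD[OF assms(1)]) (use assms in \<open>simp_all add: mono_Ar assms(4)[THEN reassoc]\<close>)
  thus ?thesis using assms by (intro isoI[of f g]) (auto simp: mono_Ar)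
qed

lemma iso_if_mono_split_epi:
  assumes "f \<in> Ar C"
    and "\<exists>g. g \<in> Ar C \<and> src C g = tgt C f \<and> tgt C g = src C f \<and> f \<cdot> g = \<iota> (tgt C f)"
    and "mono_ar C f"
  shows "iso_ar C f"
  using assms mono_split_epi_iso by blast

lemma coequalizer_epi:
  assumes "is_coequalizer C f g p" "f \<in> Ar C" "g \<in> Ar C" "tgt C g = tgt C f" "src C g = src C f"
  shows "epi_ar C p"
  unfolding epi_iff
proof (intro conjI allI impI)
  have p: "p \<in> Ar C" "src C p = tgt C f" "p \<cdot> f = p \<cdot> g"
    using assms(1) by (auto simp: is_coequalizer_def)
  show "p \<in> Ar C" by fact
  fix a b assume ab: "a \<in> Ar C" "b \<in> Ar C" "src C a = tgt C p" "src C b = tgt C p"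
    "tgt C a = tgt C b" "a \<cdot> p = b \<cdot> p"
  have "a \<cdot> p \<in> Hom C (tgt C f) (tgt C a)" "(a \<cdot> p) \<cdot> f = (a \<cdot> p) \<cdot> g"
    using ab p assms(2-) by (auto simp: in_Hom)
  then have "\<exists>!l. l \<in> Hom C (tgt C p) (tgt C a) \<and> l \<cdot> p = a \<cdot> p"
    using assms(1) unfolding is_coequalizer_def by blast
  thus "a = b" using ab by (metis in_Hom)
qed

end

section \<open>Calculus in a monoidal category\<close>

context monoidal_category
begin

declare unit_in [simp] tens_ob_in [simp] assoc_iso [simp] lunit_iso [simp] runit_iso [simp]
  tens_ide [simp]

lemma tens_Ar [simp]: "\<lbrakk>f \<in> Ar C; g \<in> Ar C\<rbrakk> \<Longrightarrow> f \<otimes>\<^sub>a g \<in> Ar C"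
  and src_tens [simp]: "\<lbrakk>f \<in> Ar C; g \<in> Ar C\<rbrakk> \<Longrightarrow> src C (f \<otimes>\<^sub>a g) = src C f \<otimes>\<^sub>o src C g"
  and tgt_tens [simp]: "\<lbrakk>f \<in> Ar C; g \<in> Ar C\<rbrakk> \<Longrightarrow> tgt C (f \<otimes>\<^sub>a g) = tgt C f \<otimes>\<^sub>o tgt C g"
  using tens_ar_in[of f "src C f" "tgt C f" g "src C g" "tgt C g"] by (auto simp: in_Hom)

lemma assoc_typ [simp]:
  assumes "X \<in> Ob C" "Y \<in> Ob C" "Z \<in> Ob C"
  shows "\<alpha> X Y Z \<in> Ar C" "src C (\<alpha> X Y Z) = (X \<otimes>\<^sub>o Y) \<otimes>\<^sub>o Z" "tgt C (\<alpha> X Y Z) = X \<otimes>\<^sub>o (Y \<otimes>\<^sub>o Z)"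
  using assoc_in[OF assms] by (auto simp: in_Hom)

lemma unit_typ [simp]:
  assumes "X \<in> Ob C"
  shows "\<lambda>\<^sub>l X \<in> Ar C" "src C (\<lambda>\<^sub>l X) = \<one>\<^sub>o \<otimes>\<^sub>o X" "tgt C (\<lambda>\<^sub>l X) = X"
    "\<rho> X \<in> Ar C" "src C (\<rho> X) = X \<otimes>\<^sub>o \<one>\<^sub>o" "tgt C (\<rho> X) = X"
  using lunit_in[OF assms] runit_in[OF assms] by (auto simp: in_Hom)

lemma interchange [simp]:
  "\<lbrakk>src C f' = tgt C f; src C g' = tgt C g; f \<in> Ar C; f' \<in> Ar C; g \<in> Ar C; g' \<in> Ar C\<rbrakk>
    \<Longrightarrow> (f' \<otimes>\<^sub>a g') \<cdot> (f \<otimes>\<^sub>a g) = (f' \<cdot> f) \<otimes>\<^sub>a (g' \<cdot> g)"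
  using tens_cmp[of f "src C f" "tgt C f" f' "tgt C f'" g "src C g" "tgt C g" g' "tgt C g'"]
  by (auto simp: in_Hom)

declare interchange[THEN reassoc, simp]

lemma iso_tens [simp]: "\<lbrakk>iso_ar C f; iso_ar C g\<rbrakk> \<Longrightarrow> iso_ar C (f \<otimes>\<^sub>a g)"
  and inv_tens [simp]: "\<lbrakk>iso_ar C f; iso_ar C g\<rbrakk> \<Longrightarrow> inv_ar C (f \<otimes>\<^sub>a g) = inv_ar C f \<otimes>\<^sub>a inv_ar C g"
  using isoI[of "f \<otimes>\<^sub>a g" "inv_ar C f \<otimes>\<^sub>a inv_ar C g"] by (auto simp: iso_Ar)

text \<open>In the naturality rules the indices of the structural arrow are given by equations, so
  that they apply by rewriting.\<close>

lemma assoc_natural: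
  "\<lbrakk>X = tgt C f; Y = tgt C g; Z = tgt C h; f \<in> Ar C; g \<in> Ar C; h \<in> Ar C\<rbrakk>
    \<Longrightarrow> \<alpha> X Y Z \<cdot> ((f \<otimes>\<^sub>a g) \<otimes>\<^sub>a h) = (f \<otimes>\<^sub>a (g \<otimes>\<^sub>a h)) \<cdot> \<alpha> (src C f) (src C g) (src C h)"
  using assoc_nat[of f "src C f" X g "src C g" Y h "src C h" Z] by (simp add: in_Hom)

lemma assoc_natural_3:
  "\<lbrakk>Z = tgt C h; X \<in> Ob C; Y \<in> Ob C; h \<in> Ar C\<rbrakk>
    \<Longrightarrow> \<alpha> X Y Z \<cdot> (\<iota> (X \<otimes>\<^sub>o Y) \<otimes>\<^sub>a h) = (\<iota> X \<otimes>\<^sub>a (\<iota> Y \<otimes>\<^sub>a h)) \<cdot> \<alpha> X Y (src C h)"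
  using assoc_natural[of X "\<iota> X" Y "\<iota> Y" Z h] by simp

lemma assoc_inv_natural:
  assumes "X = tgt C f" "Y = tgt C g" "Z = tgt C h" "f \<in> Ar C" "g \<in> Ar C" "h \<in> Ar C"
  shows "inv_ar C (\<alpha> X Y Z) \<cdot> (f \<otimes>\<^sub>a (g \<otimes>\<^sub>a h))
    = ((f \<otimes>\<^sub>a g) \<otimes>\<^sub>a h) \<cdot> inv_ar C (\<alpha> (src C f) (src C g) (src C h))"
proof -
  let ?a = "\<alpha> (src C f) (src C g) (src C h)"
  have "inv_ar C (\<alpha> X Y Z) \<cdot> ((f \<otimes>\<^sub>a (g \<otimes>\<^sub>a h)) \<cdot> ?a) \<cdot> inv_ar C ?a
      = inv_ar C (\<alpha> X Y Z) \<cdot> (\<alpha> X Y Z \<cdot> ((f \<otimes>\<^sub>a g) \<otimes>\<^sub>a h)) \<cdot> inv_ar C ?a"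
    using assms assoc_natural[of X f Y g Z h] by simp
  thus ?thesis using assms by (simp del: cmp_inv) simp
qed

lemma assoc_inv_natural_1:
  "\<lbrakk>X = tgt C f; Y \<in> Ob C; Z \<in> Ob C; f \<in> Ar C\<rbrakk>
    \<Longrightarrow> inv_ar C (\<alpha> X Y Z) \<cdot> (f \<otimes>\<^sub>a \<iota> (Y \<otimes>\<^sub>o Z))
      = ((f \<otimes>\<^sub>a \<iota> Y) \<otimes>\<^sub>a \<iota> Z) \<cdot> inv_ar C (\<alpha> (src C f) Y Z)"
  using assoc_inv_natural[of X f Y "\<iota> Y" Z "\<iota> Z"] by simp

lemma lunit_natural: "\<lbrakk>X = tgt C f; f \<in> Ar C\<rbrakk> \<Longrightarrow> \<lambda>\<^sub>l X \<cdot> (\<iota> \<one>\<^sub>o \<otimes>\<^sub>a f) = f \<cdot> \<lambda>\<^sub>l (src C f)"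
  and runit_natural: "\<lbrakk>X = tgt C f; f \<in> Ar C\<rbrakk> \<Longrightarrow> \<rho> X \<cdot> (f \<otimes>\<^sub>a \<iota> \<one>\<^sub>o) = f \<cdot> \<rho> (src C f)"
  using lunit_nat[of f "src C f" X] runit_nat[of f "src C f" X] by (auto simp: in_Hom)

lemmas natural = assoc_natural assoc_natural[THEN reassoc]
  assoc_natural_3 assoc_natural_3[THEN reassoc]
  assoc_inv_natural assoc_inv_natural[THEN reassoc]
  assoc_inv_natural_1 assoc_inv_natural_1[THEN reassoc]
  lunit_natural lunit_natural[THEN reassoc]
  runit_natural runit_natural[THEN reassoc]

lemma unit_tens_cancel:
  assumes "\<iota> \<one>\<^sub>o \<otimes>\<^sub>a f = \<iota> \<one>\<^sub>o \<otimes>\<^sub>a g" "f \<in> Ar C" "g \<in> Ar C" "src C f = src C g" "tgt C f = tgt C g"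
  shows "f = g"
proof -
  have "f \<cdot> \<lambda>\<^sub>l (src C f) = g \<cdot> \<lambda>\<^sub>l (src C f)"
    using assms lunit_natural[of "tgt C f" f] lunit_natural[of "tgt C g" g] by simp
  thus ?thesis by (rule epiD[of "\<lambda>\<^sub>l (src C f)" f g, rotated]) (use assms in \<open>auto\<close>)
qed

text \<open>Kelly's argument: tensoring with the unit object is faithful, and after it both sides can be
  compared by means of the pentagon and the triangle.\<close>

lemma lunit_tens:
  assumes X: "X \<in> Ob C" and Y: "Y \<in> Ob C"
  shows "\<lambda>\<^sub>l (X \<otimes>\<^sub>o Y) \<cdot> \<alpha> \<one>\<^sub>o X Y = \<lambda>\<^sub>l X \<otimes>\<^sub>a \<iota> Y"
proof (rule unit_tens_cancel)
  let ?e = "\<alpha> \<one>\<^sub>o (\<one>\<^sub>o \<otimes>\<^sub>o X) Y \<cdot> (\<alpha> \<one>\<^sub>o \<one>\<^sub>o X \<otimes>\<^sub>a \<iota> Y)"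
  have 1: "(\<iota> \<one>\<^sub>o \<otimes>\<^sub>a \<lambda>\<^sub>l X) \<cdot> \<alpha> \<one>\<^sub>o \<one>\<^sub>o X = \<rho> \<one>\<^sub>o \<otimes>\<^sub>a \<iota> X"
    and 2: "(\<iota> \<one>\<^sub>o \<otimes>\<^sub>a \<lambda>\<^sub>l (X \<otimes>\<^sub>o Y)) \<cdot> \<alpha> \<one>\<^sub>o \<one>\<^sub>o (X \<otimes>\<^sub>o Y) = \<rho> \<one>\<^sub>o \<otimes>\<^sub>a \<iota> (X \<otimes>\<^sub>o Y)"
    using X Y triangle by auto
  have "(\<iota> \<one>\<^sub>o \<otimes>\<^sub>a (\<lambda>\<^sub>l (X \<otimes>\<^sub>o Y) \<cdot> \<alpha> \<one>\<^sub>o X Y)) \<cdot> ?e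
      = (\<iota> \<one>\<^sub>o \<otimes>\<^sub>a \<lambda>\<^sub>l (X \<otimes>\<^sub>o Y)) \<cdot> (\<iota> \<one>\<^sub>o \<otimes>\<^sub>a \<alpha> \<one>\<^sub>o X Y) \<cdot> ?e"
    using X Y by simp
  also have "\<dots> = (\<iota> \<one>\<^sub>o \<otimes>\<^sub>a \<lambda>\<^sub>l (X \<otimes>\<^sub>o Y)) \<cdot> \<alpha> \<one>\<^sub>o \<one>\<^sub>o (X \<otimes>\<^sub>o Y) \<cdot> \<alpha> (\<one>\<^sub>o \<otimes>\<^sub>o \<one>\<^sub>o) X Y"
    using X Y pentagon[of "\<one>\<^sub>o" "\<one>\<^sub>o" X Y] by simp
  also have "\<dots> = (\<rho> \<one>\<^sub>o \<otimes>\<^sub>a \<iota> (X \<otimes>\<^sub>o Y)) \<cdot> \<alpha> (\<one>\<^sub>o \<otimes>\<^sub>o \<one>\<^sub>o) X Y"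
    using X Y by (simp add: 2[THEN reassoc])
  also have "\<dots> = \<alpha> \<one>\<^sub>o X Y \<cdot> ((\<rho> \<one>\<^sub>o \<otimes>\<^sub>a \<iota> X) \<otimes>\<^sub>a \<iota> Y)"
    using X Y by (simp add: natural)
  also have "\<dots> = \<alpha> \<one>\<^sub>o X Y \<cdot> ((\<iota> \<one>\<^sub>o \<otimes>\<^sub>a \<lambda>\<^sub>l X) \<otimes>\<^sub>a \<iota> Y) \<cdot> (\<alpha> \<one>\<^sub>o \<one>\<^sub>o X \<otimes>\<^sub>a \<iota> Y)"
    using X Y by (simp add: 1)
  also have "\<dots> = (\<iota> \<one>\<^sub>o \<otimes>\<^sub>a (\<lambda>\<^sub>l X \<otimes>\<^sub>a \<iota> Y)) \<cdot> ?e"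
    using X Y by (simp add: natural del: interchange interchange[THEN reassoc])
  finally show "\<iota> \<one>\<^sub>o \<otimes>\<^sub>a (\<lambda>\<^sub>l (X \<otimes>\<^sub>o Y) \<cdot> \<alpha> \<one>\<^sub>o X Y) = \<iota> \<one>\<^sub>o \<otimes>\<^sub>a (\<lambda>\<^sub>l X \<otimes>\<^sub>a \<iota> Y)"
    by (rule epiD[of ?e, rotated]) (use X Y in \<open>auto\<close>)
qed (use X Y in auto)

end

text \<open>Reversing the tensor product turns statements on right actions, right duals and right units
  into their mirror images, so that only one of each pair needs a proof.\<close>

definition rev_mon :: "('o, 'm, 'k, 'z) mon_category_scheme \<Rightarrow> ('o, 'm, 'k, 'z) mon_category_scheme"
  where "rev_mon C = C\<lparr>tens_ob := \<lambda>X Y. tens_ob C Y X, tens_ar := \<lambda>f g. tens_ar C g f,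
    assoc := \<lambda>X Y Z. inv_ar C (assoc C Z Y X), lunit := runit C, runit := lunit C\<rparr>"

lemma rev_mon_simps [simp]:
  "Ob (rev_mon C) = Ob C" "Ar (rev_mon C) = Ar C" "src (rev_mon C) = src C" "tgt (rev_mon C) = tgt C"
  "ide (rev_mon C) = ide C" "cmp (rev_mon C) = cmp C" "unit_ob (rev_mon C) = unit_ob C"
  "tens_ob (rev_mon C) X Y = tens_ob C Y X" "tens_ar (rev_mon C) f g = tens_ar C g f"
  "assoc (rev_mon C) X Y Z = inv_ar C (assoc C Z Y X)" "lunit (rev_mon C) = runit C"
  "runit (rev_mon C) = lunit C" "Hom (rev_mon C) = Hom C"
  "inverse_arrows (rev_mon C) = inverse_arrows C" "iso_ar (rev_mon C) = iso_ar C"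
  "inv_ar (rev_mon C) = inv_ar C" "epi_ar (rev_mon C) = epi_ar C" "mono_ar (rev_mon C) = mono_ar C"
  "zero_ar (rev_mon C) = zero_ar C" "add_ar (rev_mon C) = add_ar C" "smul_ar (rev_mon C) = smul_ar C"
  by (auto simp: rev_mon_def Hom_def inverse_arrows_def iso_ar_def inv_ar_def epi_ar_def mono_ar_def
      fun_eq_iff)

context monoidal_category
begin

lemma pentagon_inv:
  assumes "W \<in> Ob C" "X \<in> Ob C" "Y \<in> Ob C" "Z \<in> Ob C"
  shows "inv_ar C (\<alpha> (W \<otimes>\<^sub>o X) Y Z) \<cdot> inv_ar C (\<alpha> W X (Y \<otimes>\<^sub>o Z))
    = (inv_ar C (\<alpha> W X Y) \<otimes>\<^sub>a \<iota> Z) \<cdot> inv_ar C (\<alpha> W (X \<otimes>\<^sub>o Y) Z) \<cdot> (\<iota> W \<otimes>\<^sub>a inv_ar C (\<alpha> X Y Z))"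
  using arg_cong[OF pentagon[OF assms], of "inv_ar C"] assms by (simp add: inv_of_cmp)

lemma triangle_inv:
  assumes "X \<in> Ob C" "Y \<in> Ob C"
  shows "(\<rho> X \<otimes>\<^sub>a \<iota> Y) \<cdot> inv_ar C (\<alpha> X \<one>\<^sub>o Y) = \<iota> X \<otimes>\<^sub>a \<lambda>\<^sub>l Y"
  using assms by (simp flip: triangle)

lemma rev_monoidal: "monoidal_category (rev_mon C)"
proof unfold_locales
  fix X Y Z X' Y' Z' f g h
  assume *: "f \<in> Hom (rev_mon C) X X'" "g \<in> Hom (rev_mon C) Y Y'" "h \<in> Hom (rev_mon C) Z Z'"
  show "assoc (rev_mon C) X' Y' Z' \<cdot>\<^bsub>rev_mon C\<^esub> ((f \<otimes>\<^sub>a\<^bsub>rev_mon C\<^esub> g) \<otimes>\<^sub>a\<^bsub>rev_mon C\<^esub> h)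
      = (f \<otimes>\<^sub>a\<^bsub>rev_mon C\<^esub> (g \<otimes>\<^sub>a\<^bsub>rev_mon C\<^esub> h)) \<cdot>\<^bsub>rev_mon C\<^esub> assoc (rev_mon C) X Y Z"
    using * assoc_inv_natural[of Z' h Y' g X' f] by (auto simp: in_Hom)
qed (auto simp: in_Hom natural pentagon_inv triangle_inv)

lemma is_dual_rev: "is_dual (rev_mon C) Y X = is_dual C X Y"
  unfolding is_dual_def fun_eq_iff by (auto simp: in_Hom)

lemma tens_unit_cancel:
  "\<lbrakk>f \<otimes>\<^sub>a \<iota> \<one>\<^sub>o = g \<otimes>\<^sub>a \<iota> \<one>\<^sub>o; f \<in> Ar C; g \<in> Ar C; src C f = src C g; tgt C f = tgt C g\<rbrakk> \<Longrightarrow> f = g"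
  using monoidal_category.unit_tens_cancel[OF rev_monoidal, of f g] by simp

text \<open>By naturality \<open>\<lambda>\<^sub>l (\<one> \<otimes> \<one>) = \<one> \<otimes> \<lambda>\<^sub>l \<one>\<close>, so that both unitors satisfy the triangle.\<close>

lemma lunit_unit_eq_runit_unit: "\<lambda>\<^sub>l \<one>\<^sub>o = \<rho> \<one>\<^sub>o"
proof (rule tens_unit_cancel)
  have "\<lambda>\<^sub>l \<one>\<^sub>o \<cdot> (\<iota> \<one>\<^sub>o \<otimes>\<^sub>a \<lambda>\<^sub>l \<one>\<^sub>o) = \<lambda>\<^sub>l \<one>\<^sub>o \<cdot> \<lambda>\<^sub>l (\<one>\<^sub>o \<otimes>\<^sub>o \<one>\<^sub>o)"
    by (simp add: natural)
  hence "\<iota> \<one>\<^sub>o \<otimes>\<^sub>a \<lambda>\<^sub>l \<one>\<^sub>o = \<lambda>\<^sub>l (\<one>\<^sub>o \<otimes>\<^sub>o \<one>\<^sub>o)"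
    by (rule monoD[of "\<lambda>\<^sub>l \<one>\<^sub>o", rotated]) auto
  thus "\<lambda>\<^sub>l \<one>\<^sub>o \<otimes>\<^sub>a \<iota> \<one>\<^sub>o = \<rho> \<one>\<^sub>o \<otimes>\<^sub>a \<iota> \<one>\<^sub>o"
    using triangle[of "\<one>\<^sub>o" "\<one>\<^sub>o"] lunit_tens[of "\<one>\<^sub>o" "\<one>\<^sub>o"] by simp
qed auto

end

section \<open>Duals\<close>

context monoidal_category
begin

lemmas merge = interchange interchange[THEN reassoc]

lemma is_dualD:
  assumes "is_dual C X Y ev coev"
  shows "X \<in> Ob C" "Y \<in> Ob C" "ev \<in> Ar C" "src C ev = Y \<otimes>\<^sub>o X" "tgt C ev = \<one>\<^sub>o"
    "coev \<in> Ar C" "src C coev = \<one>\<^sub>o" "tgt C coev = X \<otimes>\<^sub>o Y"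
    "\<rho> X \<cdot> (\<iota> X \<otimes>\<^sub>a ev) \<cdot> \<alpha> X Y X \<cdot> (coev \<otimes>\<^sub>a \<iota> X) = \<lambda>\<^sub>l X"
    "\<lambda>\<^sub>l Y \<cdot> (ev \<otimes>\<^sub>a \<iota> Y) \<cdot> inv_ar C (\<alpha> Y X Y) \<cdot> (\<iota> Y \<otimes>\<^sub>a coev) = \<rho> Y"
  using assms by (auto simp: is_dual_def in_Hom)

lemma pentagon_mixed:
  assumes "W \<in> Ob C" "X \<in> Ob C" "Y \<in> Ob C" "Z \<in> Ob C"
  shows "(\<iota> W \<otimes>\<^sub>a inv_ar C (\<alpha> X Y Z)) \<cdot> \<alpha> W X (Y \<otimes>\<^sub>o Z)
      = \<alpha> W (X \<otimes>\<^sub>o Y) Z \<cdot> (\<alpha> W X Y \<otimes>\<^sub>a \<iota> Z) \<cdot> inv_ar C (\<alpha> (W \<otimes>\<^sub>o X) Y Z)"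
    and "inv_ar C (\<alpha> W X (Y \<otimes>\<^sub>o Z)) \<cdot> (\<iota> W \<otimes>\<^sub>a \<alpha> X Y Z)
      = \<alpha> (W \<otimes>\<^sub>o X) Y Z \<cdot> (inv_ar C (\<alpha> W X Y) \<otimes>\<^sub>a \<iota> Z) \<cdot> inv_ar C (\<alpha> W (X \<otimes>\<^sub>o Y) Z)"
proof -
  have "(\<iota> W \<otimes>\<^sub>a inv_ar C (\<alpha> X Y Z)) \<cdot> (\<alpha> W X (Y \<otimes>\<^sub>o Z) \<cdot> \<alpha> (W \<otimes>\<^sub>o X) Y Z) \<cdot> inv_ar C (\<alpha> (W \<otimes>\<^sub>o X) Y Z)
      = \<alpha> W (X \<otimes>\<^sub>o Y) Z \<cdot> (\<alpha> W X Y \<otimes>\<^sub>a \<iota> Z) \<cdot> inv_ar C (\<alpha> (W \<otimes>\<^sub>o X) Y Z)"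
    using assms by (simp only: pentagon) simp
  thus "(\<iota> W \<otimes>\<^sub>a inv_ar C (\<alpha> X Y Z)) \<cdot> \<alpha> W X (Y \<otimes>\<^sub>o Z)
      = \<alpha> W (X \<otimes>\<^sub>o Y) Z \<cdot> (\<alpha> W X Y \<otimes>\<^sub>a \<iota> Z) \<cdot> inv_ar C (\<alpha> (W \<otimes>\<^sub>o X) Y Z)"
    using assms by simp
  have "inv_ar C (\<alpha> W X (Y \<otimes>\<^sub>o Z)) \<cdot> ((\<iota> W \<otimes>\<^sub>a \<alpha> X Y Z) \<cdot> \<alpha> W (X \<otimes>\<^sub>o Y) Z \<cdot> (\<alpha> W X Y \<otimes>\<^sub>a \<iota> Z))
        \<cdot> (inv_ar C (\<alpha> W X Y) \<otimes>\<^sub>a \<iota> Z) \<cdot> inv_ar C (\<alpha> W (X \<otimes>\<^sub>o Y) Z)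
      = \<alpha> (W \<otimes>\<^sub>o X) Y Z \<cdot> (inv_ar C (\<alpha> W X Y) \<otimes>\<^sub>a \<iota> Z) \<cdot> inv_ar C (\<alpha> W (X \<otimes>\<^sub>o Y) Z)"
    using assms by (simp only: pentagon[symmetric]) simp
  thus "inv_ar C (\<alpha> W X (Y \<otimes>\<^sub>o Z)) \<cdot> (\<iota> W \<otimes>\<^sub>a \<alpha> X Y Z)
      = \<alpha> (W \<otimes>\<^sub>o X) Y Z \<cdot> (inv_ar C (\<alpha> W X Y) \<otimes>\<^sub>a \<iota> Z) \<cdot> inv_ar C (\<alpha> W (X \<otimes>\<^sub>o Y) Z)"
    using assms by simp
qed

text \<open>The two directions of the adjunction between \<open>Y \<otimes> -\<close> and \<open>X \<otimes> -\<close>, for \<open>Y\<close> a left dual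
  of \<open>X\<close>.\<close>

definition flat where
  "flat X Y ev Z u = \<lambda>\<^sub>l Z \<cdot> (ev \<otimes>\<^sub>a \<iota> Z) \<cdot> inv_ar C (\<alpha> Y X Z) \<cdot> (\<iota> Y \<otimes>\<^sub>a u)"

definition sharp where
  "sharp X Y coev V v = (\<iota> X \<otimes>\<^sub>a v) \<cdot> \<alpha> X Y V \<cdot> (coev \<otimes>\<^sub>a \<iota> V) \<cdot> inv_ar C (\<lambda>\<^sub>l V)"

text \<open>That \<open>flat\<close> and \<open>sharp\<close> are mutually inverse comes down to the zigzag identities whiskered by
  a third object.\<close>

lemma zigzag_tens:
  assumes d: "is_dual C X Y ev coev" and Z: "Z \<in> Ob C"
  shows "(\<iota> X \<otimes>\<^sub>a \<lambda>\<^sub>l Z) \<cdot> (\<iota> X \<otimes>\<^sub>a (ev \<otimes>\<^sub>a \<iota> Z)) \<cdot> (\<iota> X \<otimes>\<^sub>a inv_ar C (\<alpha> Y X Z))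
      \<cdot> \<alpha> X Y (X \<otimes>\<^sub>o Z) \<cdot> (coev \<otimes>\<^sub>a \<iota> (X \<otimes>\<^sub>o Z)) = \<lambda>\<^sub>l (X \<otimes>\<^sub>o Z)"
proof -
  note [simp] = is_dualD[OF d] Z
  have "(\<iota> X \<otimes>\<^sub>a \<lambda>\<^sub>l Z) \<cdot> (\<iota> X \<otimes>\<^sub>a (ev \<otimes>\<^sub>a \<iota> Z)) \<cdot> (\<iota> X \<otimes>\<^sub>a inv_ar C (\<alpha> Y X Z))
      \<cdot> \<alpha> X Y (X \<otimes>\<^sub>o Z) \<cdot> (coev \<otimes>\<^sub>a \<iota> (X \<otimes>\<^sub>o Z))
      = (\<iota> X \<otimes>\<^sub>a \<lambda>\<^sub>l Z) \<cdot> ((\<iota> X \<otimes>\<^sub>a (ev \<otimes>\<^sub>a \<iota> Z)) \<cdot> \<alpha> X (Y \<otimes>\<^sub>o X) Z) \<cdot> (\<alpha> X Y X \<otimes>\<^sub>a \<iota> Z)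
      \<cdot> inv_ar C (\<alpha> (X \<otimes>\<^sub>o Y) X Z) \<cdot> (coev \<otimes>\<^sub>a \<iota> (X \<otimes>\<^sub>o Z))"
    by (simp add: pentagon_mixed[THEN reassoc] del: merge)
  also have "\<dots> = (\<iota> X \<otimes>\<^sub>a \<lambda>\<^sub>l Z) \<cdot> (\<alpha> X \<one>\<^sub>o Z \<cdot> ((\<iota> X \<otimes>\<^sub>a ev) \<otimes>\<^sub>a \<iota> Z)) \<cdot> (\<alpha> X Y X \<otimes>\<^sub>a \<iota> Z)
      \<cdot> ((coev \<otimes>\<^sub>a \<iota> X) \<otimes>\<^sub>a \<iota> Z) \<cdot> inv_ar C (\<alpha> \<one>\<^sub>o X Z)"
    by (simp add: natural del: merge)
  also have "\<dots> = (\<rho> X \<otimes>\<^sub>a \<iota> Z) \<cdot> ((\<iota> X \<otimes>\<^sub>a ev) \<otimes>\<^sub>a \<iota> Z) \<cdot> (\<alpha> X Y X \<otimes>\<^sub>a \<iota> Z)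
      \<cdot> ((coev \<otimes>\<^sub>a \<iota> X) \<otimes>\<^sub>a \<iota> Z) \<cdot> inv_ar C (\<alpha> \<one>\<^sub>o X Z)"
    by (simp add: triangle[THEN reassoc] del: merge)
  also have "\<dots> = (\<lambda>\<^sub>l X \<otimes>\<^sub>a \<iota> Z) \<cdot> inv_ar C (\<alpha> \<one>\<^sub>o X Z)"
    by simp
  also have "\<dots> = \<lambda>\<^sub>l (X \<otimes>\<^sub>o Z)"
    by (simp flip: lunit_tens)
  finally show ?thesis .
qed

lemma zigzag_tens':
  assumes d: "is_dual C X Y ev coev" and V: "V \<in> Ob C"
  shows "\<lambda>\<^sub>l (Y \<otimes>\<^sub>o V) \<cdot> (ev \<otimes>\<^sub>a \<iota> (Y \<otimes>\<^sub>o V)) \<cdot> inv_ar C (\<alpha> Y X (Y \<otimes>\<^sub>o V))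
      \<cdot> (\<iota> Y \<otimes>\<^sub>a \<alpha> X Y V) \<cdot> (\<iota> Y \<otimes>\<^sub>a (coev \<otimes>\<^sub>a \<iota> V)) = \<iota> Y \<otimes>\<^sub>a \<lambda>\<^sub>l V"
proof -
  note [simp] = is_dualD[OF d] V
  have "\<lambda>\<^sub>l (Y \<otimes>\<^sub>o V) \<cdot> (ev \<otimes>\<^sub>a \<iota> (Y \<otimes>\<^sub>o V)) \<cdot> inv_ar C (\<alpha> Y X (Y \<otimes>\<^sub>o V))
      \<cdot> (\<iota> Y \<otimes>\<^sub>a \<alpha> X Y V) \<cdot> (\<iota> Y \<otimes>\<^sub>a (coev \<otimes>\<^sub>a \<iota> V))
      = \<lambda>\<^sub>l (Y \<otimes>\<^sub>o V) \<cdot> ((ev \<otimes>\<^sub>a (\<iota> Y \<otimes>\<^sub>a \<iota> V)) \<cdot> \<alpha> (Y \<otimes>\<^sub>o X) Y V) \<cdot> (inv_ar C (\<alpha> Y X Y) \<otimes>\<^sub>a \<iota> V)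
        \<cdot> inv_ar C (\<alpha> Y (X \<otimes>\<^sub>o Y) V) \<cdot> (\<iota> Y \<otimes>\<^sub>a (coev \<otimes>\<^sub>a \<iota> V))"
    by (simp add: pentagon_mixed[THEN reassoc] del: merge)
  also have "\<dots> = \<lambda>\<^sub>l (Y \<otimes>\<^sub>o V) \<cdot> (\<alpha> \<one>\<^sub>o Y V \<cdot> ((ev \<otimes>\<^sub>a \<iota> Y) \<otimes>\<^sub>a \<iota> V)) \<cdot> (inv_ar C (\<alpha> Y X Y) \<otimes>\<^sub>a \<iota> V)
        \<cdot> ((\<iota> Y \<otimes>\<^sub>a coev) \<otimes>\<^sub>a \<iota> V) \<cdot> inv_ar C (\<alpha> Y \<one>\<^sub>o V)"
    by (simp add: natural del: merge)
  also have "\<dots> = (\<lambda>\<^sub>l Y \<otimes>\<^sub>a \<iota> V) \<cdot> ((ev \<otimes>\<^sub>a \<iota> Y) \<otimes>\<^sub>a \<iota> V) \<cdot> (inv_ar C (\<alpha> Y X Y) \<otimes>\<^sub>a \<iota> V)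
        \<cdot> ((\<iota> Y \<otimes>\<^sub>a coev) \<otimes>\<^sub>a \<iota> V) \<cdot> inv_ar C (\<alpha> Y \<one>\<^sub>o V)"
    by (simp add: lunit_tens[THEN reassoc] del: merge)
  also have "\<dots> = (\<rho> Y \<otimes>\<^sub>a \<iota> V) \<cdot> inv_ar C (\<alpha> Y \<one>\<^sub>o V)"
    by simp
  also have "\<dots> = \<iota> Y \<otimes>\<^sub>a \<lambda>\<^sub>l V"
    by (simp add: triangle_inv)
  finally show ?thesis .
qed

lemma flat_typ:
  assumes d: "is_dual C X Y ev coev" and "Z \<in> Ob C" "u \<in> Ar C" "tgt C u = X \<otimes>\<^sub>o Z"
  shows "flat X Y ev Z u \<in> Ar C" "src C (flat X Y ev Z u) = Y \<otimes>\<^sub>o src C u" "tgt C (flat X Y ev Z u) = Z"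
  using is_dualD[OF d] assms(2-) by (simp_all add: flat_def)

lemma sharp_typ:
  assumes d: "is_dual C X Y ev coev" and "V \<in> Ob C" "v \<in> Ar C" "src C v = Y \<otimes>\<^sub>o V"
  shows "sharp X Y coev V v \<in> Ar C" "tgt C (sharp X Y coev V v) = X \<otimes>\<^sub>o tgt C v"
    "src C (sharp X Y coev V v) = V"
  using is_dualD[OF d] assms(2-) by (simp_all add: sharp_def)

lemma sharp_flat:
  assumes d: "is_dual C X Y ev coev" and [simp]: "Z \<in> Ob C" "u \<in> Ar C" "tgt C u = X \<otimes>\<^sub>o Z"
  shows "sharp X Y coev (src C u) (flat X Y ev Z u) = u"
proof -
  note [simp] = is_dualD[OF d]
  have "sharp X Y coev (src C u) (flat X Y ev Z u)
      = (\<iota> X \<otimes>\<^sub>a \<lambda>\<^sub>l Z) \<cdot> (\<iota> X \<otimes>\<^sub>a (ev \<otimes>\<^sub>a \<iota> Z)) \<cdot> (\<iota> X \<otimes>\<^sub>a inv_ar C (\<alpha> Y X Z))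
      \<cdot> ((\<iota> X \<otimes>\<^sub>a (\<iota> Y \<otimes>\<^sub>a u)) \<cdot> \<alpha> X Y (src C u)) \<cdot> (coev \<otimes>\<^sub>a \<iota> (src C u)) \<cdot> inv_ar C (\<lambda>\<^sub>l (src C u))"
    unfolding sharp_def flat_def by simp
  also have "\<dots> = (\<iota> X \<otimes>\<^sub>a \<lambda>\<^sub>l Z) \<cdot> (\<iota> X \<otimes>\<^sub>a (ev \<otimes>\<^sub>a \<iota> Z)) \<cdot> (\<iota> X \<otimes>\<^sub>a inv_ar C (\<alpha> Y X Z))
      \<cdot> (\<alpha> X Y (X \<otimes>\<^sub>o Z) \<cdot> ((\<iota> X \<otimes>\<^sub>a \<iota> Y) \<otimes>\<^sub>a u)) \<cdot> (coev \<otimes>\<^sub>a \<iota> (src C u)) \<cdot> inv_ar C (\<lambda>\<^sub>l (src C u))"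
    by (simp add: natural del: merge)
  also have "\<dots> = ((\<iota> X \<otimes>\<^sub>a \<lambda>\<^sub>l Z) \<cdot> (\<iota> X \<otimes>\<^sub>a (ev \<otimes>\<^sub>a \<iota> Z)) \<cdot> (\<iota> X \<otimes>\<^sub>a inv_ar C (\<alpha> Y X Z))
      \<cdot> \<alpha> X Y (X \<otimes>\<^sub>o Z) \<cdot> (coev \<otimes>\<^sub>a \<iota> (X \<otimes>\<^sub>o Z))) \<cdot> (\<iota> \<one>\<^sub>o \<otimes>\<^sub>a u) \<cdot> inv_ar C (\<lambda>\<^sub>l (src C u))"
    by simp
  also have "\<dots> = \<lambda>\<^sub>l (X \<otimes>\<^sub>o Z) \<cdot> (\<iota> \<one>\<^sub>o \<otimes>\<^sub>a u) \<cdot> inv_ar C (\<lambda>\<^sub>l (src C u))"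
    by (simp only: zigzag_tens[OF d \<open>Z \<in> Ob C\<close>])
  also have "\<dots> = u" by (simp add: natural)
  finally show ?thesis .
qed

lemma flat_sharp:
  assumes d: "is_dual C X Y ev coev" and [simp]: "V \<in> Ob C" "v \<in> Ar C" "src C v = Y \<otimes>\<^sub>o V"
  shows "flat X Y ev (tgt C v) (sharp X Y coev V v) = v"
proof -
  note [simp] = is_dualD[OF d]
  have "flat X Y ev (tgt C v) (sharp X Y coev V v)
      = \<lambda>\<^sub>l (tgt C v) \<cdot> (ev \<otimes>\<^sub>a \<iota> (tgt C v)) \<cdot> (inv_ar C (\<alpha> Y X (tgt C v)) \<cdot> (\<iota> Y \<otimes>\<^sub>a (\<iota> X \<otimes>\<^sub>a v)))
        \<cdot> (\<iota> Y \<otimes>\<^sub>a \<alpha> X Y V) \<cdot> (\<iota> Y \<otimes>\<^sub>a (coev \<otimes>\<^sub>a \<iota> V)) \<cdot> (\<iota> Y \<otimes>\<^sub>a inv_ar C (\<lambda>\<^sub>l V))"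
    unfolding sharp_def flat_def by simp
  also have "\<dots> = \<lambda>\<^sub>l (tgt C v) \<cdot> (ev \<otimes>\<^sub>a \<iota> (tgt C v)) \<cdot> (((\<iota> Y \<otimes>\<^sub>a \<iota> X) \<otimes>\<^sub>a v) \<cdot> inv_ar C (\<alpha> Y X (Y \<otimes>\<^sub>o V)))
        \<cdot> (\<iota> Y \<otimes>\<^sub>a \<alpha> X Y V) \<cdot> (\<iota> Y \<otimes>\<^sub>a (coev \<otimes>\<^sub>a \<iota> V)) \<cdot> (\<iota> Y \<otimes>\<^sub>a inv_ar C (\<lambda>\<^sub>l V))"
    by (simp add: natural del: merge)
  also have "\<dots> = \<lambda>\<^sub>l (tgt C v) \<cdot> (ev \<otimes>\<^sub>a v) \<cdot> inv_ar C (\<alpha> Y X (Y \<otimes>\<^sub>o V))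
        \<cdot> (\<iota> Y \<otimes>\<^sub>a \<alpha> X Y V) \<cdot> (\<iota> Y \<otimes>\<^sub>a (coev \<otimes>\<^sub>a \<iota> V)) \<cdot> (\<iota> Y \<otimes>\<^sub>a inv_ar C (\<lambda>\<^sub>l V))"
    by simp
  also have "\<dots> = (\<lambda>\<^sub>l (tgt C v) \<cdot> (\<iota> \<one>\<^sub>o \<otimes>\<^sub>a v)) \<cdot> (ev \<otimes>\<^sub>a \<iota> (Y \<otimes>\<^sub>o V)) \<cdot> inv_ar C (\<alpha> Y X (Y \<otimes>\<^sub>o V))
        \<cdot> (\<iota> Y \<otimes>\<^sub>a \<alpha> X Y V) \<cdot> (\<iota> Y \<otimes>\<^sub>a (coev \<otimes>\<^sub>a \<iota> V)) \<cdot> (\<iota> Y \<otimes>\<^sub>a inv_ar C (\<lambda>\<^sub>l V))"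
    by simp
  also have "\<dots> = v \<cdot> (\<lambda>\<^sub>l (Y \<otimes>\<^sub>o V) \<cdot> (ev \<otimes>\<^sub>a \<iota> (Y \<otimes>\<^sub>o V)) \<cdot> inv_ar C (\<alpha> Y X (Y \<otimes>\<^sub>o V))
        \<cdot> (\<iota> Y \<otimes>\<^sub>a \<alpha> X Y V) \<cdot> (\<iota> Y \<otimes>\<^sub>a (coev \<otimes>\<^sub>a \<iota> V))) \<cdot> (\<iota> Y \<otimes>\<^sub>a inv_ar C (\<lambda>\<^sub>l V))"
    by (simp add: natural del: merge)
  also have "\<dots> = v \<cdot> (\<iota> Y \<otimes>\<^sub>a \<lambda>\<^sub>l V) \<cdot> (\<iota> Y \<otimes>\<^sub>a inv_ar C (\<lambda>\<^sub>l V))"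
    by (simp only: zigzag_tens'[OF d \<open>V \<in> Ob C\<close>])
  also have "\<dots> = v" by simp
  finally show ?thesis .
qed

lemma flat_inj:
  assumes d: "is_dual C X Y ev coev" and "Z \<in> Ob C" "u \<in> Ar C" "tgt C u = X \<otimes>\<^sub>o Z"
    "u' \<in> Ar C" "tgt C u' = X \<otimes>\<^sub>o Z" "src C u = src C u'" "flat X Y ev Z u = flat X Y ev Z u'"
  shows "u = u'"
  using sharp_flat[OF d, of Z u] sharp_flat[OF d, of Z u'] assms(2-) by metis

lemma sharp_cmp:
  assumes d: "is_dual C X Y ev coev" and "f \<in> Ar C" "v \<in> Ar C" "src C v = Y \<otimes>\<^sub>o tgt C f"
  shows "sharp X Y coev (src C f) (v \<cdot> (\<iota> Y \<otimes>\<^sub>a f)) = sharp X Y coev (tgt C f) v \<cdot> f"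
proof -
  note [simp] = is_dualD[OF d] assms(2-)
  have "inv_ar C (\<lambda>\<^sub>l (tgt C f)) \<cdot> f = (\<iota> \<one>\<^sub>o \<otimes>\<^sub>a f) \<cdot> inv_ar C (\<lambda>\<^sub>l (src C f))"
    by (rule monoD[of "\<lambda>\<^sub>l (tgt C f)"]) (simp_all add: natural)
  hence "sharp X Y coev (tgt C f) v \<cdot> f
      = (\<iota> X \<otimes>\<^sub>a v) \<cdot> (\<alpha> X Y (tgt C f) \<cdot> ((\<iota> X \<otimes>\<^sub>a \<iota> Y) \<otimes>\<^sub>a f)) \<cdot> (coev \<otimes>\<^sub>a \<iota> (src C f)) \<cdot> inv_ar C (\<lambda>\<^sub>l (src C f))"
    unfolding sharp_def by simp
  also have "\<dots> = (\<iota> X \<otimes>\<^sub>a v) \<cdot> ((\<iota> X \<otimes>\<^sub>a (\<iota> Y \<otimes>\<^sub>a f)) \<cdot> \<alpha> X Y (src C f)) \<cdot> (coev \<otimes>\<^sub>a \<iota> (src C f)) \<cdot> inv_ar C (\<lambda>\<^sub>l (src C f))"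
    by (simp add: natural del: merge)
  finally show ?thesis unfolding sharp_def by simp
qed

lemma flat_cmp:
  assumes d: "is_dual C X Y ev coev" and "f \<in> Ar C" "u \<in> Ar C" "tgt C u = X \<otimes>\<^sub>o src C f"
  shows "flat X Y ev (tgt C f) ((\<iota> X \<otimes>\<^sub>a f) \<cdot> u) = f \<cdot> flat X Y ev (src C f) u"
proof -
  note [simp] = is_dualD[OF d] assms(2-)
  have "flat X Y ev (tgt C f) ((\<iota> X \<otimes>\<^sub>a f) \<cdot> u)
     = \<lambda>\<^sub>l (tgt C f) \<cdot> (ev \<otimes>\<^sub>a \<iota> (tgt C f)) \<cdot> (inv_ar C (\<alpha> Y X (tgt C f)) \<cdot> (\<iota> Y \<otimes>\<^sub>a (\<iota> X \<otimes>\<^sub>a f))) \<cdot> (\<iota> Y \<otimes>\<^sub>a u)"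
    unfolding flat_def by simp
  also have "\<dots> = \<lambda>\<^sub>l (tgt C f) \<cdot> (ev \<otimes>\<^sub>a \<iota> (tgt C f)) \<cdot> (((\<iota> Y \<otimes>\<^sub>a \<iota> X) \<otimes>\<^sub>a f) \<cdot> inv_ar C (\<alpha> Y X (src C f))) \<cdot> (\<iota> Y \<otimes>\<^sub>a u)"
    by (simp add: natural del: merge)
  also have "\<dots> = (\<lambda>\<^sub>l (tgt C f) \<cdot> (\<iota> \<one>\<^sub>o \<otimes>\<^sub>a f)) \<cdot> (ev \<otimes>\<^sub>a \<iota> (src C f)) \<cdot> inv_ar C (\<alpha> Y X (src C f)) \<cdot> (\<iota> Y \<otimes>\<^sub>a u)"
    by simp
  also have "\<dots> = f \<cdot> flat X Y ev (src C f) u"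
    unfolding flat_def by (simp add: natural del: merge)
  finally show ?thesis .
qed

text \<open>Under transposition, precomposition with \<open>Y \<otimes> f\<close> corresponds to precomposition with
  \<open>f\<close>.\<close>

lemma epi_tens_left:
  assumes d: "is_dual C X Y ev coev" and f: "epi_ar C f"
  shows "epi_ar C (\<iota> Y \<otimes>\<^sub>a f)"
  unfolding epi_iff
proof (intro conjI allI impI)
  note [simp] = is_dualD[OF d] epi_Ar[OF f]
  show "\<iota> Y \<otimes>\<^sub>a f \<in> Ar C" by simp
  fix g h assume gh: "g \<in> Ar C" "h \<in> Ar C" "src C g = tgt C (\<iota> Y \<otimes>\<^sub>a f)" "src C h = tgt C (\<iota> Y \<otimes>\<^sub>a f)"
    "tgt C g = tgt C h" "g \<cdot> (\<iota> Y \<otimes>\<^sub>a f) = h \<cdot> (\<iota> Y \<otimes>\<^sub>a f)"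
  note [simp] = sharp_typ[OF d]
  have "sharp X Y coev (tgt C f) g \<cdot> f = sharp X Y coev (tgt C f) h \<cdot> f"
    using gh by (simp flip: sharp_cmp[OF d])
  hence eq: "sharp X Y coev (tgt C f) g = sharp X Y coev (tgt C f) h"
    by (rule epiD[OF f]) (use gh in simp_all)
  have "g = flat X Y ev (tgt C g) (sharp X Y coev (tgt C f) g)"
    using gh(1,3) flat_sharp[OF d, of "tgt C f" g] by simp
  also have "\<dots> = flat X Y ev (tgt C h) (sharp X Y coev (tgt C f) h)"
    unfolding eq gh(5) ..
  also have "\<dots> = h"
    using gh(2,4) flat_sharp[OF d, of "tgt C f" h] by simp
  finally show "g = h" .
qed

lemma is_dual_iso:
  assumes d: "is_dual C X Y ev coev" and a: "iso_ar C a" "a \<in> Ar C" "src C a = X"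
  shows "\<exists>ev' coev'. is_dual C (tgt C a) Y ev' coev'"
proof (intro exI)
  note [simp] = is_dualD[OF d] a
  define b X' where "b = inv_ar C a" and "X' = tgt C a"
  have [simp]: "b \<in> Ar C" "src C b = X'" "tgt C b = X" "tgt C a = X'" "X' \<in> Ob C" "a \<cdot> b = \<iota> X'" "b \<cdot> a = \<iota> X"
    by (simp_all add: b_def X'_def)
  have 1: "\<rho> X' \<cdot> (\<iota> X' \<otimes>\<^sub>a (ev \<cdot> (\<iota> Y \<otimes>\<^sub>a b))) \<cdot> \<alpha> X' Y X' \<cdot> (((a \<otimes>\<^sub>a \<iota> Y) \<cdot> coev) \<otimes>\<^sub>a \<iota> X') = \<lambda>\<^sub>l X'"
  proof -
    have "\<rho> X' \<cdot> (\<iota> X' \<otimes>\<^sub>a (ev \<cdot> (\<iota> Y \<otimes>\<^sub>a b))) \<cdot> \<alpha> X' Y X' \<cdot> (((a \<otimes>\<^sub>a \<iota> Y) \<cdot> coev) \<otimes>\<^sub>a \<iota> X')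
      = \<rho> X' \<cdot> (\<iota> X' \<otimes>\<^sub>a ev) \<cdot> (\<iota> X' \<otimes>\<^sub>a (\<iota> Y \<otimes>\<^sub>a b)) \<cdot> (\<alpha> X' Y X' \<cdot> ((a \<otimes>\<^sub>a \<iota> Y) \<otimes>\<^sub>a \<iota> X')) \<cdot> (coev \<otimes>\<^sub>a \<iota> X')"
      by simp
    also have "\<dots> = \<rho> X' \<cdot> (\<iota> X' \<otimes>\<^sub>a ev) \<cdot> (\<iota> X' \<otimes>\<^sub>a (\<iota> Y \<otimes>\<^sub>a b)) \<cdot> (a \<otimes>\<^sub>a (\<iota> Y \<otimes>\<^sub>a \<iota> X')) \<cdot> \<alpha> X Y X' \<cdot> (coev \<otimes>\<^sub>a \<iota> X')"
      by (simp add: natural del: merge)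
    also have "\<dots> = \<rho> X' \<cdot> (a \<otimes>\<^sub>a ev) \<cdot> ((\<iota> X \<otimes>\<^sub>a (\<iota> Y \<otimes>\<^sub>a b)) \<cdot> \<alpha> X Y X') \<cdot> (coev \<otimes>\<^sub>a \<iota> X')"
      by simp
    also have "\<dots> = \<rho> X' \<cdot> (a \<otimes>\<^sub>a ev) \<cdot> (\<alpha> X Y X \<cdot> ((\<iota> X \<otimes>\<^sub>a \<iota> Y) \<otimes>\<^sub>a b)) \<cdot> (coev \<otimes>\<^sub>a \<iota> X')"
      by (simp add: natural del: merge)
    also have "\<dots> = (\<rho> X' \<cdot> (a \<otimes>\<^sub>a \<iota> \<one>\<^sub>o)) \<cdot> (\<iota> X \<otimes>\<^sub>a ev) \<cdot> \<alpha> X Y X \<cdot> (coev \<otimes>\<^sub>a \<iota> X) \<cdot> (\<iota> \<one>\<^sub>o \<otimes>\<^sub>a b)"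
      by simp
    also have "\<dots> = a \<cdot> (\<rho> X \<cdot> (\<iota> X \<otimes>\<^sub>a ev) \<cdot> \<alpha> X Y X \<cdot> (coev \<otimes>\<^sub>a \<iota> X)) \<cdot> (\<iota> \<one>\<^sub>o \<otimes>\<^sub>a b)"
      by (simp add: natural del: merge is_dualD(9)[OF d])
    also have "\<dots> = a \<cdot> b \<cdot> \<lambda>\<^sub>l X'"
      using natural(9)[of X b] by (simp only: is_dualD(9)[OF d]) simp
    also have "\<dots> = \<lambda>\<^sub>l X'" by (simp add: \<open>a \<cdot> b = \<iota> X'\<close>[THEN reassoc])
    finally show ?thesis .
  qed
  have 2: "\<lambda>\<^sub>l Y \<cdot> ((ev \<cdot> (\<iota> Y \<otimes>\<^sub>a b)) \<otimes>\<^sub>a \<iota> Y) \<cdot> inv_ar C (\<alpha> Y X' Y) \<cdot> (\<iota> Y \<otimes>\<^sub>a ((a \<otimes>\<^sub>a \<iota> Y) \<cdot> coev)) = \<rho> Y"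
  proof -
    have "\<lambda>\<^sub>l Y \<cdot> ((ev \<cdot> (\<iota> Y \<otimes>\<^sub>a b)) \<otimes>\<^sub>a \<iota> Y) \<cdot> inv_ar C (\<alpha> Y X' Y) \<cdot> (\<iota> Y \<otimes>\<^sub>a ((a \<otimes>\<^sub>a \<iota> Y) \<cdot> coev))
     = \<lambda>\<^sub>l Y \<cdot> (ev \<otimes>\<^sub>a \<iota> Y) \<cdot> ((\<iota> Y \<otimes>\<^sub>a b) \<otimes>\<^sub>a \<iota> Y) \<cdot> (inv_ar C (\<alpha> Y X' Y) \<cdot> (\<iota> Y \<otimes>\<^sub>a (a \<otimes>\<^sub>a \<iota> Y))) \<cdot> (\<iota> Y \<otimes>\<^sub>a coev)"
      by simp
    also have "\<dots> = \<lambda>\<^sub>l Y \<cdot> (ev \<otimes>\<^sub>a \<iota> Y) \<cdot> ((\<iota> Y \<otimes>\<^sub>a b) \<otimes>\<^sub>a \<iota> Y) \<cdot> ((\<iota> Y \<otimes>\<^sub>a a) \<otimes>\<^sub>a \<iota> Y) \<cdot> inv_ar C (\<alpha> Y X Y) \<cdot> (\<iota> Y \<otimes>\<^sub>a coev)"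
      by (simp add: natural del: merge)
    also have "\<dots> = \<rho> Y" by (simp add: tens_ide)
    finally show ?thesis .
  qed
  show "is_dual C (tgt C a) Y (ev \<cdot> (\<iota> Y \<otimes>\<^sub>a b)) ((a \<otimes>\<^sub>a \<iota> Y) \<cdot> coev)"
    unfolding is_dual_def using 1 2 by (simp add: in_Hom del: merge)
qed

lemma epi_tens_right:
  assumes d: "is_dual C X Y ev coev" and f: "epi_ar C f"
  shows "epi_ar C (f \<otimes>\<^sub>a \<iota> X)"
  using monoidal_category.epi_tens_left[OF rev_monoidal, of Y X ev coev f] d f by (simp add: is_dual_rev)

end

section \<open>Strong monoidal functors\<close>

context cat_functor
begin

declare fob_in [simp] far_ide [simp]

lemma far_typ [simp]:
  assumes "f \<in> Ar C"
  shows "far F f \<in> Ar D" "src D (far F f) = fob F (src C f)" "tgt D (far F f) = fob F (tgt C f)"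
  using assms far_in[of f "src C f" "tgt C f"] by (auto simp: C.in_Hom D.in_Hom)

lemma far_cmp' [simp]:
  "\<lbrakk>src C g = tgt C f; f \<in> Ar C; g \<in> Ar C\<rbrakk> \<Longrightarrow> far F (g \<cdot>\<^bsub>C\<^esub> f) = far F g \<cdot>\<^bsub>D\<^esub> far F f"
  using far_cmp[of f "src C f" "tgt C f" g "tgt C g"] by (auto simp: C.in_Hom)

lemma iso_far [simp]: "iso_ar C f \<Longrightarrow> iso_ar D (far F f)"
  and inv_far [simp]: "iso_ar C f \<Longrightarrow> inv_ar D (far F f) = far F (inv_ar C f)"
proof -
  assume [simp]: "iso_ar C f"
  note [simp] = C.iso_Ar[OF \<open>iso_ar C f\<close>]
  have "far F (inv_ar C f) \<cdot>\<^bsub>D\<^esub> far F f = far F (inv_ar C f \<cdot>\<^bsub>C\<^esub> f)"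
    "far F f \<cdot>\<^bsub>D\<^esub> far F (inv_ar C f) = far F (f \<cdot>\<^bsub>C\<^esub> inv_ar C f)"
    by (simp_all del: C.inv_cmp C.cmp_inv)
  thus "iso_ar D (far F f)" "inv_ar D (far F f) = far F (inv_ar C f)"
    using D.isoI[of "far F f" "far F (inv_ar C f)"] by simp_all
qed

end

definition rev_functor :: "('o, 'm, 'p, 'n, 'w) mon_functor_data_scheme
    \<Rightarrow> ('o, 'm, 'p, 'n, 'w) mon_functor_data_scheme" where
  "rev_functor F = F\<lparr>fmu := \<lambda>X Y. fmu F Y X\<rparr>"

lemma rev_functor_simps [simp]:
  "fob (rev_functor F) = fob F" "far (rev_functor F) = far F" "fmu (rev_functor F) X Y = fmu F Y X"
  "fmu0 (rev_functor F) = fmu0 F"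
  by (simp_all add: rev_functor_def)

context strong_monoidal_functor
begin

declare fmu_iso [simp] fmu0_iso [simp]

lemma fmu_typ [simp]:
  assumes "X \<in> Ob C" "Y \<in> Ob C"
  shows "fmu F X Y \<in> Ar D" "src D (fmu F X Y) = fob F X \<otimes>\<^sub>o\<^bsub>D\<^esub> fob F Y"
    "tgt D (fmu F X Y) = fob F (X \<otimes>\<^sub>o\<^bsub>C\<^esub> Y)"
  using fmu_in[OF assms] by (auto simp: D.in_Hom)

lemma fmu0_typ [simp]:
  "fmu0 F \<in> Ar D" "src D (fmu0 F) = \<one>\<^sub>o\<^bsub>D\<^esub>" "tgt D (fmu0 F) = fob F \<one>\<^sub>o\<^bsub>C\<^esub>"
  using fmu0_in by (auto simp: D.in_Hom)

lemma fmu_natural: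
  "\<lbrakk>X = src C f; Y = src C g; f \<in> Ar C; g \<in> Ar C\<rbrakk>
    \<Longrightarrow> far F (f \<otimes>\<^sub>a\<^bsub>C\<^esub> g) \<cdot>\<^bsub>D\<^esub> fmu F X Y = fmu F (tgt C f) (tgt C g) \<cdot>\<^bsub>D\<^esub> (far F f \<otimes>\<^sub>a\<^bsub>D\<^esub> far F g)"
  using fmu_nat[of f X "tgt C f" g Y "tgt C g"] by (simp add: C.in_Hom)

lemmas mu_natural = fmu_natural fmu_natural[THEN D.reassoc]

lemma fmu_assoc_inv:
  assumes [simp]: "X \<in> Ob C" "Y \<in> Ob C" "Z \<in> Ob C"
  shows "far F (inv_ar C (\<alpha>\<^bsub>C\<^esub> X Y Z)) \<cdot>\<^bsub>D\<^esub> fmu F X (Y \<otimes>\<^sub>o\<^bsub>C\<^esub> Z)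
      = fmu F (X \<otimes>\<^sub>o\<^bsub>C\<^esub> Y) Z \<cdot>\<^bsub>D\<^esub> (fmu F X Y \<otimes>\<^sub>a\<^bsub>D\<^esub> \<iota>\<^bsub>D\<^esub> (fob F Z))
        \<cdot>\<^bsub>D\<^esub> inv_ar D (\<alpha>\<^bsub>D\<^esub> (fob F X) (fob F Y) (fob F Z)) \<cdot>\<^bsub>D\<^esub> (\<iota>\<^bsub>D\<^esub> (fob F X) \<otimes>\<^sub>a\<^bsub>D\<^esub> inv_ar D (fmu F Y Z))"
    (is "_ = ?r")
proof (rule D.epiD[of "(\<iota>\<^bsub>D\<^esub> (fob F X) \<otimes>\<^sub>a\<^bsub>D\<^esub> fmu F Y Z) \<cdot>\<^bsub>D\<^esub> \<alpha>\<^bsub>D\<^esub> (fob F X) (fob F Y) (fob F Z)"])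
  have "far F (inv_ar C (\<alpha>\<^bsub>C\<^esub> X Y Z)) \<cdot>\<^bsub>D\<^esub> fmu F X (Y \<otimes>\<^sub>o\<^bsub>C\<^esub> Z) \<cdot>\<^bsub>D\<^esub> (\<iota>\<^bsub>D\<^esub> (fob F X) \<otimes>\<^sub>a\<^bsub>D\<^esub> fmu F Y Z)
        \<cdot>\<^bsub>D\<^esub> \<alpha>\<^bsub>D\<^esub> (fob F X) (fob F Y) (fob F Z)
    = (far F (inv_ar C (\<alpha>\<^bsub>C\<^esub> X Y Z)) \<cdot>\<^bsub>D\<^esub> far F (\<alpha>\<^bsub>C\<^esub> X Y Z)) \<cdot>\<^bsub>D\<^esub> fmu F (X \<otimes>\<^sub>o\<^bsub>C\<^esub> Y) Z \<cdot>\<^bsub>D\<^esub> (fmu F X Y \<otimes>\<^sub>a\<^bsub>D\<^esub> \<iota>\<^bsub>D\<^esub> (fob F Z))"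
    by (simp add: fmu_assoc[symmetric] del: inv_far)
  also have "\<dots> = fmu F (X \<otimes>\<^sub>o\<^bsub>C\<^esub> Y) Z \<cdot>\<^bsub>D\<^esub> (fmu F X Y \<otimes>\<^sub>a\<^bsub>D\<^esub> \<iota>\<^bsub>D\<^esub> (fob F Z))"
    by (simp del: far_cmp' D.cmp_assoc_right flip: far_cmp')
  also have "\<dots> = ?r \<cdot>\<^bsub>D\<^esub> (\<iota>\<^bsub>D\<^esub> (fob F X) \<otimes>\<^sub>a\<^bsub>D\<^esub> fmu F Y Z) \<cdot>\<^bsub>D\<^esub> \<alpha>\<^bsub>D\<^esub> (fob F X) (fob F Y) (fob F Z)"
    by simp
  finally show "(far F (inv_ar C (\<alpha>\<^bsub>C\<^esub> X Y Z)) \<cdot>\<^bsub>D\<^esub> fmu F X (Y \<otimes>\<^sub>o\<^bsub>C\<^esub> Z)) \<cdot>\<^bsub>D\<^esub> (\<iota>\<^bsub>D\<^esub> (fob F X) \<otimes>\<^sub>a\<^bsub>D\<^esub> fmu F Y Z)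
        \<cdot>\<^bsub>D\<^esub> \<alpha>\<^bsub>D\<^esub> (fob F X) (fob F Y) (fob F Z)
      = ?r \<cdot>\<^bsub>D\<^esub> (\<iota>\<^bsub>D\<^esub> (fob F X) \<otimes>\<^sub>a\<^bsub>D\<^esub> fmu F Y Z) \<cdot>\<^bsub>D\<^esub> \<alpha>\<^bsub>D\<^esub> (fob F X) (fob F Y) (fob F Z)" by simp
qed simp_all

lemma fmu_lunit_inv:
  assumes [simp]: "X \<in> Ob C"
  shows "far F (\<lambda>\<^sub>l\<^bsub>C\<^esub> X) \<cdot>\<^bsub>D\<^esub> fmu F \<one>\<^sub>o\<^bsub>C\<^esub> X = \<lambda>\<^sub>l\<^bsub>D\<^esub> (fob F X) \<cdot>\<^bsub>D\<^esub> (inv_ar D (fmu0 F) \<otimes>\<^sub>a\<^bsub>D\<^esub> \<iota>\<^bsub>D\<^esub> (fob F X))"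
  by (rule D.epiD[of "fmu0 F \<otimes>\<^sub>a\<^bsub>D\<^esub> \<iota>\<^bsub>D\<^esub> (fob F X)"]) (simp_all add: fmu_lunit)

lemma rev_strong_monoidal: "strong_monoidal_functor (rev_mon C) (rev_mon D) (rev_functor F)"
proof -
  interpret rC: monoidal_category "rev_mon C" by (rule C.rev_monoidal)
  interpret rD: monoidal_category "rev_mon D" by (rule D.rev_monoidal)
  show ?thesis
    by unfold_locales
      (auto simp: C.in_Hom D.in_Hom mu_natural fmu_lunit fmu_runit fmu_assoc_inv
        fmu_assoc_inv[THEN D.reassoc])
qed

definition ev_image where
  "ev_image X Y ev = inv_ar D (fmu0 F) \<cdot>\<^bsub>D\<^esub> far F ev \<cdot>\<^bsub>D\<^esub> fmu F Y X"

definition coev_image where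
  "coev_image X Y coev = inv_ar D (fmu F X Y) \<cdot>\<^bsub>D\<^esub> far F coev \<cdot>\<^bsub>D\<^esub> fmu0 F"

lemma dual_image_zigzag:
  assumes d: "is_dual C X Y ev coev"
  shows "\<rho>\<^bsub>D\<^esub> (fob F X) \<cdot>\<^bsub>D\<^esub> (\<iota>\<^bsub>D\<^esub> (fob F X) \<otimes>\<^sub>a\<^bsub>D\<^esub> ev_image X Y ev) \<cdot>\<^bsub>D\<^esub> \<alpha>\<^bsub>D\<^esub> (fob F X) (fob F Y) (fob F X)
      \<cdot>\<^bsub>D\<^esub> (coev_image X Y coev \<otimes>\<^sub>a\<^bsub>D\<^esub> \<iota>\<^bsub>D\<^esub> (fob F X)) = \<lambda>\<^sub>l\<^bsub>D\<^esub> (fob F X)"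
proof -
  note [simp] = C.is_dualD(1-8)[OF d]
  let ?e = "ev_image X Y ev" and ?c = "coev_image X Y coev" and ?i = "\<iota>\<^bsub>D\<^esub> (fob F X)"
  let ?a = "\<alpha>\<^bsub>D\<^esub> (fob F X) (fob F Y) (fob F X)"
  have [simp]: "?e \<in> Ar D" "src D ?e = fob F Y \<otimes>\<^sub>o\<^bsub>D\<^esub> fob F X" "tgt D ?e = \<one>\<^sub>o\<^bsub>D\<^esub>"
    "?c \<in> Ar D" "tgt D ?c = fob F X \<otimes>\<^sub>o\<^bsub>D\<^esub> fob F Y" "src D ?c = \<one>\<^sub>o\<^bsub>D\<^esub>"
    by (simp_all add: ev_image_def coev_image_def)
  have e: "fmu0 F \<cdot>\<^bsub>D\<^esub> ?e = far F ev \<cdot>\<^bsub>D\<^esub> fmu F Y X" and c: "far F coev \<cdot>\<^bsub>D\<^esub> fmu0 F = fmu F X Y \<cdot>\<^bsub>D\<^esub> ?c"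
    by (simp_all add: ev_image_def coev_image_def)
  have "\<lambda>\<^sub>l\<^bsub>D\<^esub> (fob F X) = far F (\<rho>\<^bsub>C\<^esub> X \<cdot>\<^bsub>C\<^esub> (\<iota>\<^bsub>C\<^esub> X \<otimes>\<^sub>a\<^bsub>C\<^esub> ev) \<cdot>\<^bsub>C\<^esub> \<alpha>\<^bsub>C\<^esub> X Y X \<cdot>\<^bsub>C\<^esub> (coev \<otimes>\<^sub>a\<^bsub>C\<^esub> \<iota>\<^bsub>C\<^esub> X))
      \<cdot>\<^bsub>D\<^esub> fmu F \<one>\<^sub>o\<^bsub>C\<^esub> X \<cdot>\<^bsub>D\<^esub> (fmu0 F \<otimes>\<^sub>a\<^bsub>D\<^esub> ?i)"
    by (simp only: C.is_dualD(9)[OF d]) (simp add: fmu_lunit)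
  also have "\<dots> = far F (\<rho>\<^bsub>C\<^esub> X) \<cdot>\<^bsub>D\<^esub> far F (\<iota>\<^bsub>C\<^esub> X \<otimes>\<^sub>a\<^bsub>C\<^esub> ev) \<cdot>\<^bsub>D\<^esub> far F (\<alpha>\<^bsub>C\<^esub> X Y X)
      \<cdot>\<^bsub>D\<^esub> fmu F (X \<otimes>\<^sub>o\<^bsub>C\<^esub> Y) X \<cdot>\<^bsub>D\<^esub> ((far F coev \<cdot>\<^bsub>D\<^esub> fmu0 F) \<otimes>\<^sub>a\<^bsub>D\<^esub> ?i)"
    by (simp add: mu_natural)
  also have "\<dots> = far F (\<rho>\<^bsub>C\<^esub> X) \<cdot>\<^bsub>D\<^esub> far F (\<iota>\<^bsub>C\<^esub> X \<otimes>\<^sub>a\<^bsub>C\<^esub> ev) \<cdot>\<^bsub>D\<^esub> (far F (\<alpha>\<^bsub>C\<^esub> X Y X)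
      \<cdot>\<^bsub>D\<^esub> fmu F (X \<otimes>\<^sub>o\<^bsub>C\<^esub> Y) X \<cdot>\<^bsub>D\<^esub> (fmu F X Y \<otimes>\<^sub>a\<^bsub>D\<^esub> ?i)) \<cdot>\<^bsub>D\<^esub> (?c \<otimes>\<^sub>a\<^bsub>D\<^esub> ?i)"
    unfolding c by simp
  also have "\<dots> = far F (\<rho>\<^bsub>C\<^esub> X) \<cdot>\<^bsub>D\<^esub> far F (\<iota>\<^bsub>C\<^esub> X \<otimes>\<^sub>a\<^bsub>C\<^esub> ev) \<cdot>\<^bsub>D\<^esub> (fmu F X (Y \<otimes>\<^sub>o\<^bsub>C\<^esub> X) \<cdot>\<^bsub>D\<^esub> (?i \<otimes>\<^sub>a\<^bsub>D\<^esub> fmu F Y X) \<cdot>\<^bsub>D\<^esub> ?a)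
       \<cdot>\<^bsub>D\<^esub> (?c \<otimes>\<^sub>a\<^bsub>D\<^esub> ?i)"
    by (simp only: fmu_assoc C.is_dualD(1,2)[OF d])
  also have "\<dots> = far F (\<rho>\<^bsub>C\<^esub> X) \<cdot>\<^bsub>D\<^esub> fmu F X \<one>\<^sub>o\<^bsub>C\<^esub> \<cdot>\<^bsub>D\<^esub> (?i \<otimes>\<^sub>a\<^bsub>D\<^esub> (far F ev \<cdot>\<^bsub>D\<^esub> fmu F Y X)) \<cdot>\<^bsub>D\<^esub> ?a \<cdot>\<^bsub>D\<^esub> (?c \<otimes>\<^sub>a\<^bsub>D\<^esub> ?i)"
    by (simp add: mu_natural)
  also have "\<dots> = (far F (\<rho>\<^bsub>C\<^esub> X) \<cdot>\<^bsub>D\<^esub> fmu F X \<one>\<^sub>o\<^bsub>C\<^esub> \<cdot>\<^bsub>D\<^esub> (?i \<otimes>\<^sub>a\<^bsub>D\<^esub> fmu0 F)) \<cdot>\<^bsub>D\<^esub> (?i \<otimes>\<^sub>a\<^bsub>D\<^esub> ?e) \<cdot>\<^bsub>D\<^esub> ?a \<cdot>\<^bsub>D\<^esub> (?c \<otimes>\<^sub>a\<^bsub>D\<^esub> ?i)"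
    unfolding e[symmetric] by simp
  also have "\<dots> = \<rho>\<^bsub>D\<^esub> (fob F X) \<cdot>\<^bsub>D\<^esub> (?i \<otimes>\<^sub>a\<^bsub>D\<^esub> ?e) \<cdot>\<^bsub>D\<^esub> ?a \<cdot>\<^bsub>D\<^esub> (?c \<otimes>\<^sub>a\<^bsub>D\<^esub> ?i)"
    by (simp only: fmu_runit C.is_dualD(1,2)[OF d])
  finally show ?thesis ..
qed

lemma is_dual_image:
  assumes d: "is_dual C X Y ev coev"
  shows "is_dual D (fob F X) (fob F Y) (ev_image X Y ev) (coev_image X Y coev)"
proof -
  note [simp] = C.is_dualD(1-8)[OF d]
  interpret rev: strong_monoidal_functor "rev_mon C" "rev_mon D" "rev_functor F"
    by (rule rev_strong_monoidal)
  have "is_dual (rev_mon C) Y X ev coev" using d by (simp add: C.is_dual_rev)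
  from rev.dual_image_zigzag[OF this]
  have "\<lambda>\<^sub>l\<^bsub>D\<^esub> (fob F Y) \<cdot>\<^bsub>D\<^esub> (ev_image X Y ev \<otimes>\<^sub>a\<^bsub>D\<^esub> \<iota>\<^bsub>D\<^esub> (fob F Y))
      \<cdot>\<^bsub>D\<^esub> inv_ar D (\<alpha>\<^bsub>D\<^esub> (fob F Y) (fob F X) (fob F Y)) \<cdot>\<^bsub>D\<^esub> (\<iota>\<^bsub>D\<^esub> (fob F Y) \<otimes>\<^sub>a\<^bsub>D\<^esub> coev_image X Y coev)
    = \<rho>\<^bsub>D\<^esub> (fob F Y)"
    by (simp add: rev.ev_image_def rev.coev_image_def ev_image_def coev_image_def)
  thus ?thesis
    unfolding is_dual_def using dual_image_zigzag[OF d]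
    by (simp add: D.in_Hom ev_image_def coev_image_def)
qed

text \<open>This compatibility allows the projection formula below to be checked after transposition
  along a pair of duals in \<open>C\<close> and its image in \<open>D\<close>.\<close>

lemma far_flat:
  assumes d: "is_dual C W V ev coev" and [simp]: "Z \<in> Ob C" "u \<in> Ar C" "tgt C u = W \<otimes>\<^sub>o\<^bsub>C\<^esub> Z"
  shows "D.flat (fob F W) (fob F V) (ev_image W V ev) (fob F Z) (inv_ar D (fmu F W Z) \<cdot>\<^bsub>D\<^esub> far F u)
      = far F (C.flat W V ev Z u) \<cdot>\<^bsub>D\<^esub> fmu F V (src C u)"
proof -
  note [simp] = C.is_dualD(1-8)[OF d]
  let ?e = "ev_image W V ev" and ?m = "inv_ar D (fmu F W Z)"
  let ?a = "inv_ar D (\<alpha>\<^bsub>D\<^esub> (fob F V) (fob F W) (fob F Z))"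
  have [simp]: "?e \<in> Ar D" "src D ?e = fob F V \<otimes>\<^sub>o\<^bsub>D\<^esub> fob F W" "tgt D ?e = \<one>\<^sub>o\<^bsub>D\<^esub>"
    by (simp_all add: ev_image_def)
  have e: "inv_ar D (fmu0 F) \<cdot>\<^bsub>D\<^esub> far F ev \<cdot>\<^bsub>D\<^esub> fmu F V W = ?e" by (simp add: ev_image_def)
  have "far F (C.flat W V ev Z u) \<cdot>\<^bsub>D\<^esub> fmu F V (src C u)
      = far F (\<lambda>\<^sub>l\<^bsub>C\<^esub> Z) \<cdot>\<^bsub>D\<^esub> far F (ev \<otimes>\<^sub>a\<^bsub>C\<^esub> \<iota>\<^bsub>C\<^esub> Z) \<cdot>\<^bsub>D\<^esub> (far F (inv_ar C (\<alpha>\<^bsub>C\<^esub> V W Z)) \<cdot>\<^bsub>D\<^esub> fmu F V (W \<otimes>\<^sub>o\<^bsub>C\<^esub> Z))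
        \<cdot>\<^bsub>D\<^esub> (\<iota>\<^bsub>D\<^esub> (fob F V) \<otimes>\<^sub>a\<^bsub>D\<^esub> far F u)"
    unfolding C.flat_def by (simp add: mu_natural)
  also have "\<dots> = (far F (\<lambda>\<^sub>l\<^bsub>C\<^esub> Z) \<cdot>\<^bsub>D\<^esub> fmu F \<one>\<^sub>o\<^bsub>C\<^esub> Z) \<cdot>\<^bsub>D\<^esub> (far F ev \<otimes>\<^sub>a\<^bsub>D\<^esub> \<iota>\<^bsub>D\<^esub> (fob F Z))
        \<cdot>\<^bsub>D\<^esub> (fmu F V W \<otimes>\<^sub>a\<^bsub>D\<^esub> \<iota>\<^bsub>D\<^esub> (fob F Z)) \<cdot>\<^bsub>D\<^esub> ?a \<cdot>\<^bsub>D\<^esub> (\<iota>\<^bsub>D\<^esub> (fob F V) \<otimes>\<^sub>a\<^bsub>D\<^esub> ?m) \<cdot>\<^bsub>D\<^esub> (\<iota>\<^bsub>D\<^esub> (fob F V) \<otimes>\<^sub>a\<^bsub>D\<^esub> far F u)"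
    by (simp add: fmu_assoc_inv mu_natural)
  also have "\<dots> = \<lambda>\<^sub>l\<^bsub>D\<^esub> (fob F Z) \<cdot>\<^bsub>D\<^esub> ((inv_ar D (fmu0 F) \<cdot>\<^bsub>D\<^esub> far F ev \<cdot>\<^bsub>D\<^esub> fmu F V W) \<otimes>\<^sub>a\<^bsub>D\<^esub> \<iota>\<^bsub>D\<^esub> (fob F Z))
        \<cdot>\<^bsub>D\<^esub> ?a \<cdot>\<^bsub>D\<^esub> (\<iota>\<^bsub>D\<^esub> (fob F V) \<otimes>\<^sub>a\<^bsub>D\<^esub> (?m \<cdot>\<^bsub>D\<^esub> far F u))"
    by (simp add: fmu_lunit_inv)
  also have "\<dots> = D.flat (fob F W) (fob F V) ?e (fob F Z) (?m \<cdot>\<^bsub>D\<^esub> far F u)"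
    unfolding D.flat_def e by simp
  finally show ?thesis ..
qed

end

section \<open>The lax monoidal structure of a right adjoint\<close>

locale monoidal_adjunction = strong_monoidal_functor C D F + adjunction C D F R \<eta> \<epsilon>
  for C :: "('o, 'm, 'k, 'x) mon_category_scheme" (structure) and D :: "('p, 'n, 'l, 'y) mon_category_scheme"
    and F :: "('o, 'm, 'p, 'n, 'z) mon_functor_data_scheme"
    and R :: "('p, 'n, 'o, 'm, 'w) functor_data_scheme"
    and \<eta> :: "'o \<Rightarrow> 'm" and \<epsilon> :: "'p \<Rightarrow> 'n"
begin

lemma unit_typ [simp]:
  assumes "X \<in> Ob C"
  shows "\<eta> X \<in> Ar C" "src C (\<eta> X) = X" "tgt C (\<eta> X) = fob R (fob F X)"
  using unit_nat assms by (auto simp: nat_trans_def C.in_Hom id_functor_def comp_functor_def)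

lemma counit_typ [simp]:
  assumes "Y \<in> Ob D"
  shows "\<epsilon> Y \<in> Ar D" "src D (\<epsilon> Y) = fob F (fob R Y)" "tgt D (\<epsilon> Y) = Y"
  using counit_nat assms by (auto simp: nat_trans_def D.in_Hom id_functor_def comp_functor_def)

lemma unit_natural: "\<lbrakk>X = tgt C f; f \<in> Ar C\<rbrakk> \<Longrightarrow> \<eta> X \<cdot> f = far R (far F f) \<cdot> \<eta> (src C f)"
  using unit_nat by (auto simp: nat_trans_def C.in_Hom id_functor_def comp_functor_def)

lemma counit_natural: "\<lbrakk>Y = tgt D f; f \<in> Ar D\<rbrakk> \<Longrightarrow> \<epsilon> Y \<cdot>\<^bsub>D\<^esub> far F (far R f) = f \<cdot>\<^bsub>D\<^esub> \<epsilon> (src D f)"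
  using counit_nat by (auto simp: nat_trans_def D.in_Hom id_functor_def comp_functor_def)

lemmas adj_simps = counit_natural counit_natural[THEN D.reassoc]
  triangle_F triangle_F[THEN D.reassoc] triangle_R triangle_R[THEN C.reassoc]

text \<open>The inverse of transposition is \<open>a \<mapsto> R(a) \<circ> \<eta>\<close>.\<close>

lemma transpose_inject:
  assumes "\<epsilon> Y \<cdot>\<^bsub>D\<^esub> far F f = \<epsilon> Y \<cdot>\<^bsub>D\<^esub> far F g" "f \<in> Ar C" "g \<in> Ar C" "src C f = src C g"
    "tgt C f = fob R Y" "tgt C g = fob R Y" "Y \<in> Ob D"
  shows "f = g"
proof -
  have "far R (\<epsilon> Y \<cdot>\<^bsub>D\<^esub> far F h) \<cdot> \<eta> (src C h) = h" if "h \<in> Ar C" "tgt C h = fob R Y" for h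
    using that assms by (simp add: unit_natural[symmetric] triangle_R[THEN C.reassoc])
  from this[of f] this[of g] assms show ?thesis by simp
qed

lemma transpose_transpose:
  "\<lbrakk>src D a = fob F W; a \<in> Ar D; W \<in> Ob C\<rbrakk> \<Longrightarrow> \<epsilon> (tgt D a) \<cdot>\<^bsub>D\<^esub> far F (far R a \<cdot> \<eta> W) = a"
  by (simp add: adj_simps)

abbreviation "R2 \<equiv> radj_mu C D F R \<eta> \<epsilon>"
abbreviation "R0 \<equiv> radj_mu0 C D F R \<eta>"

lemma R2_typ [simp]:
  assumes "X \<in> Ob D" "Y \<in> Ob D"
  shows "R2 X Y \<in> Ar C" "src C (R2 X Y) = fob R X \<otimes>\<^sub>o fob R Y" "tgt C (R2 X Y) = fob R (X \<otimes>\<^sub>o\<^bsub>D\<^esub> Y)"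
  using assms by (simp_all add: radj_mu_def)

lemma R0_typ [simp]: "R0 \<in> Ar C" "src C R0 = \<one>\<^sub>o" "tgt C R0 = fob R \<one>\<^sub>o\<^bsub>D\<^esub>"
  by (simp_all add: radj_mu0_def)

text \<open>The transposes of \<open>R2\<close> and \<open>R0\<close>: all coherence of the lax structure follows from these two
  equations, by the injectivity of transposition.\<close>

lemma counit_R2:
  "\<lbrakk>Z = X \<otimes>\<^sub>o\<^bsub>D\<^esub> Y; X \<in> Ob D; Y \<in> Ob D\<rbrakk> \<Longrightarrow> \<epsilon> Z \<cdot>\<^bsub>D\<^esub> far F (R2 X Y) \<cdot>\<^bsub>D\<^esub> fmu F (fob R X) (fob R Y) = \<epsilon> X \<otimes>\<^sub>a\<^bsub>D\<^esub> \<epsilon> Y"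
  by (simp add: radj_mu_def adj_simps)

lemma counit_R0: "\<epsilon> \<one>\<^sub>o\<^bsub>D\<^esub> \<cdot>\<^bsub>D\<^esub> far F R0 \<cdot>\<^bsub>D\<^esub> fmu0 F = \<iota>\<^bsub>D\<^esub> \<one>\<^sub>o\<^bsub>D\<^esub>"
  by (simp add: radj_mu0_def adj_simps)

lemmas counit_R = counit_R2 counit_R2[THEN D.reassoc3] counit_R0 counit_R0[THEN D.reassoc3]

lemma R2_natural:
  assumes [simp]: "f \<in> Ar D" "g \<in> Ar D" and XY: "X = src D f" "Y = src D g"
  shows "far R (f \<otimes>\<^sub>a\<^bsub>D\<^esub> g) \<cdot> R2 X Y = R2 (tgt D f) (tgt D g) \<cdot> (far R f \<otimes>\<^sub>a far R g)"
proof (rule transpose_inject[of "tgt D f \<otimes>\<^sub>o\<^bsub>D\<^esub> tgt D g"])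
  let ?e = "fmu F (fob R X) (fob R Y)" and ?T = "tgt D f \<otimes>\<^sub>o\<^bsub>D\<^esub> tgt D g"
  show "\<epsilon> ?T \<cdot>\<^bsub>D\<^esub> far F (far R (f \<otimes>\<^sub>a\<^bsub>D\<^esub> g) \<cdot> R2 X Y) = \<epsilon> ?T \<cdot>\<^bsub>D\<^esub> far F (R2 (tgt D f) (tgt D g) \<cdot> (far R f \<otimes>\<^sub>a far R g))"
    by (rule D.epiD[of ?e]) (simp_all add: XY mu_natural adj_simps counit_R)
qed (simp_all add: XY)

lemma R2_assoc:
  assumes [simp]: "X \<in> Ob D" "Y \<in> Ob D" "Z \<in> Ob D"
  shows "far R (\<alpha>\<^bsub>D\<^esub> X Y Z) \<cdot> R2 (X \<otimes>\<^sub>o\<^bsub>D\<^esub> Y) Z \<cdot> (R2 X Y \<otimes>\<^sub>a \<iota> (fob R Z))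
      = R2 X (Y \<otimes>\<^sub>o\<^bsub>D\<^esub> Z) \<cdot> (\<iota> (fob R X) \<otimes>\<^sub>a R2 Y Z) \<cdot> \<alpha> (fob R X) (fob R Y) (fob R Z)"
    (is "?l = ?r")
proof (rule transpose_inject[of "X \<otimes>\<^sub>o\<^bsub>D\<^esub> (Y \<otimes>\<^sub>o\<^bsub>D\<^esub> Z)"])
  let ?x = "fob R X" and ?y = "fob R Y" and ?z = "fob R Z" and ?T = "X \<otimes>\<^sub>o\<^bsub>D\<^esub> (Y \<otimes>\<^sub>o\<^bsub>D\<^esub> Z)"
  let ?e = "fmu F (?x \<otimes>\<^sub>o ?y) ?z \<cdot>\<^bsub>D\<^esub> (fmu F ?x ?y \<otimes>\<^sub>a\<^bsub>D\<^esub> \<iota>\<^bsub>D\<^esub> (fob F ?z))"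
  show "\<epsilon> ?T \<cdot>\<^bsub>D\<^esub> far F ?l = \<epsilon> ?T \<cdot>\<^bsub>D\<^esub> far F ?r"
  proof (rule D.epiD[of ?e])
    have "(\<epsilon> ?T \<cdot>\<^bsub>D\<^esub> far F ?l) \<cdot>\<^bsub>D\<^esub> ?e = \<alpha>\<^bsub>D\<^esub> X Y Z \<cdot>\<^bsub>D\<^esub> ((\<epsilon> X \<otimes>\<^sub>a\<^bsub>D\<^esub> \<epsilon> Y) \<otimes>\<^sub>a\<^bsub>D\<^esub> \<epsilon> Z)"
      by (simp add: mu_natural adj_simps counit_R)
    also have "\<dots> = (\<epsilon> X \<otimes>\<^sub>a\<^bsub>D\<^esub> (\<epsilon> Y \<otimes>\<^sub>a\<^bsub>D\<^esub> \<epsilon> Z)) \<cdot>\<^bsub>D\<^esub> \<alpha>\<^bsub>D\<^esub> (fob F ?x) (fob F ?y) (fob F ?z)"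
      by (simp add: D.natural)
    also have "\<dots> = (\<epsilon> ?T \<cdot>\<^bsub>D\<^esub> far F ?r) \<cdot>\<^bsub>D\<^esub> ?e"
      by (simp add: fmu_assoc mu_natural counit_R)
    finally show "(\<epsilon> ?T \<cdot>\<^bsub>D\<^esub> far F ?l) \<cdot>\<^bsub>D\<^esub> ?e = (\<epsilon> ?T \<cdot>\<^bsub>D\<^esub> far F ?r) \<cdot>\<^bsub>D\<^esub> ?e" .
  qed simp_all
qed simp_all

lemma R2_lunit:
  assumes [simp]: "X \<in> Ob D"
  shows "far R (\<lambda>\<^sub>l\<^bsub>D\<^esub> X) \<cdot> R2 \<one>\<^sub>o\<^bsub>D\<^esub> X \<cdot> (R0 \<otimes>\<^sub>a \<iota> (fob R X)) = \<lambda>\<^sub>l (fob R X)" (is "?l = ?r")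
proof (rule transpose_inject[of X])
  let ?e = "fmu F \<one>\<^sub>o (fob R X) \<cdot>\<^bsub>D\<^esub> (fmu0 F \<otimes>\<^sub>a\<^bsub>D\<^esub> \<iota>\<^bsub>D\<^esub> (fob F (fob R X)))"
  show "\<epsilon> X \<cdot>\<^bsub>D\<^esub> far F ?l = \<epsilon> X \<cdot>\<^bsub>D\<^esub> far F ?r"
  proof (rule D.epiD[of ?e])
    have "(\<epsilon> X \<cdot>\<^bsub>D\<^esub> far F ?l) \<cdot>\<^bsub>D\<^esub> ?e = \<lambda>\<^sub>l\<^bsub>D\<^esub> X \<cdot>\<^bsub>D\<^esub> (\<iota>\<^bsub>D\<^esub> \<one>\<^sub>o\<^bsub>D\<^esub> \<otimes>\<^sub>a\<^bsub>D\<^esub> \<epsilon> X)"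
      by (simp add: mu_natural adj_simps counit_R)
    also have "\<dots> = (\<epsilon> X \<cdot>\<^bsub>D\<^esub> far F ?r) \<cdot>\<^bsub>D\<^esub> ?e"
      by (simp add: D.natural fmu_lunit)
    finally show "(\<epsilon> X \<cdot>\<^bsub>D\<^esub> far F ?l) \<cdot>\<^bsub>D\<^esub> ?e = (\<epsilon> X \<cdot>\<^bsub>D\<^esub> far F ?r) \<cdot>\<^bsub>D\<^esub> ?e" .
  qed simp_all
qed simp_all

lemma rev_monoidal_adjunction:
  "monoidal_adjunction (rev_mon C) (rev_mon D) (rev_functor F) R \<eta> \<epsilon>"
proof -
  interpret rev: strong_monoidal_functor "rev_mon C" "rev_mon D" "rev_functor F"
    by (rule rev_strong_monoidal)
  show ?thesis
    by unfold_locales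
      (auto simp: C.in_Hom D.in_Hom nat_trans_def id_functor_def comp_functor_def unit_natural
        counit_natural triangle_F triangle_R)
qed

lemma radj_rev [simp]:
  "radj_mu (rev_mon C) (rev_mon D) (rev_functor F) R \<eta> \<epsilon> X Y = R2 Y X"
  "radj_mu0 (rev_mon C) (rev_mon D) (rev_functor F) R \<eta> = R0"
  by (simp_all add: radj_mu_def radj_mu0_def)

lemma R2_runit:
  "X \<in> Ob D \<Longrightarrow> far R (\<rho>\<^bsub>D\<^esub> X) \<cdot> R2 X \<one>\<^sub>o\<^bsub>D\<^esub> \<cdot> (\<iota> (fob R X) \<otimes>\<^sub>a R0) = \<rho> (fob R X)"
  using monoidal_adjunction.R2_lunit[OF rev_monoidal_adjunction, of X] by simp

text \<open>The projection formula. After transposition under the adjunction and along the duals of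
  \<open>W\<close> and \<open>F W\<close>, composition with this arrow becomes the bijection between arrows into \<open>R Y\<close>
  and arrows into \<open>Y\<close>; so it is invertible as soon as \<open>W\<close> has a left dual.\<close>

definition projection where
  "projection W Y = R2 (fob F W) Y \<cdot> (\<eta> W \<otimes>\<^sub>a \<iota> (fob R Y))"

lemma projection_typ [simp]:
  assumes "W \<in> Ob C" "Y \<in> Ob D"
  shows "projection W Y \<in> Ar C" "src C (projection W Y) = W \<otimes>\<^sub>o fob R Y"
    "tgt C (projection W Y) = fob R (fob F W \<otimes>\<^sub>o\<^bsub>D\<^esub> Y)"
  using assms by (simp_all add: projection_def)

lemma counit_projection:
  assumes [simp]: "W \<in> Ob C" "Y \<in> Ob D"
  shows "\<epsilon> (fob F W \<otimes>\<^sub>o\<^bsub>D\<^esub> Y) \<cdot>\<^bsub>D\<^esub> far F (projection W Y) = (\<iota>\<^bsub>D\<^esub> (fob F W) \<otimes>\<^sub>a\<^bsub>D\<^esub> \<epsilon> Y) \<cdot>\<^bsub>D\<^esub> inv_ar D (fmu F W (fob R Y))"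
proof (rule D.epiD[of "fmu F W (fob R Y)"])
  have "\<epsilon> (fob F W \<otimes>\<^sub>o\<^bsub>D\<^esub> Y) \<cdot>\<^bsub>D\<^esub> far F (projection W Y) \<cdot>\<^bsub>D\<^esub> fmu F W (fob R Y)
    = \<epsilon> (fob F W \<otimes>\<^sub>o\<^bsub>D\<^esub> Y) \<cdot>\<^bsub>D\<^esub> far F (R2 (fob F W) Y) \<cdot>\<^bsub>D\<^esub> fmu F (fob R (fob F W)) (fob R Y) \<cdot>\<^bsub>D\<^esub> (far F (\<eta> W) \<otimes>\<^sub>a\<^bsub>D\<^esub> \<iota>\<^bsub>D\<^esub> (fob F (fob R Y)))"
    by (simp add: projection_def mu_natural)
  also have "\<dots> = \<iota>\<^bsub>D\<^esub> (fob F W) \<otimes>\<^sub>a\<^bsub>D\<^esub> \<epsilon> Y" by (simp add: counit_R adj_simps)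
  finally show "(\<epsilon> (fob F W \<otimes>\<^sub>o\<^bsub>D\<^esub> Y) \<cdot>\<^bsub>D\<^esub> far F (projection W Y)) \<cdot>\<^bsub>D\<^esub> fmu F W (fob R Y)
    = ((\<iota>\<^bsub>D\<^esub> (fob F W) \<otimes>\<^sub>a\<^bsub>D\<^esub> \<epsilon> Y) \<cdot>\<^bsub>D\<^esub> inv_ar D (fmu F W (fob R Y))) \<cdot>\<^bsub>D\<^esub> fmu F W (fob R Y)" by simp
qed simp_all

lemma flat_projection:
  assumes d: "is_dual C W V ev coev"
    and [simp]: "Y \<in> Ob D" "u \<in> Ar C" "tgt C u = W \<otimes>\<^sub>o fob R Y"
  shows "D.flat (fob F W) (fob F V) (ev_image W V ev) Y
        (\<epsilon> (fob F W \<otimes>\<^sub>o\<^bsub>D\<^esub> Y) \<cdot>\<^bsub>D\<^esub> far F (projection W Y \<cdot> u))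
      = \<epsilon> Y \<cdot>\<^bsub>D\<^esub> far F (C.flat W V ev (fob R Y) u) \<cdot>\<^bsub>D\<^esub> fmu F V (src C u)"
proof -
  note [simp] = C.is_dualD(1-8)[OF d]
  have "\<epsilon> (fob F W \<otimes>\<^sub>o\<^bsub>D\<^esub> Y) \<cdot>\<^bsub>D\<^esub> far F (projection W Y \<cdot> u)
     = (\<iota>\<^bsub>D\<^esub> (fob F W) \<otimes>\<^sub>a\<^bsub>D\<^esub> \<epsilon> Y) \<cdot>\<^bsub>D\<^esub> (inv_ar D (fmu F W (fob R Y)) \<cdot>\<^bsub>D\<^esub> far F u)"
    by (simp add: counit_projection[THEN D.reassoc])
  thus ?thesis
    using D.flat_cmp[OF is_dual_image[OF d], of "\<epsilon> Y" "inv_ar D (fmu F W (fob R Y)) \<cdot>\<^bsub>D\<^esub> far F u"]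
      far_flat[OF d, of "fob R Y" u]
    by simp
qed

lemma projection_iso:
  assumes d: "is_dual C W V ev coev" and [simp]: "Y \<in> Ob D"
  shows "iso_ar C (projection W Y)"
proof (rule C.iso_if_mono_split_epi)
  note [simp] = C.is_dualD(1-8)[OF d]
  note dF = is_dual_image[OF d]
  let ?p = "projection W Y" and ?T = "fob F W \<otimes>\<^sub>o\<^bsub>D\<^esub> Y"
  show "?p \<in> Ar C" by simp
  show "mono_ar C ?p" unfolding C.mono_iff
  proof (intro conjI allI impI)
    fix u u' assume u [simp]: "u \<in> Ar C" "u' \<in> Ar C" and t: "tgt C u = src C ?p" "tgt C u' = src C ?p"
      and s: "src C u = src C u'" and eq: "?p \<cdot> u = ?p \<cdot> u'"
    have t' [simp]: "tgt C u = W \<otimes>\<^sub>o fob R Y" "tgt C u' = W \<otimes>\<^sub>o fob R Y" using t by simp_all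
    note f = C.flat_typ[OF d, of "fob R Y"]
    have "(\<epsilon> Y \<cdot>\<^bsub>D\<^esub> far F (C.flat W V ev (fob R Y) u)) \<cdot>\<^bsub>D\<^esub> fmu F V (src C u')
        = (\<epsilon> Y \<cdot>\<^bsub>D\<^esub> far F (C.flat W V ev (fob R Y) u')) \<cdot>\<^bsub>D\<^esub> fmu F V (src C u')"
      using flat_projection[OF d, of Y u] flat_projection[OF d, of Y u'] eq
      by (simp add: f s)
    hence "\<epsilon> Y \<cdot>\<^bsub>D\<^esub> far F (C.flat W V ev (fob R Y) u) = \<epsilon> Y \<cdot>\<^bsub>D\<^esub> far F (C.flat W V ev (fob R Y) u')"
      by (rule D.epiD[of "fmu F V (src C u')", rotated]) (simp_all add: f s)
    hence "C.flat W V ev (fob R Y) u = C.flat W V ev (fob R Y) u'"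
      by (rule transpose_inject) (simp_all add: f s)
    thus "u = u'" by (rule C.flat_inj[OF d, of "fob R Y", rotated 6]) (simp_all add: s)
  qed simp
  let ?B = "fob R ?T"
  \<comment> \<open>The right inverse is the arrow that the chain of bijections assigns to the counit, the
    transpose of the identity.\<close>
  define a where "a = D.flat (fob F W) (fob F V) (ev_image W V ev) Y (\<epsilon> ?T)"
  have [simp]: "a \<in> Ar D" "src D a = fob F V \<otimes>\<^sub>o\<^bsub>D\<^esub> fob F ?B" "tgt D a = Y"
    using D.flat_typ[OF dF, of Y "\<epsilon> ?T"] by (simp_all add: a_def)
  define v where "v = far R (a \<cdot>\<^bsub>D\<^esub> inv_ar D (fmu F V ?B)) \<cdot> \<eta> (V \<otimes>\<^sub>o ?B)"
  have [simp]: "v \<in> Ar C" "src C v = V \<otimes>\<^sub>o ?B" "tgt C v = fob R Y" by (simp_all add: v_def)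
  have v: "\<epsilon> Y \<cdot>\<^bsub>D\<^esub> far F v = a \<cdot>\<^bsub>D\<^esub> inv_ar D (fmu F V ?B)"
    using transpose_transpose[of "a \<cdot>\<^bsub>D\<^esub> inv_ar D (fmu F V ?B)" "V \<otimes>\<^sub>o ?B"] by (simp add: v_def)
  define g where "g = C.sharp W V coev ?B v"
  have [simp]: "g \<in> Ar C" "src C g = ?B" "tgt C g = W \<otimes>\<^sub>o fob R Y"
    using C.sharp_typ[OF d, of ?B v] by (simp_all add: g_def)
  have g: "C.flat W V ev (fob R Y) g = v" using C.flat_sharp[OF d, of ?B v] by (simp add: g_def)
  have "D.flat (fob F W) (fob F V) (ev_image W V ev) Y (\<epsilon> ?T \<cdot>\<^bsub>D\<^esub> far F (?p \<cdot> g)) = a"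
    using flat_projection[OF d, of Y g] by (simp add: g v[THEN D.reassoc])
  hence "\<epsilon> ?T \<cdot>\<^bsub>D\<^esub> far F (?p \<cdot> g) = \<epsilon> ?T"
    unfolding a_def by (rule D.flat_inj[OF dF, of Y, rotated 6]) simp_all
  hence "?p \<cdot> g = \<iota> ?B" by (intro transpose_inject[of ?T "?p \<cdot> g" "\<iota> ?B"]) simp_all
  thus "\<exists>g. g \<in> Ar C \<and> src C g = tgt C ?p \<and> tgt C g = src C ?p \<and> ?p \<cdot> g = \<iota> (tgt C ?p)"
    by (intro exI[of _ g]) simp
qed

end

section \<open>The central algebra of an adjunction\<close>

context monoidal_adjunction
begin

abbreviation "RI \<equiv> fob R \<one>\<^sub>o\<^bsub>D\<^esub>"

text \<open>The two actions of \<open>R \<one>\<^sub>o\<close> on \<open>R Y\<close>; on \<open>R \<one>\<^sub>o\<close> itself both are the multiplication.\<close>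

definition lact where "lact Y = far R (\<lambda>\<^sub>l\<^bsub>D\<^esub> Y) \<cdot> R2 \<one>\<^sub>o\<^bsub>D\<^esub> Y"
definition ract where "ract Y = far R (\<rho>\<^bsub>D\<^esub> Y) \<cdot> R2 Y \<one>\<^sub>o\<^bsub>D\<^esub>"

lemma act_typ [simp]:
  assumes "Y \<in> Ob D"
  shows "lact Y \<in> Ar C" "src C (lact Y) = RI \<otimes>\<^sub>o fob R Y" "tgt C (lact Y) = fob R Y"
    "ract Y \<in> Ar C" "src C (ract Y) = fob R Y \<otimes>\<^sub>o RI" "tgt C (ract Y) = fob R Y"
  using assms by (simp_all add: lact_def ract_def)

lemma ract_rev: "monoidal_adjunction.lact (rev_mon C) (rev_mon D) (rev_functor F) R \<eta> \<epsilon> = ract"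
  using monoidal_adjunction.lact_def[OF rev_monoidal_adjunction] by (simp add: fun_eq_iff ract_def)

lemma lact_unit_eq_ract_unit: "lact \<one>\<^sub>o\<^bsub>D\<^esub> = ract \<one>\<^sub>o\<^bsub>D\<^esub>"
  by (simp add: lact_def ract_def D.lunit_unit_eq_runit_unit)

lemma lact_natural:
  assumes [simp]: "f \<in> Ar D" and Y: "Y = tgt D f"
  shows "lact Y \<cdot> (\<iota> RI \<otimes>\<^sub>a far R f) = far R f \<cdot> lact (src D f)"
proof -
  have "lact Y \<cdot> (\<iota> RI \<otimes>\<^sub>a far R f) = far R (\<lambda>\<^sub>l\<^bsub>D\<^esub> Y) \<cdot> far R (\<iota>\<^bsub>D\<^esub> \<one>\<^sub>o\<^bsub>D\<^esub> \<otimes>\<^sub>a\<^bsub>D\<^esub> f) \<cdot> R2 \<one>\<^sub>o\<^bsub>D\<^esub> (src D f)"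
    by (simp add: lact_def R2_natural Y)
  also have "\<dots> = far R (\<lambda>\<^sub>l\<^bsub>D\<^esub> Y \<cdot>\<^bsub>D\<^esub> (\<iota>\<^bsub>D\<^esub> \<one>\<^sub>o\<^bsub>D\<^esub> \<otimes>\<^sub>a\<^bsub>D\<^esub> f)) \<cdot> R2 \<one>\<^sub>o\<^bsub>D\<^esub> (src D f)" by (simp add: Y)
  also have "\<dots> = far R f \<cdot> lact (src D f)"
    by (simp add: lact_def D.natural Y del: R.far_cmp') simp
  finally show ?thesis .
qed

lemma ract_natural:
  "\<lbrakk>f \<in> Ar D; Y = tgt D f\<rbrakk> \<Longrightarrow> ract Y \<cdot> (far R f \<otimes>\<^sub>a \<iota> RI) = far R f \<cdot> ract (src D f)"
  using monoidal_adjunction.lact_natural[OF rev_monoidal_adjunction, of f Y] by (simp add: ract_rev)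

text \<open>Each of the three properties of \<open>R2\<close> below is its associativity combined with a unit
  coherence of \<open>D\<close>, and all associativity laws of the two actions are instances of them.\<close>

lemma R2_lact:
  assumes [simp]: "X \<in> Ob D" "Y \<in> Ob D"
  shows "R2 X Y \<cdot> (lact X \<otimes>\<^sub>a \<iota> (fob R Y))
    = lact (X \<otimes>\<^sub>o\<^bsub>D\<^esub> Y) \<cdot> (\<iota> RI \<otimes>\<^sub>a R2 X Y) \<cdot> \<alpha> RI (fob R X) (fob R Y)"
proof -
  let ?y = "\<iota> (fob R Y)"
  have "R2 X Y \<cdot> (lact X \<otimes>\<^sub>a ?y) = R2 X Y \<cdot> (far R (\<lambda>\<^sub>l\<^bsub>D\<^esub> X) \<otimes>\<^sub>a far R (\<iota>\<^bsub>D\<^esub> Y)) \<cdot> (R2 \<one>\<^sub>o\<^bsub>D\<^esub> X \<otimes>\<^sub>a ?y)"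
    by (simp add: lact_def)
  also have "\<dots> = far R (\<lambda>\<^sub>l\<^bsub>D\<^esub> X \<otimes>\<^sub>a\<^bsub>D\<^esub> \<iota>\<^bsub>D\<^esub> Y) \<cdot> R2 (\<one>\<^sub>o\<^bsub>D\<^esub> \<otimes>\<^sub>o\<^bsub>D\<^esub> X) Y \<cdot> (R2 \<one>\<^sub>o\<^bsub>D\<^esub> X \<otimes>\<^sub>a ?y)"
    by (simp add: R2_natural[THEN C.reassoc])
  also have "\<dots> = far R (\<lambda>\<^sub>l\<^bsub>D\<^esub> (X \<otimes>\<^sub>o\<^bsub>D\<^esub> Y)) \<cdot> far R (\<alpha>\<^bsub>D\<^esub> \<one>\<^sub>o\<^bsub>D\<^esub> X Y) \<cdot> R2 (\<one>\<^sub>o\<^bsub>D\<^esub> \<otimes>\<^sub>o\<^bsub>D\<^esub> X) Y \<cdot> (R2 \<one>\<^sub>o\<^bsub>D\<^esub> X \<otimes>\<^sub>a ?y)"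
    by (simp flip: D.lunit_tens)
  also have "\<dots> = lact (X \<otimes>\<^sub>o\<^bsub>D\<^esub> Y) \<cdot> (\<iota> RI \<otimes>\<^sub>a R2 X Y) \<cdot> \<alpha> RI (fob R X) (fob R Y)"
    by (simp add: R2_assoc lact_def)
  finally show ?thesis .
qed

lemma R2_ract:
  "\<lbrakk>X \<in> Ob D; Y \<in> Ob D\<rbrakk> \<Longrightarrow> R2 X Y \<cdot> (\<iota> (fob R X) \<otimes>\<^sub>a ract Y)
    = ract (X \<otimes>\<^sub>o\<^bsub>D\<^esub> Y) \<cdot> (R2 X Y \<otimes>\<^sub>a \<iota> RI) \<cdot> inv_ar C (\<alpha> (fob R X) (fob R Y) RI)"
  using monoidal_adjunction.R2_lact[OF rev_monoidal_adjunction, of Y X] by (simp add: ract_rev)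

lemma R2_balanced:
  assumes [simp]: "X \<in> Ob D" "Y \<in> Ob D"
  shows "R2 X Y \<cdot> (ract X \<otimes>\<^sub>a \<iota> (fob R Y))
    = R2 X Y \<cdot> (\<iota> (fob R X) \<otimes>\<^sub>a lact Y) \<cdot> \<alpha> (fob R X) RI (fob R Y)"
proof -
  let ?y = "\<iota> (fob R Y)" and ?x = "\<iota> (fob R X)"
  have "R2 X Y \<cdot> (ract X \<otimes>\<^sub>a ?y) = R2 X Y \<cdot> (far R (\<rho>\<^bsub>D\<^esub> X) \<otimes>\<^sub>a far R (\<iota>\<^bsub>D\<^esub> Y)) \<cdot> (R2 X \<one>\<^sub>o\<^bsub>D\<^esub> \<otimes>\<^sub>a ?y)"
    by (simp add: ract_def)
  also have "\<dots> = far R (\<rho>\<^bsub>D\<^esub> X \<otimes>\<^sub>a\<^bsub>D\<^esub> \<iota>\<^bsub>D\<^esub> Y) \<cdot> R2 (X \<otimes>\<^sub>o\<^bsub>D\<^esub> \<one>\<^sub>o\<^bsub>D\<^esub>) Y \<cdot> (R2 X \<one>\<^sub>o\<^bsub>D\<^esub> \<otimes>\<^sub>a ?y)"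
    by (simp add: R2_natural[THEN C.reassoc])
  also have "\<dots> = far R (\<iota>\<^bsub>D\<^esub> X \<otimes>\<^sub>a\<^bsub>D\<^esub> \<lambda>\<^sub>l\<^bsub>D\<^esub> Y) \<cdot> far R (\<alpha>\<^bsub>D\<^esub> X \<one>\<^sub>o\<^bsub>D\<^esub> Y) \<cdot> R2 (X \<otimes>\<^sub>o\<^bsub>D\<^esub> \<one>\<^sub>o\<^bsub>D\<^esub>) Y \<cdot> (R2 X \<one>\<^sub>o\<^bsub>D\<^esub> \<otimes>\<^sub>a ?y)"
    by (simp flip: D.triangle)
  also have "\<dots> = far R (\<iota>\<^bsub>D\<^esub> X \<otimes>\<^sub>a\<^bsub>D\<^esub> \<lambda>\<^sub>l\<^bsub>D\<^esub> Y) \<cdot> R2 X (\<one>\<^sub>o\<^bsub>D\<^esub> \<otimes>\<^sub>o\<^bsub>D\<^esub> Y) \<cdot> (?x \<otimes>\<^sub>a R2 \<one>\<^sub>o\<^bsub>D\<^esub> Y) \<cdot> \<alpha> (fob R X) RI (fob R Y)"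
    by (simp add: R2_assoc)
  also have "\<dots> = R2 X Y \<cdot> (?x \<otimes>\<^sub>a lact Y) \<cdot> \<alpha> (fob R X) RI (fob R Y)"
    by (simp add: R2_natural[THEN C.reassoc] lact_def)
  finally show ?thesis .
qed

lemma lact_lact:
  assumes [simp]: "Y \<in> Ob D"
  shows "lact Y \<cdot> (lact \<one>\<^sub>o\<^bsub>D\<^esub> \<otimes>\<^sub>a \<iota> (fob R Y)) = lact Y \<cdot> (\<iota> RI \<otimes>\<^sub>a lact Y) \<cdot> \<alpha> RI RI (fob R Y)"
proof -
  have "lact Y \<cdot> (lact \<one>\<^sub>o\<^bsub>D\<^esub> \<otimes>\<^sub>a \<iota> (fob R Y)) = far R (\<lambda>\<^sub>l\<^bsub>D\<^esub> Y) \<cdot> R2 \<one>\<^sub>o\<^bsub>D\<^esub> Y \<cdot> (lact \<one>\<^sub>o\<^bsub>D\<^esub> \<otimes>\<^sub>a \<iota> (fob R Y))"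
    by (simp add: lact_def[of Y])
  also have "\<dots> = (lact Y \<cdot> (\<iota> RI \<otimes>\<^sub>a far R (\<lambda>\<^sub>l\<^bsub>D\<^esub> Y))) \<cdot> (\<iota> RI \<otimes>\<^sub>a R2 \<one>\<^sub>o\<^bsub>D\<^esub> Y) \<cdot> \<alpha> RI RI (fob R Y)"
    by (simp add: R2_lact lact_natural[THEN C.reassoc] del: C.merge)
  finally show ?thesis by (simp add: lact_def[of Y])
qed

lemma ract_ract:
  assumes [simp]: "X \<in> Ob D"
  shows "ract X \<cdot> (ract X \<otimes>\<^sub>a \<iota> RI) = ract X \<cdot> (\<iota> (fob R X) \<otimes>\<^sub>a lact \<one>\<^sub>o\<^bsub>D\<^esub>) \<cdot> \<alpha> (fob R X) RI RI"
proof -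
  have "ract X \<cdot> (ract X \<otimes>\<^sub>a \<iota> RI) = far R (\<rho>\<^bsub>D\<^esub> X) \<cdot> (R2 X \<one>\<^sub>o\<^bsub>D\<^esub> \<cdot> (ract X \<otimes>\<^sub>a \<iota> RI))"
    by (simp add: ract_def[of X])
  also have "\<dots> = ract X \<cdot> (\<iota> (fob R X) \<otimes>\<^sub>a lact \<one>\<^sub>o\<^bsub>D\<^esub>) \<cdot> \<alpha> (fob R X) RI RI"
    by (simp add: R2_balanced) (simp add: ract_def)
  finally show ?thesis .
qed

lemma ract_lact:
  assumes [simp]: "X \<in> Ob D"
  shows "ract X \<cdot> (lact X \<otimes>\<^sub>a \<iota> RI) = lact X \<cdot> (\<iota> RI \<otimes>\<^sub>a ract X) \<cdot> \<alpha> RI (fob R X) RI"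
proof -
  have "ract X \<cdot> (lact X \<otimes>\<^sub>a \<iota> RI) = far R (\<rho>\<^bsub>D\<^esub> X) \<cdot> (R2 X \<one>\<^sub>o\<^bsub>D\<^esub> \<cdot> (lact X \<otimes>\<^sub>a \<iota> RI))"
    by (simp add: ract_def[of X])
  also have "\<dots> = (lact X \<cdot> (\<iota> RI \<otimes>\<^sub>a far R (\<rho>\<^bsub>D\<^esub> X))) \<cdot> (\<iota> RI \<otimes>\<^sub>a R2 X \<one>\<^sub>o\<^bsub>D\<^esub>) \<cdot> \<alpha> RI (fob R X) RI"
    by (simp add: R2_lact lact_natural[THEN C.reassoc] del: C.merge)
  finally show ?thesis by (simp add: ract_def[of X])
qed

lemma lact_one: "Y \<in> Ob D \<Longrightarrow> lact Y \<cdot> (R0 \<otimes>\<^sub>a \<iota> (fob R Y)) = \<lambda>\<^sub>l (fob R Y)"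
  and ract_one: "Y \<in> Ob D \<Longrightarrow> ract Y \<cdot> (\<iota> (fob R Y) \<otimes>\<^sub>a R0) = \<rho> (fob R Y)"
  by (simp_all add: lact_def ract_def R2_lunit R2_runit)

text \<open>The two arrows \<open>R \<one> \<otimes> X \<rightarrow> R F X\<close> and \<open>X \<otimes> R \<one> \<rightarrow> R F X\<close> that are compared by the
  half-braiding.\<close>

abbreviation "L \<equiv> hb_left C D F R \<eta> \<epsilon>"
abbreviation "Q \<equiv> hb_right C D F R \<eta> \<epsilon>"

lemma L_eq: "X \<in> Ob C \<Longrightarrow> L X = lact (fob F X) \<cdot> (\<iota> RI \<otimes>\<^sub>a \<eta> X)"
  and Q_eq: "X \<in> Ob C \<Longrightarrow> Q X = ract (fob F X) \<cdot> (\<eta> X \<otimes>\<^sub>a \<iota> RI)"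
  by (simp_all add: hb_left_def hb_right_def lact_def ract_def)

text \<open>\<open>Q\<close> is the projection formula at the unit object, and \<open>L\<close> is its mirror image.\<close>

lemma Q_eq_projection: "X \<in> Ob C \<Longrightarrow> Q X = far R (\<rho>\<^bsub>D\<^esub> (fob F X)) \<cdot> projection X \<one>\<^sub>o\<^bsub>D\<^esub>"
  by (simp add: hb_right_def projection_def)

lemma hb_typ [simp]:
  assumes "X \<in> Ob C"
  shows "L X \<in> Ar C" "src C (L X) = RI \<otimes>\<^sub>o X" "tgt C (L X) = fob R (fob F X)"
    "Q X \<in> Ar C" "src C (Q X) = X \<otimes>\<^sub>o RI" "tgt C (Q X) = fob R (fob F X)"
  using assms by (simp_all add: L_eq Q_eq)

lemma Q_rev: "hb_left (rev_mon C) (rev_mon D) (rev_functor F) R \<eta> \<epsilon> = Q"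
  and L_rev: "hb_right (rev_mon C) (rev_mon D) (rev_functor F) R \<eta> \<epsilon> = L"
  by (simp_all add: fun_eq_iff hb_left_def hb_right_def)

lemma Q_iso: "is_dual C X V ev coev \<Longrightarrow> iso_ar C (Q X)"
  using projection_iso[of X V ev coev "\<one>\<^sub>o\<^bsub>D\<^esub>"] C.is_dualD(1)[of X V ev coev]
  by (simp add: Q_eq_projection)

lemma L_iso: "is_dual C V X ev coev \<Longrightarrow> iso_ar C (L X)"
  using monoidal_adjunction.Q_iso[OF rev_monoidal_adjunction, of X V ev coev]
  by (simp add: C.is_dual_rev L_rev)

lemma L_natural:
  assumes [simp]: "f \<in> Ar C" and X: "X = tgt C f"
  shows "L X \<cdot> (\<iota> RI \<otimes>\<^sub>a f) = far R (far F f) \<cdot> L (src C f)"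
proof -
  have "L X \<cdot> (\<iota> RI \<otimes>\<^sub>a f) = lact (fob F X) \<cdot> (\<iota> RI \<otimes>\<^sub>a (\<eta> X \<cdot> f))" by (simp add: L_eq X)
  also have "\<dots> = (lact (fob F X) \<cdot> (\<iota> RI \<otimes>\<^sub>a far R (far F f))) \<cdot> (\<iota> RI \<otimes>\<^sub>a \<eta> (src C f))"
    by (simp add: unit_natural X)
  also have "\<dots> = far R (far F f) \<cdot> L (src C f)"
    by (simp add: lact_natural[THEN C.reassoc] L_eq X del: C.merge)
  finally show ?thesis .
qed

lemma Q_natural:
  "\<lbrakk>f \<in> Ar C; X = tgt C f\<rbrakk> \<Longrightarrow> Q X \<cdot> (f \<otimes>\<^sub>a \<iota> RI) = far R (far F f) \<cdot> Q (src C f)"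
  using monoidal_adjunction.L_natural[OF rev_monoidal_adjunction, of f X] by (simp add: Q_rev)

text \<open>The two actions on \<open>R Y\<close> are recovered from \<open>L\<close> and \<open>Q\<close>; therefore the half-braiding at \<open>R Y\<close>
  exchanges them.\<close>

lemma counit_L:
  assumes [simp]: "Y \<in> Ob D" shows "far R (\<epsilon> Y) \<cdot> L (fob R Y) = lact Y"
proof -
  have "far R (\<epsilon> Y) \<cdot> L (fob R Y) = lact Y \<cdot> (\<iota> RI \<otimes>\<^sub>a far R (\<epsilon> Y)) \<cdot> (\<iota> RI \<otimes>\<^sub>a \<eta> (fob R Y))"
    by (simp add: lact_natural[THEN C.reassoc] L_eq del: C.merge)
  thus ?thesis by (simp add: adj_simps)
qed

lemma counit_Q: "Y \<in> Ob D \<Longrightarrow> far R (\<epsilon> Y) \<cdot> Q (fob R Y) = ract Y"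
  using monoidal_adjunction.counit_L[OF rev_monoidal_adjunction, of Y] by (simp add: Q_rev ract_rev)

lemma ract_Q:
  assumes [simp]: "X \<in> Ob C"
  shows "ract (fob F X) \<cdot> (Q X \<otimes>\<^sub>a \<iota> RI) = Q X \<cdot> (\<iota> X \<otimes>\<^sub>a lact \<one>\<^sub>o\<^bsub>D\<^esub>) \<cdot> \<alpha> X RI RI"
proof -
  let ?r = "ract (fob F X)"
  have "?r \<cdot> (Q X \<otimes>\<^sub>a \<iota> RI) = (?r \<cdot> (?r \<otimes>\<^sub>a \<iota> RI)) \<cdot> ((\<eta> X \<otimes>\<^sub>a \<iota> RI) \<otimes>\<^sub>a \<iota> RI)"
    by (simp add: Q_eq)
  also have "\<dots> = ?r \<cdot> (\<iota> (fob R (fob F X)) \<otimes>\<^sub>a lact \<one>\<^sub>o\<^bsub>D\<^esub>) \<cdot> \<alpha> (fob R (fob F X)) RI RI \<cdot> ((\<eta> X \<otimes>\<^sub>a \<iota> RI) \<otimes>\<^sub>a \<iota> RI)"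
    by (simp only: ract_ract fob_in assms) simp
  also have "\<dots> = ?r \<cdot> (\<iota> (fob R (fob F X)) \<otimes>\<^sub>a lact \<one>\<^sub>o\<^bsub>D\<^esub>) \<cdot> (\<eta> X \<otimes>\<^sub>a (\<iota> RI \<otimes>\<^sub>a \<iota> RI)) \<cdot> \<alpha> X RI RI"
    by (simp add: C.natural del: C.merge C.tens_ide)
  also have "\<dots> = Q X \<cdot> (\<iota> X \<otimes>\<^sub>a lact \<one>\<^sub>o\<^bsub>D\<^esub>) \<cdot> \<alpha> X RI RI"
    by (simp add: Q_eq)
  finally show ?thesis .
qed

lemma ract_L:
  assumes [simp]: "X \<in> Ob C"
  shows "ract (fob F X) \<cdot> (L X \<otimes>\<^sub>a \<iota> RI) = lact (fob F X) \<cdot> (\<iota> RI \<otimes>\<^sub>a Q X) \<cdot> \<alpha> RI X RI"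
proof -
  let ?r = "ract (fob F X)" and ?l = "lact (fob F X)"
  have "?r \<cdot> (L X \<otimes>\<^sub>a \<iota> RI) = (?r \<cdot> (?l \<otimes>\<^sub>a \<iota> RI)) \<cdot> ((\<iota> RI \<otimes>\<^sub>a \<eta> X) \<otimes>\<^sub>a \<iota> RI)"
    by (simp add: L_eq)
  also have "\<dots> = ?l \<cdot> (\<iota> RI \<otimes>\<^sub>a ?r) \<cdot> \<alpha> RI (fob R (fob F X)) RI \<cdot> ((\<iota> RI \<otimes>\<^sub>a \<eta> X) \<otimes>\<^sub>a \<iota> RI)"
    by (simp only: ract_lact fob_in assms) simp
  also have "\<dots> = ?l \<cdot> (\<iota> RI \<otimes>\<^sub>a ?r) \<cdot> (\<iota> RI \<otimes>\<^sub>a (\<eta> X \<otimes>\<^sub>a \<iota> RI)) \<cdot> \<alpha> RI X RI"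
    by (simp add: C.natural del: C.merge)
  also have "\<dots> = ?l \<cdot> (\<iota> RI \<otimes>\<^sub>a Q X) \<cdot> \<alpha> RI X RI"
    by (simp add: Q_eq)
  finally show ?thesis .
qed

lemma lact_L:
  assumes [simp]: "X \<in> Ob C"
  shows "L X \<cdot> (lact \<one>\<^sub>o\<^bsub>D\<^esub> \<otimes>\<^sub>a \<iota> X) = lact (fob F X) \<cdot> (\<iota> RI \<otimes>\<^sub>a L X) \<cdot> \<alpha> RI RI X"
proof -
  let ?l = "lact (fob F X)"
  have "L X \<cdot> (lact \<one>\<^sub>o\<^bsub>D\<^esub> \<otimes>\<^sub>a \<iota> X) = (?l \<cdot> (lact \<one>\<^sub>o\<^bsub>D\<^esub> \<otimes>\<^sub>a \<iota> (fob R (fob F X)))) \<cdot> (\<iota> (RI \<otimes>\<^sub>o RI) \<otimes>\<^sub>a \<eta> X)"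
    by (simp add: L_eq)
  also have "\<dots> = ?l \<cdot> (\<iota> RI \<otimes>\<^sub>a ?l) \<cdot> \<alpha> RI RI (fob R (fob F X)) \<cdot> (\<iota> (RI \<otimes>\<^sub>o RI) \<otimes>\<^sub>a \<eta> X)"
    by (simp only: lact_lact fob_in assms) simp
  also have "\<dots> = ?l \<cdot> (\<iota> RI \<otimes>\<^sub>a ?l) \<cdot> (\<iota> RI \<otimes>\<^sub>a (\<iota> RI \<otimes>\<^sub>a \<eta> X)) \<cdot> \<alpha> RI RI X"
    by (simp add: C.natural del: C.merge)
  also have "\<dots> = ?l \<cdot> (\<iota> RI \<otimes>\<^sub>a L X) \<cdot> \<alpha> RI RI X"
    by (simp add: L_eq)
  finally show ?thesis .
qed

text \<open>The lax monoidal structure of the endofunctor \<open>R F\<close>; the unit of the adjunction is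
  monoidal for it.\<close>

definition RF2 where "RF2 X Y = far R (fmu F X Y) \<cdot> R2 (fob F X) (fob F Y)"

lemma RF2_typ [simp]:
  assumes "X \<in> Ob C" "Y \<in> Ob C"
  shows "RF2 X Y \<in> Ar C" "src C (RF2 X Y) = fob R (fob F X) \<otimes>\<^sub>o fob R (fob F Y)"
    "tgt C (RF2 X Y) = fob R (fob F (X \<otimes>\<^sub>o Y))"
  using assms by (simp_all add: RF2_def)

lemma RF2_rev: "monoidal_adjunction.RF2 (rev_mon C) (rev_mon D) (rev_functor F) R \<eta> \<epsilon> X Y = RF2 Y X"
  using monoidal_adjunction.RF2_def[OF rev_monoidal_adjunction] by (simp add: RF2_def)

lemma unit_tens:
  assumes [simp]: "X \<in> Ob C" "Y \<in> Ob C"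
  shows "\<eta> (X \<otimes>\<^sub>o Y) = RF2 X Y \<cdot> (\<eta> X \<otimes>\<^sub>a \<eta> Y)"
proof (rule transpose_inject[of "fob F (X \<otimes>\<^sub>o Y)"])
  let ?E = "\<epsilon> (fob F (X \<otimes>\<^sub>o Y))"
  show "?E \<cdot>\<^bsub>D\<^esub> far F (\<eta> (X \<otimes>\<^sub>o Y)) = ?E \<cdot>\<^bsub>D\<^esub> far F (RF2 X Y \<cdot> (\<eta> X \<otimes>\<^sub>a \<eta> Y))"
    by (rule D.epiD[of "fmu F X Y"]) (simp_all add: RF2_def mu_natural adj_simps counit_R)
qed simp_all

lemma L_tens:
  assumes [simp]: "X \<in> Ob C" "Y \<in> Ob C"
  shows "L (X \<otimes>\<^sub>o Y) \<cdot> \<alpha> RI X Y = RF2 X Y \<cdot> (L X \<otimes>\<^sub>a \<eta> Y)"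
proof -
  let ?m = "far R (fmu F X Y)" and ?R2 = "R2 (fob F X) (fob F Y)" and ?i = "\<iota> RI"
  have "L (X \<otimes>\<^sub>o Y) \<cdot> \<alpha> RI X Y
      = (lact (fob F (X \<otimes>\<^sub>o Y)) \<cdot> (?i \<otimes>\<^sub>a ?m)) \<cdot> (?i \<otimes>\<^sub>a ?R2) \<cdot> ((?i \<otimes>\<^sub>a (\<eta> X \<otimes>\<^sub>a \<eta> Y)) \<cdot> \<alpha> RI X Y)"
    by (simp add: L_eq unit_tens RF2_def)
  also have "\<dots> = ?m \<cdot> lact (fob F X \<otimes>\<^sub>o\<^bsub>D\<^esub> fob F Y) \<cdot> (?i \<otimes>\<^sub>a ?R2)
      \<cdot> (\<alpha> RI (fob R (fob F X)) (fob R (fob F Y)) \<cdot> ((?i \<otimes>\<^sub>a \<eta> X) \<otimes>\<^sub>a \<eta> Y))"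
    by (simp add: lact_natural[THEN C.reassoc] C.natural del: C.merge)
  also have "\<dots> = ?m \<cdot> (?R2 \<cdot> (lact (fob F X) \<otimes>\<^sub>a \<iota> (fob R (fob F Y)))) \<cdot> ((?i \<otimes>\<^sub>a \<eta> X) \<otimes>\<^sub>a \<eta> Y)"
    by (simp only: R2_lact fob_in assms) simp
  also have "\<dots> = RF2 X Y \<cdot> (L X \<otimes>\<^sub>a \<eta> Y)"
    by (simp add: L_eq RF2_def)
  finally show ?thesis .
qed

lemma Q_tens:
  "\<lbrakk>X \<in> Ob C; Y \<in> Ob C\<rbrakk> \<Longrightarrow> Q (X \<otimes>\<^sub>o Y) \<cdot> inv_ar C (\<alpha> X Y RI) = RF2 X Y \<cdot> (\<eta> X \<otimes>\<^sub>a Q Y)"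
  using monoidal_adjunction.L_tens[OF rev_monoidal_adjunction, of Y X] by (simp add: Q_rev RF2_rev)

text \<open>The balancedness of \<open>R2\<close> at free objects, where the right action becomes \<open>Q\<close>.\<close>

lemma RF2_balanced:
  assumes [simp]: "X \<in> Ob C" "Y \<in> Ob D" "f \<in> Ar C" "src C f = V" "tgt C f = fob R Y"
  shows "R2 (fob F X) Y \<cdot> (\<eta> X \<otimes>\<^sub>a (lact Y \<cdot> (\<iota> RI \<otimes>\<^sub>a f))) \<cdot> \<alpha> X RI V
    = R2 (fob F X) Y \<cdot> (Q X \<otimes>\<^sub>a f)"
proof -
  have [simp]: "V \<in> Ob C" using C.src_Ob[of f] by simp
  let ?x = "\<iota> (fob R (fob F X))"
  have "R2 (fob F X) Y \<cdot> (\<eta> X \<otimes>\<^sub>a (lact Y \<cdot> (\<iota> RI \<otimes>\<^sub>a f))) \<cdot> \<alpha> X RI V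
    = R2 (fob F X) Y \<cdot> (?x \<otimes>\<^sub>a lact Y) \<cdot> ((\<eta> X \<otimes>\<^sub>a (\<iota> RI \<otimes>\<^sub>a f)) \<cdot> \<alpha> X RI V)"
    by simp
  also have "\<dots> = R2 (fob F X) Y \<cdot> (?x \<otimes>\<^sub>a lact Y) \<cdot> (\<alpha> (fob R (fob F X)) RI (fob R Y) \<cdot> ((\<eta> X \<otimes>\<^sub>a \<iota> RI) \<otimes>\<^sub>a f))"
    by (simp add: C.natural del: C.merge)
  also have "\<dots> = (R2 (fob F X) Y \<cdot> (ract (fob F X) \<otimes>\<^sub>a \<iota> (fob R Y))) \<cdot> ((\<eta> X \<otimes>\<^sub>a \<iota> RI) \<otimes>\<^sub>a f)"
    by (simp only: R2_balanced fob_in assms) simp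
  also have "\<dots> = R2 (fob F X) Y \<cdot> (Q X \<otimes>\<^sub>a f)" by (simp add: Q_eq)
  finally show ?thesis .
qed

end

text \<open>Both kinds of duals are used: left duals make \<open>Q\<close> invertible, and right duals make \<open>L\<close>
  invertible, hence the half-braiding.\<close>

locale rigid_adjunction = monoidal_adjunction C D F R \<eta> \<epsilon>
  for C :: "('o, 'm, 'k, 'x) mon_category_scheme" (structure) and D :: "('p, 'n, 'k, 'y) mon_category_scheme"
    and F :: "('o, 'm, 'p, 'n, 'z) mon_functor_data_scheme"
    and R :: "('p, 'n, 'o, 'm, 'w) functor_data_scheme"
    and \<eta> :: "'o \<Rightarrow> 'm" and \<epsilon> :: "'p \<Rightarrow> 'n" +
  assumes rigid_C: "rigid C"
begin

lemma dual_left: "X \<in> Ob C \<Longrightarrow> \<exists>V ev coev. is_dual C X V ev coev"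
  and dual_right: "X \<in> Ob C \<Longrightarrow> \<exists>V ev coev. is_dual C V X ev coev"
  using rigid_C unfolding rigid_def by blast+

lemma iso_L [simp]: "X \<in> Ob C \<Longrightarrow> iso_ar C (L X)"
  and iso_Q [simp]: "X \<in> Ob C \<Longrightarrow> iso_ar C (Q X)"
  using dual_left dual_right L_iso Q_iso by blast+

abbreviation "A \<equiv> adj_algebra C D F R \<eta> \<epsilon>"
abbreviation "\<sigma> \<equiv> ahb A"

lemma adj_braiding_iff:
  assumes [simp]: "X \<in> Ob C"
  shows "is_adj_braiding C D F R \<eta> \<epsilon> X s \<longleftrightarrow> s = inv_ar C (Q X) \<cdot> L X"
proof
  assume "is_adj_braiding C D F R \<eta> \<epsilon> X s"
  hence [simp]: "s \<in> Ar C" "src C s = RI \<otimes>\<^sub>o X" "tgt C s = X \<otimes>\<^sub>o RI" and *: "Q X \<cdot> s = L X"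
    by (auto simp: is_adj_braiding_def C.in_Hom)
  show "s = inv_ar C (Q X) \<cdot> L X" by (simp flip: *)
qed (simp add: is_adj_braiding_def C.in_Hom)

lemma braiding_eq: "X \<in> Ob C \<Longrightarrow> \<sigma> X = inv_ar C (Q X) \<cdot> L X"
  unfolding adj_algebra_def by simp (rule the_equality, simp_all add: adj_braiding_iff)

lemma alg_simps [simp]: "aob A = RI" "amul A = lact \<one>\<^sub>o\<^bsub>D\<^esub>" "aone A = R0"
  by (simp_all add: adj_algebra_def lact_def)

lemma braiding_typ [simp]:
  assumes "X \<in> Ob C"
  shows "\<sigma> X \<in> Ar C" "src C (\<sigma> X) = RI \<otimes>\<^sub>o X" "tgt C (\<sigma> X) = X \<otimes>\<^sub>o RI" "iso_ar C (\<sigma> X)"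
  using assms by (simp_all add: braiding_eq)

lemma Q_braiding: "X \<in> Ob C \<Longrightarrow> Q X \<cdot> \<sigma> X = L X"
  by (simp add: braiding_eq)

lemma ract_braiding: "Y \<in> Ob D \<Longrightarrow> ract Y \<cdot> \<sigma> (fob R Y) = lact Y"
  by (simp add: counit_Q[symmetric] Q_braiding counit_L)

text \<open>The axioms of a half-braiding and its compatibility with the algebra structure are verified
  after composition with the invertible \<open>Q\<close>, which turns the half-braiding into \<open>L\<close>.\<close>

lemma braiding_natural:
  assumes [simp]: "f \<in> Ar C" and [simp]: "X = tgt C f"
  shows "\<sigma> X \<cdot> (\<iota> RI \<otimes>\<^sub>a f) = (f \<otimes>\<^sub>a \<iota> RI) \<cdot> \<sigma> (src C f)"
proof (rule C.monoD[of "Q (tgt C f)"])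
  show "Q (tgt C f) \<cdot> \<sigma> X \<cdot> (\<iota> RI \<otimes>\<^sub>a f) = Q (tgt C f) \<cdot> (f \<otimes>\<^sub>a \<iota> RI) \<cdot> \<sigma> (src C f)"
    by (simp add: Q_braiding[THEN C.reassoc] Q_braiding Q_natural[THEN C.reassoc] L_natural)
qed simp_all

lemma braiding_tens:
  assumes [simp]: "X \<in> Ob C" "Y \<in> Ob C"
  shows "\<alpha> X Y RI \<cdot> \<sigma> (X \<otimes>\<^sub>o Y) \<cdot> \<alpha> RI X Y
    = (\<iota> X \<otimes>\<^sub>a \<sigma> Y) \<cdot> \<alpha> X RI Y \<cdot> (\<sigma> X \<otimes>\<^sub>a \<iota> Y)" (is "?l = ?r")
proof (rule C.monoD[of "Q (X \<otimes>\<^sub>o Y) \<cdot> inv_ar C (\<alpha> X Y RI)"])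
  have "(Q (X \<otimes>\<^sub>o Y) \<cdot> inv_ar C (\<alpha> X Y RI)) \<cdot> ?r
      = RF2 X Y \<cdot> (\<eta> X \<otimes>\<^sub>a Q Y) \<cdot> ?r"
    by (simp only: Q_tens assms) simp
  also have "\<dots> = RF2 X Y \<cdot> (\<eta> X \<otimes>\<^sub>a L Y) \<cdot> \<alpha> X RI Y \<cdot> (\<sigma> X \<otimes>\<^sub>a \<iota> Y)"
    by (simp add: Q_braiding)
  also have "\<dots> = far R (fmu F X Y) \<cdot> (R2 (fob F X) (fob F Y) \<cdot> (\<eta> X \<otimes>\<^sub>a L Y) \<cdot> \<alpha> X RI Y) \<cdot> (\<sigma> X \<otimes>\<^sub>a \<iota> Y)"
    by (simp add: RF2_def)
  also have "\<dots> = far R (fmu F X Y) \<cdot> R2 (fob F X) (fob F Y) \<cdot> ((Q X \<cdot> \<sigma> X) \<otimes>\<^sub>a \<eta> Y)"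
    by (simp add: L_eq[of Y] RF2_balanced)
  also have "\<dots> = RF2 X Y \<cdot> (L X \<otimes>\<^sub>a \<eta> Y)" by (simp add: Q_braiding RF2_def)
  also have "\<dots> = (Q (X \<otimes>\<^sub>o Y) \<cdot> inv_ar C (\<alpha> X Y RI)) \<cdot> ?l"
    by (simp add: L_tens[symmetric] Q_braiding[THEN C.reassoc])
  finally show "(Q (X \<otimes>\<^sub>o Y) \<cdot> inv_ar C (\<alpha> X Y RI)) \<cdot> ?l = (Q (X \<otimes>\<^sub>o Y) \<cdot> inv_ar C (\<alpha> X Y RI)) \<cdot> ?r" ..
qed simp_all

lemma braiding_mul:
  assumes [simp]: "X \<in> Ob C"
  shows "\<sigma> X \<cdot> (lact \<one>\<^sub>o\<^bsub>D\<^esub> \<otimes>\<^sub>a \<iota> X) = (\<iota> X \<otimes>\<^sub>a lact \<one>\<^sub>o\<^bsub>D\<^esub>) \<cdot> \<alpha> X RI RI \<cdot> (\<sigma> X \<otimes>\<^sub>a \<iota> RI)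
            \<cdot> inv_ar C (\<alpha> RI X RI) \<cdot> (\<iota> RI \<otimes>\<^sub>a \<sigma> X) \<cdot> \<alpha> RI RI X" (is "?l = ?r")
proof (rule C.monoD[of "Q X"])
  have "Q X \<cdot> ?r = (ract (fob F X) \<cdot> (Q X \<otimes>\<^sub>a \<iota> RI)) \<cdot> (\<sigma> X \<otimes>\<^sub>a \<iota> RI)
            \<cdot> inv_ar C (\<alpha> RI X RI) \<cdot> (\<iota> RI \<otimes>\<^sub>a \<sigma> X) \<cdot> \<alpha> RI RI X"
    by (simp only: ract_Q assms) simp
  also have "\<dots> = (ract (fob F X) \<cdot> (L X \<otimes>\<^sub>a \<iota> RI))
            \<cdot> inv_ar C (\<alpha> RI X RI) \<cdot> (\<iota> RI \<otimes>\<^sub>a \<sigma> X) \<cdot> \<alpha> RI RI X"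
    by (simp add: Q_braiding)
  also have "\<dots> = lact (fob F X) \<cdot> (\<iota> RI \<otimes>\<^sub>a (Q X \<cdot> \<sigma> X)) \<cdot> \<alpha> RI RI X"
    by (simp only: ract_L assms) simp
  also have "\<dots> = Q X \<cdot> ?l" by (simp add: Q_braiding lact_L[symmetric] Q_braiding[THEN C.reassoc])
  finally show "Q X \<cdot> ?l = Q X \<cdot> ?r" ..
qed simp_all

lemma braiding_one:
  assumes [simp]: "X \<in> Ob C"
  shows "\<sigma> X \<cdot> (R0 \<otimes>\<^sub>a \<iota> X) = (\<iota> X \<otimes>\<^sub>a R0) \<cdot> inv_ar C (\<rho> X) \<cdot> \<lambda>\<^sub>l X" (is "?l = ?r")
proof (rule C.monoD[of "Q X"])
  let ?X = "fob R (fob F X)"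
  have "Q X \<cdot> ?l = (lact (fob F X) \<cdot> (R0 \<otimes>\<^sub>a \<iota> ?X)) \<cdot> (\<iota> \<one>\<^sub>o \<otimes>\<^sub>a \<eta> X)"
    by (simp add: Q_braiding[THEN C.reassoc] L_eq)
  also have "\<dots> = \<eta> X \<cdot> \<lambda>\<^sub>l X"
    by (simp only: lact_one fob_in assms) (simp add: C.natural)
  also have "\<dots> = (\<rho> ?X \<cdot> (\<eta> X \<otimes>\<^sub>a \<iota> \<one>\<^sub>o)) \<cdot> inv_ar C (\<rho> X) \<cdot> \<lambda>\<^sub>l X"
    by (simp add: C.natural del: C.cmp_assoc_right) simp
  also have "\<dots> = (ract (fob F X) \<cdot> (\<iota> ?X \<otimes>\<^sub>a R0)) \<cdot> (\<eta> X \<otimes>\<^sub>a \<iota> \<one>\<^sub>o) \<cdot> inv_ar C (\<rho> X) \<cdot> \<lambda>\<^sub>l X"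
    by (simp only: ract_one fob_in assms) simp
  also have "\<dots> = Q X \<cdot> ?r" by (simp add: Q_eq)
  finally show "Q X \<cdot> ?l = Q X \<cdot> ?r" .
qed simp_all

theorem adj_algebra_commutative_central: "commutative_central_algebra C A"
proof unfold_locales
  fix X Y f
  show "aob A \<in> Ob C" "amul A \<in> Hom C (aob A \<otimes>\<^sub>o aob A) (aob A)" "aone A \<in> Hom C \<one>\<^sub>o (aob A)"
    by (simp_all add: C.in_Hom)
  show "amul A \<cdot> (amul A \<otimes>\<^sub>a \<iota> (aob A)) = amul A \<cdot> (\<iota> (aob A) \<otimes>\<^sub>a amul A) \<cdot> \<alpha> (aob A) (aob A) (aob A)"
    using lact_lact[of "\<one>\<^sub>o\<^bsub>D\<^esub>"] by simp
  show "amul A \<cdot> (aone A \<otimes>\<^sub>a \<iota> (aob A)) = \<lambda>\<^sub>l (aob A)" using lact_one[of "\<one>\<^sub>o\<^bsub>D\<^esub>"] by simp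
  show "amul A \<cdot> (\<iota> (aob A) \<otimes>\<^sub>a aone A) = \<rho> (aob A)"
    using ract_one[of "\<one>\<^sub>o\<^bsub>D\<^esub>"] by (simp add: lact_unit_eq_ract_unit)
  show "amul A \<cdot> \<sigma> (aob A) = amul A"
    using ract_braiding[of "\<one>\<^sub>o\<^bsub>D\<^esub>"] by (simp add: lact_unit_eq_ract_unit)
  show "f \<in> Hom C X Y \<Longrightarrow> \<sigma> Y \<cdot> (\<iota> (aob A) \<otimes>\<^sub>a f) = (f \<otimes>\<^sub>a \<iota> (aob A)) \<cdot> \<sigma> X"
    by (auto simp: C.in_Hom braiding_natural)
qed (simp_all add: C.in_Hom braiding_tens braiding_mul braiding_one)

end

section \<open>Linear categories\<close>

context linear_category
begin

lemma Hom_space_simps [simp]: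
  "carrier (Hom_space C X Y) = Hom C X Y" "zero (Hom_space C X Y) = zero_ar C X Y"
  "add (Hom_space C X Y) = add_ar C" "smult (Hom_space C X Y) = smul_ar C"
  by (simp_all add: Hom_space_def)

lemma zero_typ [simp]:
  assumes "X \<in> Ob C" "Y \<in> Ob C"
  shows "zero_ar C X Y \<in> Ar C" "src C (zero_ar C X Y) = X" "tgt C (zero_ar C X Y) = Y"
proof -
  interpret H: module k "Hom_space C X Y" using assms by (rule Hom_module)
  show "zero_ar C X Y \<in> Ar C" "src C (zero_ar C X Y) = X" "tgt C (zero_ar C X Y) = Y"
    using H.zero_closed by (auto simp: in_Hom)
qed

lemma add_typ [simp]:
  assumes "src C f = src C g" "tgt C f = tgt C g" "f \<in> Ar C" "g \<in> Ar C"
  shows "add_ar C f g \<in> Ar C" "src C (add_ar C f g) = src C g" "tgt C (add_ar C f g) = tgt C g"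
proof -
  interpret H: module k "Hom_space C (src C f) (tgt C f)" using assms by (intro Hom_module) simp_all
  show "add_ar C f g \<in> Ar C" "src C (add_ar C f g) = src C g" "tgt C (add_ar C f g) = tgt C g"
    using H.add.m_closed[of f g] assms by (auto simp: in_Hom)
qed

lemma smul_typ [simp]:
  assumes "f \<in> Ar C" "c \<in> carrier k"
  shows "smul_ar C c f \<in> Ar C" "src C (smul_ar C c f) = src C f" "tgt C (smul_ar C c f) = tgt C f"
proof -
  interpret H: module k "Hom_space C (src C f) (tgt C f)" using assms by (intro Hom_module) simp_all
  show "smul_ar C c f \<in> Ar C" "src C (smul_ar C c f) = src C f" "tgt C (smul_ar C c f) = tgt C f"
    using H.smult_closed[of c f] assms by (auto simp: in_Hom)
qed

lemma idempotent_zero: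
  assumes "add_ar C f f = f" "f \<in> Ar C"
  shows "f = zero_ar C (src C f) (tgt C f)"
proof -
  interpret H: module k "Hom_space C (src C f) (tgt C f)" using assms by (intro Hom_module) simp_all
  show ?thesis using H.add.l_cancel_one[of f f] assms by (auto simp: in_Hom)
qed

lemma add_zero [simp]:
  assumes "X \<in> Ob C" "Y \<in> Ob C"
  shows "add_ar C (zero_ar C X Y) (zero_ar C X Y) = zero_ar C X Y"
proof -
  interpret H: module k "Hom_space C X Y" using assms by (intro Hom_module) simp_all
  show ?thesis using H.l_zero[OF H.zero_closed] by simp
qed

lemma add_cmp: "\<lbrakk>src C g = tgt C f; src C g' = src C g; tgt C g' = tgt C g; f \<in> Ar C; g \<in> Ar C; g' \<in> Ar C\<rbrakk>
    \<Longrightarrow> add_ar C g g' \<cdot> f = add_ar C (g \<cdot> f) (g' \<cdot> f)"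
  and cmp_add: "\<lbrakk>src C g = tgt C f; src C f' = src C f; tgt C f' = tgt C f; f \<in> Ar C; f' \<in> Ar C; g \<in> Ar C\<rbrakk>
    \<Longrightarrow> g \<cdot> add_ar C f f' = add_ar C (g \<cdot> f) (g \<cdot> f')"
  and smul_cmp: "\<lbrakk>src C g = tgt C f; f \<in> Ar C; g \<in> Ar C; c \<in> carrier k\<rbrakk>
    \<Longrightarrow> smul_ar C c g \<cdot> f = smul_ar C c (g \<cdot> f)"
  and cmp_smul: "\<lbrakk>src C g = tgt C f; f \<in> Ar C; g \<in> Ar C; c \<in> carrier k\<rbrakk>
    \<Longrightarrow> g \<cdot> smul_ar C c f = smul_ar C c (g \<cdot> f)"
  using cmp_add_left[of f "src C f" "src C g" g "tgt C g" g'] cmp_add_right[of f "src C f" "src C g" f' g "tgt C g"]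
    cmp_smul_left[of c f "src C f" "tgt C f" g "tgt C g"] cmp_smul_right[of c f "src C f" "tgt C f" g "tgt C g"]
  by (auto simp: in_Hom)

lemma zero_cmp [simp]: "\<lbrakk>X = tgt C f; Y \<in> Ob C; f \<in> Ar C\<rbrakk> \<Longrightarrow> zero_ar C X Y \<cdot> f = zero_ar C (src C f) Y"
  using idempotent_zero[of "zero_ar C X Y \<cdot> f"] by (simp flip: add_cmp)

lemma cmp_zero [simp]: "\<lbrakk>Y = src C f; X \<in> Ob C; f \<in> Ar C\<rbrakk> \<Longrightarrow> f \<cdot> zero_ar C X Y = zero_ar C X (tgt C f)"
  using idempotent_zero[of "f \<cdot> zero_ar C X Y"] by (simp flip: cmp_add)

definition minus_ar where "minus_ar f g = add_ar C f (smul_ar C (\<ominus>\<^bsub>k\<^esub> \<one>\<^bsub>k\<^esub>) g)"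

lemma neg_one [simp]: "\<ominus>\<^bsub>k\<^esub> \<one>\<^bsub>k\<^esub> \<in> carrier k"
proof -
  interpret field k by (rule field)
  show ?thesis by simp
qed

lemma minus_typ [simp]:
  assumes "src C f = src C g" "tgt C f = tgt C g" "f \<in> Ar C" "g \<in> Ar C"
  shows "minus_ar f g \<in> Ar C" "src C (minus_ar f g) = src C g" "tgt C (minus_ar f g) = tgt C g"
  using assms by (simp_all add: minus_ar_def)

lemma minus_zero_iff:
  assumes "src C f = src C g" "tgt C f = tgt C g" "f \<in> Ar C" "g \<in> Ar C"
  shows "minus_ar f g = zero_ar C (src C g) (tgt C g) \<longleftrightarrow> f = g"
proof -
  interpret H: module k "Hom_space C (src C g) (tgt C g)" using assms by (intro Hom_module) simp_all
  have g: "g \<in> carrier (Hom_space C (src C g) (tgt C g))" and f: "f \<in> carrier (Hom_space C (src C g) (tgt C g))"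
    using assms by (simp_all add: in_Hom)
  have "g \<oplus>\<^bsub>Hom_space C (src C g) (tgt C g)\<^esub> smul_ar C (\<ominus>\<^bsub>k\<^esub> \<one>\<^bsub>k\<^esub>) g
     = (\<one>\<^bsub>k\<^esub> \<oplus>\<^bsub>k\<^esub> \<ominus>\<^bsub>k\<^esub> \<one>\<^bsub>k\<^esub>) \<odot>\<^bsub>Hom_space C (src C g) (tgt C g)\<^esub> g"
    using H.smult_l_distr[OF H.R.one_closed neg_one g] H.smult_one[OF g] by simp
  also have "\<dots> = zero_ar C (src C g) (tgt C g)"
    using H.smult_l_null[OF g] by (simp add: H.R.r_neg)
  finally have *: "minus_ar g g = zero_ar C (src C g) (tgt C g)" by (simp add: minus_ar_def)
  show ?thesis
    using * H.add.m_comm H.add.right_cancel[OF _ f g, of "smul_ar C (\<ominus>\<^bsub>k\<^esub> \<one>\<^bsub>k\<^esub>) g"] assms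
    by (auto simp: minus_ar_def in_Hom)
qed

lemma minus_cmp: "\<lbrakk>src C g = tgt C f; src C g' = src C g; tgt C g' = tgt C g; f \<in> Ar C; g \<in> Ar C; g' \<in> Ar C\<rbrakk>
    \<Longrightarrow> minus_ar g g' \<cdot> f = minus_ar (g \<cdot> f) (g' \<cdot> f)"
  and cmp_minus: "\<lbrakk>src C g = tgt C f; src C f' = src C f; tgt C f' = tgt C f; f \<in> Ar C; f' \<in> Ar C; g \<in> Ar C\<rbrakk>
    \<Longrightarrow> g \<cdot> minus_ar f f' = minus_ar (g \<cdot> f) (g \<cdot> f')"
  by (simp_all add: minus_ar_def add_cmp smul_cmp cmp_add cmp_smul)

lemma epi_if_zero:
  assumes f: "f \<in> Ar C"
    and *: "\<And>g. g \<in> Ar C \<Longrightarrow> src C g = tgt C f \<Longrightarrow> g \<cdot> f = zero_ar C (src C f) (tgt C g)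
      \<Longrightarrow> g = zero_ar C (src C g) (tgt C g)"
  shows "epi_ar C f"
  unfolding epi_iff
proof (intro conjI allI impI)
  fix g h assume gh: "g \<in> Ar C" "h \<in> Ar C" "src C g = tgt C f" "src C h = tgt C f" "tgt C g = tgt C h"
    and eq: "g \<cdot> f = h \<cdot> f"
  have "minus_ar g h \<cdot> f = zero_ar C (src C f) (tgt C h)"
    using gh f eq minus_zero_iff[of "h \<cdot> f" "h \<cdot> f"] by (simp add: minus_cmp)
  hence "minus_ar g h = zero_ar C (src C h) (tgt C h)"
    using *[of "minus_ar g h"] gh f by simp
  thus "g = h" using minus_zero_iff[of g h] gh by simp
qed fact

lemma kernelD:
  assumes "is_kernel C f i"
  shows "f \<in> Ar C" "i \<in> Ar C" "tgt C i = src C f" "f \<cdot> i = zero_ar C (src C i) (tgt C f)"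
  using assms by (auto simp: is_kernel_def)

lemma cokernelD:
  assumes "is_cokernel C f p"
  shows "f \<in> Ar C" "p \<in> Ar C" "src C p = tgt C f" "p \<cdot> f = zero_ar C (src C f) (tgt C p)"
  using assms by (auto simp: is_cokernel_def)

lemma kernel_factor:
  assumes "is_kernel C f i" "h \<in> Ar C" "tgt C h = src C f" "f \<cdot> h = zero_ar C (src C h) (tgt C f)"
  obtains l where "l \<in> Ar C" "src C l = src C h" "tgt C l = src C i" "i \<cdot> l = h"
proof -
  have "h \<in> Hom C (src C h) (src C f)" using assms by (simp add: in_Hom)
  hence "\<exists>!l. l \<in> Hom C (src C h) (src C i) \<and> i \<cdot> l = h"
    using assms unfolding is_kernel_def by blast
  thus ?thesis using that by (auto simp: in_Hom)
qed

lemma cokernel_factor: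
  assumes "is_cokernel C f p" "h \<in> Ar C" "src C h = tgt C f" "h \<cdot> f = zero_ar C (src C f) (tgt C h)"
  obtains l where "l \<in> Ar C" "src C l = tgt C p" "tgt C l = tgt C h" "l \<cdot> p = h"
proof -
  have "h \<in> Hom C (tgt C f) (tgt C h)" using assms by (simp add: in_Hom)
  hence "\<exists>!l. l \<in> Hom C (tgt C p) (tgt C h) \<and> l \<cdot> p = h"
    using assms unfolding is_cokernel_def by blast
  thus ?thesis using that by (auto simp: in_Hom)
qed

lemma kernel_mono:
  assumes "is_kernel C f i" shows "mono_ar C i"
  unfolding mono_iff
proof (intro conjI allI impI)
  note [simp] = kernelD[OF assms]
  show "i \<in> Ar C" by simp
  fix g h assume [simp]: "g \<in> Ar C" "h \<in> Ar C" "tgt C g = src C i" "tgt C h = src C i" "src C g = src C h"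
    and eq: "i \<cdot> g = i \<cdot> h"
  have "f \<cdot> (i \<cdot> h) = zero_ar C (src C h) (tgt C f)"
    by (simp add: kernelD(4)[OF assms, THEN reassoc])
  moreover have "i \<cdot> h \<in> Hom C (src C h) (src C f)" by (simp add: in_Hom)
  ultimately have "\<exists>!l. l \<in> Hom C (src C h) (src C i) \<and> i \<cdot> l = i \<cdot> h"
    using assms unfolding is_kernel_def by blast
  moreover have "g \<in> Hom C (src C h) (src C i) \<and> i \<cdot> g = i \<cdot> h" "h \<in> Hom C (src C h) (src C i) \<and> i \<cdot> h = i \<cdot> h"
    using eq by (simp_all add: in_Hom)
  ultimately show "g = h" by blast
qed

lemma kernelI:
  assumes "f \<in> Ar C" "mono_ar C i" "tgt C i = src C f" "f \<cdot> i = zero_ar C (src C i) (tgt C f)"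
    and "\<And>h. \<lbrakk>h \<in> Ar C; tgt C h = src C f; f \<cdot> h = zero_ar C (src C h) (tgt C f)\<rbrakk>
      \<Longrightarrow> \<exists>l. l \<in> Ar C \<and> src C l = src C h \<and> tgt C l = src C i \<and> i \<cdot> l = h"
  shows "is_kernel C f i"
  unfolding is_kernel_def
proof (intro conjI allI ballI impI)
  fix W h assume h: "h \<in> Hom C W (src C f)" "f \<cdot> h = zero_ar C W (tgt C f)"
  then obtain l where l: "l \<in> Ar C" "src C l = W" "tgt C l = src C i" "i \<cdot> l = h"
    using assms(5)[of h] by (auto simp: in_Hom)
  show "\<exists>!l. l \<in> Hom C W (src C i) \<and> i \<cdot> l = h"
  proof (rule ex1I[of _ l])
    fix l' assume "l' \<in> Hom C W (src C i) \<and> i \<cdot> l' = h"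
    thus "l' = l" by (intro monoD[OF assms(2), of l' l]) (use l in \<open>auto simp: in_Hom\<close>)
  qed (use l in \<open>auto simp: in_Hom\<close>)
qed (use assms in \<open>auto simp: mono_Ar\<close>)

lemma kernel_iso:
  assumes ker: "is_kernel C g' i'"
    and iso: "iso_ar C a" "iso_ar C b" "iso_ar C c"
    and [simp]: "g \<in> Ar C" "i \<in> Ar C" "src C a = src C g" "tgt C a = src C g'" "src C b = tgt C g"
      "tgt C b = tgt C g'" "src C c = src C i" "tgt C c = src C i'" "tgt C i = src C g"
    and eq: "b \<cdot> g = g' \<cdot> a" "i' \<cdot> c = a \<cdot> i"
  shows "is_kernel C g i"
proof (rule kernelI)
  note [simp] = kernelD[OF ker] iso iso_Ar[OF iso(1)] iso_Ar[OF iso(2)] iso_Ar[OF iso(3)]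
  have i: "i = inv_ar C a \<cdot> i' \<cdot> c" by (simp add: eq)
  have "mono_ar C (inv_ar C a \<cdot> i' \<cdot> c)"
    using kernel_mono[OF ker] by simp
  thus "mono_ar C i" by (simp only: i[symmetric])
  have "b \<cdot> (g \<cdot> i) = g' \<cdot> i' \<cdot> c" by (simp add: eq eq(1)[THEN reassoc])
  also have "\<dots> = b \<cdot> zero_ar C (src C i) (tgt C g)" by (simp add: kernelD(4)[OF ker, THEN reassoc])
  finally have "b \<cdot> (g \<cdot> i) = b \<cdot> zero_ar C (src C i) (tgt C g)" .
  thus "g \<cdot> i = zero_ar C (src C i) (tgt C g)" by (rule monoD[of b, rotated]) simp_all
  fix h assume [simp]: "h \<in> Ar C" "tgt C h = src C g" and h: "g \<cdot> h = zero_ar C (src C h) (tgt C g)"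
  have "g' \<cdot> (a \<cdot> h) = b \<cdot> (g \<cdot> h)" by (simp add: eq(1)[THEN reassoc])
  hence "g' \<cdot> (a \<cdot> h) = zero_ar C (src C (a \<cdot> h)) (tgt C g')" by (simp add: h)
  then obtain l where [simp]: "l \<in> Ar C" "src C l = src C h" "tgt C l = src C i'" and l: "i' \<cdot> l = a \<cdot> h"
    using kernel_factor[OF ker, of "a \<cdot> h"] by auto
  have "i \<cdot> (inv_ar C c \<cdot> l) = (inv_ar C a \<cdot> i' \<cdot> c) \<cdot> (inv_ar C c \<cdot> l)" by (simp only: i[symmetric])
  also have "\<dots> = h" by (simp add: l)
  finally have "i \<cdot> (inv_ar C c \<cdot> l) = h" .
  thus "\<exists>l. l \<in> Ar C \<and> src C l = src C h \<and> tgt C l = src C i \<and> i \<cdot> l = h"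
    by (intro exI[of _ "inv_ar C c \<cdot> l"]) simp
qed (use assms in simp_all)

lemma zero_ob_iff: "zero_ob C Z \<longleftrightarrow> Z \<in> Ob C \<and> \<iota> Z = zero_ar C Z Z"
proof
  assume Z: "zero_ob C Z"
  hence Z': "Z \<in> Ob C" by (simp add: zero_ob_def)
  hence "\<exists>!f. f \<in> Hom C Z Z" using Z by (auto simp: zero_ob_def)
  with Z' show "Z \<in> Ob C \<and> \<iota> Z = zero_ar C Z Z"
    by (metis in_Hom ide_Ar src_ide tgt_ide zero_typ)
next
  assume Z: "Z \<in> Ob C \<and> \<iota> Z = zero_ar C Z Z"
  show "zero_ob C Z" unfolding zero_ob_def
  proof (intro conjI ballI)
    fix X assume X: "X \<in> Ob C"
    show "\<exists>!f. f \<in> Hom C X Z"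
    proof (rule ex1I[of _ "zero_ar C X Z"])
      fix f assume "f \<in> Hom C X Z"
      hence f: "f \<in> Ar C" "src C f = X" "tgt C f = Z" by (auto simp: in_Hom)
      hence "f = \<iota> Z \<cdot> f" by simp
      also have "\<iota> Z = zero_ar C Z Z" using Z by simp
      finally show "f = zero_ar C X Z" using f Z by simp
    qed (use X Z in \<open>auto simp: in_Hom\<close>)
    show "\<exists>!f. f \<in> Hom C Z X"
    proof (rule ex1I[of _ "zero_ar C Z X"])
      fix f assume "f \<in> Hom C Z X"
      hence f: "f \<in> Ar C" "tgt C f = X" "src C f = Z" by (auto simp: in_Hom)
      hence "f = f \<cdot> \<iota> Z" by simp
      also have "\<iota> Z = zero_ar C Z Z" using Z by simp
      finally show "f = zero_ar C Z X" using f Z by simp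
    qed (use X Z in \<open>auto simp: in_Hom\<close>)
  qed (use Z in simp)
qed

lemma zero_ob_iso:
  assumes Z: "zero_ob C Z" and [simp]: "iso_ar C a" "src C a = X" "tgt C a = Z"
  shows "zero_ob C X"
proof -
  have [simp]: "a \<in> Ar C" by (rule iso_Ar) simp
  have [simp]: "X \<in> Ob C" "Z \<in> Ob C" using src_Ob[of a] tgt_Ob[of a] by simp_all
  have "\<iota> X = inv_ar C a \<cdot> \<iota> Z \<cdot> a" by simp
  also have "\<dots> = zero_ar C X X" using Z by (simp add: zero_ob_iff del: ide_tgt_cmp)
  finally show ?thesis by (simp add: zero_ob_iff)
qed

end

text \<open>The opposite category exchanges kernels with cokernels, so that only statements about kernels
  need a proof.\<close>

definition op_cat :: "('o, 'm, 'k, 'z) lin_category_scheme \<Rightarrow> ('o, 'm, 'k, 'z) lin_category_scheme"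
  where "op_cat C = C\<lparr>src := tgt C, tgt := src C, cmp := \<lambda>g f. cmp C f g,
    zero_ar := \<lambda>X Y. zero_ar C Y X\<rparr>"

lemma op_cat_simps [simp]:
  "Ob (op_cat C) = Ob C" "Ar (op_cat C) = Ar C" "src (op_cat C) = tgt C" "tgt (op_cat C) = src C"
  "ide (op_cat C) = ide C" "cmp (op_cat C) g f = cmp C f g" "zero_ar (op_cat C) X Y = zero_ar C Y X"
  "add_ar (op_cat C) = add_ar C" "smul_ar (op_cat C) = smul_ar C"
  by (simp_all add: op_cat_def)

lemma Hom_op [simp]: "Hom (op_cat C) X Y = Hom C Y X"
  by (auto simp: Hom_def)

lemma Hom_space_op [simp]: "Hom_space (op_cat C) X Y = Hom_space C Y X"
  by (simp add: Hom_space_def)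

lemma kernel_op [simp]: "is_kernel (op_cat C) = is_cokernel C"
  and cokernel_op [simp]: "is_cokernel (op_cat C) = is_kernel C"
  by (simp_all add: is_kernel_def is_cokernel_def fun_eq_iff)

lemma mono_op [simp]: "mono_ar (op_cat C) = epi_ar C" and epi_op [simp]: "epi_ar (op_cat C) = mono_ar C"
  by (simp_all add: mono_ar_def epi_ar_def fun_eq_iff)

lemma inverse_arrows_op [simp]: "inverse_arrows (op_cat C) f g \<longleftrightarrow> inverse_arrows C f g"
  by (auto simp: inverse_arrows_def)

lemma iso_op [simp]: "iso_ar (op_cat C) = iso_ar C" and inv_op [simp]: "inv_ar (op_cat C) = inv_ar C"
  by (simp_all add: iso_ar_def inv_ar_def fun_eq_iff)

context linear_category
begin

lemma op_linear: "linear_category k (op_cat C)"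
  by (intro linear_category.intro linear_category_axioms.intro category.intro)
    (auto simp: in_Hom field Hom_module add_cmp cmp_add smul_cmp cmp_smul)

lemma cokernel_epi: "is_cokernel C f p \<Longrightarrow> epi_ar C p"
  using linear_category.kernel_mono[OF op_linear, of f p] by simp

lemma cokernelI:
  "\<lbrakk>f \<in> Ar C; epi_ar C p; src C p = tgt C f; p \<cdot> f = zero_ar C (src C f) (tgt C p);
    \<And>h. \<lbrakk>h \<in> Ar C; src C h = tgt C f; h \<cdot> f = zero_ar C (src C f) (tgt C h)\<rbrakk>
      \<Longrightarrow> \<exists>l. l \<in> Ar C \<and> tgt C l = tgt C h \<and> src C l = tgt C p \<and> l \<cdot> p = h\<rbrakk>
   \<Longrightarrow> is_cokernel C f p"
  using linear_category.kernelI[OF op_linear, of f p] by simp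

lemma cokernel_iso:
  assumes "is_cokernel C g' p'" "iso_ar C a" "iso_ar C b" "iso_ar C c" "g \<in> Ar C" "p \<in> Ar C"
    "src C a = src C g" "tgt C a = src C g'" "src C b = tgt C g" "tgt C b = tgt C g'"
    "src C c = tgt C p" "tgt C c = tgt C p'" "src C p = tgt C g" "b \<cdot> g = g' \<cdot> a" "p' \<cdot> b = c \<cdot> p"
  shows "is_cokernel C g p"
proof -
  note [simp] = cokernelD(1-3)[OF assms(1)] assms(2-13) iso_Ar[OF assms(2)] iso_Ar[OF assms(3)]
    iso_Ar[OF assms(4)]
  have "inv_ar C b \<cdot> (g' \<cdot> a) \<cdot> inv_ar C a = inv_ar C b \<cdot> (b \<cdot> g) \<cdot> inv_ar C a"
    by (simp only: assms(14))
  hence "g \<cdot> inv_ar C a = inv_ar C b \<cdot> g'" by simp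
  moreover have "inv_ar C c \<cdot> (p' \<cdot> b) \<cdot> inv_ar C b = inv_ar C c \<cdot> (c \<cdot> p) \<cdot> inv_ar C b"
    by (simp only: assms(15))
  hence "p \<cdot> inv_ar C b = inv_ar C c \<cdot> p'" by simp
  ultimately show ?thesis
    using linear_category.kernel_iso[OF op_linear, of g' p' "inv_ar C b" "inv_ar C a" "inv_ar C c" g p] assms(1)
    by simp
qed

lemma short_exact_iso:
  assumes ex: "short_exact C f' g'"
    and "iso_ar C a" "iso_ar C b" "iso_ar C c" "f \<in> Ar C" "g \<in> Ar C" "src C g = tgt C f"
    "src C a = src C f" "tgt C a = src C f'" "src C b = tgt C f" "tgt C b = tgt C f'"
    "src C c = tgt C g" "tgt C c = tgt C g'" "b \<cdot> f = f' \<cdot> a" "c \<cdot> g = g' \<cdot> b"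
  shows "short_exact C f g"
proof -
  have k: "is_kernel C g' f'" and c: "is_cokernel C f' g'" using ex by (auto simp: short_exact_def)
  have t: "tgt C f' = src C g'" using kernelD(3)[OF k] .
  have "is_kernel C g f"
    by (rule kernel_iso[OF k assms(3,4,2)]) (simp_all only: assms(5-) t)
  moreover have "is_cokernel C f g"
    by (rule cokernel_iso[OF c assms(2-4)]) (simp_all only: assms(5-))
  ultimately show ?thesis by (simp add: short_exact_def)
qed

end

context abelian_category
begin

text \<open>An epimorphism is the cokernel of some arrow, and that arrow factors through its kernel.\<close>

lemma kernel_of_cokernel:
  assumes p: "epi_ar C p" and i: "is_kernel C p i"
  shows "is_cokernel C i p"
proof -
  obtain g where g: "is_cokernel C g p" using epi_normal[OF p] by blast
  note [simp] = cokernelD[OF g] kernelD[OF i]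
  obtain e where [simp]: "e \<in> Ar C" "src C e = src C g" "tgt C e = src C i" and e: "i \<cdot> e = g"
    using kernel_factor[OF i, of g] by auto
  show ?thesis
  proof (rule cokernelI)
    fix h assume [simp]: "h \<in> Ar C" "src C h = tgt C i" and h: "h \<cdot> i = zero_ar C (src C i) (tgt C h)"
    have "h \<cdot> g = (h \<cdot> i) \<cdot> e" by (simp add: e)
    also have "\<dots> = zero_ar C (src C g) (tgt C h)" by (simp only: h) simp
    finally have "h \<cdot> g = zero_ar C (src C g) (tgt C h)" .
    thus "\<exists>l. l \<in> Ar C \<and> tgt C l = tgt C h \<and> src C l = tgt C p \<and> l \<cdot> p = h"
      using cokernel_factor[OF g, of h] by auto
  qed (use p in simp_all)
qed

text \<open>Image factorization. For \<open>f = i \<circ> e\<close> with \<open>i\<close> the kernel of the cokernel of \<open>f\<close>, let \<open>j\<close> be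
  the kernel of the cokernel of \<open>e\<close>. The monomorphism \<open>i \<circ> j\<close>, through which \<open>f\<close> factors, is a
  kernel of some \<open>g\<close>; as \<open>g \<circ> f = 0\<close>, also \<open>g \<circ> i = 0\<close>, so \<open>i\<close> factors through \<open>i \<circ> j\<close> and \<open>j\<close>
  has a section.\<close>

lemma image_factorization:
  assumes p: "is_cokernel C f p" and i: "is_kernel C p i"
  obtains e where "epi_ar C e" "src C e = src C f" "tgt C e = src C i" "i \<cdot> e = f"
proof -
  note [simp] = cokernelD[OF p] kernelD[OF i]
  obtain e where [simp]: "e \<in> Ar C" "src C e = src C f" "tgt C e = src C i" and e: "i \<cdot> e = f"
    using kernel_factor[OF i, of f] by auto
  obtain q where q: "is_cokernel C e q" using cokernel_ex[of e] by auto
  note [simp] = cokernelD[OF q]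
  obtain j where j: "is_kernel C q j" using kernel_ex[of q] by auto
  note [simp] = kernelD[OF j]
  obtain e' where [simp]: "e' \<in> Ar C" "src C e' = src C f" "tgt C e' = src C j" and e': "j \<cdot> e' = e"
    using kernel_factor[OF j, of e] by auto
  have "mono_ar C (i \<cdot> j)" using kernel_mono[OF i] kernel_mono[OF j] by simp
  then obtain g where g: "is_kernel C g (i \<cdot> j)" using mono_normal by blast
  have "src C g = tgt C (i \<cdot> j)" using kernelD(3)[OF g] ..
  hence [simp]: "src C g = tgt C f" "g \<in> Ar C" using kernelD(1)[OF g] by simp_all
  have gij: "g \<cdot> i \<cdot> j = zero_ar C (src C j) (tgt C g)" using kernelD(4)[OF g] by simp
  have "g \<cdot> f = (g \<cdot> i \<cdot> j) \<cdot> e'" by (simp add: e e')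
  also have "\<dots> = zero_ar C (src C f) (tgt C g)" unfolding gij by simp
  finally obtain g' where [simp]: "g' \<in> Ar C" "src C g' = tgt C p" "tgt C g' = tgt C g" and g': "g' \<cdot> p = g"
    using cokernel_factor[OF p, of g] by auto
  have "g \<cdot> i = (g' \<cdot> p) \<cdot> i" by (simp only: g')
  also have "\<dots> = zero_ar C (src C i) (tgt C g)" by simp
  finally have "g \<cdot> i = zero_ar C (src C i) (tgt C g)" .
  then obtain s where [simp]: "s \<in> Ar C" "src C s = src C i" "tgt C s = src C j" and s: "(i \<cdot> j) \<cdot> s = i"
    using kernel_factor[OF g, of i] by auto
  have js: "j \<cdot> s = \<iota> (src C i)"
    by (rule monoD[OF kernel_mono[OF i]]) (use s in simp_all)
  have q0: "q = zero_ar C (src C i) (tgt C q)"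
    using arg_cong[OF js, of "\<lambda>x. q \<cdot> x"] by (simp add: kernelD(4)[OF j, THEN reassoc])
  have "epi_ar C e"
  proof (rule epi_if_zero)
    fix u assume [simp]: "u \<in> Ar C" "src C u = tgt C e" and "u \<cdot> e = zero_ar C (src C e) (tgt C u)"
    then obtain l where [simp]: "l \<in> Ar C" "src C l = tgt C q" "tgt C l = tgt C u" and "l \<cdot> q = u"
      using cokernel_factor[OF q, of u] by auto
    moreover have "l \<cdot> q = zero_ar C (src C i) (tgt C u)" by (subst q0) simp
    ultimately show "u = zero_ar C (src C u) (tgt C u)" by simp
  qed simp
  thus ?thesis using that e by simp
qed

end

context cat_functor
begin

lemma faithfulD:
  assumes "faithful C F" "far F f = far F g" "f \<in> Ar C" "g \<in> Ar C" "src C f = src C g" "tgt C f = tgt C g"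
  shows "f = g"
proof -
  have "inj_on (far F) (Hom C (src C g) (tgt C g))" using assms(1,4) by (simp add: faithful_def)
  thus ?thesis using assms by (auto simp: C.in_Hom dest: inj_onD)
qed

lemma faithful_reflects_epi:
  assumes "faithful C F" "epi_ar D (far F f)" "f \<in> Ar C"
  shows "epi_ar C f"
  unfolding C.epi_iff
proof (intro conjI allI impI)
  fix g h assume gh: "g \<in> Ar C" "h \<in> Ar C" "src C g = tgt C f" "src C h = tgt C f" "tgt C g = tgt C h"
    "g \<cdot>\<^bsub>C\<^esub> f = h \<cdot>\<^bsub>C\<^esub> f"
  have "far F g \<cdot>\<^bsub>D\<^esub> far F f = far F h \<cdot>\<^bsub>D\<^esub> far F f"
    using gh assms(3) by (simp flip: far_cmp')
  hence "far F g = far F h" by (rule D.epiD[OF assms(2)]) (use gh assms(3) in simp_all)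
  thus "g = h" by (rule faithfulD[OF assms(1)]) (use gh in simp_all)
qed fact

end

locale linear_functor = C: linear_category k C + D: linear_category k D + cat_functor C D F
  for k :: "('k, 'y) ring_scheme" and C :: "('o, 'm, 'k, 'x) lin_category_scheme"
    and D :: "('p, 'n, 'k, 'z) lin_category_scheme" (structure) and F :: "('o, 'm, 'p, 'n, 'w) functor_data_scheme" +
  assumes F_lin: "linear k C D F"
begin

lemma far_add [simp]:
  assumes "src C f = src C g" "tgt C f = tgt C g" "f \<in> Ar C" "g \<in> Ar C"
  shows "far F (add_ar C f g) = add_ar D (far F f) (far F g)"
proof -
  have "f \<in> Hom C (src C g) (tgt C g)" "g \<in> Hom C (src C g) (tgt C g)" using assms by (auto simp: C.in_Hom)
  moreover have "src C g \<in> Ob C" "tgt C g \<in> Ob C" using assms by simp_all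
  ultimately show ?thesis using F_lin unfolding linear_def by blast
qed

lemma far_smul [simp]:
  assumes "f \<in> Ar C" "c \<in> carrier k"
  shows "far F (smul_ar C c f) = smul_ar D c (far F f)"
proof -
  have "f \<in> Hom C (src C f) (tgt C f)" "src C f \<in> Ob C" "tgt C f \<in> Ob C" using assms by (auto simp: C.in_Hom)
  thus ?thesis using F_lin assms(2) unfolding linear_def by blast
qed

lemma far_zero [simp]:
  assumes "X \<in> Ob C" "Y \<in> Ob C"
  shows "far F (zero_ar C X Y) = zero_ar D (fob F X) (fob F Y)"
proof -
  have "add_ar D (far F (zero_ar C X Y)) (far F (zero_ar C X Y)) = far F (add_ar C (zero_ar C X Y) (zero_ar C X Y))"
    using assms by (simp del: C.add_zero)
  thus ?thesis using D.idempotent_zero[of "far F (zero_ar C X Y)"] assms by simp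
qed

lemma far_minus [simp]: "\<lbrakk>src C f = src C g; tgt C f = tgt C g; f \<in> Ar C; g \<in> Ar C\<rbrakk>
    \<Longrightarrow> far F (C.minus_ar f g) = D.minus_ar (far F f) (far F g)"
  by (simp add: C.minus_ar_def D.minus_ar_def)

text \<open>The image factorization \<open>f = i \<circ> e\<close> reduces the claim to the short exact sequence of \<open>i\<close> and
  \<open>p\<close>, since \<open>F\<close> keeps \<open>e\<close> epi.\<close>

lemma exact_preserves_cokernel:
  assumes ab: "abelian_category k C" and ex: "exact C D F" and p: "is_cokernel C f p"
  shows "is_cokernel D (far F f) (far F p)"
proof -
  interpret C: abelian_category k C by (rule ab)
  note [simp] = C.cokernelD[OF p]
  have epi: "epi_ar D (far F e)" if e: "epi_ar C e" for e
  proof -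
    obtain j where j: "is_kernel C e j" using C.kernel_ex[of e] e by (auto simp: C.epi_Ar)
    hence "short_exact C j e" using C.kernel_of_cokernel[OF e j] by (simp add: short_exact_def)
    hence "is_cokernel D (far F j) (far F e)" using ex by (auto simp: exact_def short_exact_def)
    thus ?thesis by (rule D.cokernel_epi)
  qed
  obtain i where i: "is_kernel C p i" using C.kernel_ex[of p] by auto
  note [simp] = C.kernelD[OF i]
  obtain e where e: "epi_ar C e" and [simp]: "src C e = src C f" "tgt C e = src C i" and f: "i \<cdot>\<^bsub>C\<^esub> e = f"
    using C.image_factorization[OF p i] .
  have [simp]: "e \<in> Ar C" using e by (rule C.epi_Ar)
  have "far F f = far F (i \<cdot>\<^bsub>C\<^esub> e)" by (simp only: f)
  also have "\<dots> = far F i \<cdot> far F e" by simp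
  finally have ff: "far F f = far F i \<cdot> far F e" .
  have "short_exact C i p"
    using C.kernel_of_cokernel[OF C.cokernel_epi[OF p] i] i by (simp add: short_exact_def)
  hence c: "is_cokernel D (far F i) (far F p)" using ex by (auto simp: exact_def short_exact_def)
  show ?thesis
  proof (rule D.cokernelI)
    show "epi_ar D (far F p)" using c by (rule D.cokernel_epi)
    show "far F p \<cdot> far F f = zero_ar D (src D (far F f)) (tgt D (far F p))"
      by (simp flip: far_cmp')
    fix h assume [simp]: "h \<in> Ar D" "src D h = tgt D (far F f)"
      and h: "h \<cdot> far F f = zero_ar D (src D (far F f)) (tgt D h)"
    have "h \<cdot> far F i = zero_ar D (fob F (src C i)) (tgt D h)"
      by (rule D.epiD[OF epi[OF e]]) (use h in \<open>simp_all add: ff\<close>)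
    thus "\<exists>l. l \<in> Ar D \<and> tgt D l = tgt D h \<and> src D l = tgt D (far F p) \<and> l \<cdot> far F p = h"
      using D.cokernel_factor[OF c, of h] by auto
  qed simp_all
qed

end

section \<open>Additive monoidal categories\<close>

locale linear_monoidal_category = linear_category k C + monoidal_category C
  for k :: "('k, 'y) ring_scheme" and C :: "('o, 'm, 'k, 'z) mon_category_scheme" (structure) +
  assumes tens_add_left': "\<lbrakk>f \<in> Hom C X X'; f' \<in> Hom C X X'; g \<in> Hom C Y Y'\<rbrakk>
      \<Longrightarrow> add_ar C f f' \<otimes>\<^sub>a g = add_ar C (f \<otimes>\<^sub>a g) (f' \<otimes>\<^sub>a g)"
    and tens_add_right': "\<lbrakk>f \<in> Hom C X X'; g \<in> Hom C Y Y'; g' \<in> Hom C Y Y'\<rbrakk>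
      \<Longrightarrow> f \<otimes>\<^sub>a add_ar C g g' = add_ar C (f \<otimes>\<^sub>a g) (f \<otimes>\<^sub>a g')"
begin

lemma tens_zero [simp]:
  assumes "X \<in> Ob C" "Y \<in> Ob C" "f \<in> Ar C"
  shows "f \<otimes>\<^sub>a zero_ar C X Y = zero_ar C (src C f \<otimes>\<^sub>o X) (tgt C f \<otimes>\<^sub>o Y)"
    and "zero_ar C X Y \<otimes>\<^sub>a f = zero_ar C (X \<otimes>\<^sub>o src C f) (Y \<otimes>\<^sub>o tgt C f)"
  using idempotent_zero[of "f \<otimes>\<^sub>a zero_ar C X Y"] idempotent_zero[of "zero_ar C X Y \<otimes>\<^sub>a f"] assms
    tens_add_right'[of f "src C f" "tgt C f" "zero_ar C X Y" X Y "zero_ar C X Y"]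
    tens_add_left'[of "zero_ar C X Y" X Y "zero_ar C X Y" f "src C f" "tgt C f"]
  by (simp_all add: in_Hom)

text \<open>Tensoring with an object that has a dual is a left adjoint, hence right exact.\<close>

lemma cokernel_tens_left:
  assumes d: "is_dual C X Y ev coev" and p: "is_cokernel C f p"
  shows "is_cokernel C (\<iota> Y \<otimes>\<^sub>a f) (\<iota> Y \<otimes>\<^sub>a p)"
proof (rule cokernelI)
  note [simp] = is_dualD(1-8)[OF d] cokernelD[OF p]
  show "epi_ar C (\<iota> Y \<otimes>\<^sub>a p)" by (rule epi_tens_left[OF d cokernel_epi[OF p]])
  show "(\<iota> Y \<otimes>\<^sub>a p) \<cdot> (\<iota> Y \<otimes>\<^sub>a f) = zero_ar C (src C (\<iota> Y \<otimes>\<^sub>a f)) (tgt C (\<iota> Y \<otimes>\<^sub>a p))"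
    by simp
  fix h assume [simp]: "h \<in> Ar C" "src C h = tgt C (\<iota> Y \<otimes>\<^sub>a f)"
    and h: "h \<cdot> (\<iota> Y \<otimes>\<^sub>a f) = zero_ar C (src C (\<iota> Y \<otimes>\<^sub>a f)) (tgt C h)"
  let ?s = "sharp X Y coev (tgt C f) h"
  have [simp]: "?s \<in> Ar C" "src C ?s = tgt C f" "tgt C ?s = X \<otimes>\<^sub>o tgt C h"
    using sharp_typ[OF d, of "tgt C f" h] by simp_all
  have "?s \<cdot> f = sharp X Y coev (src C f) (h \<cdot> (\<iota> Y \<otimes>\<^sub>a f))"
    using sharp_cmp[OF d, of f h] by simp
  also have "\<dots> = zero_ar C (src C f) (X \<otimes>\<^sub>o tgt C h)"
    unfolding h by (simp add: sharp_def)
  finally obtain l where [simp]: "l \<in> Ar C" "src C l = tgt C p" "tgt C l = X \<otimes>\<^sub>o tgt C h" and l: "l \<cdot> p = ?s"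
    using cokernel_factor[OF p, of ?s] by auto
  have "flat X Y ev (tgt C h) l \<cdot> (\<iota> Y \<otimes>\<^sub>a p) = flat X Y ev (tgt C h) ?s"
    by (simp add: flat_def l)
  also have "\<dots> = h" using flat_sharp[OF d, of "tgt C f" h] by simp
  finally show "\<exists>l. l \<in> Ar C \<and> tgt C l = tgt C h \<and> src C l = tgt C (\<iota> Y \<otimes>\<^sub>a p) \<and> l \<cdot> (\<iota> Y \<otimes>\<^sub>a p) = h"
    using flat_typ[OF d, of "tgt C h" l] by auto
qed (use is_dualD[OF d] cokernelD[OF p] in simp_all)

lemma rev_linear_monoidal: "linear_monoidal_category k (rev_mon C)"
proof -
  have "linear_category k (rev_mon C)"
    by (intro linear_category.intro linear_category_axioms.intro category.intro)
      (auto simp: in_Hom field Hom_module add_cmp cmp_add smul_cmp cmp_smul Hom_space_def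
        Hom_module[unfolded Hom_space_def])
  thus ?thesis
    by (intro linear_monoidal_category.intro linear_monoidal_category_axioms.intro rev_monoidal)
      (auto simp: tens_add_left' tens_add_right')
qed

lemma cokernel_tens_right:
  assumes "is_dual C Y X ev coev" "is_cokernel C f p"
  shows "is_cokernel C (f \<otimes>\<^sub>a \<iota> Y) (p \<otimes>\<^sub>a \<iota> Y)"
  using linear_monoidal_category.cokernel_tens_left[OF rev_linear_monoidal, of X Y ev coev f p] assms
  by (simp add: is_dual_rev is_cokernel_def)

end

sublocale tensor_category \<subseteq> linear_monoidal_category k C
  by unfold_locales (rule tens_add_left tens_add_right; assumption)+

section \<open>Coequalizers\<close>

context category
begin

lemma coequalizer_factor:
  assumes "is_coequalizer C f g p" "h \<in> Ar C" "src C h = tgt C f" "h \<cdot> f = h \<cdot> g"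
  obtains l where "l \<in> Ar C" "src C l = tgt C p" "tgt C l = tgt C h" "l \<cdot> p = h"
proof -
  have "h \<in> Hom C (tgt C f) (tgt C h)" using assms by (simp add: in_Hom)
  moreover have "\<forall>h\<in>Hom C (tgt C f) W. h \<cdot> f = h \<cdot> g \<longrightarrow> (\<exists>!l. l \<in> Hom C (tgt C p) W \<and> l \<cdot> p = h)" for W
    using assms(1) unfolding is_coequalizer_def by simp
  ultimately have "\<exists>!l. l \<in> Hom C (tgt C p) (tgt C h) \<and> l \<cdot> p = h"
    using assms(4) by blast
  thus ?thesis using that by (auto simp: in_Hom)
qed

lemma coequalizerD:
  assumes "is_coequalizer C f g p"
  shows "p \<in> Ar C" "src C p = tgt C f" "p \<cdot> f = p \<cdot> g"
  using assms by (auto simp: is_coequalizer_def)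

lemma coequalizerI:
  assumes "epi_ar C p" "src C p = tgt C f" "p \<cdot> f = p \<cdot> g"
    and "\<And>h. \<lbrakk>h \<in> Ar C; src C h = tgt C f; h \<cdot> f = h \<cdot> g\<rbrakk>
      \<Longrightarrow> \<exists>l. l \<in> Ar C \<and> src C l = tgt C p \<and> tgt C l = tgt C h \<and> l \<cdot> p = h"
  shows "is_coequalizer C f g p"
  unfolding is_coequalizer_def
proof (intro conjI allI ballI impI)
  fix W h assume h: "h \<in> Hom C (tgt C f) W" "h \<cdot> f = h \<cdot> g"
  then obtain l where l: "l \<in> Ar C" "src C l = tgt C p" "tgt C l = W" "l \<cdot> p = h"
    using assms(4)[of h] by (auto simp: in_Hom)
  show "\<exists>!l. l \<in> Hom C (tgt C p) W \<and> l \<cdot> p = h"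
  proof (rule ex1I[of _ l])
    fix l' assume "l' \<in> Hom C (tgt C p) W \<and> l' \<cdot> p = h"
    thus "l' = l" by (intro epiD[OF assms(1), of l' l]) (use l in \<open>auto simp: in_Hom\<close>)
  qed (use l in \<open>auto simp: in_Hom\<close>)
qed (use assms in \<open>auto simp: epi_Ar\<close>)

lemma coequalizer_iso:
  assumes p: "is_coequalizer C f g p" and a: "iso_ar C a" "iso_ar C b"
    and [simp]: "f \<in> Ar C" "g \<in> Ar C" "src C g = src C f" "tgt C g = tgt C f"
      "f' \<in> Ar C" "g' \<in> Ar C" "src C f' = src C a" "src C g' = src C a" "tgt C f' = src C b"
      "tgt C g' = src C b" "tgt C a = src C f" "tgt C b = tgt C f"
    and eq: "b \<cdot> f' = f \<cdot> a" "b \<cdot> g' = g \<cdot> a"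
  shows "is_coequalizer C f' g' (p \<cdot> b)"
proof (rule coequalizerI)
  note [simp] = coequalizerD(1,2)[OF p] a iso_Ar[OF a(1)] iso_Ar[OF a(2)]
  show "epi_ar C (p \<cdot> b)" using coequalizer_epi[OF p] by simp
  show "(p \<cdot> b) \<cdot> f' = (p \<cdot> b) \<cdot> g'"
    using coequalizerD(3)[OF p] by (simp add: eq coequalizerD(3)[OF p, THEN reassoc])
  fix h assume [simp]: "h \<in> Ar C" "src C h = tgt C f'" and h: "h \<cdot> f' = h \<cdot> g'"
  have bf: "inv_ar C b \<cdot> f = f' \<cdot> inv_ar C a" "inv_ar C b \<cdot> g = g' \<cdot> inv_ar C a"
  proof -
    have "inv_ar C b \<cdot> (f \<cdot> a) \<cdot> inv_ar C a = inv_ar C b \<cdot> (b \<cdot> f') \<cdot> inv_ar C a"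
      "inv_ar C b \<cdot> (g \<cdot> a) \<cdot> inv_ar C a = inv_ar C b \<cdot> (b \<cdot> g') \<cdot> inv_ar C a" by (simp_all only: eq)
    thus "inv_ar C b \<cdot> f = f' \<cdot> inv_ar C a" "inv_ar C b \<cdot> g = g' \<cdot> inv_ar C a" by simp_all
  qed
  have "(h \<cdot> inv_ar C b) \<cdot> f = (h \<cdot> inv_ar C b) \<cdot> g" by (simp add: bf h[THEN reassoc])
  then obtain l where [simp]: "l \<in> Ar C" "src C l = tgt C p" "tgt C l = tgt C h" and l: "l \<cdot> p = h \<cdot> inv_ar C b"
    using coequalizer_factor[OF p, of "h \<cdot> inv_ar C b"] by auto
  show "\<exists>l. l \<in> Ar C \<and> src C l = tgt C (p \<cdot> b) \<and> tgt C l = tgt C h \<and> l \<cdot> p \<cdot> b = h"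
    by (intro exI[of _ l]) (simp add: l[THEN reassoc])
qed (use coequalizerD(1,2)[OF p] a in \<open>simp add: iso_Ar\<close>)

lemma coequalizer_unique:
  assumes p: "is_coequalizer C f g p" and q: "is_coequalizer C f g q"
    and [simp]: "f \<in> Ar C" "g \<in> Ar C" "src C g = src C f" "tgt C g = tgt C f"
  obtains w where "iso_ar C w" "w \<in> Ar C" "src C w = tgt C p" "tgt C w = tgt C q" "w \<cdot> p = q"
proof -
  note [simp] = coequalizerD(1,2)[OF p] coequalizerD(1,2)[OF q]
  obtain w where [simp]: "w \<in> Ar C" "src C w = tgt C p" "tgt C w = tgt C q" and w: "w \<cdot> p = q"
    by (rule coequalizer_factor[OF p, of q]) (simp_all add: coequalizerD(3)[OF q])
  obtain v where [simp]: "v \<in> Ar C" "src C v = tgt C q" "tgt C v = tgt C p" and v: "v \<cdot> q = p"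
    by (rule coequalizer_factor[OF q, of p]) (simp_all add: coequalizerD(3)[OF p])
  have "v \<cdot> w = \<iota> (tgt C p)"
    by (rule epiD[OF coequalizer_epi[OF p]]) (simp_all add: v w)
  moreover have "w \<cdot> v = \<iota> (tgt C q)"
    by (rule epiD[OF coequalizer_epi[OF q]]) (simp_all add: v w)
  ultimately have "iso_ar C w" by (intro isoI[of w v]) simp_all
  thus ?thesis using that w by simp
qed

end

section \<open>Monadicity of a faithful exact right adjoint\<close>

locale faithful_exact_adjunction =
  C: tensor_category k C + D: tensor_category k D + rigid_adjunction C D F R \<eta> \<epsilon>
  for k :: "('k, 'v) ring_scheme"
    and C :: "('o, 'm, 'k, 'x) mon_category_scheme" (structure) and D :: "('p, 'n, 'k, 'y) mon_category_scheme"
    and F :: "('o, 'm, 'p, 'n, 'z) mon_functor_data_scheme"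
    and R :: "('p, 'n, 'o, 'm, 'w) functor_data_scheme"
    and \<eta> :: "'o \<Rightarrow> 'm" and \<epsilon> :: "'p \<Rightarrow> 'n" +
  assumes F_linear: "linear k C D F"
    and R_faithful: "faithful D R"
    and R_exact: "exact D C R"
begin

sublocale FL: linear_functor k C D F
  by unfold_locales (rule F_linear)

lemma R_linear: "linear k D C R"
  unfolding linear_def
proof (intro conjI ballI)
  fix X Y f assume f: "X \<in> Ob D" "Y \<in> Ob D" "f \<in> Hom D X Y"
  { fix g assume g: "g \<in> Hom D X Y"
    show "far R (add_ar D f g) = add_ar C (far R f) (far R g)"
      by (rule transpose_inject[of Y]) (use f g in \<open>simp_all add: D.in_Hom adj_simps D.cmp_add D.add_cmp\<close>) }
  { fix c assume c: "c \<in> carrier k"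
    show "far R (smul_ar D c f) = smul_ar C c (far R f)"
      by (rule transpose_inject[of Y]) (use f c in \<open>simp_all add: D.in_Hom adj_simps D.cmp_smul D.smul_cmp\<close>) }
qed

sublocale RL: linear_functor k D C R
  by unfold_locales (rule R_linear)

lemma counit_epi: "Y \<in> Ob D \<Longrightarrow> epi_ar D (\<epsilon> Y)"
  by (rule R.faithful_reflects_epi[OF R_faithful], rule C.split_epi[of _ "\<eta> (fob R Y)"])
    (simp_all add: triangle_R)

lemma counit_cokernel:
  assumes "Y \<in> Ob D"
  obtains i where "is_kernel D (\<epsilon> Y) i" "is_cokernel D i (\<epsilon> Y)"
  using assms D.kernel_ex[of "\<epsilon> Y"] D.kernel_of_cokernel[OF counit_epi[OF assms]] by auto

text \<open>As \<open>\<epsilon>\<close> is the cokernel of its kernel \<open>i\<close>, it suffices that \<open>h \<circ> i = 0\<close>. Since \<open>R\<close> is faithful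
  this may be seen after applying \<open>R\<close>, where \<open>\<eta>\<close> splits the fork of \<open>\<epsilon>\<close>, so that \<open>R h\<close> factors
  through \<open>R \<epsilon>\<close>.\<close>

lemma counit_factor:
  assumes [simp]: "Y \<in> Ob D" "h \<in> Ar D" "src D h = fob F (fob R Y)"
    and h: "h \<cdot>\<^bsub>D\<^esub> far F (far R (\<epsilon> Y)) = h \<cdot>\<^bsub>D\<^esub> \<epsilon> (fob F (fob R Y))"
  obtains g where "g \<in> Ar D" "src D g = Y" "tgt D g = tgt D h" "g \<cdot>\<^bsub>D\<^esub> \<epsilon> Y = h"
proof -
  obtain i where i: "is_kernel D (\<epsilon> Y) i" and c: "is_cokernel D i (\<epsilon> Y)"
    using counit_cokernel[of Y] by auto
  note [simp] = D.kernelD[OF i]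
  have "far R h = far R (h \<cdot>\<^bsub>D\<^esub> \<epsilon> (fob F (fob R Y))) \<cdot> \<eta> (fob R (fob F (fob R Y)))"
    by (simp add: adj_simps)
  also have "\<dots> = far R (h \<cdot>\<^bsub>D\<^esub> far F (far R (\<epsilon> Y))) \<cdot> \<eta> (fob R (fob F (fob R Y)))" by (simp only: h)
  also have "\<dots> = far R h \<cdot> \<eta> (fob R Y) \<cdot> far R (\<epsilon> Y)" by (simp add: unit_natural)
  finally have Rh: "far R h = far R h \<cdot> \<eta> (fob R Y) \<cdot> far R (\<epsilon> Y)" .
  have "far R (\<epsilon> Y) \<cdot> far R i = zero_ar C (fob R (src D i)) (fob R Y)"
    by (simp flip: R.far_cmp')
  hence "(far R h \<cdot> \<eta> (fob R Y) \<cdot> far R (\<epsilon> Y)) \<cdot> far R i = zero_ar C (fob R (src D i)) (fob R (tgt D h))"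
    by simp
  hence "far R (h \<cdot>\<^bsub>D\<^esub> i) = far R (zero_ar D (src D i) (tgt D h))" by (simp only: Rh[symmetric]) simp
  hence "h \<cdot>\<^bsub>D\<^esub> i = zero_ar D (src D i) (tgt D h)"
    by (rule R.faithfulD[OF R_faithful]) simp_all
  thus ?thesis using D.cokernel_factor[OF c, of h] that by auto
qed

text \<open>As \<open>Q\<close> is epi, a morphism \<open>f\<close> of modules is one of algebras for the monad \<open>R F\<close>; hence
  \<open>\<epsilon> \<circ> F f\<close> factors through \<open>\<epsilon>\<close>.\<close>

lemma R_full:
  assumes Y [simp]: "Y \<in> Ob D" "Y' \<in> Ob D" and f [simp]: "f \<in> Ar C" "src C f = fob R Y" "tgt C f = fob R Y'"
    and m: "f \<cdot> ract Y = ract Y' \<cdot> (f \<otimes>\<^sub>a \<iota> RI)"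
  obtains g where "g \<in> Ar D" "src D g = Y" "tgt D g = Y'" "far R g = f"
proof -
  have *: "f \<cdot> far R (\<epsilon> Y) = far R (\<epsilon> Y') \<cdot> far R (far F f)"
  proof (rule C.epiD[of "Q (fob R Y)"])
    have "(f \<cdot> far R (\<epsilon> Y)) \<cdot> Q (fob R Y) = ract Y' \<cdot> (f \<otimes>\<^sub>a \<iota> RI)"
      by (simp add: counit_Q m)
    also have "\<dots> = far R (\<epsilon> Y') \<cdot> (Q (fob R Y') \<cdot> (f \<otimes>\<^sub>a \<iota> RI))"
      by (simp flip: counit_Q)
    also have "\<dots> = (far R (\<epsilon> Y') \<cdot> far R (far F f)) \<cdot> Q (fob R Y)"
      by (simp add: Q_natural)
    finally show "(f \<cdot> far R (\<epsilon> Y)) \<cdot> Q (fob R Y) = (far R (\<epsilon> Y') \<cdot> far R (far F f)) \<cdot> Q (fob R Y)" .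
  qed simp_all
  let ?h = "\<epsilon> Y' \<cdot>\<^bsub>D\<^esub> far F f"
  have "?h \<cdot>\<^bsub>D\<^esub> far F (far R (\<epsilon> Y)) = \<epsilon> Y' \<cdot>\<^bsub>D\<^esub> far F (f \<cdot> far R (\<epsilon> Y))" by simp
  also have "\<dots> = \<epsilon> Y' \<cdot>\<^bsub>D\<^esub> far F (far R (\<epsilon> Y' \<cdot>\<^bsub>D\<^esub> far F f))" by (simp add: *)
  also have "\<dots> = ?h \<cdot>\<^bsub>D\<^esub> \<epsilon> (fob F (fob R Y))"
    by (simp add: adj_simps del: R.far_cmp' far_cmp')
  finally obtain g where [simp]: "g \<in> Ar D" "src D g = Y" "tgt D g = Y'" and g: "g \<cdot>\<^bsub>D\<^esub> \<epsilon> Y = ?h"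
    using counit_factor[of Y ?h] by auto
  have "far R g = f"
    by (rule transpose_inject[of Y']) (simp_all add: adj_simps g)
  thus ?thesis by (intro that[of g]) simp_all
qed

text \<open>Beck's argument. A module \<open>(M, r)\<close> is an algebra for the monad \<open>R F\<close> by the map \<open>t\<close> with
  \<open>t \<circ> Q = r\<close>. Let \<open>q\<close> be the cokernel of \<open>F t - \<epsilon>\<close>. By exactness \<open>R q\<close> is the cokernel of
  \<open>R(F t) - R \<epsilon>\<close>, and so is \<open>t\<close>, as its fork is split by \<open>\<eta>\<close>; comparing the two cokernels
  identifies \<open>M\<close> with \<open>R Y\<close> for \<open>Y\<close> the target of \<open>q\<close>.\<close>

lemma module_from_R:
  assumes M: "right_module C A (M, r)"
  obtains Y \<phi> where "Y \<in> Ob D" "iso_ar C \<phi>" "\<phi> \<in> Ar C" "src C \<phi> = M" "tgt C \<phi> = fob R Y"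
    "\<phi> \<cdot> r = ract Y \<cdot> (\<phi> \<otimes>\<^sub>a \<iota> RI)"
proof -
  have [simp]: "M \<in> Ob C" "r \<in> Ar C" "src C r = M \<otimes>\<^sub>o RI" "tgt C r = M"
    and rr: "r \<cdot> (r \<otimes>\<^sub>a \<iota> RI) = r \<cdot> (\<iota> M \<otimes>\<^sub>a lact \<one>\<^sub>o\<^bsub>D\<^esub>) \<cdot> \<alpha> M RI RI"
    and r1: "r \<cdot> (\<iota> M \<otimes>\<^sub>a R0) = \<rho> M"
    using M by (auto simp: right_module_def C.in_Hom)
  define t where "t = r \<cdot> inv_ar C (Q M)"
  have [simp]: "t \<in> Ar C" "src C t = fob R (fob F M)" "tgt C t = M" by (simp_all add: t_def)
  have tQ: "t \<cdot> Q M = r" by (simp add: t_def)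
  have "Q M \<cdot> (\<iota> M \<otimes>\<^sub>a R0) = (ract (fob F M) \<cdot> (\<iota> (fob R (fob F M)) \<otimes>\<^sub>a R0)) \<cdot> (\<eta> M \<otimes>\<^sub>a \<iota> \<one>\<^sub>o)"
    by (simp add: Q_eq)
  also have "\<dots> = \<eta> M \<cdot> \<rho> M" by (simp only: ract_one fob_in \<open>M \<in> Ob C\<close>) (simp add: C.natural)
  finally have Q1: "Q M \<cdot> (\<iota> M \<otimes>\<^sub>a R0) = \<eta> M \<cdot> \<rho> M" .
  have t1: "t \<cdot> \<eta> M = \<iota> M"
  proof (rule C.epiD[of "\<rho> M"])
    show "(t \<cdot> \<eta> M) \<cdot> \<rho> M = \<iota> M \<cdot> \<rho> M"
      by (simp add: Q1[symmetric] tQ[THEN C.reassoc] r1)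
  qed simp_all
  have tt: "t \<cdot> far R (far F t) = t \<cdot> far R (\<epsilon> (fob F M))"
  proof (rule C.epiD[of "Q (fob R (fob F M)) \<cdot> (Q M \<otimes>\<^sub>a \<iota> RI)"])
    let ?e = "Q (fob R (fob F M)) \<cdot> (Q M \<otimes>\<^sub>a \<iota> RI)"
    have "(t \<cdot> far R (far F t)) \<cdot> ?e = t \<cdot> (far R (far F t) \<cdot> Q (fob R (fob F M))) \<cdot> (Q M \<otimes>\<^sub>a \<iota> RI)"
      by simp
    also have "\<dots> = t \<cdot> (Q M \<cdot> (t \<otimes>\<^sub>a \<iota> RI)) \<cdot> (Q M \<otimes>\<^sub>a \<iota> RI)" by (simp add: Q_natural)
    also have "\<dots> = r \<cdot> (r \<otimes>\<^sub>a \<iota> RI)" by (simp add: tQ[THEN C.reassoc] tQ)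
    also have "\<dots> = t \<cdot> (Q M \<cdot> (\<iota> M \<otimes>\<^sub>a lact \<one>\<^sub>o\<^bsub>D\<^esub>) \<cdot> \<alpha> M RI RI)" by (simp add: rr tQ[THEN C.reassoc])
    also have "\<dots> = t \<cdot> ract (fob F M) \<cdot> (Q M \<otimes>\<^sub>a \<iota> RI)" by (simp add: ract_Q)
    also have "\<dots> = (t \<cdot> far R (\<epsilon> (fob F M))) \<cdot> ?e"
      by (simp add: counit_Q[THEN C.reassoc])
    finally show "(t \<cdot> far R (far F t)) \<cdot> ?e = (t \<cdot> far R (\<epsilon> (fob F M))) \<cdot> ?e" .
  qed simp_all
  let ?d = "D.minus_ar (far F t) (\<epsilon> (fob F M))"
  obtain q where q: "is_cokernel D ?d q" using D.cokernel_ex[of ?d] by auto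
  have [simp]: "q \<in> Ar D" "src D q = fob F M" using D.cokernelD(2,3)[OF q] by simp_all
  define Y where "Y = tgt D q"
  have [simp]: "Y \<in> Ob D" "tgt D q = Y" by (simp_all add: Y_def)
  have "q \<cdot>\<^bsub>D\<^esub> ?d = zero_ar D (src D ?d) Y" using D.cokernelD(4)[OF q] by simp
  hence qd: "q \<cdot>\<^bsub>D\<^esub> far F t = q \<cdot>\<^bsub>D\<^esub> \<epsilon> (fob F M)"
    using D.minus_zero_iff[of "q \<cdot>\<^bsub>D\<^esub> far F t" "q \<cdot>\<^bsub>D\<^esub> \<epsilon> (fob F M)"] by (simp add: D.cmp_minus)
  have Rq: "is_cokernel C (far R ?d) (far R q)"
    by (rule RL.exact_preserves_cokernel[OF _ R_exact q]) unfold_locales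
  have "t \<cdot> far R ?d = zero_ar C (src C (far R ?d)) M"
    using C.minus_zero_iff[of "t \<cdot> far R (\<epsilon> (fob F M))" "t \<cdot> far R (\<epsilon> (fob F M))"]
    by (simp add: C.cmp_minus tt)
  then obtain \<psi> where [simp]: "\<psi> \<in> Ar C" "src C \<psi> = fob R Y" "tgt C \<psi> = M" and \<psi>: "\<psi> \<cdot> far R q = t"
    using C.cokernel_factor[OF Rq, of t] by auto
  define \<phi> where "\<phi> = far R q \<cdot> \<eta> M"
  have [simp]: "\<phi> \<in> Ar C" "src C \<phi> = M" "tgt C \<phi> = fob R Y" by (simp_all add: \<phi>_def)
  have "\<phi> \<cdot> t = far R (q \<cdot>\<^bsub>D\<^esub> far F t) \<cdot> \<eta> (fob R (fob F M))"
    by (simp add: \<phi>_def unit_natural)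
  also have "\<dots> = far R q" unfolding qd by (simp add: adj_simps)
  finally have \<phi>t: "\<phi> \<cdot> t = far R q" .
  have "\<psi> \<cdot> \<phi> = \<iota> M"
    by (rule C.epiD[OF C.split_epi[of t "\<eta> M"]]) (simp_all add: t1 \<phi>t \<psi>)
  moreover have "\<phi> \<cdot> \<psi> = \<iota> (fob R Y)"
    by (rule C.epiD[OF C.cokernel_epi[OF Rq]]) (simp_all add: \<psi> \<phi>t)
  ultimately have iso: "iso_ar C \<phi>" by (intro C.isoI[of \<phi> \<psi>]) simp_all
  have "\<phi> \<cdot> r = \<phi> \<cdot> t \<cdot> Q M" by (simp add: tQ)
  also have "\<dots> = far R q \<cdot> Q M" by (simp add: \<phi>t[THEN C.reassoc])
  also have "\<dots> = far R (q \<cdot>\<^bsub>D\<^esub> \<epsilon> (fob F M) \<cdot>\<^bsub>D\<^esub> far F (\<eta> M)) \<cdot> Q M" by (simp add: adj_simps)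
  also have "\<dots> = far R (\<epsilon> Y \<cdot>\<^bsub>D\<^esub> far F \<phi>) \<cdot> Q M"
    by (simp add: \<phi>_def counit_natural[THEN D.reassoc] del: R.far_cmp')
  also have "\<dots> = far R (\<epsilon> Y) \<cdot> (Q (fob R Y) \<cdot> (\<phi> \<otimes>\<^sub>a \<iota> RI))" by (simp add: Q_natural)
  also have "\<dots> = ract Y \<cdot> (\<phi> \<otimes>\<^sub>a \<iota> RI)" by (simp add: counit_Q[THEN C.reassoc])
  finally have "\<phi> \<cdot> r = ract Y \<cdot> (\<phi> \<otimes>\<^sub>a \<iota> RI)" .
  thus ?thesis using iso by (intro that[of Y \<phi>]) simp_all
qed

section \<open>The tensor product over the algebra of an adjunction\<close>

lemma epi_tens_C:
  assumes "epi_ar C f" "Z \<in> Ob C"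
  shows "epi_ar C (f \<otimes>\<^sub>a \<iota> Z)" "epi_ar C (\<iota> Z \<otimes>\<^sub>a f)"
proof -
  obtain V ev coev V' ev' coev' where "is_dual C Z V ev coev" "is_dual C V' Z ev' coev'"
    using dual_left[OF assms(2)] dual_right[OF assms(2)] by blast
  thus "epi_ar C (f \<otimes>\<^sub>a \<iota> Z)" "epi_ar C (\<iota> Z \<otimes>\<^sub>a f)"
    using C.epi_tens_left C.epi_tens_right assms(1) by blast+
qed

lemma R2_via_projection:
  assumes [simp]: "X \<in> Ob D" "Y \<in> Ob D"
  shows "R2 X Y = far R (\<epsilon> X \<otimes>\<^sub>a\<^bsub>D\<^esub> \<iota>\<^bsub>D\<^esub> Y) \<cdot> projection (fob R X) Y"
  by (simp add: projection_def R2_natural[THEN C.reassoc] adj_simps)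

lemma counit_tens_cokernel:
  assumes i: "is_cokernel D i (\<epsilon> X)" and Y: "Y \<in> Ob D"
  shows "is_cokernel C (far R (i \<otimes>\<^sub>a\<^bsub>D\<^esub> \<iota>\<^bsub>D\<^esub> Y)) (far R (\<epsilon> X \<otimes>\<^sub>a\<^bsub>D\<^esub> \<iota>\<^bsub>D\<^esub> Y))"
proof (rule RL.exact_preserves_cokernel[OF _ R_exact])
  obtain V ev coev where d: "is_dual D Y V ev coev" using D.rigid Y unfolding rigid_def by blast
  show "is_cokernel D (i \<otimes>\<^sub>a\<^bsub>D\<^esub> \<iota>\<^bsub>D\<^esub> Y) (\<epsilon> X \<otimes>\<^sub>a\<^bsub>D\<^esub> \<iota>\<^bsub>D\<^esub> Y)" by (rule D.cokernel_tens_right[OF d i])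
qed unfold_locales

lemma R2_epi:
  assumes X [simp]: "X \<in> Ob D" and Y [simp]: "Y \<in> Ob D"
  shows "epi_ar C (R2 X Y)"
proof -
  obtain i where i: "is_cokernel D i (\<epsilon> X)" using counit_cokernel[OF X] .
  obtain V ev coev where "is_dual C (fob R X) V ev coev" using dual_left[of "fob R X"] by auto
  thus ?thesis
    using C.cokernel_epi[OF counit_tens_cokernel[OF i Y]] projection_iso[of "fob R X" V ev coev Y]
    by (simp add: R2_via_projection)
qed

text \<open>The projection formula identifies \<open>RX \<otimes>\<^sub>a RY\<close> with \<open>R(FRX \<otimes>\<^sub>a Y)\<close>, and \<open>R2 X Y\<close> with
  \<open>R(\<epsilon> \<otimes>\<^sub>a Y)\<close>. The latter is the cokernel of \<open>R(i \<otimes>\<^sub>a Y)\<close>, for \<open>i\<close> the kernel of \<open>\<epsilon>\<close>, so it remains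
  to see that a balanced map kills \<open>R(i \<otimes>\<^sub>a Y)\<close>. As \<open>R2\<close> is epi, it suffices to compose with
  \<open>R2\<close>, and there the map factors through \<open>R(\<epsilon> \<circ> i) = 0\<close>.\<close>

lemma R2_coequalizer:
  assumes X [simp]: "X \<in> Ob D" and Y [simp]: "Y \<in> Ob D"
  shows "is_coequalizer C (ract X \<otimes>\<^sub>a \<iota> (fob R Y))
    ((\<iota> (fob R X) \<otimes>\<^sub>a lact Y) \<cdot> \<alpha> (fob R X) RI (fob R Y)) (R2 X Y)"
proof (rule C.coequalizerI)
  let ?f = "ract X \<otimes>\<^sub>a \<iota> (fob R Y)" and ?g = "(\<iota> (fob R X) \<otimes>\<^sub>a lact Y) \<cdot> \<alpha> (fob R X) RI (fob R Y)"
  show "epi_ar C (R2 X Y)" by (rule R2_epi) simp_all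
  show "R2 X Y \<cdot> ?f = R2 X Y \<cdot> ?g" by (rule R2_balanced) simp_all
  fix h assume [simp]: "h \<in> Ar C" "src C h = tgt C ?f" and h: "h \<cdot> ?f = h \<cdot> ?g"
  obtain i where k: "is_kernel D (\<epsilon> X) i" and i: "is_cokernel D i (\<epsilon> X)" using counit_cokernel[OF X] .
  have [simp]: "i \<in> Ar D" "tgt D i = fob F (fob R X)" and \<epsilon>i: "\<epsilon> X \<cdot>\<^bsub>D\<^esub> i = zero_ar D (src D i) X"
    using D.kernelD[OF k] by simp_all
  let ?P = "projection (fob R X) Y" and ?E = "far R (\<epsilon> X \<otimes>\<^sub>a\<^bsub>D\<^esub> \<iota>\<^bsub>D\<^esub> Y)"
  have [simp]: "iso_ar C ?P" using dual_left[of "fob R X"] projection_iso by auto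
  define h' where "h' = h \<cdot> inv_ar C ?P"
  have [simp]: "h' \<in> Ar C" "src C h' = fob R (fob F (fob R X) \<otimes>\<^sub>o\<^bsub>D\<^esub> Y)" "tgt C h' = tgt C h"
    and h'P: "h' \<cdot> ?P = h" by (simp_all add: h'_def)
  have *: "h' \<cdot> R2 (fob F (fob R X)) Y = h \<cdot> (far R (\<epsilon> X) \<otimes>\<^sub>a \<iota> (fob R Y))"
  proof (rule C.epiD[of "Q (fob R X) \<otimes>\<^sub>a \<iota> (fob R Y)"])
    have "(h' \<cdot> R2 (fob F (fob R X)) Y) \<cdot> (Q (fob R X) \<otimes>\<^sub>a \<iota> (fob R Y))
        = h' \<cdot> R2 (fob F (fob R X)) Y \<cdot> (\<eta> (fob R X) \<otimes>\<^sub>a (lact Y \<cdot> (\<iota> RI \<otimes>\<^sub>a \<iota> (fob R Y))))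
          \<cdot> \<alpha> (fob R X) RI (fob R Y)"
      using RF2_balanced[of "fob R X" Y "\<iota> (fob R Y)" "fob R Y"] by simp
    also have "\<dots> = h' \<cdot> ?P \<cdot> ?g" by (simp add: projection_def)
    also have "\<dots> = h \<cdot> ?g" by (simp add: h'P[THEN C.reassoc])
    also have "\<dots> = h \<cdot> ?f" by (rule h[symmetric])
    also have "\<dots> = (h \<cdot> (far R (\<epsilon> X) \<otimes>\<^sub>a \<iota> (fob R Y))) \<cdot> (Q (fob R X) \<otimes>\<^sub>a \<iota> (fob R Y))"
      by (simp add: counit_Q)
    finally show "(h' \<cdot> R2 (fob F (fob R X)) Y) \<cdot> (Q (fob R X) \<otimes>\<^sub>a \<iota> (fob R Y))
       = (h \<cdot> (far R (\<epsilon> X) \<otimes>\<^sub>a \<iota> (fob R Y))) \<cdot> (Q (fob R X) \<otimes>\<^sub>a \<iota> (fob R Y))" .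
  qed simp_all
  have "h' \<cdot> far R (i \<otimes>\<^sub>a\<^bsub>D\<^esub> \<iota>\<^bsub>D\<^esub> Y) = zero_ar C (fob R (src D i \<otimes>\<^sub>o\<^bsub>D\<^esub> Y)) (tgt C h)"
  proof (rule C.epiD[OF R2_epi[of "src D i" Y]])
    have "(h' \<cdot> far R (i \<otimes>\<^sub>a\<^bsub>D\<^esub> \<iota>\<^bsub>D\<^esub> Y)) \<cdot> R2 (src D i) Y
       = (h' \<cdot> R2 (fob F (fob R X)) Y) \<cdot> (far R i \<otimes>\<^sub>a \<iota> (fob R Y))" by (simp add: R2_natural)
    also have "\<dots> = h \<cdot> ((far R (\<epsilon> X) \<cdot> far R i) \<otimes>\<^sub>a \<iota> (fob R Y))" unfolding * by simp
    also have "far R (\<epsilon> X) \<cdot> far R i = far R (\<epsilon> X \<cdot>\<^bsub>D\<^esub> i)" by simp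
    also have "\<dots> = zero_ar C (fob R (src D i)) (fob R X)" unfolding \<epsilon>i by simp
    finally show "(h' \<cdot> far R (i \<otimes>\<^sub>a\<^bsub>D\<^esub> \<iota>\<^bsub>D\<^esub> Y)) \<cdot> R2 (src D i) Y
      = zero_ar C (fob R (src D i \<otimes>\<^sub>o\<^bsub>D\<^esub> Y)) (tgt C h) \<cdot> R2 (src D i) Y" by simp
  qed simp_all
  then obtain l where [simp]: "l \<in> Ar C" "src C l = fob R (X \<otimes>\<^sub>o\<^bsub>D\<^esub> Y)" "tgt C l = tgt C h" and l: "l \<cdot> ?E = h'"
    using C.cokernel_factor[OF counit_tens_cokernel[OF i Y], of h'] by auto
  have "l \<cdot> R2 X Y = (l \<cdot> ?E) \<cdot> ?P" by (simp add: R2_via_projection)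
  also have "\<dots> = h" by (simp only: l h'P)
  finally show "\<exists>l. l \<in> Ar C \<and> src C l = tgt C (R2 X Y) \<and> tgt C l = tgt C h \<and> l \<cdot> R2 X Y = h"
    by (intro exI[of _ l]) simp
qed simp_all

end

section \<open>The category of modules\<close>

lemma mod_tensor_cat_simps:
  "Ob (mod_tensor_cat C A) = {P. right_module C A P}"
  "Ar (mod_tensor_cat C A) = {(P, f, N). right_module C A P \<and> right_module C A N \<and> module_hom C A P f N}"
  "src (mod_tensor_cat C A) (P, f, N) = P"
  "tgt (mod_tensor_cat C A) (P, f, N) = N"
  "ide (mod_tensor_cat C A) P = (P, ide C (fst P), P)"
  "cmp (mod_tensor_cat C A) (N', g, S) (P, f, N) = (P, cmp C g f, S)"
  "zero_ar (mod_tensor_cat C A) P N = (P, zero_ar C (fst P) (fst N), N)"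
  "add_ar (mod_tensor_cat C A) (P, f, N) (P', f', N'') = (P, add_ar C f f', N)"
  "smul_ar (mod_tensor_cat C A) c (P, f, N) = (P, smul_ar C c f, N)"
  "tens_ob (mod_tensor_cat C A) = mod_tens_ob C A"
  "tens_ar (mod_tensor_cat C A) = mod_tens_ar C A"
  "unit_ob (mod_tensor_cat C A) = mod_unit A"
  "assoc (mod_tensor_cat C A) = mod_assoc C A"
  "lunit (mod_tensor_cat C A) = mod_lunit C A"
  "runit (mod_tensor_cat C A) = mod_runit C A"
  by (simp_all add: mod_tensor_cat_def mod_cat_def lin_category.extend_def)

lemma (in category) the_factor:
  assumes "epi_ar C p" "h \<in> Ar C" "src C h = tgt C p" "tgt C h = T" "h \<cdot> p = q"
  shows "(THE h. h \<in> Hom C (tgt C p) T \<and> h \<cdot> p = q) = h"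
proof (rule the_equality)
  fix h' assume "h' \<in> Hom C (tgt C p) T \<and> h' \<cdot> p = q"
  thus "h' = h" by (intro epiD[OF assms(1), of h' h]) (use assms in \<open>auto simp: in_Hom\<close>)
qed (use assms in \<open>auto simp: in_Hom\<close>)

context faithful_exact_adjunction
begin

abbreviation "E \<equiv> mod_tensor_cat C A"
abbreviation "is_mod \<equiv> right_module C A"
abbreviation "tob \<equiv> mod_tens_ob C A"
abbreviation "proj \<equiv> mod_proj C A"
abbreviation "munit \<equiv> mod_unit A"

lemma is_mod_iff: "is_mod P \<longleftrightarrow> fst P \<in> Ob C \<and> snd P \<in> Ar C \<and> src C (snd P) = fst P \<otimes>\<^sub>o RI \<and> tgt C (snd P) = fst P
    \<and> snd P \<cdot> (snd P \<otimes>\<^sub>a \<iota> RI) = snd P \<cdot> (\<iota> (fst P) \<otimes>\<^sub>a lact \<one>\<^sub>o\<^bsub>D\<^esub>) \<cdot> \<alpha> (fst P) RI RI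
    \<and> snd P \<cdot> (\<iota> (fst P) \<otimes>\<^sub>a R0) = \<rho> (fst P)"
  by (auto simp: right_module_def C.in_Hom split: prod.splits)

lemma is_mod_typ [simp]:
  assumes "is_mod P"
  shows "fst P \<in> Ob C" "snd P \<in> Ar C" "src C (snd P) = fst P \<otimes>\<^sub>o RI" "tgt C (snd P) = fst P"
  using assms by (simp_all add: is_mod_iff)

text \<open>The arrows of modules are triples \<open>(P, f, Q)\<close>; computations take place with the arrow \<open>f\<close> of
  \<open>C\<close>.\<close>

definition mhom where
  "mhom P f N \<longleftrightarrow> is_mod P \<and> is_mod N \<and> f \<in> Ar C \<and> src C f = fst P \<and> tgt C f = fst N
     \<and> f \<cdot> snd P = snd N \<cdot> (f \<otimes>\<^sub>a \<iota> RI)"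

lemma mhomD:
  assumes "mhom P f N"
  shows "is_mod P" "is_mod N" "f \<in> Ar C" "src C f = fst P" "tgt C f = fst N"
    "f \<cdot> snd P = snd N \<cdot> (f \<otimes>\<^sub>a \<iota> RI)"
  using assms by (simp_all add: mhom_def)

lemma E_simps [simp]:
  "Ob E = {P. is_mod P}" "Ar E = {(P, f, N). mhom P f N}"
  "(P, f, N) \<in> Hom E P' N' \<longleftrightarrow> P = P' \<and> N = N' \<and> mhom P f N"
  by (auto simp: mod_tensor_cat_simps mhom_def module_hom_def C.in_Hom Hom_def split: prod.splits)

lemmas E_defs [simp] = mod_tensor_cat_simps(3-)

lemma Hom_E: "a \<in> Hom E P N \<longleftrightarrow> (\<exists>f. a = (P, f, N) \<and> mhom P f N)"
  by (cases a) auto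

lemma mhom_ide [simp]: "is_mod P \<Longrightarrow> mhom P (\<iota> (fst P)) P"
  by (simp add: mhom_def)

lemma mhom_cmp [simp]:
  assumes "mhom P f N" "mhom N g S" shows "mhom P (g \<cdot> f) S"
proof -
  note [simp] = mhomD(1-5)[OF assms(1)] mhomD(1-5)[OF assms(2)]
  have "(g \<cdot> f) \<cdot> snd P = g \<cdot> snd N \<cdot> (f \<otimes>\<^sub>a \<iota> RI)" by (simp add: mhomD(6)[OF assms(1)])
  also have "\<dots> = snd S \<cdot> ((g \<cdot> f) \<otimes>\<^sub>a \<iota> RI)" by (simp add: mhomD(6)[OF assms(2), THEN C.reassoc])
  finally show ?thesis by (simp add: mhom_def)
qed

lemma mhom_inv:
  assumes f: "mhom P f N" and [simp]: "iso_ar C f"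
  shows "mhom N (inv_ar C f) P"
proof -
  note [simp] = mhomD(1-5)[OF f]
  have "inv_ar C f \<cdot> (f \<cdot> snd P) \<cdot> (inv_ar C f \<otimes>\<^sub>a \<iota> RI)
      = inv_ar C f \<cdot> (snd N \<cdot> (f \<otimes>\<^sub>a \<iota> RI)) \<cdot> (inv_ar C f \<otimes>\<^sub>a \<iota> RI)"
    by (simp only: mhomD(6)[OF f])
  thus ?thesis by (simp add: mhom_def)
qed

lemma mhom_zero: "\<lbrakk>is_mod P; is_mod N\<rbrakk> \<Longrightarrow> mhom P (zero_ar C (fst P) (fst N)) N"
  by (simp add: mhom_def)

lemma mhom_add: "\<lbrakk>mhom P f N; mhom P g N\<rbrakk> \<Longrightarrow> mhom P (add_ar C f g) N"
  using C.tens_add_left[of f "fst P" "fst N" g "\<iota> RI" RI RI]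
  by (simp add: mhom_def C.add_cmp C.cmp_add C.in_Hom)

lemma mhom_smul: "\<lbrakk>mhom P f N; c \<in> carrier k\<rbrakk> \<Longrightarrow> mhom P (smul_ar C c f) N"
  using C.tens_smul_left[of c f "fst P" "fst N" "\<iota> RI" RI RI]
  by (simp add: mhom_def C.smul_cmp C.cmp_smul C.in_Hom)

lemma E_linear: "linear_category k E"
proof (intro linear_category.intro linear_category_axioms.intro category.intro)
  fix P N assume PN: "P \<in> Ob E" "N \<in> Ob E"
  interpret H: module k "Hom_space C (fst P) (fst N)" using PN by (intro C.Hom_module) simp_all
  have inH: "f \<in> carrier (Hom_space C (fst P) (fst N))" if "mhom P f N" for f
    using that by (simp add: mhom_def C.in_Hom)
  have assoc: "add_ar C (add_ar C f g) h = add_ar C f (add_ar C g h)"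
    if "mhom P f N" "mhom P g N" "mhom P h N" for f g h using H.a_assoc[of f g h] inH that by simp
  have comm: "add_ar C f g = add_ar C g f" if "mhom P f N" "mhom P g N" for f g
    using H.a_comm[of f g] inH that by simp
  have l_zero: "add_ar C (zero_ar C (fst P) (fst N)) f = f" if "mhom P f N" for f
    using H.l_zero[of f] inH that by simp
  have l_distr: "smul_ar C (a \<oplus>\<^bsub>k\<^esub> b) f = add_ar C (smul_ar C a f) (smul_ar C b f)"
    if "mhom P f N" "a \<in> carrier k" "b \<in> carrier k" for a b f using H.smult_l_distr[of a b f] inH that by simp
  have smul_smul: "smul_ar C (a \<otimes>\<^bsub>k\<^esub> b) f = smul_ar C a (smul_ar C b f)"
    if "mhom P f N" "a \<in> carrier k" "b \<in> carrier k" for a b f using H.smult_assoc1[of a b f] inH that by simp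
  have r_distr: "smul_ar C a (add_ar C f g) = add_ar C (smul_ar C a f) (smul_ar C a g)"
    if "mhom P f N" "mhom P g N" "a \<in> carrier k" for a f g using H.smult_r_distr[of a f g] inH that by simp
  have smul_one: "smul_ar C \<one>\<^bsub>k\<^esub> f = f" if "mhom P f N" for f using H.smult_one[of f] inH that by simp
  have HE: "x \<in> carrier (Hom_space E P N) \<longleftrightarrow> (\<exists>f. x = (P, f, N) \<and> mhom P f N)" for x
    by (simp add: Hom_space_def Hom_E)
  have HS [simp]: "add (Hom_space E P N) = add_ar E" "zero (Hom_space E P N) = zero_ar E P N"
    "smult (Hom_space E P N) = smul_ar E" by (simp_all add: Hom_space_def)
  show "module k (Hom_space E P N)"
  proof (rule moduleI)
    show "cring k" by (rule H.R.cring_axioms)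
    show "abelian_group (Hom_space E P N)"
    proof (rule abelian_groupI)
      fix x assume "x \<in> carrier (Hom_space E P N)"
      then obtain f where x: "x = (P, f, N)" "mhom P f N" by (auto simp: HE)
      show "\<zero>\<^bsub>Hom_space E P N\<^esub> \<oplus>\<^bsub>Hom_space E P N\<^esub> x = x"
        using x l_zero by simp
      let ?g = "smul_ar C (\<ominus>\<^bsub>k\<^esub> \<one>\<^bsub>k\<^esub>) f"
      have "add_ar C f ?g = zero_ar C (fst P) (fst N)"
        using C.minus_zero_iff[of f f] mhomD[OF x(2)] by (simp add: C.minus_ar_def)
      hence "add_ar C ?g f = zero_ar C (fst P) (fst N)"
        using comm[OF x(2) mhom_smul[OF x(2) C.neg_one]] by simp
      thus "\<exists>y\<in>carrier (Hom_space E P N). y \<oplus>\<^bsub>Hom_space E P N\<^esub> x = \<zero>\<^bsub>Hom_space E P N\<^esub>"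
        using x mhom_smul[OF x(2) C.neg_one] by (intro bexI[of _ "(P, ?g, N)"]) (simp_all add: HE)
    qed (use PN in \<open>auto simp: HE mhom_zero mhom_add l_zero assoc intro: comm\<close>)
  qed (auto simp: HE mhom_smul mhom_add l_distr r_distr smul_smul smul_one)
next
  show "field k" by (rule C.field)
qed (auto simp: Hom_E mhomD C.add_cmp C.cmp_add C.smul_cmp C.cmp_smul dest: mhomD)

sublocale EL: linear_category k E
  by (rule E_linear)

lemma iso_E:
  assumes "mhom P f N" "iso_ar C f"
  shows "iso_ar E (P, f, N)" "inv_ar E (P, f, N) = (N, inv_ar C f, P)"
  using EL.isoI[of "(P, f, N)" "(N, inv_ar C f, P)"] assms mhom_inv[OF assms] mhomD[OF assms(1)]
  by simp_all

text \<open>A presentation of a module is an isomorphism with a module that comes from an object of \<open>D\<close>; the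
  structure of the tensor product over \<open>A\<close> is computed from presentations.\<close>

definition kob where "kob X = (fob R X, ract X)"

lemma kob_simps [simp]: "fst (kob X) = fob R X" "snd (kob X) = ract X"
  by (simp_all add: kob_def)

lemma kob_mod [simp]: "X \<in> Ob D \<Longrightarrow> is_mod (kob X)"
  by (simp add: is_mod_iff ract_ract ract_one)

lemma munit_eq: "munit = kob \<one>\<^sub>o\<^bsub>D\<^esub>"
  by (simp add: mod_unit_def kob_def lact_unit_eq_ract_unit)

lemma munit_mod [simp]: "is_mod munit" "fst munit = RI" "snd munit = ract \<one>\<^sub>o\<^bsub>D\<^esub>"
  by (simp_all add: munit_eq)

definition pres where
  "pres P X \<phi> \<longleftrightarrow> X \<in> Ob D \<and> iso_ar C \<phi> \<and> mhom P \<phi> (kob X)"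

lemma presD:
  assumes "pres P X \<phi>"
  shows "X \<in> Ob D" "is_mod P" "iso_ar C \<phi>" "\<phi> \<in> Ar C" "src C \<phi> = fst P" "tgt C \<phi> = fob R X"
    "\<phi> \<cdot> snd P = ract X \<cdot> (\<phi> \<otimes>\<^sub>a \<iota> RI)" "mhom P \<phi> (kob X)"
  using assms by (simp_all add: pres_def mhom_def)

lemma pres_kob: "X \<in> Ob D \<Longrightarrow> pres (kob X) X (\<iota> (fob R X))"
  using mhom_ide[of "kob X"] by (simp add: pres_def)

lemma pres_ex:
  assumes "is_mod P" obtains X \<phi> where "pres P X \<phi>"
proof -
  obtain Y \<phi> where "Y \<in> Ob D" "iso_ar C \<phi>" "\<phi> \<in> Ar C" "src C \<phi> = fst P" "tgt C \<phi> = fob R Y"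
    "\<phi> \<cdot> snd P = ract Y \<cdot> (\<phi> \<otimes>\<^sub>a \<iota> RI)"
    using module_from_R[of "fst P" "snd P"] assms by auto
  thus ?thesis using assms that[of Y \<phi>] by (simp add: pres_def mhom_def)
qed

lemma mhom_R: "g \<in> Ar D \<Longrightarrow> mhom (kob (src D g)) (far R g) (kob (tgt D g))"
  by (simp add: mhom_def ract_natural)

lemma pres_mhom:
  assumes f: "mhom P f P'" and P: "pres P X \<phi>" and P': "pres P' X' \<phi>'"
  obtains g where "g \<in> Ar D" "src D g = X" "tgt D g = X'" "far R g \<cdot> \<phi> = \<phi>' \<cdot> f"
proof -
  note [simp] = presD[OF P] presD[OF P'] mhomD(3-5)[OF f]
  let ?f = "\<phi>' \<cdot> f \<cdot> inv_ar C \<phi>"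
  have "mhom (kob X) ?f (kob X')"
    by (intro mhom_cmp[of _ _ P] mhom_cmp[of _ _ P'] mhom_inv f) simp_all
  then obtain g where "g \<in> Ar D" "src D g = X" "tgt D g = X'" and g: "far R g = ?f"
    using R_full[of X X' ?f] by (auto simp: mhom_def)
  thus ?thesis by (intro that[of g]) simp_all
qed

lemma mhom_pres:
  assumes g [simp]: "g \<in> Ar D" "src D g = X" "tgt D g = X'" and P: "pres P X \<phi>" and P': "pres P' X' \<phi>'"
  shows "mhom P (inv_ar C \<phi>' \<cdot> far R g \<cdot> \<phi>) P'"
proof (intro mhom_cmp)
  show "mhom P \<phi> (kob X)" "mhom (kob X') (inv_ar C \<phi>') P'"
    using presD(8)[OF P] mhom_inv[OF presD(8)[OF P'] presD(3)[OF P']] by simp_all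
  show "mhom (kob X) (far R g) (kob X')" using mhom_R[of g] by simp
qed

lemma action_braiding:
  assumes P: "pres P X \<phi>"
  shows "\<phi> \<cdot> snd P \<cdot> \<sigma> (fst P) = lact X \<cdot> (\<iota> RI \<otimes>\<^sub>a \<phi>)"
proof -
  note [simp] = presD(1-6)[OF P]
  have "\<phi> \<cdot> snd P \<cdot> \<sigma> (fst P) = ract X \<cdot> (\<phi> \<otimes>\<^sub>a \<iota> RI) \<cdot> \<sigma> (fst P)"
    by (simp add: presD(7)[OF P, THEN C.reassoc])
  also have "\<dots> = ract X \<cdot> \<sigma> (fob R X) \<cdot> (\<iota> RI \<otimes>\<^sub>a \<phi>)" by (simp add: braiding_natural)
  also have "\<dots> = lact X \<cdot> (\<iota> RI \<otimes>\<^sub>a \<phi>)" by (simp add: ract_braiding[THEN C.reassoc])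
  finally show ?thesis .
qed

lemma pres_coequalizer:
  assumes P: "pres P X \<phi>" and N: "pres N Y \<psi>"
  shows "is_coequalizer C (snd P \<otimes>\<^sub>a \<iota> (fst N))
    ((\<iota> (fst P) \<otimes>\<^sub>a (snd N \<cdot> \<sigma> (fst N))) \<cdot> \<alpha> (fst P) RI (fst N)) (R2 X Y \<cdot> (\<phi> \<otimes>\<^sub>a \<psi>))"
proof -
  note [simp] = presD(1-6)[OF P] presD(1-6)[OF N]
  show ?thesis
  proof (rule C.coequalizer_iso[OF R2_coequalizer, of X Y "(\<phi> \<otimes>\<^sub>a \<iota> RI) \<otimes>\<^sub>a \<psi>"])
    show "(\<phi> \<otimes>\<^sub>a \<psi>) \<cdot> (snd P \<otimes>\<^sub>a \<iota> (fst N)) = (ract X \<otimes>\<^sub>a \<iota> (fob R Y)) \<cdot> ((\<phi> \<otimes>\<^sub>a \<iota> RI) \<otimes>\<^sub>a \<psi>)"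
      by (simp add: presD(7)[OF P])
    have "(\<phi> \<otimes>\<^sub>a \<psi>) \<cdot> (\<iota> (fst P) \<otimes>\<^sub>a (snd N \<cdot> \<sigma> (fst N))) \<cdot> \<alpha> (fst P) RI (fst N)
       = (\<iota> (fob R X) \<otimes>\<^sub>a lact Y) \<cdot> (\<phi> \<otimes>\<^sub>a (\<iota> RI \<otimes>\<^sub>a \<psi>)) \<cdot> \<alpha> (fst P) RI (fst N)"
      by (simp add: action_braiding[OF N])
    also have "\<dots> = ((\<iota> (fob R X) \<otimes>\<^sub>a lact Y) \<cdot> \<alpha> (fob R X) RI (fob R Y)) \<cdot> ((\<phi> \<otimes>\<^sub>a \<iota> RI) \<otimes>\<^sub>a \<psi>)"
      by (simp add: C.natural del: C.merge)
    finally show "(\<phi> \<otimes>\<^sub>a \<psi>) \<cdot> (\<iota> (fst P) \<otimes>\<^sub>a (snd N \<cdot> \<sigma> (fst N))) \<cdot> \<alpha> (fst P) RI (fst N)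
       = ((\<iota> (fob R X) \<otimes>\<^sub>a lact Y) \<cdot> \<alpha> (fob R X) RI (fob R Y)) \<cdot> ((\<phi> \<otimes>\<^sub>a \<iota> RI) \<otimes>\<^sub>a \<psi>)" .
  qed simp_all
qed

lemma proj_coequalizer:
  assumes "is_mod P" "is_mod N"
  shows "is_coequalizer C (snd P \<otimes>\<^sub>a \<iota> (fst N))
    ((\<iota> (fst P) \<otimes>\<^sub>a (snd N \<cdot> \<sigma> (fst N))) \<cdot> \<alpha> (fst P) RI (fst N)) (proj P N)"
proof -
  obtain X \<phi> Y \<psi> where "pres P X \<phi>" "pres N Y \<psi>" using pres_ex assms by metis
  from someI[of "is_coequalizer C (snd P \<otimes>\<^sub>a \<iota> (fst N))
    ((\<iota> (fst P) \<otimes>\<^sub>a (snd N \<cdot> \<sigma> (fst N))) \<cdot> \<alpha> (fst P) RI (fst N))", OF pres_coequalizer[OF this]]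
  show ?thesis by (cases P; cases N) (simp add: mod_proj_def)
qed

lemma fst_tob: "fst (tob P N) = tgt C (proj P N)"
  by (simp add: mod_tens_ob_def Let_def split: prod.splits)

lemma snd_tob: "snd (tob P N) = (THE t. t \<in> Hom C (tgt C (proj P N) \<otimes>\<^sub>o RI) (tgt C (proj P N)) \<and>
      t \<cdot> (proj P N \<otimes>\<^sub>a \<iota> RI) = proj P N \<cdot> (\<iota> (fst P) \<otimes>\<^sub>a snd N) \<cdot> \<alpha> (fst P) (fst N) RI)"
  by (cases P; cases N) (simp add: mod_tens_ob_def Let_def)

lemma proj_typ [simp]:
  assumes "is_mod P" "is_mod N"
  shows "proj P N \<in> Ar C" "src C (proj P N) = fst P \<otimes>\<^sub>o fst N" "tgt C (proj P N) = fst (tob P N)"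
    "epi_ar C (proj P N)" "fst (tob P N) \<in> Ob C"
  using C.coequalizerD(1,2)[OF proj_coequalizer[OF assms]]
    C.coequalizer_epi[OF proj_coequalizer[OF assms]] assms
  by (auto simp: fst_tob)

lemma proj_balanced:
  "\<lbrakk>is_mod P; is_mod N\<rbrakk> \<Longrightarrow> proj P N \<cdot> (snd P \<otimes>\<^sub>a \<iota> (fst N))
    = proj P N \<cdot> (\<iota> (fst P) \<otimes>\<^sub>a (snd N \<cdot> \<sigma> (fst N))) \<cdot> \<alpha> (fst P) RI (fst N)"
  using C.coequalizerD(3)[OF proj_coequalizer[of P N]] .

lemma mod_transport:
  assumes [simp]: "Y \<in> Ob D" "iso_ar C w" "w \<in> Ar C" "src C w = T" "tgt C w = fob R Y"
    "t \<in> Ar C" "src C t = T \<otimes>\<^sub>o RI" "tgt C t = T"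
    and wt: "w \<cdot> t = ract Y \<cdot> (w \<otimes>\<^sub>a \<iota> RI)"
  shows "is_mod (T, t)"
  unfolding is_mod_iff fst_conv snd_conv
proof (intro conjI)
  show [simp]: "T \<in> Ob C" using C.src_Ob[of w] by simp
  show "t \<cdot> (t \<otimes>\<^sub>a \<iota> RI) = t \<cdot> (\<iota> T \<otimes>\<^sub>a lact \<one>\<^sub>o\<^bsub>D\<^esub>) \<cdot> \<alpha> T RI RI"
  proof (rule C.monoD[of w])
    have "w \<cdot> t \<cdot> (t \<otimes>\<^sub>a \<iota> RI) = ract Y \<cdot> ((w \<cdot> t) \<otimes>\<^sub>a \<iota> RI)"
      by (simp add: wt[THEN C.reassoc])
    also have "\<dots> = (ract Y \<cdot> (ract Y \<otimes>\<^sub>a \<iota> RI)) \<cdot> ((w \<otimes>\<^sub>a \<iota> RI) \<otimes>\<^sub>a \<iota> RI)"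
      unfolding wt by simp
    also have "\<dots> = ract Y \<cdot> (\<iota> (fob R Y) \<otimes>\<^sub>a lact \<one>\<^sub>o\<^bsub>D\<^esub>) \<cdot> \<alpha> (fob R Y) RI RI \<cdot> ((w \<otimes>\<^sub>a \<iota> RI) \<otimes>\<^sub>a \<iota> RI)"
      by (simp add: ract_ract)
    also have "\<dots> = ract Y \<cdot> (\<iota> (fob R Y) \<otimes>\<^sub>a lact \<one>\<^sub>o\<^bsub>D\<^esub>) \<cdot> (w \<otimes>\<^sub>a (\<iota> RI \<otimes>\<^sub>a \<iota> RI)) \<cdot> \<alpha> T RI RI"
      by (simp add: C.natural del: C.merge C.tens_ide)
    also have "\<dots> = w \<cdot> t \<cdot> (\<iota> T \<otimes>\<^sub>a lact \<one>\<^sub>o\<^bsub>D\<^esub>) \<cdot> \<alpha> T RI RI"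
      by (simp add: wt[THEN C.reassoc])
    finally show "w \<cdot> t \<cdot> (t \<otimes>\<^sub>a \<iota> RI) = w \<cdot> t \<cdot> (\<iota> T \<otimes>\<^sub>a lact \<one>\<^sub>o\<^bsub>D\<^esub>) \<cdot> \<alpha> T RI RI" .
  qed simp_all
  show "t \<cdot> (\<iota> T \<otimes>\<^sub>a R0) = \<rho> T"
  proof (rule C.monoD[of w])
    have "w \<cdot> t \<cdot> (\<iota> T \<otimes>\<^sub>a R0) = (ract Y \<cdot> (\<iota> (fob R Y) \<otimes>\<^sub>a R0)) \<cdot> (w \<otimes>\<^sub>a \<iota> \<one>\<^sub>o)"
      by (simp add: wt[THEN C.reassoc])
    also have "\<dots> = w \<cdot> \<rho> T" by (simp add: ract_one C.natural)
    finally show "w \<cdot> t \<cdot> (\<iota> T \<otimes>\<^sub>a R0) = w \<cdot> \<rho> T" .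
  qed simp_all
qed simp_all

text \<open>\<open>R2\<close> is a coequalizer of the pair defining the tensor product, so the underlying object is as
  claimed. The action is characterized by its composite with the epimorphism \<open>proj \<otimes> A\<close>, hence
  is the one transported from \<open>R(X \<otimes> Y)\<close>.\<close>

lemma tens_pres:
  assumes P: "pres P X \<phi>" and N: "pres N Y \<psi>"
  obtains \<omega> where "pres (tob P N) (X \<otimes>\<^sub>o\<^bsub>D\<^esub> Y) \<omega>" "\<omega> \<cdot> proj P N = R2 X Y \<cdot> (\<phi> \<otimes>\<^sub>a \<psi>)"
proof -
  note [simp] = presD(1-6)[OF P] presD(1-6)[OF N]
  let ?p = "proj P N" and ?T = "fst (tob P N)" and ?XY = "X \<otimes>\<^sub>o\<^bsub>D\<^esub> Y"
  obtain w where [simp]: "iso_ar C w" "w \<in> Ar C" "src C w = ?T" "tgt C w = fob R ?XY"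
    and w: "w \<cdot> ?p = R2 X Y \<cdot> (\<phi> \<otimes>\<^sub>a \<psi>)"
    by (rule C.coequalizer_unique[OF proj_coequalizer pres_coequalizer[OF P N]]) simp_all
  define t where "t = inv_ar C w \<cdot> ract ?XY \<cdot> (w \<otimes>\<^sub>a \<iota> RI)"
  have [simp]: "t \<in> Ar C" "src C t = ?T \<otimes>\<^sub>o RI" "tgt C t = ?T" by (simp_all add: t_def)
  have "(ract ?XY \<cdot> (w \<otimes>\<^sub>a \<iota> RI)) \<cdot> (?p \<otimes>\<^sub>a \<iota> RI) = ract ?XY \<cdot> (R2 X Y \<otimes>\<^sub>a \<iota> RI) \<cdot> ((\<phi> \<otimes>\<^sub>a \<psi>) \<otimes>\<^sub>a \<iota> RI)"
    by (simp add: w)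
  also have "\<dots> = R2 X Y \<cdot> (\<iota> (fob R X) \<otimes>\<^sub>a ract Y) \<cdot> \<alpha> (fob R X) (fob R Y) RI \<cdot> ((\<phi> \<otimes>\<^sub>a \<psi>) \<otimes>\<^sub>a \<iota> RI)"
    using R2_ract[THEN C.reassoc, of X Y "\<alpha> (fob R X) (fob R Y) RI \<cdot> ((\<phi> \<otimes>\<^sub>a \<psi>) \<otimes>\<^sub>a \<iota> RI)"] by simp
  also have "\<dots> = R2 X Y \<cdot> (\<iota> (fob R X) \<otimes>\<^sub>a ract Y) \<cdot> (\<phi> \<otimes>\<^sub>a (\<psi> \<otimes>\<^sub>a \<iota> RI)) \<cdot> \<alpha> (fst P) (fst N) RI"
    by (simp add: C.natural del: C.merge)
  also have "\<dots> = R2 X Y \<cdot> (\<phi> \<otimes>\<^sub>a \<psi>) \<cdot> (\<iota> (fst P) \<otimes>\<^sub>a snd N) \<cdot> \<alpha> (fst P) (fst N) RI"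
    by (simp add: presD(7)[OF N])
  also have "\<dots> = w \<cdot> ?p \<cdot> (\<iota> (fst P) \<otimes>\<^sub>a snd N) \<cdot> \<alpha> (fst P) (fst N) RI"
    by (simp add: w[THEN C.reassoc])
  finally have "t \<cdot> (?p \<otimes>\<^sub>a \<iota> RI) = inv_ar C w \<cdot> w \<cdot> ?p \<cdot> (\<iota> (fst P) \<otimes>\<^sub>a snd N) \<cdot> \<alpha> (fst P) (fst N) RI"
    by (simp add: t_def)
  hence tp: "t \<cdot> (?p \<otimes>\<^sub>a \<iota> RI) = ?p \<cdot> (\<iota> (fst P) \<otimes>\<^sub>a snd N) \<cdot> \<alpha> (fst P) (fst N) RI"
    by simp
  have "snd (tob P N) = (THE t. t \<in> Hom C (?T \<otimes>\<^sub>o RI) ?T \<and>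
      t \<cdot> (?p \<otimes>\<^sub>a \<iota> RI) = ?p \<cdot> (\<iota> (fst P) \<otimes>\<^sub>a snd N) \<cdot> \<alpha> (fst P) (fst N) RI)"
    by (simp add: snd_tob)
  also have "\<dots> = t"
    using C.the_factor[of "?p \<otimes>\<^sub>a \<iota> RI" t ?T] tp epi_tens_C(1)[of ?p RI] by simp
  finally have t: "snd (tob P N) = t" .
  have wt: "w \<cdot> t = ract ?XY \<cdot> (w \<otimes>\<^sub>a \<iota> RI)" by (simp add: t_def)
  have "is_mod (?T, t)" by (rule mod_transport[of ?XY w]) (simp_all add: wt)
  hence m: "is_mod (tob P N)" by (simp flip: t)
  have "pres (tob P N) ?XY w" using m wt by (simp add: pres_def mhom_def t)
  thus ?thesis using that w by blast
qed

lemma tob_mod [simp]: "\<lbrakk>is_mod P; is_mod N\<rbrakk> \<Longrightarrow> is_mod (tob P N)"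
  by (metis pres_ex presD(2) tens_pres)

text \<open>The underlying arrows of the tensor product of morphisms and, below, of the associators and the
  unitors. In each case presentations provide an arrow with the defining property, and it is the
  only one because the projections are epi.\<close>

definition tar where
  "tar P f P' N g N' = fst (snd (mod_tens_ar C A (P, f, P') (N, g, N')))"

lemma tens_ar_eq: "mod_tens_ar C A (P, f, P') (N, g, N') = (tob P N, tar P f P' N g N', tob P' N')"
  by (simp add: tar_def mod_tens_ar_def Let_def)

lemma tar_props:
  assumes f: "mhom P f P'" and g: "mhom N g N'"
  shows "mhom (tob P N) (tar P f P' N g N') (tob P' N')"
    and "tar P f P' N g N' \<cdot> proj P N = proj P' N' \<cdot> (f \<otimes>\<^sub>a g)"
proof -
  note [simp] = mhomD(1-5)[OF f] mhomD(1-5)[OF g]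
  obtain X \<phi> X' \<phi>' Y \<psi> Y' \<psi>'
    where P: "pres P X \<phi>" and P': "pres P' X' \<phi>'" and N: "pres N Y \<psi>" and N': "pres N' Y' \<psi>'"
    using pres_ex mhomD(1,2)[OF f] mhomD(1,2)[OF g] by metis
  obtain \<omega> where w: "pres (tob P N) (X \<otimes>\<^sub>o\<^bsub>D\<^esub> Y) \<omega>" "\<omega> \<cdot> proj P N = R2 X Y \<cdot> (\<phi> \<otimes>\<^sub>a \<psi>)"
    using tens_pres[OF P N] .
  obtain \<omega>' where w': "pres (tob P' N') (X' \<otimes>\<^sub>o\<^bsub>D\<^esub> Y') \<omega>'" "\<omega>' \<cdot> proj P' N' = R2 X' Y' \<cdot> (\<phi>' \<otimes>\<^sub>a \<psi>')"
    using tens_pres[OF P' N'] .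
  obtain a where [simp]: "a \<in> Ar D" "src D a = X" "tgt D a = X'" and a: "far R a \<cdot> \<phi> = \<phi>' \<cdot> f"
    using pres_mhom[OF f P P'] .
  obtain b where [simp]: "b \<in> Ar D" "src D b = Y" "tgt D b = Y'" and b: "far R b \<cdot> \<psi> = \<psi>' \<cdot> g"
    using pres_mhom[OF g N N'] .
  note [simp] = presD(1-6)[OF P] presD(1-6)[OF P'] presD(1-6)[OF N] presD(1-6)[OF N']
    presD(3-6)[OF w(1)] presD(3-6)[OF w'(1)]
  let ?h = "inv_ar C \<omega>' \<cdot> far R (a \<otimes>\<^sub>a\<^bsub>D\<^esub> b) \<cdot> \<omega>"
  have h: "mhom (tob P N) ?h (tob P' N')" by (rule mhom_pres[OF _ _ _ w(1) w'(1)]) simp_all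
  have "?h \<cdot> proj P N = inv_ar C \<omega>' \<cdot> R2 X' Y' \<cdot> ((far R a \<cdot> \<phi>) \<otimes>\<^sub>a (far R b \<cdot> \<psi>))"
    by (simp add: w(2) R2_natural[THEN C.reassoc])
  also have "\<dots> = inv_ar C \<omega>' \<cdot> (R2 X' Y' \<cdot> (\<phi>' \<otimes>\<^sub>a \<psi>')) \<cdot> (f \<otimes>\<^sub>a g)" unfolding a b by simp
  also have "\<dots> = proj P' N' \<cdot> (f \<otimes>\<^sub>a g)" by (simp flip: w'(2))
  finally have hp: "?h \<cdot> proj P N = proj P' N' \<cdot> (f \<otimes>\<^sub>a g)" .
  have "tar P f P' N g N' = ?h"
    unfolding tar_def mod_tens_ar_def
    using C.the_factor[of "proj P N" ?h "fst (tob P' N')"] hp by (simp add: Let_def)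
  thus "mhom (tob P N) (tar P f P' N g N') (tob P' N')"
    "tar P f P' N g N' \<cdot> proj P N = proj P' N' \<cdot> (f \<otimes>\<^sub>a g)" using h hp by simp_all
qed

lemma triple_epi:
  assumes [simp]: "is_mod P" "is_mod N" "is_mod U"
  shows "epi_ar C (proj (tob P N) U \<cdot> (proj P N \<otimes>\<^sub>a \<iota> (fst U)))"
  using epi_tens_C(1)[of "proj P N" "fst U"] by simp

definition aar where "aar P N U = fst (snd (mod_assoc C A P N U))"

lemma assoc_eq: "mod_assoc C A P N U = (tob (tob P N) U, aar P N U, tob P (tob N U))"
  by (simp add: aar_def mod_assoc_def Let_def)

lemma aar_props:
  assumes P: "is_mod P" and N: "is_mod N" and U: "is_mod U"
  shows "mhom (tob (tob P N) U) (aar P N U) (tob P (tob N U))" "iso_ar C (aar P N U)"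
    "aar P N U \<cdot> proj (tob P N) U \<cdot> (proj P N \<otimes>\<^sub>a \<iota> (fst U))
      = proj P (tob N U) \<cdot> (\<iota> (fst P) \<otimes>\<^sub>a proj N U) \<cdot> \<alpha> (fst P) (fst N) (fst U)"
proof -
  note [simp] = P N U
  obtain X \<phi> Y \<psi> Z \<chi> where P: "pres P X \<phi>" and N: "pres N Y \<psi>" and U: "pres U Z \<chi>"
    using pres_ex assms by metis
  obtain \<omega> where w: "pres (tob P N) (X \<otimes>\<^sub>o\<^bsub>D\<^esub> Y) \<omega>" "\<omega> \<cdot> proj P N = R2 X Y \<cdot> (\<phi> \<otimes>\<^sub>a \<psi>)"
    using tens_pres[OF P N] .
  obtain \<xi> where x: "pres (tob N U) (Y \<otimes>\<^sub>o\<^bsub>D\<^esub> Z) \<xi>" "\<xi> \<cdot> proj N U = R2 Y Z \<cdot> (\<psi> \<otimes>\<^sub>a \<chi>)"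
    using tens_pres[OF N U] .
  obtain \<omega>' where w': "pres (tob (tob P N) U) ((X \<otimes>\<^sub>o\<^bsub>D\<^esub> Y) \<otimes>\<^sub>o\<^bsub>D\<^esub> Z) \<omega>'"
      "\<omega>' \<cdot> proj (tob P N) U = R2 (X \<otimes>\<^sub>o\<^bsub>D\<^esub> Y) Z \<cdot> (\<omega> \<otimes>\<^sub>a \<chi>)"
    using tens_pres[OF w(1) U] .
  obtain \<xi>' where x': "pres (tob P (tob N U)) (X \<otimes>\<^sub>o\<^bsub>D\<^esub> (Y \<otimes>\<^sub>o\<^bsub>D\<^esub> Z)) \<xi>'"
      "\<xi>' \<cdot> proj P (tob N U) = R2 X (Y \<otimes>\<^sub>o\<^bsub>D\<^esub> Z) \<cdot> (\<phi> \<otimes>\<^sub>a \<xi>)"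
    using tens_pres[OF P x(1)] .
  note [simp] = presD(1-6)[OF P] presD(1-6)[OF N] presD(1-6)[OF U] presD(3-6)[OF w(1)] presD(3-6)[OF w'(1)]
    presD(3-6)[OF x(1)] presD(3-6)[OF x'(1)]
  let ?h = "inv_ar C \<xi>' \<cdot> far R (\<alpha>\<^bsub>D\<^esub> X Y Z) \<cdot> \<omega>'" and ?x = "fob R X" and ?y = "fob R Y" and ?z = "fob R Z"
  let ?a = "\<alpha> (fst P) (fst N) (fst U)"
  have h: "mhom (tob (tob P N) U) ?h (tob P (tob N U))" by (rule mhom_pres[OF _ _ _ w'(1) x'(1)]) simp_all
  have "\<xi>' \<cdot> ?h \<cdot> proj (tob P N) U \<cdot> (proj P N \<otimes>\<^sub>a \<iota> (fst U))
      = far R (\<alpha>\<^bsub>D\<^esub> X Y Z) \<cdot> R2 (X \<otimes>\<^sub>o\<^bsub>D\<^esub> Y) Z \<cdot> ((\<omega> \<cdot> proj P N) \<otimes>\<^sub>a \<chi>)"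
    by (simp add: w'(2)[THEN C.reassoc])
  also have "\<dots> = (far R (\<alpha>\<^bsub>D\<^esub> X Y Z) \<cdot> R2 (X \<otimes>\<^sub>o\<^bsub>D\<^esub> Y) Z \<cdot> (R2 X Y \<otimes>\<^sub>a \<iota> ?z)) \<cdot> ((\<phi> \<otimes>\<^sub>a \<psi>) \<otimes>\<^sub>a \<chi>)"
    unfolding w(2) by simp
  also have "\<dots> = R2 X (Y \<otimes>\<^sub>o\<^bsub>D\<^esub> Z) \<cdot> (\<iota> ?x \<otimes>\<^sub>a R2 Y Z) \<cdot> \<alpha> ?x ?y ?z \<cdot> ((\<phi> \<otimes>\<^sub>a \<psi>) \<otimes>\<^sub>a \<chi>)"
    by (simp add: R2_assoc)
  also have "\<dots> = R2 X (Y \<otimes>\<^sub>o\<^bsub>D\<^esub> Z) \<cdot> (\<iota> ?x \<otimes>\<^sub>a R2 Y Z) \<cdot> (\<phi> \<otimes>\<^sub>a (\<psi> \<otimes>\<^sub>a \<chi>)) \<cdot> ?a"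
    by (simp add: C.natural del: C.merge)
  also have "\<dots> = R2 X (Y \<otimes>\<^sub>o\<^bsub>D\<^esub> Z) \<cdot> (\<phi> \<otimes>\<^sub>a (\<xi> \<cdot> proj N U)) \<cdot> ?a"
    unfolding x(2) by simp
  also have "\<dots> = \<xi>' \<cdot> proj P (tob N U) \<cdot> (\<iota> (fst P) \<otimes>\<^sub>a proj N U) \<cdot> ?a"
    by (simp add: x'(2)[THEN C.reassoc])
  finally have hp: "?h \<cdot> proj (tob P N) U \<cdot> (proj P N \<otimes>\<^sub>a \<iota> (fst U))
      = proj P (tob N U) \<cdot> (\<iota> (fst P) \<otimes>\<^sub>a proj N U) \<cdot> ?a"
    by (rule C.monoD[of \<xi>', rotated]) simp_all
  have "aar P N U = ?h"
    unfolding aar_def mod_assoc_def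
    using C.the_factor[OF triple_epi[of P N U], of ?h "fst (tob P (tob N U))"] hp by (simp add: Let_def)
  thus "mhom (tob (tob P N) U) (aar P N U) (tob P (tob N U))" "iso_ar C (aar P N U)"
    "aar P N U \<cdot> proj (tob P N) U \<cdot> (proj P N \<otimes>\<^sub>a \<iota> (fst U))
      = proj P (tob N U) \<cdot> (\<iota> (fst P) \<otimes>\<^sub>a proj N U) \<cdot> ?a" using h hp by simp_all
qed

definition lar where "lar P = fst (snd (mod_lunit C A P))"
definition rar where "rar P = fst (snd (mod_runit C A P))"

lemma unit_eq: "mod_lunit C A P = (tob munit P, lar P, P)" "mod_runit C A P = (tob P munit, rar P, P)"
  by (simp_all add: lar_def rar_def mod_lunit_def mod_runit_def Let_def split: prod.splits)

lemma lar_eq: "lar P = (THE h. h \<in> Hom C (fst (tob munit P)) (fst P) \<and> h \<cdot> proj munit P = snd P \<cdot> \<sigma> (fst P))"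
  and rar_eq: "rar P = (THE h. h \<in> Hom C (fst (tob P munit)) (fst P) \<and> h \<cdot> proj P munit = snd P)"
  by (cases P; simp add: lar_def mod_lunit_def rar_def mod_runit_def Let_def)+

lemma lar_props:
  assumes P: "is_mod P"
  shows "mhom (tob munit P) (lar P) P" "iso_ar C (lar P)" "lar P \<cdot> proj munit P = snd P \<cdot> \<sigma> (fst P)"
proof -
  note [simp] = P
  obtain X \<phi> where P: "pres P X \<phi>" using pres_ex assms by metis
  have U: "pres munit \<one>\<^sub>o\<^bsub>D\<^esub> (\<iota> RI)" using pres_kob[of "\<one>\<^sub>o\<^bsub>D\<^esub>"] by (simp add: munit_eq)
  obtain \<omega> where w: "pres (tob munit P) (\<one>\<^sub>o\<^bsub>D\<^esub> \<otimes>\<^sub>o\<^bsub>D\<^esub> X) \<omega>" "\<omega> \<cdot> proj munit P = R2 \<one>\<^sub>o\<^bsub>D\<^esub> X \<cdot> (\<iota> RI \<otimes>\<^sub>a \<phi>)"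
    using tens_pres[OF U P] .
  note [simp] = presD(1-6)[OF P] presD(3-6)[OF w(1)]
  let ?h = "inv_ar C \<phi> \<cdot> far R (\<lambda>\<^sub>l\<^bsub>D\<^esub> X) \<cdot> \<omega>"
  have h: "mhom (tob munit P) ?h P" by (rule mhom_pres[OF _ _ _ w(1) P]) simp_all
  have "\<phi> \<cdot> ?h \<cdot> proj munit P = lact X \<cdot> (\<iota> RI \<otimes>\<^sub>a \<phi>)" by (simp add: w(2) lact_def)
  also have "\<dots> = \<phi> \<cdot> snd P \<cdot> \<sigma> (fst P)" by (simp add: action_braiding[OF P])
  finally have hp: "?h \<cdot> proj munit P = snd P \<cdot> \<sigma> (fst P)"
    by (rule C.monoD[of \<phi>, rotated]) simp_all
  have "lar P = ?h"
    unfolding lar_eq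
    using C.the_factor[of "proj munit P" ?h "fst P"] hp by simp
  thus "mhom (tob munit P) (lar P) P" "iso_ar C (lar P)" "lar P \<cdot> proj munit P = snd P \<cdot> \<sigma> (fst P)"
    using h hp by simp_all
qed

lemma rar_props:
  assumes P: "is_mod P"
  shows "mhom (tob P munit) (rar P) P" "iso_ar C (rar P)" "rar P \<cdot> proj P munit = snd P"
proof -
  note [simp] = P
  obtain X \<phi> where P: "pres P X \<phi>" using pres_ex assms by metis
  have U: "pres munit \<one>\<^sub>o\<^bsub>D\<^esub> (\<iota> RI)" using pres_kob[of "\<one>\<^sub>o\<^bsub>D\<^esub>"] by (simp add: munit_eq)
  obtain \<omega> where w: "pres (tob P munit) (X \<otimes>\<^sub>o\<^bsub>D\<^esub> \<one>\<^sub>o\<^bsub>D\<^esub>) \<omega>" "\<omega> \<cdot> proj P munit = R2 X \<one>\<^sub>o\<^bsub>D\<^esub> \<cdot> (\<phi> \<otimes>\<^sub>a \<iota> RI)"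
    using tens_pres[OF P U] .
  note [simp] = presD(1-6)[OF P] presD(3-6)[OF w(1)]
  let ?h = "inv_ar C \<phi> \<cdot> far R (\<rho>\<^bsub>D\<^esub> X) \<cdot> \<omega>"
  have h: "mhom (tob P munit) ?h P" by (rule mhom_pres[OF _ _ _ w(1) P]) simp_all
  have "\<phi> \<cdot> ?h \<cdot> proj P munit = ract X \<cdot> (\<phi> \<otimes>\<^sub>a \<iota> RI)" by (simp add: w(2) ract_def)
  also have "\<dots> = \<phi> \<cdot> snd P" by (simp add: presD(7)[OF P])
  finally have hp: "?h \<cdot> proj P munit = snd P"
    by (rule C.monoD[of \<phi>, rotated]) simp_all
  have "rar P = ?h"
    unfolding rar_eq
    using C.the_factor[of "proj P munit" ?h "fst P"] hp by simp
  thus "mhom (tob P munit) (rar P) P" "iso_ar C (rar P)" "rar P \<cdot> proj P munit = snd P"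
    using h hp by simp_all
qed

end

section \<open>The monoidal structure on modules\<close>

context faithful_exact_adjunction
begin

text \<open>The coherence laws hold because they hold in \<open>C\<close>: composition with the projections, which
  are epi, replaces every structure arrow of modules by the one of \<open>C\<close>.\<close>

lemma aar_nat:
  assumes f: "mhom P f P'" and g: "mhom N g N'" and h: "mhom U h U'"
  shows "aar P' N' U' \<cdot> tar (tob P N) (tar P f P' N g N') (tob P' N') U h U'
    = tar P f P' (tob N U) (tar N g N' U h U') (tob N' U') \<cdot> aar P N U" (is "?l = ?r")
proof -
  note m [simp] = mhomD(1-5)[OF f] mhomD(1-5)[OF g] mhomD(1-5)[OF h]
  note fg = tar_props[OF f g] and gh = tar_props[OF g h]
  note fg_h = tar_props[OF fg(1) h] and f_gh = tar_props[OF f gh(1)]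
  note a = aar_props[OF m(1,6,11)] and a' = aar_props[OF m(2,7,12)]
  note [simp] = mhomD(3-5)[OF fg(1)] mhomD(3-5)[OF gh(1)] mhomD(3-5)[OF fg_h(1)] mhomD(3-5)[OF f_gh(1)]
    mhomD(3-5)[OF a(1)] mhomD(3-5)[OF a'(1)]
  let ?e = "proj (tob P N) U \<cdot> (proj P N \<otimes>\<^sub>a \<iota> (fst U))"
  let ?fg = "tar P f P' N g N'" and ?gh = "tar N g N' U h U'" and ?\<alpha> = "\<alpha> (fst P) (fst N) (fst U)"
  show ?thesis
  proof (rule C.epiD[OF triple_epi[OF m(1,6,11)]])
    have "?l \<cdot> ?e = aar P' N' U' \<cdot> (proj (tob P' N') U' \<cdot> (?fg \<otimes>\<^sub>a h)) \<cdot> (proj P N \<otimes>\<^sub>a \<iota> (fst U))"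
      by (simp add: fg_h(2)[THEN C.reassoc])
    also have "\<dots> = (aar P' N' U' \<cdot> proj (tob P' N') U' \<cdot> (proj P' N' \<otimes>\<^sub>a \<iota> (fst U'))) \<cdot> ((f \<otimes>\<^sub>a g) \<otimes>\<^sub>a h)"
      by (simp add: fg(2))
    also have "\<dots> = proj P' (tob N' U') \<cdot> (\<iota> (fst P') \<otimes>\<^sub>a proj N' U') \<cdot> (\<alpha> (fst P') (fst N') (fst U') \<cdot> ((f \<otimes>\<^sub>a g) \<otimes>\<^sub>a h))"
      by (simp only: a'(3)) simp
    also have "\<dots> = proj P' (tob N' U') \<cdot> (\<iota> (fst P') \<otimes>\<^sub>a proj N' U') \<cdot> (f \<otimes>\<^sub>a (g \<otimes>\<^sub>a h)) \<cdot> ?\<alpha>"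
      by (simp add: C.natural del: C.merge)
    also have "\<dots> = (proj P' (tob N' U') \<cdot> (f \<otimes>\<^sub>a ?gh)) \<cdot> (\<iota> (fst P) \<otimes>\<^sub>a proj N U) \<cdot> ?\<alpha>"
      by (simp add: gh(2))
    also have "\<dots> = tar P f P' (tob N U) ?gh (tob N' U') \<cdot> (proj P (tob N U) \<cdot> (\<iota> (fst P) \<otimes>\<^sub>a proj N U) \<cdot> ?\<alpha>)"
      by (simp only: f_gh(2)[symmetric]) simp
    also have "\<dots> = ?r \<cdot> ?e" by (simp only: a(3)[symmetric]) simp
    finally show "?l \<cdot> ?e = ?r \<cdot> ?e" .
  qed simp_all
qed

lemma aar_pentagon:
  assumes m [simp]: "is_mod P" "is_mod N" "is_mod U" "is_mod V"
  shows "aar P N (tob U V) \<cdot> aar (tob P N) U V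
    = tar P (\<iota> (fst P)) P (tob (tob N U) V) (aar N U V) (tob N (tob U V))
      \<cdot> aar P (tob N U) V \<cdot> tar (tob (tob P N) U) (aar P N U) (tob P (tob N U)) V (\<iota> (fst V)) V"
    (is "?l = ?t1 \<cdot> ?a \<cdot> ?t2")
proof -
  let ?P = "\<iota> (fst P)" and ?N = "\<iota> (fst N)" and ?U = "\<iota> (fst U)" and ?V = "\<iota> (fst V)"
  note a1 = aar_props[OF m(1,2), of "tob U V"] and a2 = aar_props[OF tob_mod[OF m(1,2)] m(3,4)]
    and a3 = aar_props[OF m(2-4)] and a4 = aar_props[OF m(1) tob_mod[OF m(2,3)] m(4)]
    and a5 = aar_props[OF m(1-3)]
  note t1 = tar_props[OF mhom_ide[OF m(1)] a3(1)] and t2 = tar_props[OF a5(1) mhom_ide[OF m(4)]]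
  note [simp] = mhomD(3-5)[OF a1(1)] mhomD(3-5)[OF a2(1)] mhomD(3-5)[OF a3(1)] mhomD(3-5)[OF a4(1)]
    mhomD(3-5)[OF a5(1)] mhomD(3-5)[OF t1(1)] mhomD(3-5)[OF t2(1)]
  let ?q = "proj (tob (tob P N) U) V" and ?w = "proj (tob P N) U"
  let ?e = "?q \<cdot> ((?w \<cdot> (proj P N \<otimes>\<^sub>a ?U)) \<otimes>\<^sub>a ?V)"
  let ?F = "proj P (tob N (tob U V)) \<cdot> (?P \<otimes>\<^sub>a (proj N (tob U V) \<cdot> (?N \<otimes>\<^sub>a proj U V)))"
  have e: "epi_ar C ?e"
    using epi_tens_C(1)[OF triple_epi[OF m(1-3)], of "fst V"] by simp
  have "?l \<cdot> ?e = aar P N (tob U V) \<cdot> (aar (tob P N) U V \<cdot> ?q \<cdot> (?w \<otimes>\<^sub>a ?V)) \<cdot> ((proj P N \<otimes>\<^sub>a ?U) \<otimes>\<^sub>a ?V)"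
    by simp
  also have "\<dots> = aar P N (tob U V) \<cdot> proj (tob P N) (tob U V) \<cdot> (\<iota> (fst (tob P N)) \<otimes>\<^sub>a proj U V)
      \<cdot> \<alpha> (fst (tob P N)) (fst U) (fst V) \<cdot> ((proj P N \<otimes>\<^sub>a ?U) \<otimes>\<^sub>a ?V)"
    by (simp only: a2(3)) simp
  also have "\<dots> = aar P N (tob U V) \<cdot> proj (tob P N) (tob U V) \<cdot> (\<iota> (fst (tob P N)) \<otimes>\<^sub>a proj U V)
      \<cdot> (proj P N \<otimes>\<^sub>a (?U \<otimes>\<^sub>a ?V)) \<cdot> \<alpha> (fst P \<otimes>\<^sub>o fst N) (fst U) (fst V)"
    by (simp add: C.natural del: C.merge C.tens_ide)
  also have "\<dots> = (aar P N (tob U V) \<cdot> proj (tob P N) (tob U V) \<cdot> (proj P N \<otimes>\<^sub>a \<iota> (fst (tob U V))))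
      \<cdot> (\<iota> (fst P \<otimes>\<^sub>o fst N) \<otimes>\<^sub>a proj U V) \<cdot> \<alpha> (fst P \<otimes>\<^sub>o fst N) (fst U) (fst V)"
    by simp
  also have "\<dots> = proj P (tob N (tob U V)) \<cdot> (?P \<otimes>\<^sub>a proj N (tob U V)) \<cdot> \<alpha> (fst P) (fst N) (fst (tob U V))
      \<cdot> (\<iota> (fst P \<otimes>\<^sub>o fst N) \<otimes>\<^sub>a proj U V) \<cdot> \<alpha> (fst P \<otimes>\<^sub>o fst N) (fst U) (fst V)"
    using a1(3) by (simp only: tob_mod m) simp
  also have "\<dots> = proj P (tob N (tob U V)) \<cdot> (?P \<otimes>\<^sub>a proj N (tob U V)) \<cdot> (?P \<otimes>\<^sub>a (?N \<otimes>\<^sub>a proj U V))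
      \<cdot> \<alpha> (fst P) (fst N) (fst U \<otimes>\<^sub>o fst V) \<cdot> \<alpha> (fst P \<otimes>\<^sub>o fst N) (fst U) (fst V)"
    by (simp add: C.natural del: C.merge)
  also have "\<dots> = ?F \<cdot> \<alpha> (fst P) (fst N) (fst U \<otimes>\<^sub>o fst V) \<cdot> \<alpha> (fst P \<otimes>\<^sub>o fst N) (fst U) (fst V)"
    by simp
  also have "\<dots> = ?F \<cdot> (?P \<otimes>\<^sub>a \<alpha> (fst N) (fst U) (fst V)) \<cdot> \<alpha> (fst P) (fst N \<otimes>\<^sub>o fst U) (fst V)
      \<cdot> (\<alpha> (fst P) (fst N) (fst U) \<otimes>\<^sub>a ?V)"
    by (simp add: C.pentagon)
  finally have l: "?l \<cdot> ?e = \<dots>" .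
  have "(?t1 \<cdot> ?a \<cdot> ?t2) \<cdot> ?e
      = ?t1 \<cdot> ?a \<cdot> (?t2 \<cdot> ?q) \<cdot> ((?w \<cdot> (proj P N \<otimes>\<^sub>a ?U)) \<otimes>\<^sub>a ?V)" by simp
  also have "\<dots> = ?t1 \<cdot> ?a \<cdot> proj (tob P (tob N U)) V \<cdot> ((aar P N U \<cdot> ?w \<cdot> (proj P N \<otimes>\<^sub>a ?U)) \<otimes>\<^sub>a ?V)"
    by (simp only: t2(2)) simp
  also have "\<dots> = ?t1 \<cdot> (?a \<cdot> proj (tob P (tob N U)) V \<cdot> (proj P (tob N U) \<otimes>\<^sub>a ?V))
      \<cdot> ((?P \<otimes>\<^sub>a proj N U) \<otimes>\<^sub>a ?V) \<cdot> (\<alpha> (fst P) (fst N) (fst U) \<otimes>\<^sub>a ?V)"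
    by (simp only: a5(3)) simp
  also have "\<dots> = ?t1 \<cdot> proj P (tob (tob N U) V) \<cdot> (?P \<otimes>\<^sub>a proj (tob N U) V)
     \<cdot> (\<alpha> (fst P) (fst (tob N U)) (fst V) \<cdot> ((?P \<otimes>\<^sub>a proj N U) \<otimes>\<^sub>a ?V)) \<cdot> (\<alpha> (fst P) (fst N) (fst U) \<otimes>\<^sub>a ?V)"
    by (simp only: a4(3)) simp
  also have "\<dots> = (?t1 \<cdot> proj P (tob (tob N U) V)) \<cdot> (?P \<otimes>\<^sub>a (proj (tob N U) V \<cdot> (proj N U \<otimes>\<^sub>a ?V)))
     \<cdot> \<alpha> (fst P) (fst N \<otimes>\<^sub>o fst U) (fst V) \<cdot> (\<alpha> (fst P) (fst N) (fst U) \<otimes>\<^sub>a ?V)"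
    by (simp add: C.assoc_natural C.assoc_natural[THEN C.reassoc])
  also have "\<dots> = proj P (tob N (tob U V)) \<cdot> (?P \<otimes>\<^sub>a (aar N U V \<cdot> proj (tob N U) V \<cdot> (proj N U \<otimes>\<^sub>a ?V)))
     \<cdot> \<alpha> (fst P) (fst N \<otimes>\<^sub>o fst U) (fst V) \<cdot> (\<alpha> (fst P) (fst N) (fst U) \<otimes>\<^sub>a ?V)"
    by (simp only: t1(2)) simp
  also have "\<dots> = ?F \<cdot> (?P \<otimes>\<^sub>a \<alpha> (fst N) (fst U) (fst V)) \<cdot> \<alpha> (fst P) (fst N \<otimes>\<^sub>o fst U) (fst V)
      \<cdot> (\<alpha> (fst P) (fst N) (fst U) \<otimes>\<^sub>a ?V)"
    by (simp only: a3(3)) simp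
  finally have "?l \<cdot> ?e = (?t1 \<cdot> ?a \<cdot> ?t2) \<cdot> ?e" unfolding l ..
  thus ?thesis by (rule C.epiD[OF e]) simp_all
qed

lemma aar_triangle:
  assumes m [simp]: "is_mod P" "is_mod N"
  shows "tar P (\<iota> (fst P)) P (tob munit N) (lar N) N \<cdot> aar P munit N
    = tar (tob P munit) (rar P) P N (\<iota> (fst N)) N" (is "?t1 \<cdot> ?a = ?t2")
proof -
  note a = aar_props[OF m(1) munit_mod(1) m(2)] and l = lar_props[OF m(2)] and r = rar_props[OF m(1)]
  note t1 = tar_props[OF mhom_ide[OF m(1)] l(1)] and t2 = tar_props[OF r(1) mhom_ide[OF m(2)]]
  note [simp] = mhomD(3-5)[OF a(1)] mhomD(3-5)[OF l(1)] mhomD(3-5)[OF r(1)] mhomD(3-5)[OF t1(1)] mhomD(3-5)[OF t2(1)]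
  let ?e = "proj (tob P munit) N \<cdot> (proj P munit \<otimes>\<^sub>a \<iota> (fst N))"
  show ?thesis
  proof (rule C.epiD[OF triple_epi[OF m(1) munit_mod(1) m(2)]])
    have "(?t1 \<cdot> ?a) \<cdot> ?e = ?t1 \<cdot> (?a \<cdot> ?e)" by simp
    also have "\<dots> = (?t1 \<cdot> proj P (tob munit N)) \<cdot> (\<iota> (fst P) \<otimes>\<^sub>a proj munit N) \<cdot> \<alpha> (fst P) RI (fst N)"
      by (simp only: a(3)) simp
    also have "\<dots> = proj P N \<cdot> (\<iota> (fst P) \<otimes>\<^sub>a (lar N \<cdot> proj munit N)) \<cdot> \<alpha> (fst P) RI (fst N)"
      by (simp only: t1(2)) simp
    also have "\<dots> = proj P N \<cdot> ((rar P \<cdot> proj P munit) \<otimes>\<^sub>a \<iota> (fst N))"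
      by (simp only: l(3) r(3) proj_balanced m)
    also have "\<dots> = (proj P N \<cdot> (rar P \<otimes>\<^sub>a \<iota> (fst N))) \<cdot> (proj P munit \<otimes>\<^sub>a \<iota> (fst N))"
      by simp
    also have "\<dots> = ?t2 \<cdot> ?e" by (simp only: t2(2)[symmetric]) simp
    finally show "(?t1 \<cdot> ?a) \<cdot> ?e = ?t2 \<cdot> ?e" .
  qed simp_all
qed

lemma E_monoidal: "monoidal_category E"
proof (intro monoidal_category.intro monoidal_category_axioms.intro)
  show "category E" by (rule EL.category_axioms)
  fix X Y f assume "f \<in> Hom E X Y"
  then obtain u where f: "f = (X, u, Y)" "mhom X u Y" by (auto simp: Hom_E)
  note m [simp] = mhomD(1-5)[OF f(2)]
  note l = lar_props[OF m(1)] lar_props[OF m(2)] and r = rar_props[OF m(1)] rar_props[OF m(2)]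
  note t = tar_props[OF mhom_ide[OF munit_mod(1)] f(2), unfolded munit_mod(2)]
    tar_props[OF f(2) mhom_ide[OF munit_mod(1)], unfolded munit_mod(2)]
  note [simp] = mhomD(3-5)[OF l(1)] mhomD(3-5)[OF l(4)] mhomD(3-5)[OF r(1)] mhomD(3-5)[OF r(4)]
    mhomD(3-5)[OF t(1)] mhomD(3-5)[OF t(3)]
  have "lar Y \<cdot> tar munit (\<iota> RI) munit X u Y = u \<cdot> lar X"
  proof (rule C.epiD[of "proj munit X"])
    have "(lar Y \<cdot> tar munit (\<iota> RI) munit X u Y) \<cdot> proj munit X = (lar Y \<cdot> proj munit Y) \<cdot> (\<iota> RI \<otimes>\<^sub>a u)"
      using t(2) by simp
    also have "\<dots> = snd Y \<cdot> \<sigma> (fst Y) \<cdot> (\<iota> RI \<otimes>\<^sub>a u)" by (simp only: l(6)) simp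
    also have "\<dots> = (snd Y \<cdot> (u \<otimes>\<^sub>a \<iota> RI)) \<cdot> \<sigma> (fst X)" by (simp add: braiding_natural)
    also have "\<dots> = (u \<cdot> lar X) \<cdot> proj munit X" using l(3) by (simp add: mhomD(6)[OF f(2), symmetric])
    finally show "(lar Y \<cdot> tar munit (\<iota> RI) munit X u Y) \<cdot> proj munit X = (u \<cdot> lar X) \<cdot> proj munit X" .
  qed (use t in simp_all)
  thus "\<lambda>\<^sub>l\<^bsub>E\<^esub> Y \<cdot>\<^bsub>E\<^esub> (\<iota>\<^bsub>E\<^esub> \<one>\<^sub>o\<^bsub>E\<^esub> \<otimes>\<^sub>a\<^bsub>E\<^esub> f) = f \<cdot>\<^bsub>E\<^esub> \<lambda>\<^sub>l\<^bsub>E\<^esub> X" by (simp add: f unit_eq tens_ar_eq)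
  have "rar Y \<cdot> tar X u Y munit (\<iota> RI) munit = u \<cdot> rar X"
  proof (rule C.epiD[of "proj X munit"])
    have "(rar Y \<cdot> tar X u Y munit (\<iota> RI) munit) \<cdot> proj X munit = (rar Y \<cdot> proj Y munit) \<cdot> (u \<otimes>\<^sub>a \<iota> RI)"
      using t(4) by simp
    also have "\<dots> = snd Y \<cdot> (u \<otimes>\<^sub>a \<iota> RI)" by (simp only: r(6))
    also have "\<dots> = (u \<cdot> rar X) \<cdot> proj X munit" using r(3) by (simp add: mhomD(6)[OF f(2), symmetric])
    finally show "(rar Y \<cdot> tar X u Y munit (\<iota> RI) munit) \<cdot> proj X munit = (u \<cdot> rar X) \<cdot> proj X munit" .
  qed (use t in simp_all)
  thus "\<rho>\<^bsub>E\<^esub> Y \<cdot>\<^bsub>E\<^esub> (f \<otimes>\<^sub>a\<^bsub>E\<^esub> \<iota>\<^bsub>E\<^esub> \<one>\<^sub>o\<^bsub>E\<^esub>) = f \<cdot>\<^bsub>E\<^esub> \<rho>\<^bsub>E\<^esub> X" by (simp add: f unit_eq tens_ar_eq)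
next
  fix f X X' f' X'' g Y Y' g' Y''
  assume "f \<in> Hom E X X'" "f' \<in> Hom E X' X''" "g \<in> Hom E Y Y'" "g' \<in> Hom E Y' Y''"
  then obtain a a' b b' where f: "f = (X, a, X')" "mhom X a X'" and f': "f' = (X', a', X'')" "mhom X' a' X''"
    and g: "g = (Y, b, Y')" "mhom Y b Y'" and g': "g' = (Y', b', Y'')" "mhom Y' b' Y''"
    by (auto simp: Hom_E)
  note m [simp] = mhomD(1-5)[OF f(2)] mhomD(1-5)[OF f'(2)] mhomD(1-5)[OF g(2)] mhomD(1-5)[OF g'(2)]
  note t = tar_props[OF f(2) g(2)] tar_props[OF f'(2) g'(2)]
    tar_props[OF mhom_cmp[OF f(2) f'(2)] mhom_cmp[OF g(2) g'(2)]]
  note [simp] = mhomD(3-5)[OF t(1)] mhomD(3-5)[OF t(3)] mhomD(3-5)[OF t(5)]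
  have "tar X (a' \<cdot> a) X'' Y (b' \<cdot> b) Y'' = tar X' a' X'' Y' b' Y'' \<cdot> tar X a X' Y b Y'"
    by (rule C.epiD[of "proj X Y"]) (simp_all add: t(2,4,6) t(4)[THEN C.reassoc])
  thus "(f' \<cdot>\<^bsub>E\<^esub> f) \<otimes>\<^sub>a\<^bsub>E\<^esub> (g' \<cdot>\<^bsub>E\<^esub> g) = (f' \<otimes>\<^sub>a\<^bsub>E\<^esub> g') \<cdot>\<^bsub>E\<^esub> (f \<otimes>\<^sub>a\<^bsub>E\<^esub> g)" by (simp add: f f' g g' tens_ar_eq)
next
  fix X Y assume "X \<in> Ob E" "Y \<in> Ob E"
  hence m [simp]: "is_mod X" "is_mod Y" by simp_all
  note t = tar_props[OF mhom_ide[OF m(1)] mhom_ide[OF m(2)]]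
  note [simp] = mhomD(3-5)[OF t(1)]
  have "tar X (\<iota> (fst X)) X Y (\<iota> (fst Y)) Y = \<iota> (fst (tob X Y))"
    by (rule C.epiD[of "proj X Y"]) (simp_all add: t(2))
  thus "\<iota>\<^bsub>E\<^esub> X \<otimes>\<^sub>a\<^bsub>E\<^esub> \<iota>\<^bsub>E\<^esub> Y = \<iota>\<^bsub>E\<^esub> (X \<otimes>\<^sub>o\<^bsub>E\<^esub> Y)" by (simp add: tens_ar_eq)
  show "(\<iota>\<^bsub>E\<^esub> X \<otimes>\<^sub>a\<^bsub>E\<^esub> \<lambda>\<^sub>l\<^bsub>E\<^esub> Y) \<cdot>\<^bsub>E\<^esub> \<alpha>\<^bsub>E\<^esub> X \<one>\<^sub>o\<^bsub>E\<^esub> Y = \<rho>\<^bsub>E\<^esub> X \<otimes>\<^sub>a\<^bsub>E\<^esub> \<iota>\<^bsub>E\<^esub> Y"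
    by (simp add: tens_ar_eq assoc_eq unit_eq aar_triangle)
qed (auto simp: Hom_E tens_ar_eq assoc_eq unit_eq tar_props(1) aar_props(1) lar_props(1) rar_props(1)
    aar_nat aar_pentagon intro!: iso_E(1) aar_props(2) lar_props(2) rar_props(2))

sublocale EM: monoidal_category E
  by (rule E_monoidal)

lemma tar_add:
  assumes f: "mhom P f P'" and f': "mhom P f' P'" and g: "mhom N g N'" and g': "mhom N g' N'"
  shows "tar P (add_ar C f f') P' N g N' = add_ar C (tar P f P' N g N') (tar P f' P' N g N')"
    "tar P f P' N (add_ar C g g') N' = add_ar C (tar P f P' N g N') (tar P f P' N g' N')"
proof -
  note [simp] = mhomD(1-5)[OF f] mhomD(1-5)[OF f'] mhomD(1-5)[OF g] mhomD(1-5)[OF g']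
  note t = tar_props[OF f g] tar_props[OF f' g] tar_props[OF mhom_add[OF f f'] g]
    tar_props[OF f g'] tar_props[OF f mhom_add[OF g g']]
  note [simp] = mhomD(3-5)[OF t(1)] mhomD(3-5)[OF t(3)] mhomD(3-5)[OF t(5)] mhomD(3-5)[OF t(7)] mhomD(3-5)[OF t(9)]
  show "tar P (add_ar C f f') P' N g N' = add_ar C (tar P f P' N g N') (tar P f' P' N g N')"
    using C.tens_add_left[of f "fst P" "fst P'" f' g "fst N" "fst N'"]
    by (intro C.epiD[of "proj P N" "tar P (add_ar C f f') P' N g N'"])
      (simp_all add: t(2,4,6) C.add_cmp C.cmp_add C.in_Hom)
  show "tar P f P' N (add_ar C g g') N' = add_ar C (tar P f P' N g N') (tar P f P' N g' N')"
    using C.tens_add_right[of f "fst P" "fst P'" g "fst N" "fst N'" g']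
    by (intro C.epiD[of "proj P N" "tar P f P' N (add_ar C g g') N'"])
      (simp_all add: t(2,8,10) C.add_cmp C.cmp_add C.in_Hom)
qed

lemma tar_smul:
  assumes f: "mhom P f P'" and g: "mhom N g N'" and [simp]: "c \<in> carrier k"
  shows "tar P (smul_ar C c f) P' N g N' = smul_ar C c (tar P f P' N g N')"
    "tar P f P' N (smul_ar C c g) N' = smul_ar C c (tar P f P' N g N')"
proof -
  note [simp] = mhomD(1-5)[OF f] mhomD(1-5)[OF g]
  note t = tar_props[OF f g] tar_props[OF mhom_smul[OF f assms(3)] g] tar_props[OF f mhom_smul[OF g assms(3)]]
  note [simp] = mhomD(3-5)[OF t(1)] mhomD(3-5)[OF t(3)] mhomD(3-5)[OF t(5)]
  show "tar P (smul_ar C c f) P' N g N' = smul_ar C c (tar P f P' N g N')"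
    using C.tens_smul_left[of c f "fst P" "fst P'" g "fst N" "fst N'"]
    by (intro C.epiD[of "proj P N" "tar P (smul_ar C c f) P' N g N'"])
      (simp_all add: t(2,4) C.smul_cmp C.cmp_smul C.in_Hom)
  show "tar P f P' N (smul_ar C c g) N' = smul_ar C c (tar P f P' N g N')"
    using C.tens_smul_right[of c f "fst P" "fst P'" g "fst N" "fst N'"]
    by (intro C.epiD[of "proj P N" "tar P f P' N (smul_ar C c g) N'"])
      (simp_all add: t(2,6) C.smul_cmp C.cmp_smul C.in_Hom)
qed

section \<open>The comparison functor\<close>

text \<open>The comparison functor sends \<open>Y\<close> to the module \<open>R Y\<close>. Its monoidal structure is the
  factorization of \<open>R2\<close> through the tensor product of modules, so that its coherence is that of
  \<open>R2\<close>.\<close>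

definition kmu where
  "kmu X Y = (SOME w. pres (tob (kob X) (kob Y)) (X \<otimes>\<^sub>o\<^bsub>D\<^esub> Y) w \<and> w \<cdot> proj (kob X) (kob Y) = R2 X Y)"

lemma kmu_props:
  assumes X: "X \<in> Ob D" and Y: "Y \<in> Ob D"
  shows "pres (tob (kob X) (kob Y)) (X \<otimes>\<^sub>o\<^bsub>D\<^esub> Y) (kmu X Y)" "kmu X Y \<cdot> proj (kob X) (kob Y) = R2 X Y"
proof -
  obtain w where "pres (tob (kob X) (kob Y)) (X \<otimes>\<^sub>o\<^bsub>D\<^esub> Y) w" "w \<cdot> proj (kob X) (kob Y) = R2 X Y \<cdot> (\<iota> (fob R X) \<otimes>\<^sub>a \<iota> (fob R Y))"
    using tens_pres[OF pres_kob[OF X] pres_kob[OF Y]] .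
  hence "pres (tob (kob X) (kob Y)) (X \<otimes>\<^sub>o\<^bsub>D\<^esub> Y) w \<and> w \<cdot> proj (kob X) (kob Y) = R2 X Y"
    using X Y by simp
  hence "pres (tob (kob X) (kob Y)) (X \<otimes>\<^sub>o\<^bsub>D\<^esub> Y) (kmu X Y) \<and> kmu X Y \<cdot> proj (kob X) (kob Y) = R2 X Y"
    unfolding kmu_def by (rule someI)
  thus "pres (tob (kob X) (kob Y)) (X \<otimes>\<^sub>o\<^bsub>D\<^esub> Y) (kmu X Y)" "kmu X Y \<cdot> proj (kob X) (kob Y) = R2 X Y" by simp_all
qed

lemma kmu_typ [simp]:
  assumes "X \<in> Ob D" "Y \<in> Ob D"
  shows "kmu X Y \<in> Ar C" "src C (kmu X Y) = fst (tob (kob X) (kob Y))" "tgt C (kmu X Y) = fob R (X \<otimes>\<^sub>o\<^bsub>D\<^esub> Y)"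
    "iso_ar C (kmu X Y)" "mhom (tob (kob X) (kob Y)) (kmu X Y) (kob (X \<otimes>\<^sub>o\<^bsub>D\<^esub> Y))"
  using presD(3-6,8)[OF kmu_props(1)[OF assms]] by simp_all

definition K :: "('p, 'n, ('o, 'm) mod_ob, ('o, 'm) mod_ar) mon_functor_data" where
  "K = \<lparr>fob = kob, far = \<lambda>g. (kob (src D g), far R g, kob (tgt D g)),
     fmu = \<lambda>X Y. (tob (kob X) (kob Y), kmu X Y, kob (X \<otimes>\<^sub>o\<^bsub>D\<^esub> Y)),
     fmu0 = (munit, \<iota> RI, kob \<one>\<^sub>o\<^bsub>D\<^esub>)\<rparr>"

lemma K_simps [simp]:
  "fob K = kob" "far K g = (kob (src D g), far R g, kob (tgt D g))"
  "fmu K X Y = (tob (kob X) (kob Y), kmu X Y, kob (X \<otimes>\<^sub>o\<^bsub>D\<^esub> Y))" "fmu0 K = (munit, \<iota> RI, kob \<one>\<^sub>o\<^bsub>D\<^esub>)"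
  by (simp_all add: K_def)

lemma K_functor: "cat_functor D E K"
  by unfold_locales (auto simp: Hom_E D.in_Hom mhom_R[of _])

lemma K_strong_monoidal: "strong_monoidal_functor D E K"
proof (intro strong_monoidal_functor.intro strong_monoidal_functor_axioms.intro K_functor)
  show "monoidal_category D" "monoidal_category E"
    by (rule D.monoidal_category_axioms EM.monoidal_category_axioms)+
  show "fmu0 K \<in> Hom E \<one>\<^sub>o\<^bsub>E\<^esub> (fob K \<one>\<^sub>o\<^bsub>D\<^esub>)" "iso_ar E (fmu0 K)"
    using mhom_ide[of munit] EL.iso_ide[of munit] by (simp_all add: munit_eq)
next
  fix X Y assume [simp]: "X \<in> Ob D" "Y \<in> Ob D"
  show "fmu K X Y \<in> Hom E (fob K X \<otimes>\<^sub>o\<^bsub>E\<^esub> fob K Y) (fob K (X \<otimes>\<^sub>o\<^bsub>D\<^esub> Y))" by simp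
  show "iso_ar E (fmu K X Y)" using iso_E(1)[of _ "kmu X Y"] by simp
next
  fix f X X' g Y Y' assume "f \<in> Hom D X X'" "g \<in> Hom D Y Y'"
  hence [simp]: "f \<in> Ar D" "src D f = X" "tgt D f = X'" "g \<in> Ar D" "src D g = Y" "tgt D g = Y'"
    by (simp_all add: D.in_Hom)
  have [simp]: "X \<in> Ob D" "X' \<in> Ob D" "Y \<in> Ob D" "Y' \<in> Ob D"
    using D.src_Ob[of f] D.tgt_Ob[of f] D.src_Ob[of g] D.tgt_Ob[of g] by simp_all
  have f: "mhom (kob X) (far R f) (kob X')" and g: "mhom (kob Y) (far R g) (kob Y')"
    using mhom_R[of f] mhom_R[of g] by simp_all
  note t = tar_props[OF f g]
  note [simp] = mhomD(3-5)[OF t(1)]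
  have "kmu X' Y' \<cdot> tar (kob X) (far R f) (kob X') (kob Y) (far R g) (kob Y') = far R (f \<otimes>\<^sub>a\<^bsub>D\<^esub> g) \<cdot> kmu X Y"
    by (rule C.epiD[of "proj (kob X) (kob Y)"])
      (simp_all add: t(2) kmu_props(2)[THEN C.reassoc] kmu_props(2) R2_natural)
  thus "fmu K X' Y' \<cdot>\<^bsub>E\<^esub> (far K f \<otimes>\<^sub>a\<^bsub>E\<^esub> far K g) = far K (f \<otimes>\<^sub>a\<^bsub>D\<^esub> g) \<cdot>\<^bsub>E\<^esub> fmu K X Y" by (simp add: tens_ar_eq)
next
  fix X Y Z assume [simp]: "X \<in> Ob D" "Y \<in> Ob D" "Z \<in> Ob D"
  let ?X = "kob X" and ?Y = "kob Y" and ?Z = "kob Z"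
  note l = tar_props[OF kmu_typ(5) mhom_ide[of ?Z], of X Y, simplified]
    and r = tar_props[OF mhom_ide[of ?X] kmu_typ(5), of Y Z, simplified]
    and a = aar_props[of ?X ?Y ?Z]
  note [simp] = mhomD(3-5)[OF l(1)] mhomD(3-5)[OF r(1)] mhomD(3-5)[OF a(1)]
  let ?l = "far R (\<alpha>\<^bsub>D\<^esub> X Y Z) \<cdot> kmu (X \<otimes>\<^sub>o\<^bsub>D\<^esub> Y) Z \<cdot> tar (tob ?X ?Y) (kmu X Y) (kob (X \<otimes>\<^sub>o\<^bsub>D\<^esub> Y)) ?Z (\<iota> (fob R Z)) ?Z"
  let ?r = "kmu X (Y \<otimes>\<^sub>o\<^bsub>D\<^esub> Z) \<cdot> tar ?X (\<iota> (fob R X)) ?X (tob ?Y ?Z) (kmu Y Z) (kob (Y \<otimes>\<^sub>o\<^bsub>D\<^esub> Z)) \<cdot> aar ?X ?Y ?Z"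
  let ?e = "proj (tob ?X ?Y) ?Z \<cdot> (proj ?X ?Y \<otimes>\<^sub>a \<iota> (fst ?Z))"
  have "?l = ?r"
  proof (rule C.epiD[OF triple_epi[of ?X ?Y ?Z]])
    have "?l \<cdot> ?e = far R (\<alpha>\<^bsub>D\<^esub> X Y Z) \<cdot> (kmu (X \<otimes>\<^sub>o\<^bsub>D\<^esub> Y) Z \<cdot> proj (kob (X \<otimes>\<^sub>o\<^bsub>D\<^esub> Y)) ?Z)
        \<cdot> ((kmu X Y \<cdot> proj ?X ?Y) \<otimes>\<^sub>a \<iota> (fob R Z))"
      by (simp add: l(2)[THEN C.reassoc])
    also have "\<dots> = far R (\<alpha>\<^bsub>D\<^esub> X Y Z) \<cdot> R2 (X \<otimes>\<^sub>o\<^bsub>D\<^esub> Y) Z \<cdot> (R2 X Y \<otimes>\<^sub>a \<iota> (fob R Z))"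
      by (simp add: kmu_props(2))
    also have "\<dots> = (kmu X (Y \<otimes>\<^sub>o\<^bsub>D\<^esub> Z) \<cdot> proj ?X (kob (Y \<otimes>\<^sub>o\<^bsub>D\<^esub> Z))) \<cdot> (\<iota> (fob R X) \<otimes>\<^sub>a (kmu Y Z \<cdot> proj ?Y ?Z))
        \<cdot> \<alpha> (fob R X) (fob R Y) (fob R Z)"
      by (simp add: kmu_props(2) R2_assoc)
    also have "\<dots> = kmu X (Y \<otimes>\<^sub>o\<^bsub>D\<^esub> Z) \<cdot> tar ?X (\<iota> (fob R X)) ?X (tob ?Y ?Z) (kmu Y Z) (kob (Y \<otimes>\<^sub>o\<^bsub>D\<^esub> Z))
        \<cdot> (proj ?X (tob ?Y ?Z) \<cdot> (\<iota> (fst ?X) \<otimes>\<^sub>a proj ?Y ?Z) \<cdot> \<alpha> (fst ?X) (fst ?Y) (fst ?Z))"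
      by (simp add: r(2)[THEN C.reassoc])
    also have "\<dots> = ?r \<cdot> ?e"
      by (simp only: a(3)[symmetric] kob_mod \<open>X \<in> Ob D\<close> \<open>Y \<in> Ob D\<close> \<open>Z \<in> Ob D\<close>) simp
    finally show "?l \<cdot> ?e = ?r \<cdot> ?e" .
  qed simp_all
  thus "far K (\<alpha>\<^bsub>D\<^esub> X Y Z) \<cdot>\<^bsub>E\<^esub> fmu K (X \<otimes>\<^sub>o\<^bsub>D\<^esub> Y) Z \<cdot>\<^bsub>E\<^esub> (fmu K X Y \<otimes>\<^sub>a\<^bsub>E\<^esub> \<iota>\<^bsub>E\<^esub> (fob K Z))
      = fmu K X (Y \<otimes>\<^sub>o\<^bsub>D\<^esub> Z) \<cdot>\<^bsub>E\<^esub> (\<iota>\<^bsub>E\<^esub> (fob K X) \<otimes>\<^sub>a\<^bsub>E\<^esub> fmu K Y Z) \<cdot>\<^bsub>E\<^esub> \<alpha>\<^bsub>E\<^esub> (fob K X) (fob K Y) (fob K Z)"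
    by (simp add: tens_ar_eq assoc_eq)
next
  fix X assume [simp]: "X \<in> Ob D"
  have u: "mhom munit (\<iota> RI) (kob \<one>\<^sub>o\<^bsub>D\<^esub>)" using mhom_ide[of munit] by (simp add: munit_eq)
  have i: "mhom (kob X) (\<iota> (fob R X)) (kob X)" using mhom_ide[of "kob X"] by simp
  note l = tar_props[OF u i] and r = tar_props[OF i u]
  note l' = lar_props[of "kob X"] and r' = rar_props[of "kob X"]
  note [simp] = mhomD(3-5)[OF l(1)] mhomD(3-5)[OF r(1)] mhomD(3-5)[OF l'(1)] mhomD(3-5)[OF r'(1)]
  have "far R (\<lambda>\<^sub>l\<^bsub>D\<^esub> X) \<cdot> kmu \<one>\<^sub>o\<^bsub>D\<^esub> X \<cdot> tar munit (\<iota> RI) (kob \<one>\<^sub>o\<^bsub>D\<^esub>) (kob X) (\<iota> (fob R X)) (kob X) = lar (kob X)"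
    by (rule C.epiD[of "proj munit (kob X)"])
      (use l(2) in \<open>simp_all add: kmu_props(2) l'(3) ract_braiding lact_def\<close>)
  thus "far K (\<lambda>\<^sub>l\<^bsub>D\<^esub> X) \<cdot>\<^bsub>E\<^esub> fmu K \<one>\<^sub>o\<^bsub>D\<^esub> X \<cdot>\<^bsub>E\<^esub> (fmu0 K \<otimes>\<^sub>a\<^bsub>E\<^esub> \<iota>\<^bsub>E\<^esub> (fob K X)) = \<lambda>\<^sub>l\<^bsub>E\<^esub> (fob K X)"
    by (simp add: tens_ar_eq unit_eq)
  have "far R (\<rho>\<^bsub>D\<^esub> X) \<cdot> kmu X \<one>\<^sub>o\<^bsub>D\<^esub> \<cdot> tar (kob X) (\<iota> (fob R X)) (kob X) munit (\<iota> RI) (kob \<one>\<^sub>o\<^bsub>D\<^esub>) = rar (kob X)"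
    by (rule C.epiD[of "proj (kob X) munit"])
      (use r(2) in \<open>simp_all add: kmu_props(2) r'(3) ract_def\<close>)
  thus "far K (\<rho>\<^bsub>D\<^esub> X) \<cdot>\<^bsub>E\<^esub> fmu K X \<one>\<^sub>o\<^bsub>D\<^esub> \<cdot>\<^bsub>E\<^esub> (\<iota>\<^bsub>E\<^esub> (fob K X) \<otimes>\<^sub>a\<^bsub>E\<^esub> fmu0 K) = \<rho>\<^bsub>E\<^esub> (fob K X)"
    by (simp add: tens_ar_eq unit_eq)
qed

sublocale K: strong_monoidal_functor D E K
  by (rule K_strong_monoidal)

lemma K_linear: "linear k D E K"
  unfolding linear_def by (auto simp: D.in_Hom)

lemma K_faithful: "faithful D K"
  using R_faithful unfolding faithful_def inj_on_def by auto

lemma K_full: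
  assumes "X \<in> Ob D" "Y \<in> Ob D" "a \<in> Hom E (kob X) (kob Y)"
  shows "\<exists>g \<in> Hom D X Y. far K g = a"
proof -
  obtain u where a: "a = (kob X, u, kob Y)" and u: "mhom (kob X) u (kob Y)" using assms(3) by (auto simp: Hom_E)
  obtain g where "g \<in> Ar D" "src D g = X" "tgt D g = Y" "far R g = u"
    using R_full[OF assms(1,2), of u] mhomD[OF u] by auto
  thus ?thesis using a by (auto simp: D.in_Hom)
qed

lemma K_ess_surj:
  assumes "P \<in> Ob E"
  shows "\<exists>X a. X \<in> Ob D \<and> iso_ar E a \<and> src E a = P \<and> tgt E a = kob X"
proof -
  have "is_mod P" using assms by simp
  then obtain X \<phi> where "pres P X \<phi>" by (rule pres_ex)
  from presD[OF this] show ?thesis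
    by (intro exI[of _ X] exI[of _ "(P, \<phi>, kob X)"]) (simp add: iso_E)
qed

end

section \<open>Transport of structure along a linear equivalence\<close>

locale linear_equivalence = linear_functor k C D F
  for k :: "('k, 'y) ring_scheme" and C :: "('o, 'm, 'k, 'x) lin_category_scheme"
    and D :: "('p, 'n, 'k, 'z) lin_category_scheme" (structure) and F :: "('o, 'm, 'p, 'n, 'w) functor_data_scheme" +
  assumes F_faithful: "faithful C F"
    and F_full: "\<lbrakk>X \<in> Ob C; Y \<in> Ob C; g \<in> Hom D (fob F X) (fob F Y)\<rbrakk> \<Longrightarrow> \<exists>f \<in> Hom C X Y. far F f = g"
    and F_ess: "M \<in> Ob D \<Longrightarrow> \<exists>X a. X \<in> Ob C \<and> iso_ar D a \<and> src D a = M \<and> tgt D a = fob F X"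
begin

lemma op_equivalence: "linear_equivalence k (op_cat C) (op_cat D) F"
proof -
  have "linear_functor k (op_cat C) (op_cat D) F"
    by (intro linear_functor.intro linear_functor_axioms.intro cat_functor.intro cat_functor_axioms.intro
        C.op_linear D.op_linear linear_category.axioms(1)[OF C.op_linear] linear_category.axioms(1)[OF D.op_linear])
      (auto simp: C.in_Hom D.in_Hom linear_def)
  moreover have "\<exists>X a. X \<in> Ob C \<and> iso_ar D a \<and> tgt D a = M \<and> src D a = fob F X" if "M \<in> Ob D" for M
    using F_ess[OF that] D.iso_inv D.src_inv D.tgt_inv by metis
  ultimately show ?thesis
    using F_faithful F_full
    by (intro linear_equivalence.intro linear_equivalence_axioms.intro) (auto simp: faithful_def)
qed

lemma lift:
  assumes "X \<in> Ob C" "Y \<in> Ob C" "g \<in> Ar D" "src D g = fob F X" "tgt D g = fob F Y"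
  obtains f where "f \<in> Ar C" "src C f = X" "tgt C f = Y" "far F f = g"
  using F_full[of X Y g] assms by (auto simp: C.in_Hom D.in_Hom)

lemma ess_surj:
  assumes "M \<in> Ob D"
  obtains X a where "X \<in> Ob C" "iso_ar D a" "a \<in> Ar D" "src D a = M" "tgt D a = fob F X"
  using F_ess[OF assms] D.iso_Ar by blast

lemma arrow_presentation:
  assumes "g \<in> Ar D"
  obtains f a b where "f \<in> Ar C" "iso_ar D a" "iso_ar D b" "a \<in> Ar D" "b \<in> Ar D" "src D a = src D g"
    "src D b = tgt D g" "tgt D a = fob F (src C f)" "tgt D b = fob F (tgt C f)" "b \<cdot> g = far F f \<cdot> a"
proof -
  note [simp] = assms
  obtain X a where [simp]: "X \<in> Ob C" "iso_ar D a" "a \<in> Ar D" "src D a = src D g" "tgt D a = fob F X"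
    by (rule ess_surj[of "src D g"]) simp_all
  obtain Y b where [simp]: "Y \<in> Ob C" "iso_ar D b" "b \<in> Ar D" "src D b = tgt D g" "tgt D b = fob F Y"
    by (rule ess_surj[of "tgt D g"]) simp_all
  obtain f where "f \<in> Ar C" "src C f = X" "tgt C f = Y" "far F f = b \<cdot> g \<cdot> inv_ar D a"
    by (rule lift[of X Y "b \<cdot> g \<cdot> inv_ar D a"]) simp_all
  thus ?thesis by (intro that[of f a b]) simp_all
qed

lemma reflects_iso:
  assumes f [simp]: "f \<in> Ar C" and iso: "iso_ar D (far F f)"
  shows "iso_ar C f"
proof -
  note [simp] = iso
  obtain g where [simp]: "g \<in> Ar C" "src C g = tgt C f" "tgt C g = src C f" and g: "far F g = inv_ar D (far F f)"
    by (rule lift[of "tgt C f" "src C f" "inv_ar D (far F f)"]) simp_all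
  have "g \<cdot>\<^bsub>C\<^esub> f = \<iota>\<^bsub>C\<^esub> (src C f)" by (rule faithfulD[OF F_faithful]) (simp_all add: g)
  moreover have "f \<cdot>\<^bsub>C\<^esub> g = \<iota>\<^bsub>C\<^esub> (tgt C f)" by (rule faithfulD[OF F_faithful]) (simp_all add: g)
  ultimately show ?thesis by (intro C.isoI[of f g]) simp_all
qed

lemma preserves_mono:
  assumes "mono_ar C f" shows "mono_ar D (far F f)"
  unfolding D.mono_iff
proof (intro conjI allI impI)
  note [simp] = C.mono_Ar[OF assms]
  show "far F f \<in> Ar D" by simp
  fix g h assume gh: "g \<in> Ar D" "h \<in> Ar D" "tgt D g = src D (far F f)" "tgt D h = src D (far F f)"
    "src D g = src D h" and eq: "far F f \<cdot> g = far F f \<cdot> h"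
  note [simp] = gh(1,2) and t [simp] = gh(3,4)[simplified]
  obtain X a where [simp]: "X \<in> Ob C" "iso_ar D a" "a \<in> Ar D" "src D a = src D h" "tgt D a = fob F X"
    by (rule ess_surj[of "src D h"]) simp_all
  obtain g' where [simp]: "g' \<in> Ar C" "src C g' = X" "tgt C g' = src C f" and g': "far F g' = g \<cdot> inv_ar D a"
    by (rule lift[of X "src C f" "g \<cdot> inv_ar D a"]) (simp_all add: gh(5))
  obtain h' where [simp]: "h' \<in> Ar C" "src C h' = X" "tgt C h' = src C f" and h': "far F h' = h \<cdot> inv_ar D a"
    by (rule lift[of X "src C f" "h \<cdot> inv_ar D a"]) simp_all
  have "f \<cdot>\<^bsub>C\<^esub> g' = f \<cdot>\<^bsub>C\<^esub> h'"
    by (rule faithfulD[OF F_faithful]) (simp_all add: g' h' eq[THEN D.reassoc] gh(5))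
  hence "g' = h'" by (rule C.monoD[OF assms]) simp_all
  hence "g \<cdot> inv_ar D a = h \<cdot> inv_ar D a" using g' h' by simp
  thus "g = h" by (rule D.epiD[of "inv_ar D a", rotated]) (simp_all add: gh(5))
qed

lemma reflects_mono:
  assumes f: "f \<in> Ar C" and m: "mono_ar D (far F f)"
  shows "mono_ar C f"
  unfolding C.mono_iff
proof (intro conjI allI impI)
  fix g h assume gh: "g \<in> Ar C" "h \<in> Ar C" "tgt C g = src C f" "tgt C h = src C f" "src C g = src C h"
    "f \<cdot>\<^bsub>C\<^esub> g = f \<cdot>\<^bsub>C\<^esub> h"
  have "far F f \<cdot> far F g = far F f \<cdot> far F h" using gh f by (simp flip: far_cmp')
  hence "far F g = far F h" by (rule D.monoD[OF m]) (use gh f in simp_all)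
  thus "g = h" by (rule faithfulD[OF F_faithful]) (use gh in simp_all)
qed fact

lemma preserves_kernel:
  assumes k: "is_kernel C f i" shows "is_kernel D (far F f) (far F i)"
proof (rule D.kernelI)
  note [simp] = C.kernelD[OF k]
  show "mono_ar D (far F i)" by (rule preserves_mono[OF C.kernel_mono[OF k]])
  show "far F f \<cdot> far F i = zero_ar D (src D (far F i)) (tgt D (far F f))" by (simp flip: far_cmp')
  fix h assume [simp]: "h \<in> Ar D" and "tgt D h = src D (far F f)"
    and h: "far F f \<cdot> h = zero_ar D (src D h) (tgt D (far F f))"
  hence [simp]: "tgt D h = fob F (src C f)" by simp
  obtain X a where [simp]: "X \<in> Ob C" "iso_ar D a" "a \<in> Ar D" "src D a = src D h" "tgt D a = fob F X"
    by (rule ess_surj[of "src D h"]) simp_all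
  obtain h' where [simp]: "h' \<in> Ar C" "src C h' = X" "tgt C h' = src C f" and h': "far F h' = h \<cdot> inv_ar D a"
    by (rule lift[of X "src C f" "h \<cdot> inv_ar D a"]) simp_all
  have "f \<cdot>\<^bsub>C\<^esub> h' = zero_ar C (src C h') (tgt C f)"
    by (rule faithfulD[OF F_faithful]) (simp_all add: h' h[THEN D.reassoc])
  then obtain l where [simp]: "l \<in> Ar C" "src C l = src C h'" "tgt C l = src C i" and l: "i \<cdot>\<^bsub>C\<^esub> l = h'"
    using C.kernel_factor[OF k, of h'] by auto
  have "far F i \<cdot> far F l = far F (i \<cdot>\<^bsub>C\<^esub> l)" by simp
  hence "far F i \<cdot> (far F l \<cdot> a) = h" by (simp add: l h' D.cmp_assoc_left del: D.cmp_assoc_right) simp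
  thus "\<exists>l. l \<in> Ar D \<and> src D l = src D h \<and> tgt D l = src D (far F i) \<and> far F i \<cdot> l = h"
    by (intro exI[of _ "far F l \<cdot> a"]) simp
qed (use C.kernelD[OF k] in simp_all)

lemma preserves_cokernel: "is_cokernel C f p \<Longrightarrow> is_cokernel D (far F f) (far F p)"
  using linear_equivalence.preserves_kernel[OF op_equivalence, of f p] by simp

lemma preserves_short_exact: "short_exact C f g \<Longrightarrow> short_exact D (far F f) (far F g)"
  by (simp add: short_exact_def preserves_kernel preserves_cokernel)

lemma transport_kernels:
  assumes ex: "\<And>f. f \<in> Ar C \<Longrightarrow> \<exists>i. is_kernel C f i" and g: "g \<in> Ar D"
  shows "\<exists>i. is_kernel D g i"
proof -
  obtain f a b where f: "f \<in> Ar C" "iso_ar D a" "iso_ar D b" "a \<in> Ar D" "b \<in> Ar D" "src D a = src D g"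
    "src D b = tgt D g" "tgt D a = fob F (src C f)" "tgt D b = fob F (tgt C f)" and eq: "b \<cdot> g = far F f \<cdot> a"
    using arrow_presentation[OF g] .
  note [simp] = f g
  obtain i where i: "is_kernel C f i" using ex[OF f(1)] by blast
  note [simp] = C.kernelD[OF i]
  have "is_kernel D g (inv_ar D a \<cdot> far F i)"
    by (rule D.kernel_iso[OF preserves_kernel[OF i], of a b "\<iota> (fob F (src C i))"]) (simp_all add: eq)
  thus ?thesis ..
qed

lemma transport_normal:
  assumes ex: "\<And>f. mono_ar C f \<Longrightarrow> \<exists>g. is_kernel C g f" and g: "mono_ar D g"
  shows "\<exists>h. is_kernel D h g"
proof -
  have [simp]: "g \<in> Ar D" by (rule D.mono_Ar[OF g])
  obtain f a b where f: "f \<in> Ar C" "iso_ar D a" "iso_ar D b" "a \<in> Ar D" "b \<in> Ar D" "src D a = src D g"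
    "src D b = tgt D g" "tgt D a = fob F (src C f)" "tgt D b = fob F (tgt C f)" and eq: "b \<cdot> g = far F f \<cdot> a"
    using arrow_presentation[of g] by auto
  note [simp] = f
  have "b \<cdot> g \<cdot> inv_ar D a = far F f" by (simp add: eq[THEN D.reassoc])
  moreover have "mono_ar D (b \<cdot> g \<cdot> inv_ar D a)" using g by simp
  ultimately have "mono_ar C f" by (intro reflects_mono) simp_all
  then obtain h where h: "is_kernel C h f" using ex by blast
  note [simp] = C.kernelD(1)[OF h] and t = C.kernelD(3)[OF h, symmetric]
  have "is_kernel D (far F h \<cdot> b) g"
    by (rule D.kernel_iso[OF preserves_kernel[OF h], of b "\<iota> (fob F (tgt C h))" a]) (simp_all add: eq t)
  thus ?thesis ..
qed

lemma transport_abelian: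
  assumes ab: "abelian_category k C"
  shows "abelian_category k D"
proof -
  interpret C: abelian_category k C by (rule ab)
  show ?thesis
  proof (intro abelian_category.intro abelian_category_axioms.intro)
    show "linear_category k D" by (rule D.linear_category_axioms)
    obtain Z where "zero_ob C Z" using C.zero_ob_ex by blast
    hence "Z \<in> Ob C" "\<iota>\<^bsub>C\<^esub> Z = zero_ar C Z Z" by (simp_all add: C.zero_ob_iff)
    hence "zero_ob D (fob F Z)" by (simp add: D.zero_ob_iff flip: far_ide far_zero)
    thus "\<exists>Z. zero_ob D Z" ..
  next
    fix M N assume "M \<in> Ob D" "N \<in> Ob D"
    obtain X a where [simp]: "X \<in> Ob C" "iso_ar D a" "a \<in> Ar D" "src D a = M" "tgt D a = fob F X"
      using ess_surj[OF \<open>M \<in> Ob D\<close>] .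
    obtain Y b where [simp]: "Y \<in> Ob C" "iso_ar D b" "b \<in> Ar D" "src D b = N" "tgt D b = fob F Y"
      using ess_surj[OF \<open>N \<in> Ob D\<close>] .
    obtain P i j p q where bp: "is_biproduct C X Y P i j p q" using C.biproduct_ex[of X Y] by auto
    hence [simp]: "i \<in> Ar C" "src C i = X" "tgt C i = P" "j \<in> Ar C" "src C j = Y" "tgt C j = P"
      "p \<in> Ar C" "src C p = P" "tgt C p = X" "q \<in> Ar C" "src C q = P" "tgt C q = Y"
      and eqs: "p \<cdot>\<^bsub>C\<^esub> i = \<iota>\<^bsub>C\<^esub> X" "q \<cdot>\<^bsub>C\<^esub> j = \<iota>\<^bsub>C\<^esub> Y" "p \<cdot>\<^bsub>C\<^esub> j = zero_ar C Y X" "q \<cdot>\<^bsub>C\<^esub> i = zero_ar C X Y"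
        "add_ar C (i \<cdot>\<^bsub>C\<^esub> p) (j \<cdot>\<^bsub>C\<^esub> q) = \<iota>\<^bsub>C\<^esub> P"
      by (auto simp: is_biproduct_def C.in_Hom)
    have [simp]: "P \<in> Ob C" using C.tgt_Ob[of i] by simp
    have [simp]: "M \<in> Ob D" "N \<in> Ob D" by fact+
    have eqs': "far F p \<cdot> far F i = \<iota> (fob F X)" "far F q \<cdot> far F j = \<iota> (fob F Y)"
      "far F p \<cdot> far F j = zero_ar D (fob F Y) (fob F X)" "far F q \<cdot> far F i = zero_ar D (fob F X) (fob F Y)"
      "add_ar D (far F i \<cdot> far F p) (far F j \<cdot> far F q) = \<iota> (fob F P)"
      using arg_cong[OF eqs(1), of "far F"] arg_cong[OF eqs(2), of "far F"] arg_cong[OF eqs(3), of "far F"]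
        arg_cong[OF eqs(4), of "far F"] arg_cong[OF eqs(5), of "far F"] by simp_all
    have "is_biproduct D M N (fob F P) (far F i \<cdot> a) (far F j \<cdot> b) (inv_ar D a \<cdot> far F p) (inv_ar D b \<cdot> far F q)"
      unfolding is_biproduct_def
      by (simp add: D.in_Hom eqs' eqs'(1-4)[THEN D.reassoc])
    thus "\<exists>P i j p q. is_biproduct D M N P i j p q" by blast
  next
    fix f assume f: "f \<in> Ar D"
    show "\<exists>i. is_kernel D f i" using transport_kernels[OF C.kernel_ex f] .
    show "\<exists>i. is_cokernel D f i"
      using linear_equivalence.transport_kernels[OF op_equivalence, of f] C.cokernel_ex f by simp
  next
    fix f
    show "mono_ar D f \<Longrightarrow> \<exists>g. is_kernel D g f" by (rule transport_normal[OF C.mono_normal])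
    show "epi_ar D f \<Longrightarrow> \<exists>g. is_cokernel D g f"
      using linear_equivalence.transport_normal[OF op_equivalence, of f] C.epi_normal by simp
  qed
qed

lemma preserves_zero_ob: "zero_ob C X \<Longrightarrow> zero_ob D (fob F X)"
  by (simp add: C.zero_ob_iff D.zero_ob_iff flip: far_ide far_zero)

lemma reflects_zero_ob:
  assumes "zero_ob D (fob F X)" "X \<in> Ob C" shows "zero_ob C X"
proof -
  have "far F (\<iota>\<^bsub>C\<^esub> X) = far F (zero_ar C X X)" using assms by (simp add: D.zero_ob_iff)
  hence "\<iota>\<^bsub>C\<^esub> X = zero_ar C X X" by (rule faithfulD[OF F_faithful]) (use assms in simp_all)
  thus ?thesis using assms by (simp add: C.zero_ob_iff)
qed

lemma preserves_simple:
  assumes S: "simple_ob C S" shows "simple_ob D (fob F S)"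
proof -
  have [simp]: "S \<in> Ob C" and nz: "\<not> zero_ob C S"
    and sub: "\<And>f. \<lbrakk>mono_ar C f; tgt C f = S\<rbrakk> \<Longrightarrow> zero_ob C (src C f) \<or> iso_ar C f"
    using S by (auto simp: simple_ob_def)
  have "zero_ob D (src D g) \<or> iso_ar D g" if g: "mono_ar D g" and t [simp]: "tgt D g = fob F S" for g
  proof -
    have [simp]: "g \<in> Ar D" by (rule D.mono_Ar[OF g])
    obtain X a where [simp]: "X \<in> Ob C" "iso_ar D a" "a \<in> Ar D" "src D a = src D g" "tgt D a = fob F X"
      by (rule ess_surj[of "src D g"]) simp_all
    obtain f where [simp]: "f \<in> Ar C" "src C f = X" "tgt C f = S" and f: "far F f = g \<cdot> inv_ar D a"
      by (rule lift[of X S "g \<cdot> inv_ar D a"]) simp_all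
    have "mono_ar C f" by (rule reflects_mono) (use g f in simp_all)
    hence "zero_ob C (src C f) \<or> iso_ar C f" by (intro sub) simp_all
    thus ?thesis
    proof
      assume "zero_ob C (src C f)"
      hence "zero_ob D (fob F X)" using preserves_zero_ob by simp
      thus ?thesis using D.zero_ob_iso[of "fob F X" a "src D g"] by simp
    next
      assume "iso_ar C f"
      hence "iso_ar D (far F f \<cdot> a)" by (intro D.iso_cmp iso_far) simp_all
      thus ?thesis by (simp add: f)
    qed
  qed
  thus ?thesis using nz reflects_zero_ob[of S] by (auto simp: simple_ob_def)
qed

lemma preserves_finite_length: "finite_length C X \<Longrightarrow> finite_length D (fob F X)"
proof (induction rule: finite_length.induct)
  case (finite_length_zero X)
  thus ?case by (intro finite_length.finite_length_zero preserves_zero_ob)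
next
  case (finite_length_ext X f g)
  hence "f \<in> Ar C" "g \<in> Ar C" by (auto simp: short_exact_def is_kernel_def)
  thus ?case
    using finite_length.finite_length_ext[OF finite_length_ext.IH preserves_short_exact[OF finite_length_ext.hyps(2)]]
      finite_length_ext.hyps(3) preserves_simple[OF finite_length_ext.hyps(4)]
    by simp
qed

lemma transport_finite_length:
  assumes "\<And>X. X \<in> Ob C \<Longrightarrow> finite_length C X" "M \<in> Ob D"
  shows "finite_length D M"
proof -
  obtain X a where [simp]: "X \<in> Ob C" "iso_ar D a" "a \<in> Ar D" "src D a = M" "tgt D a = fob F X"
    using ess_surj[OF assms(2)] .
  have "finite_length D (fob F X)" by (intro preserves_finite_length assms) simp
  thus ?thesis
  proof cases
    case finite_length_zero
    thus ?thesis using D.zero_ob_iso[of "fob F X" a M] by (auto intro: finite_length.finite_length_zero)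
  next
    case (finite_length_ext Y f g)
    have k: "is_kernel D g f" using finite_length_ext by (simp add: short_exact_def)
    note [simp] = D.kernelD(1,2)[OF k]
    have [simp]: "tgt D f = fob F X" "src D g = fob F X"
      using finite_length_ext(1) D.kernelD(3)[OF k] by simp_all
    have "short_exact D (inv_ar D a \<cdot> f) (g \<cdot> a)"
      by (rule D.short_exact_iso[OF finite_length_ext(3), of "\<iota> (src D f)" a "\<iota> (tgt D g)"]) simp_all
    from finite_length.finite_length_ext[OF finite_length_ext(2) this] finite_length_ext(4,5)
    show ?thesis by simp
  qed
qed

text \<open>This reduces statements about arbitrary spaces of arrows of \<open>D\<close> to spaces of arrows of \<open>C\<close>.\<close>

lemma conjugate_bij:
  assumes [simp]: "X \<in> Ob C" "Y \<in> Ob C" "iso_ar D a" "iso_ar D b" "a \<in> Ar D" "b \<in> Ar D"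
    "src D a = M" "src D b = N" "tgt D a = fob F X" "tgt D b = fob F Y"
  shows "bij_betw (\<lambda>f. inv_ar D b \<cdot> far F f \<cdot> a) (Hom C X Y) (Hom D M N)"
proof (rule bij_betw_imageI)
  let ?T = "\<lambda>f. inv_ar D b \<cdot> far F f \<cdot> a"
  show "inj_on ?T (Hom C X Y)"
  proof (rule inj_onI)
    fix f g assume "f \<in> Hom C X Y" "g \<in> Hom C X Y" and eq: "?T f = ?T g"
    hence [simp]: "f \<in> Ar C" "src C f = X" "tgt C f = Y" "g \<in> Ar C" "src C g = X" "tgt C g = Y"
      by (auto simp: C.in_Hom)
    have "b \<cdot> ?T f \<cdot> inv_ar D a = b \<cdot> ?T g \<cdot> inv_ar D a" by (simp only: eq)
    hence "far F f = far F g" by simp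
    thus "f = g" by (rule faithfulD[OF F_faithful]) simp_all
  qed
  show "?T ` Hom C X Y = Hom D M N"
  proof (intro equalityI subsetI)
    fix h assume "h \<in> Hom D M N"
    hence [simp]: "h \<in> Ar D" "src D h = M" "tgt D h = N" by (auto simp: D.in_Hom)
    obtain f where [simp]: "f \<in> Ar C" "src C f = X" "tgt C f = Y" and f: "far F f = b \<cdot> h \<cdot> inv_ar D a"
      by (rule lift[of X Y "b \<cdot> h \<cdot> inv_ar D a"]) simp_all
    have "h = ?T f" by (simp add: f)
    thus "h \<in> ?T ` Hom C X Y" by (intro image_eqI[of _ _ f]) (simp_all add: C.in_Hom)
  qed (auto simp: C.in_Hom D.in_Hom)
qed

lemma transport_finite_dim:
  assumes fd: "\<And>X Y. \<lbrakk>X \<in> Ob C; Y \<in> Ob C\<rbrakk> \<Longrightarrow> finite_dim k (Hom_space C X Y)"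
    and MN: "M \<in> Ob D" "N \<in> Ob D"
  shows "finite_dim k (Hom_space D M N)"
proof -
  obtain X a where [simp]: "X \<in> Ob C" "iso_ar D a" "a \<in> Ar D" "src D a = M" "tgt D a = fob F X"
    using ess_surj[OF MN(1)] .
  obtain Y b where [simp]: "Y \<in> Ob C" "iso_ar D b" "b \<in> Ar D" "src D b = N" "tgt D b = fob F Y"
    using ess_surj[OF MN(2)] .
  define T where "T f = inv_ar D b \<cdot> far F f \<cdot> a" for f
  have T: "bij_betw T (Hom C X Y) (Hom D M N)" unfolding T_def[abs_def] by (rule conjugate_bij) simp_all
  interpret V: module k "Hom_space C X Y" by (rule C.Hom_module) simp_all
  interpret W: module k "Hom_space D M N" by (rule D.Hom_module) (use MN in simp_all)
  have TH: "T f \<in> Hom D M N" if "f \<in> Hom C X Y" for f using T that by (auto dest: bij_betwE)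
  have Tadd: "T (add_ar C f g) = add_ar D (T f) (T g)" if "f \<in> Hom C X Y" "g \<in> Hom C X Y" for f g
    using that by (simp add: T_def C.in_Hom D.cmp_add D.add_cmp)
  have Tsmul: "T (smul_ar C c f) = smul_ar D c (T f)" if "f \<in> Hom C X Y" "c \<in> carrier k" for c f
    using that by (simp add: T_def C.in_Hom D.cmp_smul D.smul_cmp)
  have Tzero: "T (zero_ar C X Y) = zero_ar D M N" using MN by (simp add: T_def)
  have Tsum: "T (\<Oplus>\<^bsub>Hom_space C X Y\<^esub>x\<in>B. f x) = (\<Oplus>\<^bsub>Hom_space D M N\<^esub>x\<in>B. T (f x))"
    if "finite B" "f \<in> B \<rightarrow> Hom C X Y" for B and f :: "'m \<Rightarrow> 'm"
    using that
  proof (induction B rule: finite_induct)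
    case empty thus ?case using Tzero by simp
  next
    case (insert x B)
    have f: "f \<in> B \<rightarrow> carrier (Hom_space C X Y)" "f x \<in> carrier (Hom_space C X Y)" using insert.prems by auto
    have g: "(\<lambda>x. T (f x)) \<in> B \<rightarrow> carrier (Hom_space D M N)" "T (f x) \<in> carrier (Hom_space D M N)"
      using insert.prems TH by auto
    show ?case
      using V.finsum_insert[OF insert.hyps f] W.finsum_insert[OF insert.hyps g] insert.IH
        Tadd[of "f x" "\<Oplus>\<^bsub>Hom_space C X Y\<^esub>x\<in>B. f x"] V.finsum_closed[OF f(1)] insert.prems
      by simp
  qed
  obtain B where B: "finite B" "B \<subseteq> Hom C X Y"
    and span: "\<And>v. v \<in> Hom C X Y \<Longrightarrow> \<exists>c \<in> B \<rightarrow> carrier k. v = (\<Oplus>\<^bsub>Hom_space C X Y\<^esub>b\<in>B. smul_ar C (c b) b)"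
    using fd[of X Y] by (auto simp: finite_dim_def)
  have inj: "inj_on T B" using T B(2) by (auto simp: bij_betw_def intro: inj_on_subset)
  show ?thesis unfolding finite_dim_def
  proof (intro exI[of _ "T ` B"] conjI ballI)
    show "finite (T ` B)" "T ` B \<subseteq> carrier (Hom_space D M N)" using B TH by auto
    fix w assume "w \<in> carrier (Hom_space D M N)"
    then obtain v where v: "v \<in> Hom C X Y" "w = T v" using T by (auto simp: bij_betw_def)
    obtain c where c: "c \<in> B \<rightarrow> carrier k" "v = (\<Oplus>\<^bsub>Hom_space C X Y\<^esub>b\<in>B. smul_ar C (c b) b)"
      using span[OF v(1)] by blast
    define d where "d = (\<lambda>y. c (inv_into B T y))"
    have d: "d (T x) = c x" if "x \<in> B" for x using that inj by (simp add: d_def)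
    have H: "smul_ar C (c x) x \<in> Hom C X Y" if "x \<in> B" for x
      using V.smult_closed[of "c x" x] that c(1) B(2) by auto
    have H': "smul_ar D (c x) (T x) \<in> Hom D M N" if "x \<in> B" for x
      using W.smult_closed[of "c x" "T x"] that c(1) B(2) TH by auto
    have "w = (\<Oplus>\<^bsub>Hom_space D M N\<^esub>x\<in>B. T (smul_ar C (c x) x))"
      unfolding v(2) c(2) using H by (intro Tsum B) auto
    also have "\<dots> = (\<Oplus>\<^bsub>Hom_space D M N\<^esub>x\<in>B. smul_ar D (d (T x)) (T x))"
      by (rule W.finsum_cong') (use H' c B d Tsmul in \<open>auto simp: Pi_iff\<close>)
    also have "\<dots> = (\<Oplus>\<^bsub>Hom_space D M N\<^esub>y\<in>T ` B. smul_ar D (d y) y)"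
      by (rule W.finsum_reindex[symmetric]) (use H' d inj in \<open>auto simp: Pi_iff\<close>)
    finally have "w = (\<Oplus>\<^bsub>Hom_space D M N\<^esub>y\<in>T ` B. d y \<odot>\<^bsub>Hom_space D M N\<^esub> y)" by simp
    moreover have "d \<in> T ` B \<rightarrow> carrier k" using d c(1) by auto
    ultimately show "\<exists>c\<in>T ` B \<rightarrow> carrier k. w = (\<Oplus>\<^bsub>Hom_space D M N\<^esub>y\<in>T ` B. c y \<odot>\<^bsub>Hom_space D M N\<^esub> y)"
      by blast
  qed
qed

lemma is_equivalence: "is_equivalence C D F"
proof -
  define G where "G M = (SOME X. X \<in> Ob C \<and> (\<exists>a. iso_ar D a \<and> src D a = M \<and> tgt D a = fob F X))" for M
  have G: "G M \<in> Ob C \<and> (\<exists>a. iso_ar D a \<and> src D a = M \<and> tgt D a = fob F (G M))" if "M \<in> Ob D" for M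
    unfolding G_def by (rule someI_ex) (use F_ess[OF that] in blast)
  define a where "a M = (SOME a. iso_ar D a \<and> src D a = M \<and> tgt D a = fob F (G M))" for M
  have a: "iso_ar D (a M) \<and> src D (a M) = M \<and> tgt D (a M) = fob F (G M)" if "M \<in> Ob D" for M
    unfolding a_def by (rule someI_ex) (use G[OF that] in blast)
  have [simp]: "G M \<in> Ob C" "iso_ar D (a M)" "a M \<in> Ar D" "src D (a M) = M" "tgt D (a M) = fob F (G M)"
    if "M \<in> Ob D" for M
    using G[OF that] a[OF that] D.iso_Ar[of "a M"] by simp_all
  define H where "H f = (SOME g. g \<in> Ar C \<and> src C g = G (src D f) \<and> tgt C g = G (tgt D f)
      \<and> far F g = a (tgt D f) \<cdot> f \<cdot> inv_ar D (a (src D f)))" for f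
  have H: "H f \<in> Ar C \<and> src C (H f) = G (src D f) \<and> tgt C (H f) = G (tgt D f)
      \<and> far F (H f) = a (tgt D f) \<cdot> f \<cdot> inv_ar D (a (src D f))" if [simp]: "f \<in> Ar D" for f
  proof -
    obtain g where "g \<in> Ar C" "src C g = G (src D f)" "tgt C g = G (tgt D f)"
      "far F g = a (tgt D f) \<cdot> f \<cdot> inv_ar D (a (src D f))"
      by (rule lift[of "G (src D f)" "G (tgt D f)" "a (tgt D f) \<cdot> f \<cdot> inv_ar D (a (src D f))"]) simp_all
    hence "\<exists>g. g \<in> Ar C \<and> src C g = G (src D f) \<and> tgt C g = G (tgt D f)
      \<and> far F g = a (tgt D f) \<cdot> f \<cdot> inv_ar D (a (src D f))" by blast
    thus ?thesis unfolding H_def by (rule someI_ex)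
  qed
  have [simp]: "H f \<in> Ar C" "src C (H f) = G (src D f)" "tgt C (H f) = G (tgt D f)"
      "far F (H f) = a (tgt D f) \<cdot> f \<cdot> inv_ar D (a (src D f))" if "f \<in> Ar D" for f using H[OF that] by simp_all
  define GF :: "('p, 'n, 'o, 'm) functor_data" where "GF = \<lparr>fob = G, far = H\<rparr>"
  have GF: "cat_functor D C GF"
  proof unfold_locales
    fix X assume [simp]: "X \<in> Ob D"
    show "far GF (\<iota> X) = \<iota>\<^bsub>C\<^esub> (fob GF X)"
      unfolding GF_def by simp (rule faithfulD[OF F_faithful], simp_all)
  next
    fix f X Y g Z assume "f \<in> Hom D X Y" "g \<in> Hom D Y Z"
    hence [simp]: "f \<in> Ar D" "src D f = X" "tgt D f = Y" "g \<in> Ar D" "src D g = Y" "tgt D g = Z"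
      by (auto simp: D.in_Hom)
    have [simp]: "X \<in> Ob D" "Y \<in> Ob D" "Z \<in> Ob D" using D.src_Ob[of f] D.tgt_Ob[of f] D.tgt_Ob[of g] by simp_all
    show "far GF (g \<cdot> f) = far GF g \<cdot>\<^bsub>C\<^esub> far GF f"
      unfolding GF_def by simp (rule faithfulD[OF F_faithful], simp_all)
  qed (auto simp: GF_def C.in_Hom D.in_Hom)
  define t where "t X = (SOME f. f \<in> Ar C \<and> src C f = X \<and> tgt C f = G (fob F X) \<and> far F f = a (fob F X))" for X
  have t: "t X \<in> Ar C \<and> src C (t X) = X \<and> tgt C (t X) = G (fob F X) \<and> far F (t X) = a (fob F X)"
    if [simp]: "X \<in> Ob C" for X
  proof -
    obtain f where "f \<in> Ar C" "src C f = X" "tgt C f = G (fob F X)" "far F f = a (fob F X)"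
      by (rule lift[of X "G (fob F X)" "a (fob F X)"]) simp_all
    hence "\<exists>f. f \<in> Ar C \<and> src C f = X \<and> tgt C f = G (fob F X) \<and> far F f = a (fob F X)" by blast
    thus ?thesis unfolding t_def by (rule someI_ex)
  qed
  have [simp]: "t X \<in> Ar C" "src C (t X) = X" "tgt C (t X) = G (fob F X)" "far F (t X) = a (fob F X)"
    if "X \<in> Ob C" for X using t[OF that] by simp_all
  have "nat_iso C C id_functor (comp_functor GF F) t"
    unfolding nat_iso_def nat_trans_def
  proof (intro conjI ballI allI)
    fix X Y f assume "f \<in> Hom C X Y"
    hence [simp]: "f \<in> Ar C" "src C f = X" "tgt C f = Y" by (auto simp: C.in_Hom)
    have [simp]: "X \<in> Ob C" "Y \<in> Ob C" using C.src_Ob[of f] C.tgt_Ob[of f] by simp_all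
    have "t Y \<cdot>\<^bsub>C\<^esub> f = H (far F f) \<cdot>\<^bsub>C\<^esub> t X" by (rule faithfulD[OF F_faithful]) simp_all
    thus "t Y \<cdot>\<^bsub>C\<^esub> far id_functor f = far (comp_functor GF F) f \<cdot>\<^bsub>C\<^esub> t X"
      by (simp add: id_functor_def comp_functor_def GF_def)
  qed (auto simp: id_functor_def comp_functor_def GF_def C.in_Hom intro: reflects_iso)
  moreover have "nat_iso D D (comp_functor F GF) id_functor (\<lambda>M. inv_ar D (a M))"
    unfolding nat_iso_def nat_trans_def
    by (auto simp: id_functor_def comp_functor_def GF_def D.in_Hom)
  ultimately show ?thesis
    unfolding is_equivalence_def using GF cat_functor_axioms by blast
qed

end

locale monoidal_linear_equivalence =
  C: tensor_category k C + linear_equivalence k C D F + strong_monoidal_functor C D F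
  for k :: "('k, 'y) ring_scheme" and C :: "('o, 'm, 'k, 'x) mon_category_scheme"
    and D :: "('p, 'n, 'k, 'z) mon_category_scheme" (structure) and F :: "('o, 'm, 'p, 'n, 'w) mon_functor_data_scheme" +
  assumes D_add_left: "\<lbrakk>f \<in> Hom D X X'; f' \<in> Hom D X X'; g \<in> Hom D Y Y'\<rbrakk>
      \<Longrightarrow> add_ar D f f' \<otimes>\<^sub>a g = add_ar D (f \<otimes>\<^sub>a g) (f' \<otimes>\<^sub>a g)"
    and D_add_right: "\<lbrakk>f \<in> Hom D X X'; g \<in> Hom D Y Y'; g' \<in> Hom D Y Y'\<rbrakk>
      \<Longrightarrow> f \<otimes>\<^sub>a add_ar D g g' = add_ar D (f \<otimes>\<^sub>a g) (f \<otimes>\<^sub>a g')"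
    and D_smul_left: "\<lbrakk>c \<in> carrier k; f \<in> Hom D X X'; g \<in> Hom D Y Y'\<rbrakk>
      \<Longrightarrow> smul_ar D c f \<otimes>\<^sub>a g = smul_ar D c (f \<otimes>\<^sub>a g)"
    and D_smul_right: "\<lbrakk>c \<in> carrier k; f \<in> Hom D X X'; g \<in> Hom D Y Y'\<rbrakk>
      \<Longrightarrow> f \<otimes>\<^sub>a smul_ar D c g = smul_ar D c (f \<otimes>\<^sub>a g)"
begin

lemma transport_rigid: "rigid D"
  unfolding rigid_def
proof (intro ballI conjI)
  fix M assume "M \<in> Ob D"
  then obtain X a where [simp]: "X \<in> Ob C" "iso_ar D a" "a \<in> Ar D" "src D a = M" "tgt D a = fob F X"
    by (rule ess_surj)
  obtain Y ev coev Y' ev' coev' where "is_dual C X Y ev coev" "is_dual C Y' X ev' coev'"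
    using C.rigid unfolding rigid_def by (meson \<open>X \<in> Ob C\<close>)
  hence d: "is_dual D (fob F X) (fob F Y) (ev_image X Y ev) (coev_image X Y coev)"
      "is_dual D (fob F Y') (fob F X) (ev_image Y' X ev') (coev_image Y' X coev')"
    by (auto intro: is_dual_image)
  show "\<exists>Y ev coev. is_dual D M Y ev coev"
    using D.is_dual_iso[OF d(1), of "inv_ar D a"] by auto
  have "is_dual (rev_mon D) (fob F X) (fob F Y') (ev_image Y' X ev') (coev_image Y' X coev')"
    using d(2) by (simp add: D.is_dual_rev)
  from monoidal_category.is_dual_iso[OF D.rev_monoidal this, of "inv_ar D a"]
  show "\<exists>Y ev coev. is_dual D Y M ev coev" by (auto simp: D.is_dual_rev)
qed

lemma transport_End_unit: "bij_betw (\<lambda>c. smul_ar D c (\<iota> \<one>\<^sub>o)) (carrier k) (Hom D \<one>\<^sub>o \<one>\<^sub>o)"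
proof -
  let ?T = "\<lambda>f. inv_ar D (fmu0 F) \<cdot> far F f \<cdot> fmu0 F"
  have "bij_betw ?T (Hom C \<one>\<^sub>o\<^bsub>C\<^esub> \<one>\<^sub>o\<^bsub>C\<^esub>) (Hom D \<one>\<^sub>o \<one>\<^sub>o)" by (rule conjugate_bij) simp_all
  hence "bij_betw (?T \<circ> (\<lambda>c. smul_ar C c (\<iota>\<^bsub>C\<^esub> \<one>\<^sub>o\<^bsub>C\<^esub>))) (carrier k) (Hom D \<one>\<^sub>o \<one>\<^sub>o)"
    using C.End_unit by (rule bij_betw_trans[rotated])
  moreover have "(?T \<circ> (\<lambda>c. smul_ar C c (\<iota>\<^bsub>C\<^esub> \<one>\<^sub>o\<^bsub>C\<^esub>))) c = smul_ar D c (\<iota> \<one>\<^sub>o)" if "c \<in> carrier k" for c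
    using that by (simp add: D.cmp_smul D.smul_cmp)
  ultimately show ?thesis by (rule bij_betw_cong[THEN iffD1, rotated])
qed

theorem transport_tensor_category: "tensor_category k D"
  by (intro tensor_category.intro tensor_category_axioms.intro transport_abelian C.abelian_category_axioms
      D.monoidal_category_axioms transport_rigid transport_finite_dim transport_finite_length transport_End_unit
      C.Hom_finite_dim C.finite_length D_add_left D_add_right D_smul_left D_smul_right; assumption)

theorem transport_equivalence: "tensor_equivalence k C D F"
proof -
  have "exact C D F" unfolding exact_def by (simp add: preserves_short_exact)
  hence "tensor_functor k C D F"
    by (intro tensor_functor.intro tensor_functor_axioms.intro C.tensor_category_axioms transport_tensor_category
        strong_monoidal_functor_axioms F_lin)
  thus ?thesis unfolding tensor_equivalence_def using is_equivalence by simp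
qed

end

section \<open>Composites and isomorphic copies of tensor functors\<close>

lemma comp_tensor_functor:
  fixes E (structure)
  assumes F: "tensor_functor k C D F" and G: "tensor_functor k D E G"
  shows "tensor_functor k C E (comp_mon_functor E G F)"
proof -
  interpret F: tensor_functor k C D F by (rule F)
  interpret G: tensor_functor k D E G by (rule G)
  let ?H = "comp_mon_functor E G F"
  have [simp]: "fob ?H X = fob G (fob F X)" "far ?H f = far G (far F f)"
    "fmu ?H X Y = far G (fmu F X Y) \<cdot> fmu G (fob F X) (fob F Y)" "fmu0 ?H = far G (fmu0 F) \<cdot> fmu0 G" for X Y f
    by (simp_all add: comp_mon_functor_def)
  have "cat_functor C E ?H" by unfold_locales (auto simp: F.C.in_Hom G.D.in_Hom)
  moreover have "strong_monoidal_functor_axioms C E ?H"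
  proof
    fix X Y assume [simp]: "X \<in> Ob C" "Y \<in> Ob C"
    show "fmu ?H X Y \<in> Hom E (fob ?H X \<otimes>\<^sub>o fob ?H Y) (fob ?H (X \<otimes>\<^sub>o\<^bsub>C\<^esub> Y))" by (simp add: G.D.in_Hom)
    show "iso_ar E (fmu ?H X Y)" by simp
  next
    fix f X X' g Y Y' assume "f \<in> Hom C X X'" "g \<in> Hom C Y Y'"
    hence [simp]: "f \<in> Ar C" "src C f = X" "tgt C f = X'" "g \<in> Ar C" "src C g = Y" "tgt C g = Y'"
      by (simp_all add: F.C.in_Hom)
    have [simp]: "X \<in> Ob C" "X' \<in> Ob C" "Y \<in> Ob C" "Y' \<in> Ob C"
      using F.C.src_Ob[of f] F.C.tgt_Ob[of f] F.C.src_Ob[of g] F.C.tgt_Ob[of g] by simp_all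
    have "fmu ?H X' Y' \<cdot> (far ?H f \<otimes>\<^sub>a far ?H g)
        = far G (fmu F X' Y') \<cdot> (far G (far F f \<otimes>\<^sub>a\<^bsub>D\<^esub> far F g) \<cdot> fmu G (fob F X) (fob F Y))"
      by (simp add: G.mu_natural)
    also have "\<dots> = far G (fmu F X' Y' \<cdot>\<^bsub>D\<^esub> (far F f \<otimes>\<^sub>a\<^bsub>D\<^esub> far F g)) \<cdot> fmu G (fob F X) (fob F Y)" by simp
    also have "\<dots> = far G (far F (f \<otimes>\<^sub>a\<^bsub>C\<^esub> g) \<cdot>\<^bsub>D\<^esub> fmu F X Y) \<cdot> fmu G (fob F X) (fob F Y)"
      by (simp only: F.fmu_nat[OF \<open>f \<in> Hom C X X'\<close> \<open>g \<in> Hom C Y Y'\<close>])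
    finally show "fmu ?H X' Y' \<cdot> (far ?H f \<otimes>\<^sub>a far ?H g) = far ?H (f \<otimes>\<^sub>a\<^bsub>C\<^esub> g) \<cdot> fmu ?H X Y" by simp
  next
    show "fmu0 ?H \<in> Hom E \<one>\<^sub>o (fob ?H \<one>\<^sub>o\<^bsub>C\<^esub>)" "iso_ar E (fmu0 ?H)" by (simp_all add: G.D.in_Hom)
  next
    fix X Y Z assume [simp]: "X \<in> Ob C" "Y \<in> Ob C" "Z \<in> Ob C"
    let ?x = "fob F X" and ?y = "fob F Y" and ?z = "fob F Z"
    have "far ?H (\<alpha>\<^bsub>C\<^esub> X Y Z) \<cdot> fmu ?H (X \<otimes>\<^sub>o\<^bsub>C\<^esub> Y) Z \<cdot> (fmu ?H X Y \<otimes>\<^sub>a \<iota> (fob ?H Z))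
      = far G (far F (\<alpha>\<^bsub>C\<^esub> X Y Z)) \<cdot> far G (fmu F (X \<otimes>\<^sub>o\<^bsub>C\<^esub> Y) Z) \<cdot> (fmu G (fob F (X \<otimes>\<^sub>o\<^bsub>C\<^esub> Y)) ?z
        \<cdot> (far G (fmu F X Y) \<otimes>\<^sub>a far G (\<iota>\<^bsub>D\<^esub> ?z))) \<cdot> (fmu G ?x ?y \<otimes>\<^sub>a \<iota> (fob G ?z))" by simp
    also have "\<dots> = far G (far F (\<alpha>\<^bsub>C\<^esub> X Y Z)) \<cdot> far G (fmu F (X \<otimes>\<^sub>o\<^bsub>C\<^esub> Y) Z) \<cdot> (far G (fmu F X Y \<otimes>\<^sub>a\<^bsub>D\<^esub> \<iota>\<^bsub>D\<^esub> ?z)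
        \<cdot> fmu G (?x \<otimes>\<^sub>o\<^bsub>D\<^esub> ?y) ?z) \<cdot> (fmu G ?x ?y \<otimes>\<^sub>a \<iota> (fob G ?z))"
      using G.fmu_natural[of "?x \<otimes>\<^sub>o\<^bsub>D\<^esub> ?y" "fmu F X Y" ?z "\<iota>\<^bsub>D\<^esub> ?z"] by simp
    also have "\<dots> = far G (far F (\<alpha>\<^bsub>C\<^esub> X Y Z) \<cdot>\<^bsub>D\<^esub> fmu F (X \<otimes>\<^sub>o\<^bsub>C\<^esub> Y) Z \<cdot>\<^bsub>D\<^esub> (fmu F X Y \<otimes>\<^sub>a\<^bsub>D\<^esub> \<iota>\<^bsub>D\<^esub> ?z))
        \<cdot> fmu G (?x \<otimes>\<^sub>o\<^bsub>D\<^esub> ?y) ?z \<cdot> (fmu G ?x ?y \<otimes>\<^sub>a \<iota> (fob G ?z))" by simp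
    also have "\<dots> = far G (fmu F X (Y \<otimes>\<^sub>o\<^bsub>C\<^esub> Z) \<cdot>\<^bsub>D\<^esub> (\<iota>\<^bsub>D\<^esub> ?x \<otimes>\<^sub>a\<^bsub>D\<^esub> fmu F Y Z) \<cdot>\<^bsub>D\<^esub> \<alpha>\<^bsub>D\<^esub> ?x ?y ?z)
        \<cdot> fmu G (?x \<otimes>\<^sub>o\<^bsub>D\<^esub> ?y) ?z \<cdot> (fmu G ?x ?y \<otimes>\<^sub>a \<iota> (fob G ?z))"
      by (simp only: F.fmu_assoc \<open>X \<in> Ob C\<close> \<open>Y \<in> Ob C\<close> \<open>Z \<in> Ob C\<close>)
    also have "\<dots> = far G (fmu F X (Y \<otimes>\<^sub>o\<^bsub>C\<^esub> Z)) \<cdot> far G (\<iota>\<^bsub>D\<^esub> ?x \<otimes>\<^sub>a\<^bsub>D\<^esub> fmu F Y Z) \<cdot> (far G (\<alpha>\<^bsub>D\<^esub> ?x ?y ?z)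
        \<cdot> fmu G (?x \<otimes>\<^sub>o\<^bsub>D\<^esub> ?y) ?z \<cdot> (fmu G ?x ?y \<otimes>\<^sub>a \<iota> (fob G ?z)))" by simp
    also have "\<dots> = far G (fmu F X (Y \<otimes>\<^sub>o\<^bsub>C\<^esub> Z)) \<cdot> far G (\<iota>\<^bsub>D\<^esub> ?x \<otimes>\<^sub>a\<^bsub>D\<^esub> fmu F Y Z) \<cdot> fmu G ?x (?y \<otimes>\<^sub>o\<^bsub>D\<^esub> ?z)
        \<cdot> (\<iota> (fob G ?x) \<otimes>\<^sub>a fmu G ?y ?z) \<cdot> \<alpha> (fob G ?x) (fob G ?y) (fob G ?z)"
      by (simp add: G.fmu_assoc)
    also have "\<dots> = fmu ?H X (Y \<otimes>\<^sub>o\<^bsub>C\<^esub> Z) \<cdot> (\<iota> (fob ?H X) \<otimes>\<^sub>a fmu ?H Y Z) \<cdot> \<alpha> (fob ?H X) (fob ?H Y) (fob ?H Z)"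
      by (simp add: G.mu_natural)
    finally show "far ?H (\<alpha>\<^bsub>C\<^esub> X Y Z) \<cdot> fmu ?H (X \<otimes>\<^sub>o\<^bsub>C\<^esub> Y) Z \<cdot> (fmu ?H X Y \<otimes>\<^sub>a \<iota> (fob ?H Z))
      = fmu ?H X (Y \<otimes>\<^sub>o\<^bsub>C\<^esub> Z) \<cdot> (\<iota> (fob ?H X) \<otimes>\<^sub>a fmu ?H Y Z) \<cdot> \<alpha> (fob ?H X) (fob ?H Y) (fob ?H Z)" .
  next
    fix X assume X [simp]: "X \<in> Ob C"
    let ?x = "fob F X" and ?i = "\<iota>\<^bsub>D\<^esub> (fob F X)" and ?j = "\<iota> (fob G (fob F X))"
    have "far ?H (\<lambda>\<^sub>l\<^bsub>C\<^esub> X) \<cdot> fmu ?H \<one>\<^sub>o\<^bsub>C\<^esub> X \<cdot> (fmu0 ?H \<otimes>\<^sub>a \<iota> (fob ?H X))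
      = far G (far F (\<lambda>\<^sub>l\<^bsub>C\<^esub> X)) \<cdot> far G (fmu F \<one>\<^sub>o\<^bsub>C\<^esub> X) \<cdot> (fmu G (fob F \<one>\<^sub>o\<^bsub>C\<^esub>) ?x \<cdot> (far G (fmu0 F) \<otimes>\<^sub>a far G ?i))
        \<cdot> (fmu0 G \<otimes>\<^sub>a ?j)" by simp
    also have "\<dots> = far G (far F (\<lambda>\<^sub>l\<^bsub>C\<^esub> X)) \<cdot> far G (fmu F \<one>\<^sub>o\<^bsub>C\<^esub> X) \<cdot> (far G (fmu0 F \<otimes>\<^sub>a\<^bsub>D\<^esub> ?i) \<cdot> fmu G \<one>\<^sub>o\<^bsub>D\<^esub> ?x)
        \<cdot> (fmu0 G \<otimes>\<^sub>a ?j)"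
      using G.fmu_natural[of "\<one>\<^sub>o\<^bsub>D\<^esub>" "fmu0 F" ?x ?i] by simp
    also have "\<dots> = far G (far F (\<lambda>\<^sub>l\<^bsub>C\<^esub> X) \<cdot>\<^bsub>D\<^esub> fmu F \<one>\<^sub>o\<^bsub>C\<^esub> X \<cdot>\<^bsub>D\<^esub> (fmu0 F \<otimes>\<^sub>a\<^bsub>D\<^esub> ?i)) \<cdot> fmu G \<one>\<^sub>o\<^bsub>D\<^esub> ?x \<cdot> (fmu0 G \<otimes>\<^sub>a ?j)"
      by simp
    also have "\<dots> = \<lambda>\<^sub>l (fob ?H X)" by (simp only: F.fmu_lunit X) (simp add: G.fmu_lunit)
    finally show "far ?H (\<lambda>\<^sub>l\<^bsub>C\<^esub> X) \<cdot> fmu ?H \<one>\<^sub>o\<^bsub>C\<^esub> X \<cdot> (fmu0 ?H \<otimes>\<^sub>a \<iota> (fob ?H X)) = \<lambda>\<^sub>l (fob ?H X)" .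
    have "far ?H (\<rho>\<^bsub>C\<^esub> X) \<cdot> fmu ?H X \<one>\<^sub>o\<^bsub>C\<^esub> \<cdot> (\<iota> (fob ?H X) \<otimes>\<^sub>a fmu0 ?H)
      = far G (far F (\<rho>\<^bsub>C\<^esub> X)) \<cdot> far G (fmu F X \<one>\<^sub>o\<^bsub>C\<^esub>) \<cdot> (fmu G ?x (fob F \<one>\<^sub>o\<^bsub>C\<^esub>) \<cdot> (far G ?i \<otimes>\<^sub>a far G (fmu0 F)))
        \<cdot> (?j \<otimes>\<^sub>a fmu0 G)" by simp
    also have "\<dots> = far G (far F (\<rho>\<^bsub>C\<^esub> X)) \<cdot> far G (fmu F X \<one>\<^sub>o\<^bsub>C\<^esub>) \<cdot> (far G (?i \<otimes>\<^sub>a\<^bsub>D\<^esub> fmu0 F) \<cdot> fmu G ?x \<one>\<^sub>o\<^bsub>D\<^esub>)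
        \<cdot> (?j \<otimes>\<^sub>a fmu0 G)"
      using G.fmu_natural[of ?x ?i "\<one>\<^sub>o\<^bsub>D\<^esub>" "fmu0 F"] by simp
    also have "\<dots> = far G (far F (\<rho>\<^bsub>C\<^esub> X) \<cdot>\<^bsub>D\<^esub> fmu F X \<one>\<^sub>o\<^bsub>C\<^esub> \<cdot>\<^bsub>D\<^esub> (?i \<otimes>\<^sub>a\<^bsub>D\<^esub> fmu0 F)) \<cdot> fmu G ?x \<one>\<^sub>o\<^bsub>D\<^esub> \<cdot> (?j \<otimes>\<^sub>a fmu0 G)"
      by simp
    also have "\<dots> = \<rho> (fob ?H X)" by (simp only: F.fmu_runit X) (simp add: G.fmu_runit)
    finally show "far ?H (\<rho>\<^bsub>C\<^esub> X) \<cdot> fmu ?H X \<one>\<^sub>o\<^bsub>C\<^esub> \<cdot> (\<iota> (fob ?H X) \<otimes>\<^sub>a fmu0 ?H) = \<rho> (fob ?H X)" .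
  qed
  moreover have "linear k C E ?H"
  proof -
    interpret FL: linear_functor k C D F by unfold_locales (rule F.F_linear)
    interpret GL: linear_functor k D E G by unfold_locales (rule G.F_linear)
    show ?thesis unfolding linear_def by (auto simp: F.C.in_Hom)
  qed
  moreover have "exact C E ?H" using F.F_exact G.F_exact by (simp add: exact_def)
  ultimately show ?thesis
    by (intro tensor_functor.intro tensor_functor_axioms.intro strong_monoidal_functor.intro
        F.C.tensor_category_axioms G.D.tensor_category_axioms F.C.monoidal_category_axioms
        G.D.monoidal_category_axioms)
qed

text \<open>Conjugation by the isomorphisms \<open>\<theta>\<close> turns the axioms for \<open>G\<close> into those for \<open>H\<close>, of which only
  the typing has to be known beforehand.\<close>

lemma tensor_functor_iso:
  fixes D (structure)
  assumes G: "tensor_functor k C D G"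
    and ty: "\<And>X. X \<in> Ob C \<Longrightarrow> fob H X \<in> Ob D" "\<And>f. f \<in> Ar C \<Longrightarrow> far H f \<in> Hom D (fob H (src C f)) (fob H (tgt C f))"
      "\<And>X Y. \<lbrakk>X \<in> Ob C; Y \<in> Ob C\<rbrakk> \<Longrightarrow> fmu H X Y \<in> Hom D (fob H X \<otimes>\<^sub>o fob H Y) (fob H (X \<otimes>\<^sub>o\<^bsub>C\<^esub> Y))"
    and \<theta>: "\<And>X. X \<in> Ob C \<Longrightarrow> \<theta> X \<in> Hom D (fob G X) (fob H X)" "\<And>X. X \<in> Ob C \<Longrightarrow> iso_ar D (\<theta> X)"
    and nat: "\<And>f. f \<in> Ar C \<Longrightarrow> \<theta> (tgt C f) \<cdot> far G f = far H f \<cdot> \<theta> (src C f)"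
    and mu: "\<And>X Y. \<lbrakk>X \<in> Ob C; Y \<in> Ob C\<rbrakk> \<Longrightarrow> \<theta> (X \<otimes>\<^sub>o\<^bsub>C\<^esub> Y) \<cdot> fmu G X Y = fmu H X Y \<cdot> (\<theta> X \<otimes>\<^sub>a \<theta> Y)"
    and mu0: "fmu0 H = \<theta> \<one>\<^sub>o\<^bsub>C\<^esub> \<cdot> fmu0 G"
  shows "isomorphic_tensor_functors k C D G H"
proof -
  interpret G: tensor_functor k C D G by (rule G)
  interpret GL: linear_functor k C D G by unfold_locales (rule G.F_linear)
  have \<theta>' [simp]: "\<theta> X \<in> Ar D" "src D (\<theta> X) = fob G X" "tgt D (\<theta> X) = fob H X" "iso_ar D (\<theta> X)"
    if "X \<in> Ob C" for X using \<theta>[OF that] by (simp_all add: G.D.in_Hom)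
  have [simp]: "fob H X \<in> Ob D" if "X \<in> Ob C" for X using ty(1)[OF that] .
  have H [simp]: "far H f \<in> Ar D" "src D (far H f) = fob H (src C f)" "tgt D (far H f) = fob H (tgt C f)"
    if "f \<in> Ar C" for f using ty(2)[OF that] by (simp_all add: G.D.in_Hom)
  have [simp]: "fmu H X Y \<in> Ar D" "src D (fmu H X Y) = fob H X \<otimes>\<^sub>o fob H Y" "tgt D (fmu H X Y) = fob H (X \<otimes>\<^sub>o\<^bsub>C\<^esub> Y)"
    if "X \<in> Ob C" "Y \<in> Ob C" for X Y using ty(3)[OF that] by (simp_all add: G.D.in_Hom)
  have nat': "far H f \<cdot> \<theta> X = \<theta> (tgt C f) \<cdot> far G f" if "f \<in> Ar C" "X = src C f" for f X
    using nat[of f] that by simp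
  have mu': "fmu H X Y \<cdot> (\<theta> X \<otimes>\<^sub>a \<theta> Y) = \<theta> (X \<otimes>\<^sub>o\<^bsub>C\<^esub> Y) \<cdot> fmu G X Y" if "X \<in> Ob C" "Y \<in> Ob C" for X Y
    using mu[OF that] by simp
  note nat'' = nat' nat'[THEN G.D.reassoc] mu' mu'[THEN G.D.reassoc]
  have natinv: "inv_ar D (\<theta> (tgt C f)) \<cdot> far H f = far G f \<cdot> inv_ar D (\<theta> (src C f))"
    if [simp]: "f \<in> Ar C" for f
  proof -
    have "inv_ar D (\<theta> (tgt C f)) \<cdot> (far H f \<cdot> \<theta> (src C f)) \<cdot> inv_ar D (\<theta> (src C f))
        = inv_ar D (\<theta> (tgt C f)) \<cdot> (\<theta> (tgt C f) \<cdot> far G f) \<cdot> inv_ar D (\<theta> (src C f))"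
      by (simp only: nat that)
    thus ?thesis by simp
  qed
  have "cat_functor C D H"
  proof unfold_locales
    fix X assume [simp]: "X \<in> Ob C"
    show "far H (\<iota>\<^bsub>C\<^esub> X) = \<iota> (fob H X)" by (rule G.D.epiD[of "\<theta> X"]) (simp_all add: nat'')
  next
    fix f X Y g Z assume "f \<in> Hom C X Y" "g \<in> Hom C Y Z"
    hence [simp]: "f \<in> Ar C" "src C f = X" "tgt C f = Y" "g \<in> Ar C" "src C g = Y" "tgt C g = Z"
      by (auto simp: G.C.in_Hom)
    have [simp]: "X \<in> Ob C" "Y \<in> Ob C" "Z \<in> Ob C" using G.C.src_Ob[of f] G.C.tgt_Ob[of f] G.C.tgt_Ob[of g] by simp_all
    show "far H (g \<cdot>\<^bsub>C\<^esub> f) = far H g \<cdot> far H f" by (rule G.D.epiD[of "\<theta> X"]) (simp_all add: nat'')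
  qed (auto simp: G.C.in_Hom G.D.in_Hom)
  moreover have "strong_monoidal_functor_axioms C D H"
  proof
    fix X Y assume [simp]: "X \<in> Ob C" "Y \<in> Ob C"
    show "fmu H X Y \<in> Hom D (fob H X \<otimes>\<^sub>o fob H Y) (fob H (X \<otimes>\<^sub>o\<^bsub>C\<^esub> Y))" by (simp add: G.D.in_Hom)
    have "fmu H X Y = \<theta> (X \<otimes>\<^sub>o\<^bsub>C\<^esub> Y) \<cdot> fmu G X Y \<cdot> inv_ar D (\<theta> X \<otimes>\<^sub>a \<theta> Y)"
      by (simp add: mu[THEN G.D.reassoc])
    also have "iso_ar D \<dots>" by (intro G.D.iso_cmp) simp_all
    finally show "iso_ar D (fmu H X Y)" .
  next
    fix f X X' g Y Y' assume "f \<in> Hom C X X'" "g \<in> Hom C Y Y'"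
    hence [simp]: "f \<in> Ar C" "src C f = X" "tgt C f = X'" "g \<in> Ar C" "src C g = Y" "tgt C g = Y'"
      by (simp_all add: G.C.in_Hom)
    have [simp]: "X \<in> Ob C" "X' \<in> Ob C" "Y \<in> Ob C" "Y' \<in> Ob C"
      using G.C.src_Ob[of f] G.C.tgt_Ob[of f] G.C.src_Ob[of g] G.C.tgt_Ob[of g] by simp_all
    show "fmu H X' Y' \<cdot> (far H f \<otimes>\<^sub>a far H g) = far H (f \<otimes>\<^sub>a\<^bsub>C\<^esub> g) \<cdot> fmu H X Y"
    proof (rule G.D.epiD[of "\<theta> X \<otimes>\<^sub>a \<theta> Y"])
      have "(fmu H X' Y' \<cdot> (far H f \<otimes>\<^sub>a far H g)) \<cdot> (\<theta> X \<otimes>\<^sub>a \<theta> Y)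
        = (fmu H X' Y' \<cdot> (\<theta> X' \<otimes>\<^sub>a \<theta> Y')) \<cdot> (far G f \<otimes>\<^sub>a far G g)" by (simp add: nat')
      also have "\<dots> = \<theta> (X' \<otimes>\<^sub>o\<^bsub>C\<^esub> Y') \<cdot> far G (f \<otimes>\<^sub>a\<^bsub>C\<^esub> g) \<cdot> fmu G X Y" by (simp add: mu' G.mu_natural)
      also have "\<dots> = (far H (f \<otimes>\<^sub>a\<^bsub>C\<^esub> g) \<cdot> fmu H X Y) \<cdot> (\<theta> X \<otimes>\<^sub>a \<theta> Y)" by (simp add: nat'')
      finally show "(fmu H X' Y' \<cdot> (far H f \<otimes>\<^sub>a far H g)) \<cdot> (\<theta> X \<otimes>\<^sub>a \<theta> Y)
        = (far H (f \<otimes>\<^sub>a\<^bsub>C\<^esub> g) \<cdot> fmu H X Y) \<cdot> (\<theta> X \<otimes>\<^sub>a \<theta> Y)" .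
    qed simp_all
  next
    show "fmu0 H \<in> Hom D \<one>\<^sub>o (fob H \<one>\<^sub>o\<^bsub>C\<^esub>)" "iso_ar D (fmu0 H)" by (simp_all add: G.D.in_Hom mu0)
  next
    fix X Y Z assume [simp]: "X \<in> Ob C" "Y \<in> Ob C" "Z \<in> Ob C"
    let ?l = "far H (\<alpha>\<^bsub>C\<^esub> X Y Z) \<cdot> fmu H (X \<otimes>\<^sub>o\<^bsub>C\<^esub> Y) Z \<cdot> (fmu H X Y \<otimes>\<^sub>a \<iota> (fob H Z))"
    let ?r = "fmu H X (Y \<otimes>\<^sub>o\<^bsub>C\<^esub> Z) \<cdot> (\<iota> (fob H X) \<otimes>\<^sub>a fmu H Y Z) \<cdot> \<alpha> (fob H X) (fob H Y) (fob H Z)"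
    let ?e = "(\<theta> X \<otimes>\<^sub>a \<theta> Y) \<otimes>\<^sub>a \<theta> Z"
    show "?l = ?r"
    proof (rule G.D.epiD[of ?e])
      have "?l \<cdot> ?e = far H (\<alpha>\<^bsub>C\<^esub> X Y Z) \<cdot> (fmu H (X \<otimes>\<^sub>o\<^bsub>C\<^esub> Y) Z \<cdot> (\<theta> (X \<otimes>\<^sub>o\<^bsub>C\<^esub> Y) \<otimes>\<^sub>a \<theta> Z)) \<cdot> (fmu G X Y \<otimes>\<^sub>a \<iota> (fob G Z))"
        by (simp add: mu'[of X Y])
      also have "\<dots> = \<theta> (X \<otimes>\<^sub>o\<^bsub>C\<^esub> (Y \<otimes>\<^sub>o\<^bsub>C\<^esub> Z)) \<cdot> (far G (\<alpha>\<^bsub>C\<^esub> X Y Z) \<cdot> fmu G (X \<otimes>\<^sub>o\<^bsub>C\<^esub> Y) Z \<cdot> (fmu G X Y \<otimes>\<^sub>a \<iota> (fob G Z)))"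
        by (simp add: nat'')
      also have "\<dots> = (\<theta> (X \<otimes>\<^sub>o\<^bsub>C\<^esub> (Y \<otimes>\<^sub>o\<^bsub>C\<^esub> Z)) \<cdot> fmu G X (Y \<otimes>\<^sub>o\<^bsub>C\<^esub> Z)) \<cdot> (\<iota> (fob G X) \<otimes>\<^sub>a fmu G Y Z)
          \<cdot> \<alpha> (fob G X) (fob G Y) (fob G Z)" by (simp add: G.fmu_assoc)
      also have "\<dots> = (fmu H X (Y \<otimes>\<^sub>o\<^bsub>C\<^esub> Z) \<cdot> (\<theta> X \<otimes>\<^sub>a \<theta> (Y \<otimes>\<^sub>o\<^bsub>C\<^esub> Z))) \<cdot> (\<iota> (fob G X) \<otimes>\<^sub>a fmu G Y Z)
          \<cdot> \<alpha> (fob G X) (fob G Y) (fob G Z)" by (simp only: mu' G.C.tens_ob_in \<open>X \<in> Ob C\<close> \<open>Y \<in> Ob C\<close> \<open>Z \<in> Ob C\<close>)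
      also have "\<dots> = fmu H X (Y \<otimes>\<^sub>o\<^bsub>C\<^esub> Z) \<cdot> (\<theta> X \<otimes>\<^sub>a (fmu H Y Z \<cdot> (\<theta> Y \<otimes>\<^sub>a \<theta> Z)))
          \<cdot> \<alpha> (fob G X) (fob G Y) (fob G Z)" by (simp add: mu'[of Y Z])
      also have "\<dots> = fmu H X (Y \<otimes>\<^sub>o\<^bsub>C\<^esub> Z) \<cdot> (\<iota> (fob H X) \<otimes>\<^sub>a fmu H Y Z) \<cdot> ((\<theta> X \<otimes>\<^sub>a (\<theta> Y \<otimes>\<^sub>a \<theta> Z))
          \<cdot> \<alpha> (fob G X) (fob G Y) (fob G Z))" by simp
      also have "\<dots> = ?r \<cdot> ?e" by (simp add: G.D.natural)
      finally show "?l \<cdot> ?e = ?r \<cdot> ?e" .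
    qed simp_all
  next
    fix X assume [simp]: "X \<in> Ob C"
    show "far H (\<lambda>\<^sub>l\<^bsub>C\<^esub> X) \<cdot> fmu H \<one>\<^sub>o\<^bsub>C\<^esub> X \<cdot> (fmu0 H \<otimes>\<^sub>a \<iota> (fob H X)) = \<lambda>\<^sub>l (fob H X)" (is "?l = ?r")
    proof (rule G.D.epiD[of "\<iota> \<one>\<^sub>o \<otimes>\<^sub>a \<theta> X"])
      have "?l \<cdot> (\<iota> \<one>\<^sub>o \<otimes>\<^sub>a \<theta> X) = far H (\<lambda>\<^sub>l\<^bsub>C\<^esub> X) \<cdot> (fmu H \<one>\<^sub>o\<^bsub>C\<^esub> X \<cdot> (\<theta> \<one>\<^sub>o\<^bsub>C\<^esub> \<otimes>\<^sub>a \<theta> X)) \<cdot> (fmu0 G \<otimes>\<^sub>a \<iota> (fob G X))"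
        by (simp add: mu0)
      also have "\<dots> = ?r \<cdot> (\<iota> \<one>\<^sub>o \<otimes>\<^sub>a \<theta> X)" by (simp add: nat'' G.fmu_lunit G.D.natural)
      finally show "?l \<cdot> (\<iota> \<one>\<^sub>o \<otimes>\<^sub>a \<theta> X) = ?r \<cdot> (\<iota> \<one>\<^sub>o \<otimes>\<^sub>a \<theta> X)" .
    qed (simp_all add: mu0)
    show "far H (\<rho>\<^bsub>C\<^esub> X) \<cdot> fmu H X \<one>\<^sub>o\<^bsub>C\<^esub> \<cdot> (\<iota> (fob H X) \<otimes>\<^sub>a fmu0 H) = \<rho> (fob H X)" (is "?l = ?r")
    proof (rule G.D.epiD[of "\<theta> X \<otimes>\<^sub>a \<iota> \<one>\<^sub>o"])
      have "?l \<cdot> (\<theta> X \<otimes>\<^sub>a \<iota> \<one>\<^sub>o) = far H (\<rho>\<^bsub>C\<^esub> X) \<cdot> (fmu H X \<one>\<^sub>o\<^bsub>C\<^esub> \<cdot> (\<theta> X \<otimes>\<^sub>a \<theta> \<one>\<^sub>o\<^bsub>C\<^esub>)) \<cdot> (\<iota> (fob G X) \<otimes>\<^sub>a fmu0 G)"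
        by (simp add: mu0)
      also have "\<dots> = ?r \<cdot> (\<theta> X \<otimes>\<^sub>a \<iota> \<one>\<^sub>o)" by (simp add: nat'' G.fmu_runit G.D.natural)
      finally show "?l \<cdot> (\<theta> X \<otimes>\<^sub>a \<iota> \<one>\<^sub>o) = ?r \<cdot> (\<theta> X \<otimes>\<^sub>a \<iota> \<one>\<^sub>o)" .
    qed (simp_all add: mu0)
  qed
  moreover have "linear k C D H"
    unfolding linear_def
  proof (intro conjI ballI)
    fix X Y f assume "X \<in> Ob C" "Y \<in> Ob C" "f \<in> Hom C X Y"
    hence [simp]: "X \<in> Ob C" "Y \<in> Ob C" "f \<in> Ar C" "src C f = X" "tgt C f = Y" by (auto simp: G.C.in_Hom)
    { fix g assume "g \<in> Hom C X Y"
      hence [simp]: "g \<in> Ar C" "src C g = X" "tgt C g = Y" by (auto simp: G.C.in_Hom)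
      show "far H (add_ar C f g) = add_ar D (far H f) (far H g)"
        by (rule G.D.epiD[of "\<theta> X"]) (simp_all add: nat' G.D.add_cmp G.D.cmp_add) }
    { fix c assume "c \<in> carrier k"
      thus "far H (smul_ar C c f) = smul_ar D c (far H f)"
        by (intro G.D.epiD[of "\<theta> X" "far H (smul_ar C c f)"]) (simp_all add: nat' G.D.smul_cmp G.D.cmp_smul) }
  qed
  moreover have "exact C D H"
    unfolding exact_def
  proof (intro allI impI)
    fix f g assume fg: "short_exact C f g"
    hence k: "is_kernel C g f" by (simp add: short_exact_def)
    note [simp] = G.C.kernelD(1,2)[OF k] and t = G.C.kernelD(3)[OF k]
    have e: "short_exact D (far G f) (far G g)" using fg G.F_exact by (simp add: exact_def)
    show "short_exact D (far H f) (far H g)"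
      by (rule G.D.short_exact_iso[OF e, of "inv_ar D (\<theta> (src C f))" "inv_ar D (\<theta> (tgt C f))" "inv_ar D (\<theta> (tgt C g))"])
        (use natinv[of f] natinv[of g] t in simp_all)
  qed
  ultimately have "tensor_functor k C D H"
    by (intro tensor_functor.intro tensor_functor_axioms.intro strong_monoidal_functor.intro
        G.C.tensor_category_axioms G.D.tensor_category_axioms G.C.monoidal_category_axioms
        G.D.monoidal_category_axioms)
  moreover have "monoidal_nat_iso C D G H \<theta>"
    unfolding monoidal_nat_iso_def nat_iso_def nat_trans_def
    using nat mu mu0 by (auto simp: G.C.in_Hom G.D.in_Hom)
  ultimately show ?thesis unfolding isomorphic_tensor_functors_def using G by blast
qed

section \<open>Free modules and the comparison theorem\<close>

context faithful_exact_adjunction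
begin

sublocale KE: linear_equivalence k D E K
proof (intro linear_equivalence.intro linear_equivalence_axioms.intro linear_functor.intro linear_functor_axioms.intro)
  show "linear_category k D" "linear_category k E" by (rule D.linear_category_axioms EL.linear_category_axioms)+
  show "cat_functor D E K" by (rule K_functor)
  show "linear k D E K" by (rule K_linear)
  show "faithful D K" by (rule K_faithful)
  show "\<And>X Y g. \<lbrakk>X \<in> Ob D; Y \<in> Ob D; g \<in> Hom E (fob K X) (fob K Y)\<rbrakk> \<Longrightarrow> \<exists>f\<in>Hom D X Y. far K f = g"
    using K_full by simp
  show "\<And>M. M \<in> Ob E \<Longrightarrow> \<exists>X a. X \<in> Ob D \<and> iso_ar E a \<and> src E a = M \<and> tgt E a = fob K X"
    using K_ess_surj by simp
qed

sublocale KT: monoidal_linear_equivalence k D E K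
  by unfold_locales (auto simp: Hom_E tens_ar_eq tar_add tar_smul)

abbreviation "free \<equiv> free_module C A"
abbreviation "FA \<equiv> free_module_functor C A"

lemma free_simps [simp]:
  "fst (free X) = X \<otimes>\<^sub>o RI" "snd (free X) = (\<iota> X \<otimes>\<^sub>a lact \<one>\<^sub>o\<^bsub>D\<^esub>) \<cdot> \<alpha> X RI RI"
  by (simp_all add: free_module_def)

lemma free_mod:
  assumes [simp]: "X \<in> Ob C"
  shows "is_mod (free X)" and mhom_Q: "mhom (free X) (Q X) (kob (fob F X))"
proof -
  have "is_mod (fst (free X), snd (free X))"
    by (rule mod_transport[of "fob F X" "Q X"]) (simp_all add: ract_Q)
  thus "is_mod (free X)" by (simp only: prod.collapse)
  thus "mhom (free X) (Q X) (kob (fob F X))" by (simp add: mhom_def ract_Q)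
qed

text \<open>Under \<open>Q\<close>, the half-braiding at \<open>Y\<close> followed by the product of \<open>A\<close> becomes the left action on
  \<open>R F Y\<close>, and by balancedness of \<open>R2\<close> this may be replaced by the right action on \<open>R F X\<close>.\<close>

lemma free_mu:
  assumes [simp]: "X \<in> Ob C" "Y \<in> Ob C"
  shows "Q (X \<otimes>\<^sub>o Y) \<cdot> inv_ar C (\<alpha> X Y RI)
      \<cdot> (\<iota> X \<otimes>\<^sub>a ((\<iota> Y \<otimes>\<^sub>a lact \<one>\<^sub>o\<^bsub>D\<^esub>) \<cdot> \<alpha> Y RI RI \<cdot> (\<sigma> Y \<otimes>\<^sub>a \<iota> RI) \<cdot> inv_ar C (\<alpha> RI Y RI)))
      \<cdot> \<alpha> X RI (Y \<otimes>\<^sub>o RI) = RF2 X Y \<cdot> (Q X \<otimes>\<^sub>a Q Y)"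
proof -
  let ?w = "(\<iota> Y \<otimes>\<^sub>a lact \<one>\<^sub>o\<^bsub>D\<^esub>) \<cdot> \<alpha> Y RI RI \<cdot> (\<sigma> Y \<otimes>\<^sub>a \<iota> RI) \<cdot> inv_ar C (\<alpha> RI Y RI)"
  have "Q Y \<cdot> ?w = (Q Y \<cdot> (\<iota> Y \<otimes>\<^sub>a lact \<one>\<^sub>o\<^bsub>D\<^esub>) \<cdot> \<alpha> Y RI RI) \<cdot> (\<sigma> Y \<otimes>\<^sub>a \<iota> RI) \<cdot> inv_ar C (\<alpha> RI Y RI)"
    by simp
  also have "\<dots> = ract (fob F Y) \<cdot> ((Q Y \<cdot> \<sigma> Y) \<otimes>\<^sub>a \<iota> RI) \<cdot> inv_ar C (\<alpha> RI Y RI)"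
    by (simp only: ract_Q[symmetric] assms) simp
  also have "\<dots> = (ract (fob F Y) \<cdot> (L Y \<otimes>\<^sub>a \<iota> RI)) \<cdot> inv_ar C (\<alpha> RI Y RI)"
    by (simp add: Q_braiding)
  also have "\<dots> = lact (fob F Y) \<cdot> (\<iota> RI \<otimes>\<^sub>a Q Y)" by (simp add: ract_L)
  finally have w: "Q Y \<cdot> ?w = lact (fob F Y) \<cdot> (\<iota> RI \<otimes>\<^sub>a Q Y)" .
  have "Q (X \<otimes>\<^sub>o Y) \<cdot> inv_ar C (\<alpha> X Y RI) \<cdot> (\<iota> X \<otimes>\<^sub>a ?w) \<cdot> \<alpha> X RI (Y \<otimes>\<^sub>o RI)
      = RF2 X Y \<cdot> (\<eta> X \<otimes>\<^sub>a (Q Y \<cdot> ?w)) \<cdot> \<alpha> X RI (Y \<otimes>\<^sub>o RI)"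
    by (simp add: Q_tens[THEN C.reassoc])
  also have "\<dots> = far R (fmu F X Y) \<cdot> (R2 (fob F X) (fob F Y) \<cdot> (\<eta> X \<otimes>\<^sub>a (lact (fob F Y) \<cdot> (\<iota> RI \<otimes>\<^sub>a Q Y)))
      \<cdot> \<alpha> X RI (Y \<otimes>\<^sub>o RI))"
    unfolding w by (simp add: RF2_def)
  also have "\<dots> = RF2 X Y \<cdot> (Q X \<otimes>\<^sub>a Q Y)"
    by (simp add: RF2_balanced RF2_def)
  finally show ?thesis .
qed

lemma unit_eq_R0: "\<eta> \<one>\<^sub>o = far R (fmu0 F) \<cdot> R0"
proof -
  have "far R (fmu0 F) \<cdot> far R (inv_ar D (fmu0 F)) = \<iota> (fob R (fob F \<one>\<^sub>o))"
    by (simp flip: R.far_cmp')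
  thus ?thesis by (simp add: radj_mu0_def C.reassoc)
qed

text \<open>Up to the isomorphism \<open>\<one> \<rightarrow> F \<one>\<close> this is the left unit law of the algebra, because the
  unit of the adjunction at \<open>\<one>\<close> is the unit of the algebra.\<close>

lemma Q_unit: "Q \<one>\<^sub>o = far R (fmu0 F) \<cdot> \<lambda>\<^sub>l RI"
proof -
  have "Q \<one>\<^sub>o = (ract (fob F \<one>\<^sub>o) \<cdot> (far R (fmu0 F) \<otimes>\<^sub>a \<iota> RI)) \<cdot> (R0 \<otimes>\<^sub>a \<iota> RI)"
    by (simp add: Q_eq unit_eq_R0)
  also have "\<dots> = far R (fmu0 F) \<cdot> (lact \<one>\<^sub>o\<^bsub>D\<^esub> \<cdot> (R0 \<otimes>\<^sub>a \<iota> RI))"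
    by (simp add: ract_natural lact_unit_eq_ract_unit)
  also have "\<dots> = far R (fmu0 F) \<cdot> \<lambda>\<^sub>l RI" by (simp add: lact_one)
  finally show ?thesis .
qed

abbreviation "KF \<equiv> comp_mon_functor E K F"

text \<open>The isomorphism is the inverse of \<open>Q\<close>. It intertwines the monoidal structures since the one of
  \<open>FA\<close> is determined by its composite with the epimorphism \<open>proj\<close>.\<close>

theorem free_module_functor_iso:
  assumes F: "tensor_functor k C D F"
  shows "isomorphic_tensor_functors k C E KF FA"
proof -
  have KF: "tensor_functor k C E KF"
    by (rule comp_tensor_functor[OF F]) (use KT.transport_equivalence in \<open>simp add: tensor_equivalence_def\<close>)
  define \<theta> where "\<theta> X = (kob (fob F X), inv_ar C (Q X), free X)" for X
  define mu where "mu X Y = inv_ar C (Q (X \<otimes>\<^sub>o Y)) \<cdot> far R (fmu F X Y) \<cdot> kmu (fob F X) (fob F Y)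
      \<cdot> tar (free X) (Q X) (kob (fob F X)) (free Y) (Q Y) (kob (fob F Y))" for X Y
  have [simp]: "far FA f = (free (src C f), f \<otimes>\<^sub>a \<iota> RI, free (tgt C f))"
      "far KF f = (kob (fob F (src C f)), far R (far F f), kob (fob F (tgt C f)))"
    if "f \<in> Ar C" for f
    using that by (simp_all add: free_module_functor_def comp_mon_functor_def)
  have [simp]: "fob FA X = free X" "fob KF X = kob (fob F X)" "fmu0 FA = (munit, inv_ar C (\<lambda>\<^sub>l RI), free \<one>\<^sub>o)" for X
    by (simp_all add: free_module_functor_def comp_mon_functor_def)
  note [simp] = free_mod mhom_Q
  have Qi: "mhom (kob (fob F X)) (inv_ar C (Q X)) (free X)" "iso_ar C (Q X)" if "X \<in> Ob C" for X
    using that mhom_inv[OF mhom_Q] by simp_all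
  have \<theta>: "\<theta> X \<in> Hom E (fob KF X) (fob FA X)" "iso_ar E (\<theta> X)"
    and \<theta>_inv: "inv_ar E (\<theta> X) = (free X, Q X, kob (fob F X))" if "X \<in> Ob C" for X
    using that Qi iso_E[OF Qi(1)] by (simp_all add: \<theta>_def)
  have natQ: "inv_ar C (Q (tgt C f)) \<cdot> far R (far F f) = (f \<otimes>\<^sub>a \<iota> RI) \<cdot> inv_ar C (Q (src C f))"
    if [simp]: "f \<in> Ar C" for f
  proof (rule C.epiD[of "Q (src C f)"])
    have "(inv_ar C (Q (tgt C f)) \<cdot> far R (far F f)) \<cdot> Q (src C f)
        = inv_ar C (Q (tgt C f)) \<cdot> Q (tgt C f) \<cdot> (f \<otimes>\<^sub>a \<iota> RI)"
      by (simp only: Q_natural[OF that refl] C.cmp_assoc_right) (simp add: Q_natural)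
    thus "(inv_ar C (Q (tgt C f)) \<cdot> far R (far F f)) \<cdot> Q (src C f)
        = ((f \<otimes>\<^sub>a \<iota> RI) \<cdot> inv_ar C (Q (src C f))) \<cdot> Q (src C f)" by simp
  qed simp_all
  have mF: "mhom (free (src C f)) (f \<otimes>\<^sub>a \<iota> RI) (free (tgt C f))" if [simp]: "f \<in> Ar C" for f
  proof -
    have "mhom (free (src C f)) (inv_ar C (Q (tgt C f)) \<cdot> far R (far F f) \<cdot> Q (src C f)) (free (tgt C f))"
      using mhom_R[of "far F f"] by (intro mhom_cmp[OF mhom_cmp, OF mhom_Q _ Qi(1)]) simp_all
    moreover have "inv_ar C (Q (tgt C f)) \<cdot> far R (far F f) \<cdot> Q (src C f) = f \<otimes>\<^sub>a \<iota> RI"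
      by (simp add: natQ[THEN C.reassoc])
    ultimately show ?thesis by simp
  qed
  have mu: "mhom (tob (free X) (free Y)) (mu X Y) (free (X \<otimes>\<^sub>o Y))"
      "fmu FA X Y = (tob (free X) (free Y), mu X Y, free (X \<otimes>\<^sub>o Y))"
    if [simp]: "X \<in> Ob C" "Y \<in> Ob C" for X Y
  proof -
    note t = tar_props[OF mhom_Q mhom_Q, of X Y, simplified]
    note [simp] = mhomD(3-5)[OF t(1)]
    have "mhom (kob (fob F X \<otimes>\<^sub>o\<^bsub>D\<^esub> fob F Y)) (far R (fmu F X Y)) (kob (fob F (X \<otimes>\<^sub>o Y)))"
      using mhom_R[of "fmu F X Y"] by simp
    thus m: "mhom (tob (free X) (free Y)) (mu X Y) (free (X \<otimes>\<^sub>o Y))"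
      unfolding mu_def using t(1) Qi by (intro mhom_cmp) (auto intro: kmu_typ(5))
    have "Q (X \<otimes>\<^sub>o Y) \<cdot> mu X Y \<cdot> proj (free X) (free Y) = RF2 X Y \<cdot> (Q X \<otimes>\<^sub>a Q Y)"
      by (simp add: mu_def t(2) kmu_props(2)[THEN C.reassoc] RF2_def)
    also have "\<dots> = Q (X \<otimes>\<^sub>o Y) \<cdot> (inv_ar C (\<alpha> X Y RI)
        \<cdot> (\<iota> X \<otimes>\<^sub>a ((\<iota> Y \<otimes>\<^sub>a lact \<one>\<^sub>o\<^bsub>D\<^esub>) \<cdot> \<alpha> Y RI RI \<cdot> (\<sigma> Y \<otimes>\<^sub>a \<iota> RI) \<cdot> inv_ar C (\<alpha> RI Y RI)))
        \<cdot> \<alpha> X RI (Y \<otimes>\<^sub>o RI))" by (simp add: free_mu)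
    finally have "mu X Y \<cdot> proj (free X) (free Y) = inv_ar C (\<alpha> X Y RI)
        \<cdot> (\<iota> X \<otimes>\<^sub>a ((\<iota> Y \<otimes>\<^sub>a lact \<one>\<^sub>o\<^bsub>D\<^esub>) \<cdot> \<alpha> Y RI RI \<cdot> (\<sigma> Y \<otimes>\<^sub>a \<iota> RI) \<cdot> inv_ar C (\<alpha> RI Y RI)))
        \<cdot> \<alpha> X RI (Y \<otimes>\<^sub>o RI)"
      by (rule C.monoD[of "Q (X \<otimes>\<^sub>o Y)", rotated]) (use mhomD[OF m] in simp_all)
    from C.the_factor[OF _ _ _ _ this, of "(X \<otimes>\<^sub>o Y) \<otimes>\<^sub>o RI"] mhomD[OF m]
    show "fmu FA X Y = (tob (free X) (free Y), mu X Y, free (X \<otimes>\<^sub>o Y))"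
      by (simp add: free_module_functor_def Let_def)
  qed
  show ?thesis
  proof (rule tensor_functor_iso[OF KF, of FA \<theta>])
    fix X assume X [simp]: "X \<in> Ob C"
    show "fob FA X \<in> Ob E" by simp
    show "\<theta> X \<in> Hom E (fob KF X) (fob FA X)" "iso_ar E (\<theta> X)" using \<theta>[OF X] .
    fix Y assume Y [simp]: "Y \<in> Ob C"
    show "fmu FA X Y \<in> Hom E (fob FA X \<otimes>\<^sub>o\<^bsub>E\<^esub> fob FA Y) (fob FA (X \<otimes>\<^sub>o Y))" using mu by simp
    note t = tar_props[OF mhom_Q mhom_Q, of X Y, simplified]
    note t' = tar_props[OF Qi(1) Qi(1), of X Y, simplified]
    note [simp] = mhomD(3-5)[OF t(1)] mhomD(3-5)[OF t'(1)]
    have "tar (free X) (Q X) (kob (fob F X)) (free Y) (Q Y) (kob (fob F Y))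
        \<cdot> tar (kob (fob F X)) (inv_ar C (Q X)) (free X) (kob (fob F Y)) (inv_ar C (Q Y)) (free Y)
        = \<iota> (fst (tob (kob (fob F X)) (kob (fob F Y))))"
      by (rule C.epiD[of "proj (kob (fob F X)) (kob (fob F Y))"]) (simp_all add: t(2)[THEN C.reassoc] t'(2))
    thus "\<theta> (X \<otimes>\<^sub>o Y) \<cdot>\<^bsub>E\<^esub> fmu KF X Y = fmu FA X Y \<cdot>\<^bsub>E\<^esub> (\<theta> X \<otimes>\<^sub>a\<^bsub>E\<^esub> \<theta> Y)"
      by (simp add: mu(2) \<theta>_def comp_mon_functor_def tens_ar_eq mu_def)
  next
    fix f assume "f \<in> Ar C"
    thus "far FA f \<in> Hom E (fob FA (src C f)) (fob FA (tgt C f))" "\<theta> (tgt C f) \<cdot>\<^bsub>E\<^esub> far KF f = far FA f \<cdot>\<^bsub>E\<^esub> \<theta> (src C f)"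
      using mF natQ by (simp_all add: \<theta>_def)
  next
    have "inv_ar C (Q \<one>\<^sub>o) \<cdot> far R (fmu0 F) \<cdot> \<lambda>\<^sub>l RI \<cdot> inv_ar C (\<lambda>\<^sub>l RI) = inv_ar C (\<lambda>\<^sub>l RI)"
      using C.inv_cmp_reassoc[of "Q \<one>\<^sub>o" "inv_ar C (\<lambda>\<^sub>l RI)"] by (simp add: Q_unit)
    hence "inv_ar C (Q \<one>\<^sub>o) \<cdot> far R (fmu0 F) = inv_ar C (\<lambda>\<^sub>l RI)" by simp
    thus "fmu0 FA = \<theta> \<one>\<^sub>o \<cdot>\<^bsub>E\<^esub> fmu0 KF" by (simp add: \<theta>_def comp_mon_functor_def)
  qed
qed

end

theorem proposition5p1:
  fixes k :: "'k ring"
    and C :: "('o, 'm, 'k) mon_category"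
    and D :: "('p, 'n, 'k) mon_category"
    and F :: "('o, 'm, 'p, 'n) mon_functor_data"
    and R :: "('p, 'n, 'o, 'm) functor_data"
    and \<eta> :: "'o \<Rightarrow> 'm"
    and \<epsilon> :: "'p \<Rightarrow> 'n"
  assumes "field k"
    and "tensor_category k C"
    and "tensor_category k D"
    and "tensor_functor k C D F"
    and "adjunction C D F R \<eta> \<epsilon>"
  defines "A \<equiv> adj_algebra C D F R \<eta> \<epsilon>"
  shows "(\<forall>X \<in> Ob C. \<exists>!s. is_adj_braiding C D F R \<eta> \<epsilon> X s) \<and>
    commutative_central_algebra C A \<and>
    (faithful D R \<and> exact D C R \<longrightarrow>
      tensor_category k (mod_tensor_cat C A) \<and>
      (\<exists>K :: ('p, 'n, ('o, 'm) mod_ob, ('o, 'm) mod_ar) mon_functor_data.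
        tensor_equivalence k D (mod_tensor_cat C A) K \<and>
        isomorphic_tensor_functors k C (mod_tensor_cat C A)
          (comp_mon_functor (mod_tensor_cat C A) K F) (free_module_functor C A)))"
proof -
  interpret F: tensor_functor k C D F by fact
  have ra: "rigid_adjunction C D F R \<eta> \<epsilon>"
    by (intro rigid_adjunction.intro rigid_adjunction_axioms.intro monoidal_adjunction.intro
        F.strong_monoidal_functor_axioms assms(5) F.C.rigid)
  interpret ra: rigid_adjunction C D F R \<eta> \<epsilon> by (rule ra)
  show ?thesis
  proof (intro conjI impI)
    show "\<forall>X \<in> Ob C. \<exists>!s. is_adj_braiding C D F R \<eta> \<epsilon> X s"
      by (simp add: ra.adj_braiding_iff)
    show "commutative_central_algebra C A"
      unfolding A_def by (rule ra.adj_algebra_commutative_central)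
    assume fe: "faithful D R \<and> exact D C R"
    interpret fe: faithful_exact_adjunction k C D F R \<eta> \<epsilon>
      by (intro faithful_exact_adjunction.intro faithful_exact_adjunction_axioms.intro assms(2,3) ra)
        (use F.F_linear fe in auto)
    show "tensor_category k (mod_tensor_cat C A)"
      unfolding A_def by (rule fe.KT.transport_tensor_category)
    show "\<exists>K :: ('p, 'n, ('o, 'm) mod_ob, ('o, 'm) mod_ar) mon_functor_data.
        tensor_equivalence k D (mod_tensor_cat C A) K \<and>
        isomorphic_tensor_functors k C (mod_tensor_cat C A)
          (comp_mon_functor (mod_tensor_cat C A) K F) (free_module_functor C A)"
      unfolding A_def using fe.KT.transport_equivalence fe.free_module_functor_iso[OF assms(4)] by blast
  qed
qed

end
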